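(* Let $X$ be a finite connected admissible $2$-dimensional simplicial complex without boundary, $\rho:\pi_1(X)\to\mathrm{SL}(r,\mathbb{C})$ an irreducible representation, $E=E_\rho=\tilde X\times_\rho\mathbb{C}^r$, and let $u:\tilde X\to\mathrm{SL}(r,\mathbb{C})/\mathrm{SU}(r)$ be the $\rho$-equivariant harmonic map. Let $\mathcal{D}$ be the flat connection on $E$ with holonomy $\rho$ induced by the trivial connection on $\tilde X\times\mathbb{C}^r$, let $\alpha>0$ be the exponent in the derivative estimates for $u$ at the vertices, and let $\delta<\alpha$. Then $\mathcal{D}\in\mathcal{A}^{\mathbb{C}}_{bal,flat,\delta}(E)$. The metric on the bundle $E$ induces a decomposition of $\mathcal{D}$ into skew-adjoint and self-adjoint parts, $\mathcal{D}=d_A+\psi$, where $d_A\in\mathcal{A}_{bal,\delta}(E)$ and $\psi\in\Omega^1_{bal,\delta}(i\,\mathrm{ad}(E))$. Furthermore, $\mathcal{D}$, $d_A$ and $\psi$ are smooth over $X_*$.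
   Context: **The complex.** $X$ is a finite connected $2$-dimensional simplicial complex. Admissible: every simplex lies in the closure of a $2$-simplex, and for every vertex $v$ any two $2$-simplices incident to $v$ are joined by a sequence of $2$-simplices incident to $v$ in which consecutive ones are adjacent. Without boundary: no $1$-simplex lies in the closure of exactly one $2$-simplex. Each $2$-cell is isometric to the interior of an equilateral triangle in $\mathbb{R}^2$ and each $1$-cell to the open unit interval, compatibly with restriction to faces. $X^0$ is the set of vertices, $X_*=X\setminus X^0$, $p:\tilde X\to X$ is the universal cover. **Harmonic map and exponent.** A $\rho$-equivariant map is harmonic if it is locally energy minimizing; for irreducible $\rho$ a unique $\rho$-equivariant harmonic map $u:\tilde X\to\mathrm{SL}(r,\mathbb{C})/\mathrm{SU}(r)$ exists (the target carries an $\mathrm{SL}(r,\mathbb{C})$-invariant metric of non-positive curvature). It is smooth on each $2$-cell up to the open edges, and $\alpha>0$ is a constant, the same for all vertices, such that near every vertex, in polar coordinates $(r,\theta)$ on each incident $2$-cell and local coordinates on the target, $|\partial_r^a\partial_\theta^bu^m|\le Cr^{\alpha-a}$ for $1\le a+b\le 3$. **The decomposition.** View $\mathrm{SL}(r,\mathbb{C})/\mathrm{SU}(r)$ as the positive definite Hermitian matrices $h$ of determinant one, with $g\in\mathrm{SL}(r,\mathbb{C})$ acting by $h\mapsto (g^{-1})^*hg^{-1}$. The map $u$ defines a Hermitian metric $\langle s_1,s_2\rangle=\bar s_1^Tu\,s_2$ on $\tilde X\times\mathbb{C}^r$, which descends to the metric on $E$. The trivial connection $d$ on $\tilde X\times\mathbb{C}^r$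 descends to $\mathcal{D}$. Identifying $T^{\mathbb{C}}_h$ with $\mathfrak{sl}(r,\mathbb{C})$ by $V\mapsto h^{-1}V$, the Levi-Civita connection is $\nabla s=ds+\frac12[h^{-1}dh,s]$; $d_A=u^*\nabla$ descends to a connection on $E$ (with connection form $\frac12u^{-1}du$ on $\tilde X\times\mathbb{C}^r$), unitary for the Hermitian metric on $E$ induced by $\langle s_1,s_2\rangle=\bar s_1^Tu\,s_2$, and $\psi=\mathcal{D}-d_A$. **Function spaces.** A $1$-form $\omega=\{\omega_\sigma\}$ (one form on each cell, compatible with restriction to faces) is balanced if for every $1$-cell $\tau$, $\sum_{\sigma>\tau}\omega_\sigma(e_\sigma)=0$ along $\tau$, where the sum is over $2$-cells $\sigma$ having $\tau$ as a face and $e_\sigma$ is the inward pointing unit normal. With the fixed trivialization $p^*E\cong\tilde X\times\mathbb{C}^r$, a connection $D$ is balanced if $p^*D=d+A$ with all $A_{ij}$ balanced; an endomorphism-valued $1$-form is balanced if all entries of its pullback are. Near a vertex set $t=-\log r$. $L^q_\delta$ is the completion of the smooth sections vanishing at the vertices in the norm $\big(\sum_i\int_{U_i}e^{t\delta}|s|^q+\sum_\beta\int_{V_\beta}|s|^q\big)^{1/q}$, where the $U_i$ are neighbourhoods of the vertices (norms and measures taken in the coordinates $(t,\theta)$) and the $V_\beta$ cover the rest of $X$ and contain no vertex. $L^q_{k,\delta}$ is the completion in the norm $\sum_{\ell=0}^k\|\nabla_0^\ell s\|_{L^q_\delta}$, with $\nabla_0$ a fixed connection equal to $d$ near each vertex.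 $\mathcal{A}^{\mathbb{C}}_{bal,flat,\delta}(E)$: balanced flat connections with connection form in $L^2_{1,\delta}$. $\mathcal{A}_{bal,\delta}(E)$: balanced unitary connections with connection form in $L^2_{1,\delta}$. $\Omega^1_{bal,\delta}(i\,\mathrm{ad}(E))$: balanced $1$-forms of class $L^2_{1,\delta}$ with values in traceless Hermitian endomorphisms of $E$. Connection forms are traceless. An object is smooth over $X_*$ if on each closed cell, away from the vertices, it is smooth up to the boundary of the cell. *)

theory Defs
  imports "HOL-Analysis.Analysis" "HOL-Algebra.Group"
begin

section \<open>The complex\<close>

text \<open>
  The abstract finite complex with its piecewise flat metric is realised as a geometric simplicial
  complex all of whose edges have length one; every abstract finite complex has such a realisation,
  on the vertices \<open>e\<^sub>v / sqrt 2\<close> of a Euclidean space.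
  The library's \<^const>\<open>simplicial_complex\<close> also contains the empty simplex.
\<close>

definition two_simplices :: "'a::euclidean_space set set \<Rightarrow> 'a set set" where
  "two_simplices X = {S \<in> X. 2 simplex S}"

definition equilateral_2_complex :: "'a::euclidean_space set set \<Rightarrow> bool" where
  "equilateral_2_complex X \<longleftrightarrow>
     simplicial_complex X \<and> (\<forall>S\<in>X. aff_dim S \<le> 2) \<and>
     (\<forall>a b. a \<noteq> b \<and> closed_segment a b \<in> X \<longrightarrow> dist a b = 1)"

definition admissible :: "'a::euclidean_space set set \<Rightarrow> bool" where
  "admissible X \<longleftrightarrow>
     (\<forall>S\<in>X. \<exists>T\<in>two_simplices X. S \<subseteq> T) \<and>
     (\<forall>x. {x} \<in> X \<longrightarrow>
        (\<forall>S\<in>two_simplices X. \<forall>S'\<in>two_simplices X. x \<in> S \<longrightarrow> x \<in> S' \<longrightarrow>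
           (S, S') \<in> {(T, T'). T \<in> two_simplices X \<and> T' \<in> two_simplices X \<and>
                               x \<in> T \<and> x \<in> T' \<and> 1 simplex (T \<inter> T')}\<^sup>*))"

definition without_boundary :: "'a::euclidean_space set set \<Rightarrow> bool" where
  "without_boundary X \<longleftrightarrow>
     (\<forall>e\<in>X. 1 simplex e \<longrightarrow> card {S \<in> two_simplices X. e \<subseteq> S} \<noteq> 1)"


section \<open>Fundamental group, representations, universal cover\<close>

definition is_loop :: "'a::topological_space set \<Rightarrow> 'a \<Rightarrow> (real \<Rightarrow> 'a) \<Rightarrow> bool" where
  "is_loop S x g \<longleftrightarrow> path g \<and> path_image g \<subseteq> S \<and> pathstart g = x \<and> pathfinish g = x"

definition fundamental_group ::
    "'a::topological_space set \<Rightarrow> 'a \<Rightarrow> (real \<Rightarrow> 'a) set monoid" where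
  "fundamental_group S x =
     \<lparr> carrier = {{h. homotopic_paths S g h} | g. is_loop S x g},
       mult = (\<lambda>A B. {k. \<exists>g\<in>A. \<exists>h\<in>B. homotopic_paths S (g +++ h) k}),
       one = {h. homotopic_paths S (\<lambda>_. x) h} \<rparr>"

definition special_linear :: "(complex^'n^'n) monoid" where
  "special_linear = \<lparr> carrier = {A. det A = 1}, mult = (**), one = mat 1 \<rparr>"

definition irreducible_rep :: "'g monoid \<Rightarrow> ('g \<Rightarrow> complex^'n^'n) \<Rightarrow> bool" where
  "irreducible_rep G \<rho> \<longleftrightarrow>
     (\<forall>W. vec.subspace W \<and> (\<forall>c\<in>carrier G. \<forall>w\<in>W. \<rho> c *v w \<in> W) \<longrightarrow> W = {0} \<or> W = UNIV)"

definition universal_cover ::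
    "'b::topological_space set \<Rightarrow> ('b \<Rightarrow> 'a) \<Rightarrow> 'a::topological_space set \<Rightarrow> bool" where
  "universal_cover Xt p S \<longleftrightarrow> covering_space Xt p S \<and> simply_connected Xt"

text \<open>
  \<open>T\<close> is the deck transformation by which the class \<open>c\<close> of the fundamental group, based at
  \<open>p xt0\<close>, acts on the universal cover: it moves \<open>xt0\<close> to the end point of the lift of \<open>c\<close> that
  starts at \<open>xt0\<close>.  With the library's order of path concatenation this is a left action.
\<close>

definition deck_transformation ::
    "('b::topological_space \<Rightarrow> 'a::topological_space) \<Rightarrow> 'b set \<Rightarrow> 'b \<Rightarrow> (real \<Rightarrow> 'a) set \<Rightarrow> ('b \<Rightarrow> 'b) \<Rightarrow> bool"
  where
  "deck_transformation p Xt xt0 c T \<longleftrightarrow>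
     (\<exists>T'. homeomorphism Xt Xt T T') \<and> (\<forall>x\<in>Xt. p (T x) = p x) \<and>
     (\<exists>g. path g \<and> path_image g \<subseteq> Xt \<and> pathstart g = xt0 \<and> pathfinish g = T xt0 \<and> p \<circ> g \<in> c)"


section \<open>The target\<close>

definition hconj :: "complex^'n^'n \<Rightarrow> complex^'n^'n" where
  "hconj A = (\<chi> i j. cnj (A $ j $ i))"

definition sym_space :: "(complex^'n^'n) set" where
  "sym_space = {h. hconj h = h \<and> det h = 1 \<and>
                   (\<forall>x. x \<noteq> 0 \<longrightarrow> 0 < Re (\<Sum>i\<in>UNIV. cnj (x $ i) * (h *v x) $ i))}"

definition sym_action :: "complex^'n^'n \<Rightarrow> complex^'n^'n \<Rightarrow> complex^'n^'n" where
  "sym_action g h = hconj (matrix_inv g) ** h ** matrix_inv g"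


section \<open>Calculus on the closed triangle\<close>

definition tri_vertices :: "complex set" where
  "tri_vertices = {0, 1, cis (pi / 3)}"

definition tri :: "complex set" where
  "tri = convex hull tri_vertices"

definition tri_star :: "complex set" where
  "tri_star = tri - tri_vertices"

text \<open>Derivatives are taken within \<open>S\<close>, so that on \<^const>\<open>tri_star\<close> smoothness is smoothness up to
  the open edges.\<close>

primrec Ck_on :: "nat \<Rightarrow> 'a::real_normed_vector set \<Rightarrow> ('a \<Rightarrow> 'b::real_normed_vector) \<Rightarrow> bool" where
  "Ck_on 0 S f \<longleftrightarrow> continuous_on S f"
| "Ck_on (Suc k) S f \<longleftrightarrow>
     (\<exists>f'. (\<forall>x\<in>S. (f has_derivative f' x) (at x within S)) \<and> (\<forall>v. Ck_on k S (\<lambda>x. f' x v)))"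

definition smooth_on :: "'a::real_normed_vector set \<Rightarrow> ('a \<Rightarrow> 'b::real_normed_vector) \<Rightarrow> bool" where
  "smooth_on S f \<longleftrightarrow> (\<forall>k. Ck_on k S f)"

text \<open>The derivative of \<open>f\<close> at \<open>z\<close> in direction \<open>v\<close>, one-sided on the open edges.\<close>

definition tri_deriv :: "(complex \<Rightarrow> 'c::real_normed_vector) \<Rightarrow> complex \<Rightarrow> complex \<Rightarrow> 'c" where
  "tri_deriv f z v = frechet_derivative f (at z within tri_star) v"

definition locally_integrable :: "(complex \<Rightarrow> 'c::{banach,second_countable_topology}) \<Rightarrow> bool" where
  "locally_integrable f \<longleftrightarrow>
     (\<forall>K. compact K \<and> K \<subseteq> interior tri \<longrightarrow> set_integrable lborel K f)"

definition test_function :: "(complex \<Rightarrow> real) \<Rightarrow> bool" where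
  "test_function \<phi> \<longleftrightarrow> smooth_on UNIV \<phi> \<and> closure {z. \<phi> z \<noteq> 0} \<subseteq> interior tri"

text \<open>\<open>g\<close> is the weak derivative of \<open>f\<close> in direction \<open>v\<close> on the open triangle.\<close>

definition weak_deriv ::
    "(complex \<Rightarrow> 'c::{banach,second_countable_topology}) \<Rightarrow> complex \<Rightarrow> (complex \<Rightarrow> 'c) \<Rightarrow> bool" where
  "weak_deriv f v g \<longleftrightarrow> locally_integrable f \<and> locally_integrable g \<and>
     (\<forall>\<phi>. test_function \<phi> \<longrightarrow>
        (LINT z:interior tri|lborel. frechet_derivative \<phi> (at z) v *\<^sub>R f z) =
        - (LINT z:interior tri|lborel. \<phi> z *\<^sub>R g z))"

text \<open>The values of \<open>f\<close> on the open edge from 0 to 1 are the trace of \<open>f\<close> from the interior.\<close>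

definition edge_trace :: "(complex \<Rightarrow> 'c::real_normed_vector) \<Rightarrow> bool" where
  "edge_trace f \<longleftrightarrow>
     (\<forall>a b. 0 < a \<and> a < b \<and> b < 1 \<longrightarrow>
        ((\<lambda>e. \<integral>\<^sup>+s\<in>{a..b}. ennreal (norm (f (Complex s e) - f (Complex s 0))) \<partial>lborel)
           \<longlongrightarrow> 0) (at_right 0))"

text \<open>Derivatives in polar coordinates at the vertex 0 of the triangle.\<close>

definition partial_r :: "(real \<Rightarrow> real \<Rightarrow> 'c::real_normed_vector) \<Rightarrow> real \<Rightarrow> real \<Rightarrow> 'c" where
  "partial_r f r \<theta> = vector_derivative (\<lambda>s. f s \<theta>) (at r)"

definition partial_theta :: "(real \<Rightarrow> real \<Rightarrow> 'c::real_normed_vector) \<Rightarrow> real \<Rightarrow> real \<Rightarrow> 'c" where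
  "partial_theta f r \<theta> = vector_derivative (\<lambda>\<tau>. f r \<tau>) (at \<theta> within {0..pi / 3})"


section \<open>Weighted integrals near a vertex and away from the vertices\<close>

text \<open>
  With \<open>t = - ln r\<close> one has \<open>\<partial>\<^sub>t = - z\<close> and \<open>\<partial>\<^sub>\<theta> = \<i> z\<close> as tangent vectors at \<open>z\<close>, and
  \<open>dt d\<theta> = r\<^sup>-\<^sup>2 dx dy\<close>.
\<close>

definition collar_sq :: "real \<Rightarrow> (complex \<Rightarrow> 'c::real_normed_vector) \<Rightarrow> ennreal" where
  "collar_sq \<delta> f =
     (\<integral>\<^sup>+z\<in>{z \<in> tri. 0 < norm z \<and> norm z < 1/2}.
        ennreal (exp (\<delta> * (- ln (norm z))) * (norm (f z))\<^sup>2 / (norm z)\<^sup>2) \<partial>lborel)"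

definition core_sq :: "(complex \<Rightarrow> 'c::real_normed_vector) \<Rightarrow> ennreal" where
  "core_sq f =
     (\<integral>\<^sup>+z\<in>{z \<in> tri. \<forall>w\<in>tri_vertices. 1/4 < norm (z - w)}. ennreal ((norm (f z))\<^sup>2) \<partial>lborel)"


section \<open>Charts of the universal cover, forms and connections\<close>

text \<open>
  A form assigns to a chart \<open>c\<close> of a closed 2-cell of the universal cover, to a point \<open>z\<close> of the
  triangle and to a tangent vector \<open>v\<close> at \<open>z\<close> the matrix \<open>\<omega> c z v\<close>.
\<close>

type_synonym ('b, 'n) form = "(complex \<Rightarrow> 'b) \<Rightarrow> complex \<Rightarrow> complex \<Rightarrow> complex^'n^'n"

context
  fixes X :: "'a::euclidean_space set set"
    and p :: "'b::topological_space \<Rightarrow> 'a"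
    and Xt :: "'b set"
    and xt0 :: 'b
    and \<rho> :: "(real \<Rightarrow> 'a) set \<Rightarrow> complex^'n^'n"
begin

text \<open>
  The closed 2-cells of the universal cover are parametrised by lifts of isometries of the triangle
  onto 2-simplices of \<open>X\<close>.  Each cell has six charts, permuted by the symmetries of the triangle.
  Hence every vertex of a cell is the image of 0 under one of its charts, and for every
  parametrised edge \<open>\<epsilon>\<close> of a cell exactly one chart of that cell restricts to \<open>\<epsilon>\<close> on the edge
  from 0 to 1.
\<close>

definition charts :: "(complex \<Rightarrow> 'b) set" where
  "charts = {c \<in> extensional tri. continuous_on tri c \<and> c ` tri \<subseteq> Xt \<and> p ` c ` tri \<in> X \<and>
                (\<forall>z\<in>tri. \<forall>w\<in>tri. dist (p (c z)) (p (c w)) = dist z w)}"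

definition same_edge :: "(complex \<Rightarrow> 'b) \<Rightarrow> (complex \<Rightarrow> 'b) \<Rightarrow> bool" where
  "same_edge c c' \<longleftrightarrow> (\<forall>s\<in>{0..1}. c (Complex s 0) = c' (Complex s 0))"

text \<open>The last condition is the compatibility of the forms on the closed 2-cells under restriction
  to a common edge.\<close>

definition one_form :: "('b, 'n) form \<Rightarrow> bool" where
  "one_form \<omega> \<longleftrightarrow>
     (\<forall>c\<in>charts. \<forall>z\<in>tri_star. linear (\<omega> c z)) \<and>
     (\<forall>c\<in>charts. \<forall>g. (\<forall>z w. dist (g z) (g w) = dist z w) \<and> g ` tri = tri \<longrightarrow>
        (\<forall>z\<in>tri_star. \<forall>v. \<omega> (compose tri c g) z v = \<omega> c (g z) (g v - g 0))) \<and>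
     (\<forall>c\<in>charts. \<forall>c'\<in>charts. same_edge c c' \<longrightarrow>
        (\<forall>s\<in>{0<..<1}. \<omega> c (Complex s 0) 1 = \<omega> c' (Complex s 0) 1))"

definition smooth_form :: "('b, 'n) form \<Rightarrow> bool" where
  "smooth_form \<omega> \<longleftrightarrow> (\<forall>c\<in>charts. \<forall>v. smooth_on tri_star (\<lambda>z. \<omega> c z v))"

text \<open>
  Traceless forms on the universal cover that descend to forms with values in the endomorphisms of
  \<open>E\<close>, the quotient of \<open>Xt \<times> \<complex>\<^sup>n\<close> by \<open>(x, s) \<sim> (c x, \<rho> c s)\<close>.  A connection on \<open>E\<close> is given by the
  connection form \<open>A\<close> of its pullback \<open>d + A\<close> to \<open>Xt \<times> \<complex>\<^sup>n\<close>, and \<open>d + A\<close> descends to \<open>E\<close> under the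
  same condition on \<open>A\<close>, since \<open>\<rho> c\<close> is constant.
\<close>

definition End_form :: "('b, 'n) form \<Rightarrow> bool" where
  "End_form \<omega> \<longleftrightarrow> one_form \<omega> \<and>
     (\<forall>c\<in>charts. \<forall>z\<in>tri_star. \<forall>v. trace (\<omega> c z v) = 0) \<and>
     (\<forall>a\<in>carrier (fundamental_group (\<Union>X) (p xt0)). \<forall>T. deck_transformation p Xt xt0 a T \<longrightarrow>
        (\<forall>c\<in>charts. \<forall>z\<in>tri_star. \<forall>v.
           \<omega> (compose tri T c) z v = \<rho> a ** \<omega> c z v ** matrix_inv (\<rho> a)))"

text \<open>In every chart \<open>\<i>\<close> is the inward pointing unit normal along the edge from 0 to 1; the charts
  \<open>c'\<close> below correspond to the 2-cells that have the edge of \<open>c\<close> as a face.\<close>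

definition balanced :: "('b, 'n) form \<Rightarrow> bool" where
  "balanced \<omega> \<longleftrightarrow>
     (\<forall>c\<in>charts. \<forall>s\<in>{0<..<1}. (\<Sum>c' | c' \<in> charts \<and> same_edge c c'. \<omega> c' (Complex s 0) \<i>) = 0)"

text \<open>
  The squared weighted norm on the closed cell of a chart, for the vertex 0 of the chart and the
  part of the cell away from its vertices, and the same for the covariant derivative.  The flat
  connection of \<open>E\<close> serves as the reference connection, so that in the trivialization over the
  universal cover the covariant derivative is the derivative of the components, with respect to
  \<open>dt, d\<theta>\<close> near the vertex and \<open>dx, dy\<close> away from it.
\<close>

definition L2_sq :: "real \<Rightarrow> ('b, 'n) form \<Rightarrow> (complex \<Rightarrow> 'b) \<Rightarrow> ennreal" where
  "L2_sq \<delta> \<omega> c =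
     (\<Sum>k\<in>{-1, \<i>}. collar_sq \<delta> (\<lambda>z. \<omega> c z (k * z))) + (\<Sum>k\<in>{1, \<i>}. core_sq (\<lambda>z. \<omega> c z k))"

definition L21_sq :: "real \<Rightarrow> ('b, 'n) form \<Rightarrow> (complex \<Rightarrow> 'b) \<Rightarrow> ennreal" where
  "L21_sq \<delta> \<omega> c = L2_sq \<delta> \<omega> c +
     (\<Sum>k\<in>{-1, \<i>}. \<Sum>l\<in>{-1, \<i>}.
        collar_sq \<delta> (\<lambda>z. tri_deriv (\<lambda>w. \<omega> c w (k * w)) z (l * z))) +
     (\<Sum>k\<in>{1, \<i>}. \<Sum>l\<in>{1, \<i>}. core_sq (\<lambda>z. tri_deriv (\<lambda>w. \<omega> c w k) z l))"

definition vanishes_at_vertices :: "('b, 'n) form \<Rightarrow> bool" where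
  "vanishes_at_vertices \<omega> \<longleftrightarrow>
     (\<forall>c\<in>charts. \<forall>k\<in>{-1, \<i>}. ((\<lambda>z. \<omega> c z (k * z)) \<longlongrightarrow> 0) (at 0 within tri_star))"

text \<open>
  \<open>\<omega>\<close> represents an element of the completion \<open>L\<^sup>2\<^bsub>1,\<delta>\<^esub>\<close>: it is the \<open>L\<^sup>2\<^bsub>\<delta>\<^esub>\<close>-limit of a sequence of
  smooth sections of finite norm that vanish at the vertices and form a Cauchy sequence in the norm
  of \<open>L\<^sup>2\<^bsub>1,\<delta>\<^esub>\<close>.  The norm over \<open>X\<close> is a finite sum over the cells of \<open>X\<close>, each computed in some lift;
  another lift conjugates by a constant matrix, which gives an equivalent norm, so finiteness and
  convergence in the norm over \<open>X\<close> are finiteness and convergence in every chart.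
  Of an element of \<open>L\<^sup>2\<^bsub>1,\<delta>\<^esub>\<close>, the representative is taken whose values on the open edges are its
  traces.
\<close>

definition in_L21 :: "real \<Rightarrow> ('b, 'n) form \<Rightarrow> bool" where
  "in_L21 \<delta> \<omega> \<longleftrightarrow>
     (\<forall>c\<in>charts. \<forall>v. set_borel_measurable borel tri (\<lambda>z. \<omega> c z v) \<and> edge_trace (\<lambda>z. \<omega> c z v)) \<and>
     (\<exists>\<eta>::nat \<Rightarrow> ('b, 'n) form.
        (\<forall>n. End_form (\<eta> n) \<and> smooth_form (\<eta> n) \<and> vanishes_at_vertices (\<eta> n) \<and>
             (\<forall>c\<in>charts. L21_sq \<delta> (\<eta> n) c < \<infinity>)) \<and>
        (\<forall>c\<in>charts. \<forall>e>0. \<exists>N. \<forall>m\<ge>N. \<forall>n\<ge>N.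
             L21_sq \<delta> (\<lambda>c z v. \<eta> m c z v - \<eta> n c z v) c < ennreal e) \<and>
        (\<forall>c\<in>charts. (\<lambda>n. L2_sq \<delta> (\<lambda>c z v. \<eta> n c z v - \<omega> c z v) c) \<longlonglongrightarrow> 0))"

text \<open>The curvature \<open>dA + A \<and> A\<close> of \<open>d + A\<close>, in the sense of weak derivatives, vanishes.\<close>

definition flat :: "('b, 'n) form \<Rightarrow> bool" where
  "flat A \<longleftrightarrow>
     (\<forall>c\<in>charts. \<exists>g h. weak_deriv (\<lambda>z. A c z \<i>) 1 g \<and> weak_deriv (\<lambda>z. A c z 1) \<i> h \<and>
        (AE z in lborel. z \<in> interior tri \<longrightarrow>
           g z - h z + A c z 1 ** A c z \<i> - A c z \<i> ** A c z 1 = 0))"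

text \<open>For the metric \<open>\<langle>s, s'\<rangle> = s\<^sup>* u s'\<close> on \<open>E\<close>: the condition
  \<open>d\<langle>s, s'\<rangle> = \<langle>(d + A) s, s'\<rangle> + \<langle>s, (d + A) s'\<rangle>\<close>.\<close>

definition unitary :: "('b \<Rightarrow> complex^'n^'n) \<Rightarrow> ('b, 'n) form \<Rightarrow> bool" where
  "unitary u A \<longleftrightarrow>
     (\<forall>c\<in>charts. \<forall>z\<in>tri_star. \<forall>v.
        tri_deriv (\<lambda>w. u (c w)) z v = hconj (A c z v) ** u (c z) + u (c z) ** A c z v)"

definition self_adjoint :: "('b \<Rightarrow> complex^'n^'n) \<Rightarrow> ('b, 'n) form \<Rightarrow> bool" where
  "self_adjoint u \<omega> \<longleftrightarrow>
     (\<forall>c\<in>charts. \<forall>z\<in>tri_star. \<forall>v. hconj (\<omega> c z v) ** u (c z) = u (c z) ** \<omega> c z v)"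

definition bal_flat_connections :: "real \<Rightarrow> ('b, 'n) form set" where
  "bal_flat_connections \<delta> = {A. End_form A \<and> balanced A \<and> in_L21 \<delta> A \<and> flat A}"

definition bal_unitary_connections ::
    "('b \<Rightarrow> complex^'n^'n) \<Rightarrow> real \<Rightarrow> ('b, 'n) form set" where
  "bal_unitary_connections u \<delta> = {A. End_form A \<and> balanced A \<and> in_L21 \<delta> A \<and> unitary u A}"

definition bal_hermitian_forms ::
    "('b \<Rightarrow> complex^'n^'n) \<Rightarrow> real \<Rightarrow> ('b, 'n) form set" where
  "bal_hermitian_forms u \<delta> = {\<omega>. End_form \<omega> \<and> balanced \<omega> \<and> in_L21 \<delta> \<omega> \<and> self_adjoint u \<omega>}"


section \<open>Equivariant harmonic maps\<close>

definition equivariant_map :: "('b \<Rightarrow> complex^'n^'n) \<Rightarrow> bool" where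
  "equivariant_map u \<longleftrightarrow> u ` Xt \<subseteq> sym_space \<and>
     (\<forall>a\<in>carrier (fundamental_group (\<Union>X) (p xt0)). \<forall>T. deck_transformation p Xt xt0 a T \<longrightarrow>
        (\<forall>x\<in>Xt. u (T x) = sym_action (\<rho> a) (u x)))"

text \<open>The invariant metric of the symmetric space is \<open>\<langle>V, W\<rangle>\<^sub>h = tr (h\<^sup>-\<^sup>1 V h\<^sup>-\<^sup>1 W)\<close>.\<close>

definition energy_density :: "('b \<Rightarrow> complex^'n^'n) \<Rightarrow> (complex \<Rightarrow> 'b) \<Rightarrow> complex \<Rightarrow> ennreal" where
  "energy_density v c z =
     (\<Sum>k\<in>{1, \<i>}.
        let g = matrix_inv (v (c z)) ** (SOME g. weak_deriv (\<lambda>w. v (c w)) k g) z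
        in ennreal (Re (trace (g ** g))))"

text \<open>The energy of \<open>v\<close> on \<open>\<Omega>\<close>.  Every cell is counted once for each of its six charts.\<close>

definition energy :: "'b set \<Rightarrow> ('b \<Rightarrow> complex^'n^'n) \<Rightarrow> ennreal" where
  "energy \<Omega> v =
     (\<Sum>\<^sub>\<infinity>c\<in>charts. \<integral>\<^sup>+z\<in>{z \<in> interior tri. c z \<in> \<Omega>}. energy_density v c z \<partial>lborel) / 6"

text \<open>
  Maps that are \<open>W\<^sup>1\<^sup>,\<^sup>2\<close> on every cell and whose traces from the cells around an edge agree: the trace
  from every side is the restriction of \<open>v\<close> to the edge.  On 2-cells finite energy makes the distance
  to a point of the target exponentially integrable (Moser and Trudinger), so the matrix entries of
  every \<open>W\<^sup>1\<^sup>,\<^sup>2\<close> map are weakly differentiable and have \<open>L\<^sup>1\<close> traces.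
\<close>

definition finite_energy_map :: "('b \<Rightarrow> complex^'n^'n) \<Rightarrow> bool" where
  "finite_energy_map v \<longleftrightarrow> v ` Xt \<subseteq> sym_space \<and>
     (\<forall>c\<in>charts. set_borel_measurable borel tri (\<lambda>z. v (c z)) \<and> edge_trace (\<lambda>z. v (c z)) \<and>
        (\<forall>k\<in>{1, \<i>}. \<exists>g. weak_deriv (\<lambda>z. v (c z)) k g) \<and>
        (\<integral>\<^sup>+z\<in>interior tri. energy_density v c z \<partial>lborel) < \<infinity>)"

definition locally_energy_minimizing :: "('b \<Rightarrow> complex^'n^'n) \<Rightarrow> bool" where
  "locally_energy_minimizing u \<longleftrightarrow> finite_energy_map u \<and>
     (\<forall>x\<in>Xt. \<exists>\<Omega> K. x \<in> \<Omega> \<and> openin (top_of_set Xt) \<Omega> \<and> \<Omega> \<subseteq> K \<and> compact K \<and> K \<subseteq> Xt \<and>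
        (\<forall>v. finite_energy_map v \<and> (\<forall>y\<in>Xt - \<Omega>. v y = u y) \<longrightarrow> energy \<Omega> u \<le> energy \<Omega> v))"

definition harmonic_map :: "('b \<Rightarrow> complex^'n^'n) \<Rightarrow> bool" where
  "harmonic_map u \<longleftrightarrow> equivariant_map u \<and> locally_energy_minimizing u"

definition smooth_map :: "('b \<Rightarrow> complex^'n^'n) \<Rightarrow> bool" where
  "smooth_map u \<longleftrightarrow> (\<forall>c\<in>charts. smooth_on tri_star (\<lambda>z. u (c z)))"

text \<open>
  The coordinates on the target are the matrix entries; by the chain rule the estimates in other
  local coordinates are equivalent.  The constant is allowed to depend on the chart, since on the
  universal cover it changes under deck transformations.
\<close>

definition derivative_estimates :: "real \<Rightarrow> ('b \<Rightarrow> complex^'n^'n) \<Rightarrow> bool" where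
  "derivative_estimates \<alpha> u \<longleftrightarrow>
     (\<forall>c\<in>charts. \<exists>C R. 0 < R \<and> R \<le> 1/2 \<and>
        (\<forall>a b. 1 \<le> a + b \<and> a + b \<le> 3 \<longrightarrow>
           (\<forall>r\<in>{0<..<R}. \<forall>\<theta>\<in>{0..pi / 3}.
              norm ((partial_r ^^ a) ((partial_theta ^^ b)
                      (\<lambda>r \<theta>. u (c (complex_of_real r * cis \<theta>)))) r \<theta>)
                \<le> C * r powr (\<alpha> - real a))))"


section \<open>The flat connection and its two parts\<close>

text \<open>The flat connection with holonomy \<open>\<rho>\<close> pulls back to the trivial connection \<open>d\<close>, with
  connection form zero.\<close>

definition flat_connection :: "('b, 'n) form" where
  "flat_connection = (\<lambda>c z v. 0)"

definition unitary_part :: "('b \<Rightarrow> complex^'n^'n) \<Rightarrow> ('b, 'n) form" where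
  "unitary_part u =
     (\<lambda>c z v. (1/2) *\<^sub>R (matrix_inv (u (c z)) ** tri_deriv (\<lambda>w. u (c w)) z v))"

definition self_adjoint_part :: "('b \<Rightarrow> complex^'n^'n) \<Rightarrow> ('b, 'n) form" where
  "self_adjoint_part u = (\<lambda>c z v. flat_connection c z v - unitary_part u c z v)"

end

end

theory Submission
  imports Defs
begin

text \<open>In the trivialization over the universal cover the three connection forms are multiples
  \<open>\<kappa> u\<^sup>-\<^sup>1 du\<close> with \<open>\<kappa> = 0, 1/2, -1/2\<close>.  Equivariance, smoothness and (skew-)adjointness are computed
  from this formula, and the vertex estimates bound the weighted norms, since \<open>r\<^sup>\<alpha>\<close> decays faster
  than \<open>e\<^sup>t\<^sup>\<delta>\<close> grows.

  Balancing is the boundary term of the first variation of the energy.  A square-zero matrix \<open>N\<close> and a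
  bump \<open>\<phi>\<close> at an interior point of an edge give the competitors \<open>g\<^sup>* u g\<close>, \<open>g = 1 + t \<phi> N\<close>, whose energy
  is a quadratic polynomial in \<open>t\<close>; hence its linear coefficient vanishes.  As the support of \<open>\<phi>\<close> shrinks
  to the point, the rescaled coefficient converges to a multiple of
  the real part of the trace of \<open>N\<close> times the sum of the normal components of \<open>u\<^sup>-\<^sup>1 du\<close>, and the matrices
  \<open>N\<close> span the traceless matrices.\<close>

section \<open>Calculus\<close>

text \<open>The energy is an \<open>ennreal\<close> built from an unspecified weak derivative, so
  uniqueness of weak derivatives and non-negativity of the densities are needed before the energies
  of the competitors become real integrals. Choosing N with N^2 = 0 removes every Taylor remainder:
  g has determinant one and inverse 1 - t \<phi> N, the competitor stays in the target, and nothing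
  is differentiated under an integral sign. The bump has to live on the universal cover and be
  readable in every chart; it is therefore a function of the distance between projections inside one
  sheet. The energy sees each cell through six charts, and the charts through an edge point are the
  charts sharing that edge times the symmetries of the triangle, which isometry invariance removes
  from the sum. The density of \<open>u\<close> is not controlled at the vertices in this argument:
  its integrability comes from finite energy, and the bumps avoid the vertices. In the weighted
  norms the delicate term is the mixed derivative. The estimates treat only one order of
  differentiation in r and \<theta>; the other order follows by symmetry on the open triangle, which
  suffices since the edges are null sets.\<close>

lemma bounded_bilinear_matrix_matrix_mult:
  "bounded_bilinear ((**) :: complex^'n^'n \<Rightarrow> complex^'n^'n \<Rightarrow> complex^'n^'n)"
  unfolding bilinear_conv_bounded_bilinear[symmetric] bilinear_def
  by (auto intro!: linearI simp: matrix_matrix_mult_def vec_eq_iff sum.distrib distrib_left distrib_right scaleR_sum_right)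

lemmas matrix_mult_derivative = bounded_bilinear.FDERIV[OF bounded_bilinear_matrix_matrix_mult]

text \<open>Makes one-sided derivatives well defined up to the boundary. Segments from z to points w
  of \<open>S\<close> stay in \<open>S\<close> and determine the derivative on w - z; differences of
  two such vectors, taken near an interior point, give every direction up to scale.\<close>

lemma convex_derivative_unique:
  fixes f :: "'a::euclidean_space \<Rightarrow> 'b::real_normed_vector"
  assumes S: "convex S" "interior S \<noteq> {}" "z \<in> S"
    and f': "(f has_derivative f') (at z within S)" and f'': "(f has_derivative f'') (at z within S)"
  shows "f' = f''"
proof -
  from S(2) obtain w0 e where e: "e > 0" "ball w0 e \<subseteq> S"
    by (metis all_not_in_conv mem_interior)
  have eq: "f' (w - z) = f'' (w - z)" if w: "w \<in> S" for w
  proof -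
    have sub: "(\<lambda>t. z + t *\<^sub>R (w - z)) ` {0..1} \<subseteq> S"
    proof clarify
      fix t :: real assume t: "t \<in> {0..1}"
      have "(1 - t) *\<^sub>R z + t *\<^sub>R w \<in> S"
        using t w S by (intro convexD[OF S(1)]) auto
      then show "z + t *\<^sub>R (w - z) \<in> S" by (simp add: algebra_simps)
    qed
    have d: "((\<lambda>t. z + t *\<^sub>R (w - z)) has_derivative (\<lambda>t. t *\<^sub>R (w - z))) (at (0::real) within {0..1})"
      by (auto intro!: derivative_eq_intros)
    have *: "((\<lambda>t. f (z + t *\<^sub>R (w - z))) has_vector_derivative F (w - z)) (at (0::real) within {0..1})"
      if F: "(f has_derivative F) (at z within S)" for F
    proof -
      have "(f has_derivative F) (at (z + 0 *\<^sub>R (w - z)) within (\<lambda>t. z + t *\<^sub>R (w - z)) ` {0..1})"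
        using has_derivative_subset[OF F sub] by simp
      from has_derivative_in_compose[OF d this]
      show ?thesis
        unfolding has_vector_derivative_def
        using linear_scale[OF has_derivative_linear[OF F]] by simp
    qed
    show ?thesis
      by (rule vector_derivative_unique_within[OF _ *[OF f'] *[OF f'']])
         (simp add: trivial_limit_within islimpt_Icc)
  qed
  have lin: "linear f'" "linear f''" using f' f'' has_derivative_linear by auto
  show ?thesis
  proof
    fix v
    \<comment> \<open>A small multiple of \<open>v\<close> is the difference of the directions from
      z to \<open>w0 + s v\<close> and to \<open>w0\<close>, both of which lie in
      \<open>S\<close>.\<close>
    have "\<exists>s::real. s > 0 \<and> w0 + s *\<^sub>R v \<in> S"
    proof (cases "v = 0")
      case True then show ?thesis using e by (auto intro: exI[of _ 1])
    next
      case False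
      have "dist w0 (w0 + (e / (2 * norm v)) *\<^sub>R v) < e"
        using False e by (simp add: dist_norm)
      then show ?thesis using e False by (intro exI[of _ "e / (2 * norm v)"]) auto
    qed
    then obtain s :: real where s: "s > 0" "w0 + s *\<^sub>R v \<in> S" by blast
    have 1: "f' (w0 + s *\<^sub>R v - z) = f'' (w0 + s *\<^sub>R v - z)" using eq s by blast
    have 2: "f' (w0 - z) = f'' (w0 - z)" using eq[of w0] e by (meson centre_in_ball subsetD)
    have "f' (s *\<^sub>R v) = f' (w0 + s *\<^sub>R v - z) - f' (w0 - z)"
      by (simp add: linear_diff[OF lin(1), symmetric])
    also have "\<dots> = f'' (s *\<^sub>R v)"
      by (simp add: 1 2 linear_diff[OF lin(2), symmetric])
    finally show "f' v = f'' v" using s by (simp add: linear_scale[OF lin(1)] linear_scale[OF lin(2)])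
  qed
qed

lemma Ck_on_cong: "(\<And>x. x \<in> S \<Longrightarrow> f x = g x) \<Longrightarrow> Ck_on k S f \<longleftrightarrow> Ck_on k S g"
proof (induction k)
  case 0 then show ?case by (auto cong: continuous_on_cong)
next
  case (Suc k)
  have "(f has_derivative D) (at x within S) \<longleftrightarrow> (g has_derivative D) (at x within S)" if "x \<in> S" for x D
    using Suc.prems that by (metis has_derivative_transform)
  then show ?case by auto
qed

lemma Ck_on_imp_continuous: "Ck_on k S f \<Longrightarrow> continuous_on S f"
  by (cases k) (auto simp: continuous_on_eq_continuous_within intro: has_derivative_continuous)

lemma Ck_on_SucI:
  "(\<And>x. x \<in> S \<Longrightarrow> (f has_derivative f' x) (at x within S)) \<Longrightarrow> (\<And>v. Ck_on k S (\<lambda>x. f' x v)) \<Longrightarrow> Ck_on (Suc k) S f"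
  by auto

lemma Ck_on_SucE:
  assumes "Ck_on (Suc k) S f"
  shows "\<exists>f'. (\<forall>x\<in>S. (f has_derivative f' x) (at x within S)) \<and> (\<forall>v. Ck_on k S (\<lambda>x. f' x v))"
  using assms by simp

lemma Ck_on_Suc_imp: "Ck_on (Suc k) S f \<Longrightarrow> Ck_on k S f"
proof (induction k arbitrary: f)
  case 0 then show ?case using Ck_on_imp_continuous by fastforce
next
  case (Suc k)
  from Ck_on_SucE[OF Suc.prems] obtain f' where *: "\<And>x. x \<in> S \<Longrightarrow> (f has_derivative f' x) (at x within S)"
      "\<And>v. Ck_on (Suc k) S (\<lambda>x. f' x v)" by auto
  show ?case by (rule Ck_on_SucI[OF *(1) Suc.IH[OF *(2)]])
qed

lemma Ck_on_const [simp]: "Ck_on k S (\<lambda>x. c)"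
proof (induction k arbitrary: c)
  case (Suc k)
  then show ?case by (intro Ck_on_SucI[where f' = "\<lambda>x v. 0"]) auto
qed auto

lemma Ck_on_add: "Ck_on k S f \<Longrightarrow> Ck_on k S g \<Longrightarrow> Ck_on k S (\<lambda>x. f x + g x)"
proof (induction k arbitrary: f g)
  case 0 then show ?case by (auto intro: continuous_intros)
next
  case (Suc k)
  from Ck_on_SucE[OF Suc.prems(1)] obtain f' where f': "\<And>x. x \<in> S \<Longrightarrow> (f has_derivative f' x) (at x within S)"
      "\<And>v. Ck_on k S (\<lambda>x. f' x v)" by auto
  from Ck_on_SucE[OF Suc.prems(2)] obtain g' where g': "\<And>x. x \<in> S \<Longrightarrow> (g has_derivative g' x) (at x within S)"
      "\<And>v. Ck_on k S (\<lambda>x. g' x v)" by auto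
  show ?case
  proof (rule Ck_on_SucI)
    show "((\<lambda>x. f x + g x) has_derivative (\<lambda>v. f' x v + g' x v)) (at x within S)" if "x \<in> S" for x
      by (rule has_derivative_add[OF f'(1)[OF that] g'(1)[OF that]])
    show "Ck_on k S (\<lambda>x. f' x v + g' x v)" for v
      by (rule Suc.IH[OF f'(2) g'(2)])
  qed
qed

lemma Ck_on_bounded_linear:
  "bounded_linear l \<Longrightarrow> Ck_on k S f \<Longrightarrow> Ck_on k S (\<lambda>x. l (f x))"
proof (induction k arbitrary: f)
  case 0 then show ?case by (auto intro: bounded_linear.continuous_on)
next
  case (Suc k)
  from Ck_on_SucE[OF Suc.prems(2)] obtain f' where *: "\<And>x. x \<in> S \<Longrightarrow> (f has_derivative f' x) (at x within S)"
      "\<And>v. Ck_on k S (\<lambda>x. f' x v)" by auto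
  show ?case
  proof (rule Ck_on_SucI)
    show "((\<lambda>x. l (f x)) has_derivative (\<lambda>v. l (f' x v))) (at x within S)" if "x \<in> S" for x
      by (rule bounded_linear.has_derivative[OF Suc.prems(1) *(1)[OF that]])
    show "Ck_on k S (\<lambda>x. l (f' x v))" for v
      by (rule Suc.IH[OF Suc.prems(1) *(2)])
  qed
qed

lemma Ck_on_bounded_bilinear:
  "bounded_bilinear bop \<Longrightarrow> Ck_on k S f \<Longrightarrow> Ck_on k S g \<Longrightarrow> Ck_on k S (\<lambda>x. bop (f x) (g x))"
proof (induction k arbitrary: f g)
  case 0 then show ?case by (auto intro: bounded_bilinear.continuous_on)
next
  case (Suc k)
  from Ck_on_SucE[OF Suc.prems(2)] obtain f' where f': "\<And>x. x \<in> S \<Longrightarrow> (f has_derivative f' x) (at x within S)"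
      "\<And>v. Ck_on k S (\<lambda>x. f' x v)" by auto
  from Ck_on_SucE[OF Suc.prems(3)] obtain g' where g': "\<And>x. x \<in> S \<Longrightarrow> (g has_derivative g' x) (at x within S)"
      "\<And>v. Ck_on k S (\<lambda>x. g' x v)" by auto
  have "Ck_on k S f" "Ck_on k S g" using Suc.prems Ck_on_Suc_imp by blast+
  note C = this
  show ?case
  proof (rule Ck_on_SucI)
    show "((\<lambda>x. bop (f x) (g x)) has_derivative (\<lambda>v. bop (f x) (g' x v) + bop (f' x v) (g x))) (at x within S)"
      if "x \<in> S" for x
      by (rule bounded_bilinear.FDERIV[OF Suc.prems(1) f'(1)[OF that] g'(1)[OF that]])
    show "Ck_on k S (\<lambda>x. bop (f x) (g' x v) + bop (f' x v) (g x))" for v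
      by (rule Ck_on_add[OF Suc.IH[OF Suc.prems(1) C(1) g'(2)] Suc.IH[OF Suc.prems(1) f'(2) C(2)]])
  qed
qed

lemma Ck_on_mult:
  fixes f g :: "'a::real_normed_vector \<Rightarrow> 'b::real_normed_algebra"
  shows "Ck_on k S f \<Longrightarrow> Ck_on k S g \<Longrightarrow> Ck_on k S (\<lambda>x. f x * g x)"
  by (rule Ck_on_bounded_bilinear[OF bounded_bilinear_mult])

lemma Ck_on_sum: "(\<And>i. i \<in> I \<Longrightarrow> Ck_on k S (f i)) \<Longrightarrow> Ck_on k S (\<lambda>x. \<Sum>i\<in>I. f i x)"
  by (induction I rule: infinite_finite_induct) (auto intro: Ck_on_add)

lemma Ck_on_prod:
  fixes f :: "'i \<Rightarrow> 'a::real_normed_vector \<Rightarrow> 'b::real_normed_field"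
  shows "(\<And>i. i \<in> I \<Longrightarrow> Ck_on k S (f i)) \<Longrightarrow> Ck_on k S (\<lambda>x. \<Prod>i\<in>I. f i x)"
  by (induction I rule: infinite_finite_induct) (auto intro: Ck_on_mult)

lemma Ck_on_bounded_linear_self: "bounded_linear l \<Longrightarrow> Ck_on k S l"
  by (cases k)
     (auto intro: linear_continuous_on intro!: Ck_on_SucI[where f' = "\<lambda>x. l"] bounded_linear_imp_has_derivative
        simp del: Ck_on.simps(2))

text \<open>An affine inner map has constant derivative, so the chain rule returns a composition of
  the same kind and the induction closes without any product rule.\<close>

lemma Ck_on_compose_affine:
  assumes "bounded_linear l"
  shows "Ck_on k T f \<Longrightarrow> (\<And>x. x \<in> S \<Longrightarrow> l x + c \<in> T) \<Longrightarrow> Ck_on k S (\<lambda>x. f (l x + c))"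
proof (induction k arbitrary: f)
  case 0
  have "continuous_on S (\<lambda>x. l x + c)"
    using assms by (intro continuous_intros linear_continuous_on)
  with 0 show ?case by (auto intro!: continuous_on_compose2[of T f])
next
  case (Suc k)
  from Ck_on_SucE[OF Suc.prems(1)] obtain f' where f': "\<And>x. x\<in>T \<Longrightarrow> (f has_derivative f' x) (at x within T)"
      "\<And>v. Ck_on k T (\<lambda>x. f' x v)" by auto
  have d: "((\<lambda>x. l x + c) has_derivative l) (at x within S)" for x
    using bounded_linear_imp_has_derivative[OF assms, of "at x within S"]
    by (auto intro!: derivative_eq_intros)
  have "((\<lambda>x. f (l x + c)) has_derivative (\<lambda>v. f' (l x + c) (l v))) (at x within S)" if "x \<in> S" for x
    by (rule has_derivative_in_compose2[of T f f' "\<lambda>x. l x + c"]) (use that f' Suc.prems d in auto)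
  moreover have "Ck_on k S (\<lambda>x. f' (l x + c) (l v))" for v
    using Suc.IH[of "\<lambda>x. f' x (l v)"] Suc.prems(2) f'(2) by blast
  ultimately show ?case by (rule Ck_on_SucI)
qed

lemma matrix_sum_units:
  fixes A :: "complex^'n^'m"
  shows "A = (\<Sum>i\<in>UNIV. \<Sum>j\<in>UNIV. (\<chi> a b. if a = i \<and> b = j then A $ i $ j else 0))"
proof -
  have "(\<Sum>i\<in>UNIV. \<Sum>j\<in>UNIV. if a = i \<and> b = j then A $ i $ j else 0) = A $ a $ b" for a b
  proof -
    have "(\<Sum>i\<in>UNIV. \<Sum>j\<in>UNIV. if a = i \<and> b = j then A $ i $ j else 0)
       = (\<Sum>i\<in>UNIV. if a = i then A $ i $ b else 0)"
    proof (rule sum.cong[OF refl])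
      fix i show "(\<Sum>j\<in>UNIV. if a = i \<and> b = j then A $ i $ j else 0) = (if a = i then A $ i $ b else 0)"
        by (cases "a = i") auto
    qed
    then show ?thesis by simp
  qed
  then show ?thesis by (simp add: vec_eq_iff)
qed

lemma linear_matrix_unit: "linear (\<lambda>x. \<chi> a b. if a = i \<and> b = j then x else (0::complex))"
  by (rule linearI) (auto simp: vec_eq_iff)

lemma Ck_on_matrix:
  fixes f :: "'a::real_normed_vector \<Rightarrow> complex^'n^'m"
  assumes "\<And>i j. Ck_on k S (\<lambda>x. f x $ i $ j)"
  shows "Ck_on k S f"
proof -
  have "Ck_on k S (\<lambda>x. \<Sum>i\<in>UNIV. \<Sum>j\<in>UNIV. (\<chi> a b. if a = i \<and> b = j then f x $ i $ j else 0))"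
    by (intro Ck_on_sum
       Ck_on_bounded_linear[OF linear_conv_bounded_linear[THEN iffD1, OF linear_matrix_unit]] assms)
  then show ?thesis by (subst (asm) matrix_sum_units[symmetric])
qed

lemma bounded_linear_entry: "bounded_linear (\<lambda>A::complex^'n^'m. A $ i $ j)"
  by (auto intro!: linear_conv_bounded_linear[THEN iffD1] linearI)

lemma Ck_on_entry: "Ck_on k S f \<Longrightarrow> Ck_on k S (\<lambda>x. (f x :: complex^'n^'m) $ i $ j)"
  by (rule Ck_on_bounded_linear[OF bounded_linear_entry])

lemma Ck_on_det:
  fixes f :: "'a::real_normed_vector \<Rightarrow> complex^'n^'n"
  assumes "\<And>i j. Ck_on k S (\<lambda>x. f x $ i $ j)"
  shows "Ck_on k S (\<lambda>x. det (f x))"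
  unfolding det_def by (intro Ck_on_sum Ck_on_mult Ck_on_const Ck_on_prod assms)

lemma matrix_inv_mult:
  fixes A :: "complex^'n^'n"
  assumes "det A \<noteq> 0"
  shows "A ** matrix_inv A = mat 1" "matrix_inv A ** A = mat 1"
proof -
  have "invertible A" using assms by (simp add: invertible_det_nz)
  then show "A ** matrix_inv A = mat 1" "matrix_inv A ** A = mat 1"
    unfolding invertible_def matrix_inv_def by (metis (mono_tags, lifting) someI_ex)+
qed

text \<open>Cramer's rule for the columns of the inverse. With determinant one there is no
  denominator, so inversion is polynomial in the entries; smoothness and bounds of u^{-1} rest on
  this.\<close>

lemma matrix_inv_entry:
  fixes A :: "complex^'n^'n"
  assumes "det A = 1"
  shows "matrix_inv A $ k $ m = det (\<chi> i j. if j = k then (if i = m then 1 else 0) else A $ i $ j)"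
proof -
  define x where "x = column m (matrix_inv A)"
  have "A *v x = axis m 1"
  proof -
    have "A *v x = column m (A ** matrix_inv A)"
      by (simp add: x_def vec_eq_iff matrix_vector_mult_def matrix_matrix_mult_def column_def)
    then show ?thesis using assms by (simp add: matrix_inv_mult vec_eq_iff column_def mat_def axis_def)
  qed
  then have "x = (\<chi> k. det (\<chi> i j. if j = k then axis m 1 $ i else A $ i $ j) / det A)"
    using assms by (subst cramer[symmetric]) auto
  then have "x $ k = det (\<chi> i j. if j = k then axis m 1 $ i else A $ i $ j)"
    using assms by simp
  then show ?thesis by (simp add: x_def column_def axis_def eq_commute[of m] cong: if_cong)
qed

lemma Ck_on_matrix_inv:
  fixes f :: "'a::real_normed_vector \<Rightarrow> complex^'n^'n"
  assumes f: "Ck_on k S f" and det: "\<And>x. x \<in> S \<Longrightarrow> det (f x) = 1"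
  shows "Ck_on k S (\<lambda>x. matrix_inv (f x))"
proof (rule Ck_on_matrix)
  fix a m
  have "Ck_on k S (\<lambda>x. det (\<chi> i j. if j = a then (if i = m then 1 else 0) else f x $ i $ j))"
  proof (rule Ck_on_det)
    fix i j
    show "Ck_on k S (\<lambda>x. (\<chi> i j. if j = a then (if i = m then 1 else 0) else f x $ i $ j) $ i $ j)"
      using Ck_on_entry[OF f] by (cases "j = a") auto
  qed
  then show "Ck_on k S (\<lambda>x. matrix_inv (f x) $ a $ m)"
    by (subst Ck_on_cong[where g = "\<lambda>x. det (\<chi> i j. if j = a then (if i = m then 1 else 0) else f x $ i $ j)"])
       (auto simp: det matrix_inv_entry)
qed

text \<open>The cofactor polynomials are continuous on all matrices, not only on those of
  determinant one, so compactness of a closed ball bounds them and hence the inverse.\<close>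

lemma norm_matrix_inv_bound:
  fixes B :: real
  shows "\<exists>K. \<forall>A::complex^'n^'n. det A = 1 \<and> norm A \<le> B \<longrightarrow> norm (matrix_inv A) \<le> K"
proof -
  define F where "F = (\<lambda>A::complex^'n^'n. \<Sum>k\<in>UNIV. \<Sum>m\<in>UNIV.
      norm (det (\<chi> i j. if j = k then (if i = m then 1 else 0) else A $ i $ j)))"
  have "continuous_on UNIV (\<lambda>A::complex^'n^'n. det (\<chi> i j. if j = k then (if i = m then 1 else 0) else A $ i $ j))" for k m
  proof -
    have "Ck_on 0 UNIV (\<lambda>A::complex^'n^'n. det (\<chi> i j. if j = k then (if i = m then 1 else 0) else A $ i $ j))"
    proof (rule Ck_on_det)
      fix i j
      show "Ck_on 0 UNIV (\<lambda>A::complex^'n^'n. (\<chi> i j. if j = k then (if i = m then 1 else 0) else A $ i $ j) $ i $ j)"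
        by (cases "j = k") (auto intro!: continuous_intros)
    qed
    then show ?thesis by simp
  qed
  then have "continuous_on UNIV F" unfolding F_def by (intro continuous_intros)
  then have "compact (F ` cball 0 B)"
    by (meson compact_cball compact_continuous_image continuous_on_subset subset_UNIV)
  then obtain K where "\<forall>x\<in>F ` cball 0 B. norm x \<le> K"
    using compact_imp_bounded[of "F ` cball 0 B"] unfolding bounded_iff by blast
  then have K: "F A \<le> K" if "norm A \<le> B" for A
    using that by (auto dest: abs_le_D1)
  show ?thesis
  proof (intro exI[of _ K] allI impI, elim conjE)
    fix A :: "complex^'n^'n" assume A: "det A = 1" "norm A \<le> B"
    have "norm (matrix_inv A) \<le> (\<Sum>k\<in>UNIV. norm (matrix_inv A $ k))"
      by (simp add: norm_vec_def L2_set_le_sum)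
    also have "\<dots> \<le> (\<Sum>k\<in>UNIV. \<Sum>m\<in>UNIV. norm (matrix_inv A $ k $ m))"
      by (rule sum_mono) (simp add: norm_vec_def L2_set_le_sum)
    also have "\<dots> = F A" by (simp add: F_def matrix_inv_entry[OF A(1)])
    also have "\<dots> \<le> K" using K A by simp
    finally show "norm (matrix_inv A) \<le> K" .
  qed
qed

text \<open>Differentiability is supplied by \<open>C\<close>; only the value of the derivative has
  to be found, by differentiating the identity f^{-1} (f f^{-1}) = f^{-1}.\<close>

lemma matrix_inv_derivative:
  fixes f :: "'a::real_normed_vector \<Rightarrow> complex^'n^'n"
  assumes f: "(f has_derivative f') (at x within S)" and x: "x \<in> S"
    and det: "\<And>x. x \<in> S \<Longrightarrow> det (f x) = 1"
    and C: "Ck_on 1 S (\<lambda>x. matrix_inv (f x))"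
  shows "((\<lambda>x. matrix_inv (f x)) has_derivative
      (\<lambda>v. - (matrix_inv (f x) ** f' v ** matrix_inv (f x)))) (at x within S)"
proof -
  let ?g = "\<lambda>x. matrix_inv (f x)"
  obtain g' where g': "(?g has_derivative g') (at x within S)" using C x by auto
  have inv: "f x ** ?g x = mat 1" "?g x ** f x = mat 1" if "x \<in> S" for x
    using matrix_inv_mult det that by (metis zero_neq_one)+
  have 1: "((\<lambda>y. ?g y ** (f y ** ?g y)) has_derivative (\<lambda>v. ?g x ** (f x ** g' v + f' v ** ?g x) + g' v ** (f x ** ?g x))) (at x within S)"
    by (intro matrix_mult_derivative f g')
  have 2: "(?g has_derivative (\<lambda>v. ?g x ** (f x ** g' v + f' v ** ?g x) + g' v ** (f x ** ?g x))) (at x within S)"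
    by (rule has_derivative_transform[OF x _ 1]) (simp add: inv)
  have D: "(\<lambda>v. ?g x ** (f x ** g' v + f' v ** ?g x) + g' v ** (f x ** ?g x)) = (\<lambda>v. g' v + (?g x ** f' v ** ?g x + g' v))"
    by (rule ext) (simp add: matrix_add_ldistrib matrix_mul_assoc inv x)
  \<comment> \<open>\<open>S\<close> is arbitrary, so derivatives within it need not be unique and
    cannot be compared. Instead \<open>?g + (?g - ?g)\<close> is differentiated with
    \<open>g'\<close> for the first two occurrences and the derivative from \<open>2\<close> for the
    third; all \<open>g'\<close> cancel and the formula remains.\<close>
  have "((\<lambda>y. ?g y + (?g y - ?g y)) has_derivative (\<lambda>v. g' v + (g' v - (g' v + (?g x ** f' v ** ?g x + g' v))))) (at x within S)"
    using 2 unfolding D by (intro derivative_intros g')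
  then show ?thesis by (simp add: algebra_simps)
qed

section \<open>Hermitian matrices\<close>

lemma hconj_hconj [simp]: "hconj (hconj A) = A"
  by (simp add: hconj_def vec_eq_iff)

lemma hconj_mult: "hconj (A ** B) = hconj B ** hconj A"
  by (simp add: hconj_def vec_eq_iff matrix_matrix_mult_def mult.commute)

lemma hconj_mat_1 [simp]: "hconj (mat 1) = mat 1"
  by (simp add: hconj_def vec_eq_iff mat_def)

lemma hconj_add: "hconj (A + B) = hconj A + hconj B"
  by (simp add: hconj_def vec_eq_iff)

lemma hconj_scaleR: "hconj (c *\<^sub>R A) = c *\<^sub>R hconj A"
  by (simp add: hconj_def vec_eq_iff)

lemma bounded_linear_hconj: "bounded_linear (hconj :: complex^'n^'n \<Rightarrow> _)"
  by (auto intro!: linear_conv_bounded_linear[THEN iffD1] linearI simp: hconj_add hconj_scaleR)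

lemma trace_hconj: "trace (hconj A) = cnj (trace A)"
  by (simp add: hconj_def trace_def)

lemma matrix_inv_unique:
  fixes A B :: "complex^'n^'n"
  assumes "A ** B = mat 1"
  shows "matrix_inv A = B"
proof -
  have "det A * det B = 1" using assms by (metis det_I det_mul)
  then have "det A \<noteq> 0" by auto
  then have "matrix_inv A ** (A ** B) = B" by (simp add: matrix_mul_assoc matrix_inv_mult)
  with assms show ?thesis by simp
qed

lemma sum_permutations_id:
  fixes F :: "('n::finite \<Rightarrow> 'n) \<Rightarrow> 'b::comm_monoid_add"
  assumes "\<And>q. q permutes UNIV \<Longrightarrow> q \<noteq> id \<Longrightarrow> F q = 0"
  shows "(\<Sum>q\<in>{q. q permutes UNIV}. F q) = F id"
proof -
  have "(\<Sum>q\<in>{q. q permutes UNIV}. F q) = (\<Sum>q\<in>{id}. F q)"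
    by (rule sum.mono_neutral_right) (use assms in \<open>auto simp: permutes_id finite_permutations\<close>)
  then show ?thesis by simp
qed

text \<open>In the Leibniz expansion a permutation other than the identity moves at least two
  indices. After one factor has been differentiated, an off-diagonal zero of the identity matrix is
  still present, so only the diagonal product contributes.\<close>

lemma has_derivative_det_at_id:
  fixes f :: "'a::real_normed_vector \<Rightarrow> complex^'n^'n"
  assumes f: "(f has_derivative f') (at x within S)" and fx: "f x = mat 1"
  shows "((\<lambda>y. det (f y)) has_derivative (\<lambda>v. trace (f' v))) (at x within S)"
proof -
  have e: "((\<lambda>y. f y $ i $ j) has_derivative (\<lambda>v. f' v $ i $ j)) (at x within S)" for i j
    by (rule bounded_linear.has_derivative[OF bounded_linear_entry f])
  let ?D = "\<lambda>q v. of_int (sign q) * (\<Sum>i\<in>UNIV. f' v $ i $ q i * (\<Prod>j\<in>UNIV - {i}. f x $ j $ q j)) :: complex"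
  have "((\<lambda>y. det (f y)) has_derivative (\<lambda>v. \<Sum>q\<in>{q. q permutes UNIV}. ?D q v)) (at x within S)"
    unfolding det_def
    by (intro has_derivative_sum has_derivative_mult_right has_derivative_prod e)
  moreover have "(\<Sum>q\<in>{q. q permutes UNIV}. ?D q v) = trace (f' v)" for v
  proof (subst sum_permutations_id)
    fix q :: "'n \<Rightarrow> 'n" assume q: "q permutes UNIV" "q \<noteq> id"
    have "(\<Prod>j\<in>UNIV - {i}. f x $ j $ q j) = 0" for i
    proof -
      have "\<exists>j. j \<noteq> i \<and> q j \<noteq> j"
      proof (rule ccontr)
        assume "\<not> ?thesis"
        then have *: "\<And>j. j \<noteq> i \<Longrightarrow> q j = j" by blast
        moreover have "q i = i" using * permutes_inj[OF q(1)] by (metis injD)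
        ultimately have "q = id" by (metis eq_id_iff)
        with q show False by simp
      qed
      then obtain j where "j \<in> UNIV - {i}" "f x $ j $ q j = 0" by (auto simp: fx mat_def)
      then show ?thesis by (intro prod_zero) auto
    qed
    then show "?D q v = 0" by (simp only: mult_zero_right sum.neutral_const)
  qed (simp add: trace_def fx mat_def)
  ultimately show ?thesis by simp
qed

text \<open>Multiplication by the constant matrix (f x)^{-1} moves the base point to the identity
  and keeps the determinant equal to one. The derivative of that determinant is the trace and also
  zero.\<close>

lemma trace_matrix_inv_derivative:
  fixes f :: "'a::euclidean_space \<Rightarrow> complex^'n^'n"
  assumes S: "convex S" "interior S \<noteq> {}" "x \<in> S"
    and f: "(f has_derivative f') (at x within S)"
    and det: "\<And>y. y \<in> S \<Longrightarrow> det (f y) = 1"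
  shows "trace (matrix_inv (f x) ** f' v) = 0"
proof -
  let ?g = "\<lambda>y. matrix_inv (f x) ** f y"
  have inv: "matrix_inv (f x) ** f x = mat 1" using matrix_inv_mult det S(3) by (metis zero_neq_one)
  have d1: "det (?g y) = 1" if "y \<in> S" for y
  proof -
    have "det (matrix_inv (f x)) = 1"
      using inv det[OF S(3)] by (metis det_I det_mul mult_1_right)
    then show ?thesis using det that by (simp add: det_mul)
  qed
  have "(?g has_derivative (\<lambda>v. matrix_inv (f x) ** f' v)) (at x within S)"
    by (rule bounded_linear.has_derivative[OF bounded_bilinear.bounded_linear_right[OF bounded_bilinear_matrix_matrix_mult] f])
  from has_derivative_det_at_id[OF this inv]
  have 1: "((\<lambda>y. det (?g y)) has_derivative (\<lambda>v. trace (matrix_inv (f x) ** f' v))) (at x within S)" .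
  have 2: "((\<lambda>y. det (?g y)) has_derivative (\<lambda>v. 0)) (at x within S)"
    by (rule has_derivative_transform[OF S(3) _ has_derivative_const[of 1]]) (simp add: d1)
  show ?thesis using convex_derivative_unique[OF S 1 2] by metis
qed

definition herm :: "complex^'n^'n \<Rightarrow> complex^'n \<Rightarrow> complex^'n \<Rightarrow> complex" where
  "herm h x y = (\<Sum>i\<in>UNIV. cnj (x $ i) * (h *v y) $ i)"

lemma herm_add_right: "herm h x (y + z) = herm h x y + herm h x z"
  by (simp add: herm_def matrix_vector_right_distrib distrib_left sum.distrib)

lemma herm_diff_right: "herm h x (y - z) = herm h x y - herm h x z"
  by (simp add: herm_def matrix_vector_mult_diff_distrib right_diff_distrib sum_subtractf)

lemma herm_scale_right: "herm h x (c *s y) = c * herm h x y"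
  by (simp add: herm_def vector_scalar_commute sum_distrib_left mult.left_commute)

lemma herm_scale_left: "herm h (c *s x) y = cnj c * herm h x y"
  by (simp add: herm_def sum_distrib_left mult.assoc)

lemma herm_sum_right: "herm h x (\<Sum>i\<in>I. f i) = (\<Sum>i\<in>I. herm h x (f i))"
  by (induction I rule: infinite_finite_induct) (auto simp: herm_add_right, auto simp: herm_def)

lemma herm_commute:
  assumes "hconj h = h"
  shows "herm h y x = cnj (herm h x y)"
proof -
  have h: "h $ i $ j = cnj (h $ j $ i)" for i j
    using assms by (metis (no_types) hconj_def vec_lambda_beta)
  have "herm h y x = (\<Sum>i\<in>UNIV. \<Sum>j\<in>UNIV. cnj (y $ i) * (h $ i $ j * x $ j))"
    by (simp add: herm_def matrix_vector_mult_def sum_distrib_left)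
  also have "\<dots> = (\<Sum>j\<in>UNIV. \<Sum>i\<in>UNIV. cnj (y $ i) * (h $ i $ j * x $ j))"
    by (rule sum.swap)
  also have "\<dots> = cnj (\<Sum>j\<in>UNIV. \<Sum>i\<in>UNIV. cnj (x $ j) * (h $ j $ i * y $ i))"
    by (subst h) (simp add: mult.commute mult.left_commute)
  also have "\<dots> = cnj (herm h x y)"
    by (simp add: herm_def matrix_vector_mult_def sum_distrib_left)
  finally show ?thesis .
qed

text \<open>Gram-Schmidt for the form \<open>herm h\<close>: fewer than CARD('n) vectors do not
  span, and the corrected vector \<open>w'\<close> is nonzero because \<open>w\<close> lies outside
  their span.\<close>

lemma orthonormal_extend:
  fixes h :: "complex^'n^'n" and e :: "nat \<Rightarrow> complex^'n"
  assumes h: "hconj h = h" and pos: "\<And>x. x \<noteq> 0 \<Longrightarrow> 0 < Re (herm h x x)"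
  shows "k \<le> CARD('n) \<Longrightarrow> \<exists>e. \<forall>i<k. \<forall>j<k. herm h (e i) (e j) = (if i = j then 1 else 0)"
proof (induction k)
  case (Suc k)
  then obtain e where e: "\<And>i j. i < k \<Longrightarrow> j < k \<Longrightarrow> herm h (e i) (e j) = (if i = j then 1 else 0)"
    by auto
  have "vec.dim (e ` {..<k}) \<le> card (e ` {..<k})" by (rule vec.dim_le_card') simp
  also have "\<dots> \<le> k" by (metis card_image_le card_lessThan finite_lessThan)
  also have "k < vec.dim (UNIV :: (complex^'n) set)" using Suc.prems by (simp add: card_cart_basis)
  finally have "vec.span (e ` {..<k}) \<noteq> UNIV" using vec.dim_span by (metis nat_neq_iff)
  then obtain w where w: "w \<notin> vec.span (e ` {..<k})" by auto
  define w' where "w' = w - (\<Sum>i<k. herm h (e i) w *s e i)"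
  have "w' \<noteq> 0"
  proof
    assume "w' = 0"
    then have "w = (\<Sum>i<k. herm h (e i) w *s e i)" by (simp add: w'_def)
    moreover have "\<dots> \<in> vec.span (e ` {..<k})"
      by (intro vec.span_sum vec.span_scale vec.span_base) auto
    ultimately show False using w by simp
  qed
  then have p: "0 < Re (herm h w' w')" by (rule pos)
  have im: "Im (herm h w' w') = 0" using herm_commute[OF h, of w' w'] by (metis cnj.simps(2) equal_neg_zero)
  have orth: "herm h (e i) w' = 0" if "i < k" for i
  proof -
    have "herm h (e i) w' = herm h (e i) w - (\<Sum>j<k. herm h (e j) w * (if i = j then 1 else 0))"
    proof -
      have "(\<Sum>j<k. herm h (e j) w * herm h (e i) (e j)) = (\<Sum>j<k. herm h (e j) w * (if i = j then 1 else 0))"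
        using that by (intro sum.cong) (simp_all add: e)
      then show ?thesis by (simp add: w'_def herm_diff_right herm_sum_right herm_scale_right)
    qed
    also have "(\<Sum>j<k. herm h (e j) w * (if i = j then 1 else 0)) = (\<Sum>j<k. if i = j then herm h (e j) w else 0)"
      by (rule sum.cong) auto
    also have "\<dots> = herm h (e i) w" using that by simp
    finally show ?thesis by simp
  qed
  define c :: complex where "c = complex_of_real (1 / sqrt (Re (herm h w' w')))"
  define e' where "e' = e(k := c *s w')"
  have cc: "cnj c * c * herm h w' w' = 1"
  proof -
    have "herm h w' w' = complex_of_real (Re (herm h w' w'))" using im by (simp add: complex_eq_iff)
    moreover have "cnj c * c = complex_of_real (1 / Re (herm h w' w'))"
      using p by (simp add: c_def of_real_mult[symmetric] del: of_real_mult)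
    ultimately have "cnj c * c * herm h w' w' = complex_of_real (1 / Re (herm h w' w') * Re (herm h w' w'))"
      by (metis of_real_mult)
    then show ?thesis using p by simp
  qed
  have "herm h (e' i) (e' j) = (if i = j then 1 else 0)" if "i < Suc k" "j < Suc k" for i j
  proof -
    have o2: "herm h w' (e i) = 0" if "i < k" for i
      using orth[OF that] herm_commute[OF h, of w' "e i"] by simp
    show ?thesis using that e orth o2 cc
      by (auto simp: e'_def less_Suc_eq herm_scale_left herm_scale_right mult.assoc mult.left_commute)
  qed
  then show ?case by blast
qed simp

text \<open>Let the columns of \<open>Q\<close> be an h-orthonormal basis. Then Q is invertible with
  hconj Q h Q = 1, which rearranges to the claim. It serves in place of a positive square root of
  h^{-1}.\<close>

lemma posdef_decomposition:
  fixes h :: "complex^'n^'n"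
  assumes h: "hconj h = h" and pos: "\<And>x. x \<noteq> 0 \<Longrightarrow> 0 < Re (\<Sum>i\<in>UNIV. cnj (x $ i) * (h *v x) $ i)"
  obtains Q where "matrix_inv h = Q ** hconj Q"
proof -
  obtain e :: "nat \<Rightarrow> complex^'n" where e: "\<And>i j. i < CARD('n) \<Longrightarrow> j < CARD('n) \<Longrightarrow> herm h (e i) (e j) = (if i = j then 1 else 0)"
    using orthonormal_extend[OF h pos[folded herm_def], of "CARD('n)"] by auto
  obtain b :: "'n \<Rightarrow> nat" where b: "bij_betw b UNIV {..<CARD('n)}"
    by (metis bij_betw_iff_card card_lessThan finite_class.finite_UNIV finite_lessThan)
  have b': "b i < CARD('n)" "b i = b j \<longleftrightarrow> i = j" for i j
    using b by (auto simp: bij_betw_def inj_on_def)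
  define Q :: "complex^'n^'n" where "Q = (\<chi> i j. e (b j) $ i)"
  have "(hconj Q ** (h ** Q)) $ i $ j = herm h (e (b i)) (e (b j))" for i j
    by (simp add: hconj_def Q_def matrix_matrix_mult_def herm_def matrix_vector_mult_def)
  then have 1: "hconj Q ** (h ** Q) = mat 1" using e b' by (simp add: vec_eq_iff mat_def)
  then have "(h ** Q) ** hconj Q = mat 1" by (rule matrix_left_right_inverse[THEN iffD1])
  then have "matrix_inv h = Q ** hconj Q" by (intro matrix_inv_unique) (simp add: matrix_mul_assoc)
  with that show thesis .
qed

lemma sym_spaceD:
  assumes "h \<in> sym_space"
  shows "hconj h = h" "det h = 1" "h ** matrix_inv h = mat 1" "matrix_inv h ** h = mat 1"
    "hconj (matrix_inv h) = matrix_inv h"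
proof -
  show *: "hconj h = h" "det h = 1" using assms by (auto simp: sym_space_def)
  then show inv: "h ** matrix_inv h = mat 1" "matrix_inv h ** h = mat 1"
    by (metis matrix_inv_mult zero_neq_one)+
  have "h ** hconj (matrix_inv h) = mat 1"
    by (metis hconj_mat_1 hconj_mult inv(2) *(1))
  then show "hconj (matrix_inv h) = matrix_inv h" by (metis matrix_inv_unique)
qed

text \<open>With h^{-1} = Q hconj Q, cyclicity turns the trace into that of H hconj H for the
  Hermitian matrix H = hconj Q V Q, a sum of squared moduli. Consequently \<open>ennreal\<close> in
  the energy density truncates nothing for differentiable maps.\<close>

lemma trace_square_nonneg:
  fixes h V :: "complex^'n^'n"
  assumes h: "h \<in> sym_space" and V: "hconj V = V"
  shows "0 \<le> Re (trace ((matrix_inv h ** V) ** (matrix_inv h ** V)))"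
proof -
  obtain Q where Q: "matrix_inv h = Q ** hconj Q"
    using posdef_decomposition[of h] h by (auto simp: sym_space_def)
  define H where "H = hconj Q ** V ** Q"
  have H: "hconj H = H" by (simp add: H_def hconj_mult V matrix_mul_assoc)
  have "trace ((matrix_inv h ** V) ** (matrix_inv h ** V)) = trace (Q ** (hconj Q ** V ** Q ** hconj Q ** V))"
    by (simp add: Q matrix_mul_assoc)
  also have "\<dots> = trace ((hconj Q ** V ** Q ** hconj Q ** V) ** Q)" by (rule trace_mul_sym)
  also have "\<dots> = trace (H ** hconj H)" unfolding H by (simp add: H_def matrix_mul_assoc)
  also have "\<dots> = (\<Sum>i\<in>UNIV. \<Sum>j\<in>UNIV. H $ i $ j * cnj (H $ i $ j))"
    by (simp add: trace_def matrix_matrix_mult_def hconj_def)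
  finally show ?thesis by (simp add: sum_nonneg)
qed

text \<open>Substituting g x for x in the quadratic form preserves positivity. This keeps the
  competitors inside the target.\<close>

lemma sym_space_congruence:
  assumes h: "h \<in> sym_space" and g: "det g = 1"
  shows "hconj g ** h ** g \<in> sym_space"
proof -
  have "det (hconj g) = cnj (det g)"
  proof -
    have "hconj g = transpose (\<chi> i j. cnj (g $ i $ j))" by (simp add: hconj_def transpose_def)
    then have "det (hconj g) = det (\<chi> i j. cnj (g $ i $ j))" by (metis det_transpose)
    then show ?thesis by (simp add: det_def)
  qed
  then have d: "det (hconj g) = 1" using g by simp
  have pos: "0 < Re (\<Sum>i\<in>UNIV. cnj (x $ i) * ((hconj g ** h ** g) *v x) $ i)" if "x \<noteq> 0" for x
  proof -
    have "herm (hconj g ** h ** g) x x = herm h (g *v x) (g *v x)"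
    proof -
      have adj: "(\<Sum>i\<in>UNIV. cnj (x $ i) * (hconj g *v y) $ i) = (\<Sum>i\<in>UNIV. cnj ((g *v x) $ i) * y $ i)" for y
      proof -
        have "(\<Sum>i\<in>UNIV. cnj (x $ i) * (hconj g *v y) $ i) = (\<Sum>i\<in>UNIV. \<Sum>j\<in>UNIV. cnj (x $ i) * (cnj (g $ j $ i) * y $ j))"
          by (simp add: hconj_def matrix_vector_mult_def sum_distrib_left)
        also have "\<dots> = (\<Sum>j\<in>UNIV. \<Sum>i\<in>UNIV. cnj (x $ i) * (cnj (g $ j $ i) * y $ j))" by (rule sum.swap)
        also have "\<dots> = (\<Sum>j\<in>UNIV. cnj ((g *v x) $ j) * y $ j)"
          by (simp add: matrix_vector_mult_def sum_distrib_left sum_distrib_right mult.assoc mult.commute mult.left_commute)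
        finally show ?thesis .
      qed
      show ?thesis by (simp add: herm_def adj matrix_vector_mul_assoc[symmetric])
    qed
    moreover have "g *v x \<noteq> 0"
    proof
      assume "g *v x = 0"
      then have "matrix_inv g *v (g *v x) = 0" by simp
      then show False using that g by (simp add: matrix_vector_mul_assoc matrix_inv_mult)
    qed
    ultimately show ?thesis using h by (simp add: sym_space_def herm_def)
  qed
  show ?thesis using h g d pos
    by (simp add: sym_space_def det_mul hconj_mult matrix_mul_assoc)
qed

definition unit_mat :: "'n \<Rightarrow> 'n \<Rightarrow> complex \<Rightarrow> complex^'n^'n" where
  "unit_mat i j c = (\<chi> a b. if a = i \<and> b = j then c else 0)"

lemma mult_unit_mat: "(A ** unit_mat i j c) $ a $ b = (if b = j then A $ a $ i * c else 0)"
  by (simp add: matrix_matrix_mult_def unit_mat_def if_distrib[of "\<lambda>x. _ * x"] cong: if_cong)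

lemma unit_mat_mult: "(unit_mat i j c ** A) $ a $ b = (if a = i then c * A $ j $ b else 0)"
  by (cases "a = i") (simp_all add: matrix_matrix_mult_def unit_mat_def if_distrib[of "\<lambda>x. x * _"] cong: if_cong)

lemma trace_mult_unit_mat: "trace (A ** unit_mat i j c) = A $ j $ i * c"
  by (simp add: trace_def mult_unit_mat)

text \<open>These matrices span the traceless ones, and \<open>1 + t N\<close> has determinant one for all \<open>t\<close>.\<close>

definition nil2 :: "(complex^'n^'n) set" where
  "nil2 = {N. N ** N = 0 \<and> (\<forall>s::real. det (mat 1 + s *\<^sub>R N) = 1)}"

text \<open>1 + s N is the elementary matrix of a row operation, and off-diagonal matrix units
  square to zero.\<close>

lemma unit_mat_nil2: 
  assumes "i \<noteq> j"
  shows "unit_mat i j c \<in> nil2"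
proof -
  have "det (mat 1 + s *\<^sub>R unit_mat i j c) = 1" for s :: real
  proof -
    have "mat 1 + s *\<^sub>R unit_mat i j c = (\<chi> k. if k = i then row i (mat 1) + (s *\<^sub>R c) *s row j (mat 1) else row k (mat 1))"
      using assms by (auto simp: vec_eq_iff unit_mat_def mat_def row_def)
    then show ?thesis using det_row_operation[OF assms, of "mat 1"] by (simp add: det_I)
  qed
  moreover have "unit_mat i j c ** unit_mat i j c = 0"
    using assms by (simp add: vec_eq_iff mult_unit_mat) (simp add: unit_mat_def)
  ultimately show ?thesis by (simp add: nil2_def)
qed

text \<open>Conjugates of matrix units supply the square-zero matrices with nonzero diagonal entries
  that detect the diagonal of a matrix.\<close>

lemma nil2_conjugate:
  fixes P R N :: "complex^'n^'n"
  assumes N: "N \<in> nil2" and PR: "P ** R = mat 1"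
  shows "P ** N ** R \<in> nil2"
proof -
  have RP: "R ** P = mat 1" using PR by (rule matrix_left_right_inverse[THEN iffD1])
  have dd: "det P * det R = 1" using PR by (metis det_I det_mul)
  have "(P ** N ** R) ** (P ** N ** R) = P ** (N ** (R ** P) ** N) ** R"
    by (simp add: matrix_mul_assoc)
  also have "\<dots> = 0" using N by (simp add: RP nil2_def)
  finally have 1: "(P ** N ** R) ** (P ** N ** R) = 0" .
  have "det (mat 1 + s *\<^sub>R (P ** N ** R)) = 1" for s :: real
  proof -
    have "P ** (mat 1 + s *\<^sub>R N) ** R = mat 1 + s *\<^sub>R (P ** N ** R)"
      by (simp add: matrix_add_ldistrib bounded_bilinear.add_left[OF bounded_bilinear_matrix_matrix_mult] PR
        bounded_bilinear.scaleR_right[OF bounded_bilinear_matrix_matrix_mult]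
        bounded_bilinear.scaleR_left[OF bounded_bilinear_matrix_matrix_mult])
    then have "det (mat 1 + s *\<^sub>R (P ** N ** R)) = det P * det (mat 1 + s *\<^sub>R N) * det R"
      by (metis det_mul)
    then show ?thesis using N dd by (simp add: nil2_def)
  qed
  with 1 show ?thesis by (simp add: nil2_def)
qed

text \<open>Off-diagonal matrix units detect the off-diagonal entries, a conjugated unit detects
  differences of diagonal entries, and the trace condition then settles the diagonal. Complex
  multiples c of a unit recover a complex entry from real parts.\<close>

lemma traceless_eq_0I:
  fixes S :: "complex^'n^'n"
  assumes tr: "trace S = 0" and orth: "\<And>N. N \<in> nil2 \<Longrightarrow> Re (trace (S ** N)) = 0"
  shows "S = 0"
proof -
  have z0: "z = 0" if "\<And>c. Re (z * c) = 0" for z :: complex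
    using that[of 1] that[of "\<i>"] by (simp add: complex_eq_iff)
  have off: "S $ j $ i = 0" if "i \<noteq> j" for i j
    using orth[OF unit_mat_nil2[OF that]] by (intro z0) (simp add: trace_mult_unit_mat)
  have diag: "S $ j $ j = S $ i $ i" if ij: "i \<noteq> j" for i j
  proof -
    \<comment> \<open>\<open>R\<close> is the inverse of \<open>P\<close>. Conjugation by this shear
      mixes row and column i with j, so the (j, i) entry of R S P contains the difference of the two
      diagonal entries.\<close>
    define P where "P = mat 1 + unit_mat j i 1"
    define R where "R = mat 1 - unit_mat j i 1"
    have U: "unit_mat j i 1 ** unit_mat j i 1 = 0"
      using ij by (simp add: vec_eq_iff mult_unit_mat) (simp add: unit_mat_def)
    have PR: "P ** R = mat 1"
      by (simp add: P_def R_def matrix_add_ldistrib bounded_bilinear.add_left[OF bounded_bilinear_matrix_matrix_mult] U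
        bounded_bilinear.diff_right[OF bounded_bilinear_matrix_matrix_mult])
    have "(R ** S ** P) $ j $ i = 0"
    proof (rule z0)
      fix c
      have "trace (S ** (P ** unit_mat i j c ** R)) = trace ((S ** P ** unit_mat i j c) ** R)"
        by (simp add: matrix_mul_assoc)
      also have "\<dots> = trace (R ** (S ** P ** unit_mat i j c))" by (rule trace_mul_sym)
      also have "\<dots> = trace ((R ** S ** P) ** unit_mat i j c)" by (simp add: matrix_mul_assoc)
      finally show "Re ((R ** S ** P) $ j $ i * c) = 0"
        using orth[OF nil2_conjugate[OF unit_mat_nil2[OF ij] PR], of c] by (simp add: trace_mult_unit_mat)
    qed
    moreover have "(R ** S ** P) $ j $ i = S $ j $ i + S $ j $ j - (S $ i $ i + S $ i $ j)"
      by (simp add: P_def R_def matrix_add_ldistrib mult_unit_mat unit_mat_mult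
        bounded_bilinear.diff_left[OF bounded_bilinear_matrix_matrix_mult])
    ultimately show ?thesis using off ij by simp
  qed
  have "S $ i $ i = 0" for i
  proof -
    have "trace S = (\<Sum>j\<in>(UNIV::'n set). S $ i $ i)"
      unfolding trace_def by (rule sum.cong) (use diag in metis)+
    then show ?thesis using tr by simp
  qed
  with off show ?thesis by (simp add: vec_eq_iff) metis
qed

lemma trace_scaleR: "trace (c *\<^sub>R A :: complex^'n^'n) = c *\<^sub>R trace A"
  by (simp add: trace_def scaleR_sum_right)

lemma square_add_scaleR:
  fixes A B :: "complex^'n^'n"
  shows "(A + c *\<^sub>R B) ** (A + c *\<^sub>R B) = A ** A + c *\<^sub>R (A ** B) + c *\<^sub>R (B ** A) + c\<^sup>2 *\<^sub>R (B ** B)"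
  by (simp add: matrix_add_ldistrib bounded_bilinear.add_left[OF bounded_bilinear_matrix_matrix_mult]
      bounded_bilinear.scaleR_right[OF bounded_bilinear_matrix_matrix_mult]
      bounded_bilinear.scaleR_left[OF bounded_bilinear_matrix_matrix_mult] power2_eq_square scaleR_add_right)

text \<open>Since N commutes with g and N^2 = 0, the logarithmic derivative of hconj g u g is
  exactly g^{-1} (\<omega> + t a M) g. The trace of its square forgets the conjugation, so
  \<open>s\<close> disappears and a quadratic polynomial in t is left.\<close>

lemma variation_trace:
  fixes u V N :: "complex^'n^'n" and s t a :: real
  defines "\<omega> \<equiv> matrix_inv u ** V" and "M \<equiv> N + matrix_inv u ** hconj N ** u"
    and "g \<equiv> mat 1 + s *\<^sub>R N"
  assumes u: "u \<in> sym_space" and V: "hconj V = V" and N: "N ** N = 0"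
  assumes W: "W = hconj g ** u ** ((t * a) *\<^sub>R N) + (hconj g ** V + (t * a) *\<^sub>R hconj N ** u) ** g"
  shows "Re (trace ((matrix_inv (hconj g ** u ** g) ** W) ** (matrix_inv (hconj g ** u ** g) ** W))) =
     Re (trace (\<omega> ** \<omega>)) + t * (a * (4 * Re (trace (\<omega> ** N)))) + t\<^sup>2 * (a\<^sup>2 * Re (trace (M ** M)))"
proof -
  note sc = bounded_bilinear.scaleR_right[OF bounded_bilinear_matrix_matrix_mult]
        bounded_bilinear.scaleR_left[OF bounded_bilinear_matrix_matrix_mult]
  note ui = sym_spaceD[OF u]
  define g' where "g' = mat 1 - s *\<^sub>R N"
  have gg': "g ** g' = mat 1"
    by (simp add: g_def g'_def bounded_bilinear.add_left[OF bounded_bilinear_matrix_matrix_mult] bounded_bilinear.diff_right[OF bounded_bilinear_matrix_matrix_mult] sc N)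
  then have g'g: "g' ** g = mat 1" by (rule matrix_left_right_inverse[THEN iffD1])
  have Ng': "N ** g' = N"
    by (simp add: g'_def bounded_bilinear.diff_right[OF bounded_bilinear_matrix_matrix_mult] sc N)
  have hg: "hconj g' ** hconj g = mat 1" "hconj g ** hconj g' = mat 1"
    using gg' g'g by (metis hconj_mat_1 hconj_mult)+
  have hN: "hconj g' ** hconj N = hconj N" using Ng' by (metis hconj_mult)
  have inv: "matrix_inv (hconj g ** u ** g) = g' ** matrix_inv u ** hconj g'"
  proof (rule matrix_inv_unique)
    have "hconj g ** u ** g ** (g' ** matrix_inv u ** hconj g') = hconj g ** (u ** (g ** g') ** matrix_inv u) ** hconj g'"
      by (simp add: matrix_mul_assoc)
    then show "hconj g ** u ** g ** (g' ** matrix_inv u ** hconj g') = mat 1" by (simp add: gg' ui hg)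
  qed
  have "g' ** matrix_inv u ** hconj g' ** W =
      g' ** matrix_inv u ** (hconj g' ** hconj g) ** u ** ((t * a) *\<^sub>R N)
      + (g' ** matrix_inv u ** (hconj g' ** hconj g) ** V + g' ** matrix_inv u ** (hconj g' ** ((t * a) *\<^sub>R hconj N)) ** u) ** g"
    unfolding W by (simp add: matrix_add_ldistrib bounded_bilinear.add_left[OF bounded_bilinear_matrix_matrix_mult] matrix_mul_assoc)
  also have "\<dots> = (t * a) *\<^sub>R (g' ** (matrix_inv u ** u) ** N)
      + (g' ** \<omega> + (t * a) *\<^sub>R (g' ** (matrix_inv u ** hconj N ** u))) ** g"
    by (simp add: hg hN sc \<omega>_def matrix_mul_assoc)
  also have "\<dots> = (t * a) *\<^sub>R (g' ** (N ** g')) ** g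
      + (g' ** \<omega> + (t * a) *\<^sub>R (g' ** (matrix_inv u ** hconj N ** u))) ** g"
  proof -
    \<comment> \<open>Inserting g' g = 1 brings the first summand into the shape g' (...) g shared
      by the others.\<close>
    have "g' ** N = g' ** (N ** g') ** g" by (metis g'g matrix_mul_assoc matrix_mul_rid)
    then show ?thesis by (simp add: ui sc)
  qed
  also have "\<dots> = g' ** (\<omega> + (t * a) *\<^sub>R M) ** g"
    by (simp add: M_def Ng' matrix_add_ldistrib bounded_bilinear.add_left[OF bounded_bilinear_matrix_matrix_mult] sc scaleR_add_right add.commute add.left_commute)
  finally have vW: "matrix_inv (hconj g ** u ** g) ** W = g' ** (\<omega> + (t * a) *\<^sub>R M) ** g" by (simp add: inv)
  let ?Y = "\<omega> + (t * a) *\<^sub>R M"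
  have "trace ((g' ** ?Y ** g) ** (g' ** ?Y ** g)) = trace (g' ** (?Y ** (g ** g') ** ?Y ** g))"
    by (simp add: matrix_mul_assoc)
  also have "\<dots> = trace ((?Y ** (g ** g') ** ?Y ** g) ** g')" by (rule trace_mul_sym)
  also have "\<dots> = trace (?Y ** ?Y ** (g ** g'))" by (simp add: gg' matrix_mul_assoc[symmetric])
  also have "\<dots> = trace (?Y ** ?Y)" by (simp add: gg')
  also have "?Y ** ?Y = \<omega> ** \<omega> + (t * a) *\<^sub>R (\<omega> ** M) + (t * a) *\<^sub>R (M ** \<omega>) + (t * a)\<^sup>2 *\<^sub>R (M ** M)"
    by (rule square_add_scaleR)
  also have "trace \<dots> = trace (\<omega> ** \<omega>) + (t * a) *\<^sub>R trace (\<omega> ** M) + (t * a) *\<^sub>R trace (M ** \<omega>) + (t * a)\<^sup>2 *\<^sub>R trace (M ** M)"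
    by (simp only: trace_add trace_scaleR)
  finally have "Re (trace ((g' ** ?Y ** g) ** (g' ** ?Y ** g))) =
     Re (trace (\<omega> ** \<omega>)) + 2 * (t * a) * Re (trace (\<omega> ** M)) + (t * a)\<^sup>2 * Re (trace (M ** M))"
    by (simp add: trace_mul_sym[of M \<omega>])
  \<comment> \<open>M is N plus its adjoint for the metric u, and \<omega> is self-adjoint for u, so
    both parts have the same real trace against \<omega>. With the 2 from the mixed term this gives
    the factor 4.\<close>
  moreover have "Re (trace (\<omega> ** M)) = 2 * Re (trace (\<omega> ** N))"
  proof -
    have "trace (\<omega> ** (matrix_inv u ** hconj N ** u)) = trace ((\<omega> ** matrix_inv u ** hconj N) ** u)"
      by (simp add: matrix_mul_assoc)
    also have "\<dots> = trace (u ** (\<omega> ** matrix_inv u ** hconj N))" by (rule trace_mul_sym)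
    also have "\<dots> = trace (hconj \<omega> ** hconj N)"
      by (simp add: \<omega>_def hconj_mult V ui matrix_mul_assoc)
    also have "\<dots> = trace (hconj N ** hconj \<omega>)" by (rule trace_mul_sym)
    also have "\<dots> = cnj (trace (\<omega> ** N))" by (simp add: hconj_mult[symmetric] trace_hconj)
    finally show ?thesis by (simp add: M_def matrix_add_ldistrib trace_add)
  qed
  ultimately show ?thesis by (simp add: vW power_mult_distrib)
qed

section \<open>The equilateral triangle\<close>

lemma cis_pi_3: "cis (pi / 3) = Complex (1/2) (sqrt 3 / 2)"
  by (simp add: complex_eq_iff cos_60 sin_60)

lemma tri_iff: "z \<in> tri \<longleftrightarrow> 0 \<le> Im z \<and> Im z \<le> sqrt 3 * Re z \<and> Im z \<le> sqrt 3 * (1 - Re z)"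
proof -
  have "z \<in> tri \<longleftrightarrow> (\<exists>u v w. 0 \<le> u \<and> 0 \<le> v \<and> 0 \<le> w \<and> u + v + w = 1 \<and> z = u *\<^sub>R 0 + v *\<^sub>R 1 + w *\<^sub>R cis (pi/3))"
    unfolding tri_def tri_vertices_def convex_hull_3 by auto
  also have "\<dots> \<longleftrightarrow> (\<exists>v w. 0 \<le> v \<and> 0 \<le> w \<and> v + w \<le> 1 \<and> Re z = v + w / 2 \<and> Im z = w * sqrt 3 / 2)"
  proof safe
    fix v w :: real assume "0 \<le> v" "0 \<le> w" "v + w \<le> 1" "Re z = v + w / 2" "Im z = w * sqrt 3 / 2"
    then show "\<exists>u v w. 0 \<le> u \<and> 0 \<le> v \<and> 0 \<le> w \<and> u + v + w = 1 \<and> z = u *\<^sub>R 0 + v *\<^sub>R 1 + w *\<^sub>R cis (pi/3)"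
      by (intro exI[of _ "1 - v - w"] exI[of _ v] exI[of _ w]) (auto simp: complex_eq_iff cis_pi_3)
  qed (auto simp: cis_pi_3)
  also have "\<dots> \<longleftrightarrow> 0 \<le> Im z \<and> Im z \<le> sqrt 3 * Re z \<and> Im z \<le> sqrt 3 * (1 - Re z)"
  proof safe
    fix v w :: real assume *: "0 \<le> v" "0 \<le> w" "v + w \<le> 1" "Re z = v + w / 2" "Im z = w * sqrt 3 / 2"
    show "0 \<le> Im z" unfolding *(5) using * by simp
    have "sqrt 3 * Re z - Im z = sqrt 3 * v" unfolding *(4,5) by (simp add: algebra_simps)
    moreover have "0 \<le> sqrt 3 * v" using * by simp
    ultimately show "Im z \<le> sqrt 3 * Re z" by linarith
    have "sqrt 3 * (v + w) \<le> sqrt 3 * 1" using * by (intro mult_left_mono) auto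
    moreover have "sqrt 3 * (1 - Re z) - Im z = sqrt 3 * 1 - sqrt 3 * (v + w)"
      unfolding *(4,5) by (simp add: algebra_simps)
    ultimately show "Im z \<le> sqrt 3 * (1 - Re z)" by linarith
  next
    assume *: "0 \<le> Im z" "Im z \<le> sqrt 3 * Re z" "Im z \<le> sqrt 3 * (1 - Re z)"
    have s: "sqrt 3 * sqrt 3 = 3" by simp
    have "Im z / sqrt 3 \<le> Re z" "Im z / sqrt 3 \<le> 1 - Re z"
      using * by (simp_all add: pos_divide_le_eq mult.commute)
    then show "\<exists>v w. 0 \<le> v \<and> 0 \<le> w \<and> v + w \<le> 1 \<and> Re z = v + w / 2 \<and> Im z = w * sqrt 3 / 2"
      using * by (intro exI[of _ "Re z - Im z / sqrt 3"] exI[of _ "2 * Im z / sqrt 3"]) auto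
  qed
  finally show ?thesis .
qed

lemma convex_tri: "convex tri" and compact_tri: "compact tri" and closed_tri: "closed tri"
  by (auto simp: tri_def tri_vertices_def finite_imp_compact_convex_hull intro!: compact_imp_closed)

lemma affine_independent_tri_vertices: "\<not> affine_dependent tri_vertices"
proof -
  have "\<not> collinear {0, 1, cis (pi / 3)}"
    by (auto simp: collinear_lemma cis_pi_3 complex_eq_iff)
  then show ?thesis unfolding tri_vertices_def using collinear_3_eq_affine_dependent by blast
qed

lemma extreme_point_tri: "x extreme_point_of tri \<longleftrightarrow> x \<in> tri_vertices"
  unfolding tri_def by (rule extreme_point_of_convex_hull_affine_independent[OF affine_independent_tri_vertices])

lemma tri_vertices_subset: "tri_vertices \<subseteq> tri"
  unfolding tri_def by (rule hull_subset)

text \<open>Removing extreme points from a convex set leaves it convex. This is what makes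
  derivatives within \<open>tri_star\<close> unique.\<close>

lemma convex_tri_star: "convex tri_star"
proof (rule convexI)
  fix x y :: complex and u v :: real
  assume *: "x \<in> tri_star" "y \<in> tri_star" "0 \<le> u" "0 \<le> v" "u + v = 1"
  let ?w = "u *\<^sub>R x + v *\<^sub>R y"
  have "?w \<in> tri" using convexD[OF convex_tri] * by (auto simp: tri_star_def)
  moreover have "?w \<notin> tri_vertices"
  proof
    assume "?w \<in> tri_vertices"
    then have e: "?w extreme_point_of tri" by (simp add: extreme_point_tri)
    have cs: "?w \<in> closed_segment x y"
      using * by (auto simp: closed_segment_def intro!: exI[of _ v] simp: algebra_simps eq_diff_eq scaleR_add_left[symmetric])
    have "?w \<notin> open_segment x y" using e * by (auto simp: extreme_point_of_def tri_star_def)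
    then have "?w = x \<or> ?w = y" using cs by (auto simp: open_segment_def)
    then show False using * \<open>?w \<in> tri_vertices\<close> by (auto simp: tri_star_def)
  qed
  ultimately show "?w \<in> tri_star" by (simp add: tri_star_def)
qed

lemma open_strict_tri: "open {z. 0 < Im z \<and> Im z < sqrt 3 * Re z \<and> Im z < sqrt 3 * (1 - Re z)}"
  by (intro open_Collect_conj open_Collect_less continuous_intros)

lemma interior_tri_nonempty: "interior tri \<noteq> {}"
proof -
  have "{z. 0 < Im z \<and> Im z < sqrt 3 * Re z \<and> Im z < sqrt 3 * (1 - Re z)} \<subseteq> interior tri"
    by (rule interior_maximal[OF _ open_strict_tri]) (auto simp: tri_iff)
  moreover have "Complex (1/2) (1/4) \<in> {z. 0 < Im z \<and> Im z < sqrt 3 * Re z \<and> Im z < sqrt 3 * (1 - Re z)}"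
  proof -
    define c where "c = sqrt 3"
    have "1 \<le> c" by (simp add: c_def)
    then show ?thesis unfolding c_def[symmetric] by simp
  qed
  ultimately show ?thesis by blast
qed

lemma interior_tri_subset_star: "interior tri \<subseteq> tri_star"
proof
  fix z assume z: "z \<in> interior tri"
  have "z \<notin> tri_vertices"
  proof
    assume v: "z \<in> tri_vertices"
    have "tri \<noteq> {z}" using z by (metis empty_iff interior_singleton)
    with v z show False using extreme_point_not_in_interior extreme_point_tri by blast
  qed
  with z show "z \<in> tri_star" using interior_subset by (auto simp: tri_star_def)
qed

lemma interior_tri_star: "interior tri_star = interior tri"
proof
  show "interior tri_star \<subseteq> interior tri" by (rule interior_mono) (auto simp: tri_star_def)
  show "interior tri \<subseteq> interior tri_star"
    by (rule interior_maximal[OF interior_tri_subset_star open_interior])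
qed

lemma tri_star_subset: "tri_star \<subseteq> tri" by (auto simp: tri_star_def)

lemma tri_star_derivative_unique:
  "(f has_derivative f') (at z within tri_star) \<Longrightarrow> (f has_derivative f'') (at z within tri_star)
    \<Longrightarrow> z \<in> tri_star \<Longrightarrow> f' = f''"
  by (rule convex_derivative_unique[OF convex_tri_star]) (auto simp: interior_tri_star interior_tri_nonempty)

text \<open>\<open>tri_deriv\<close> is built on a choice of derivative; uniqueness turns every
  derivative obtained by calculus rules into its value.\<close>

lemma tri_deriv_eq:
  assumes "(f has_derivative f') (at z within tri_star)" "z \<in> tri_star"
  shows "tri_deriv f z v = f' v"
proof -
  have "(f has_derivative frechet_derivative f (at z within tri_star)) (at z within tri_star)"
    using assms(1) frechet_derivative_works differentiableI by blast
  then show ?thesis using tri_star_derivative_unique assms unfolding tri_deriv_def by metis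
qed

lemma has_derivative_tri_deriv:
  assumes "Ck_on (Suc k) tri_star f" "z \<in> tri_star"
  shows "(f has_derivative tri_deriv f z) (at z within tri_star)"
proof -
  from assms obtain f' where f': "(f has_derivative f') (at z within tri_star)" by auto
  have "tri_deriv f z = f'" using tri_deriv_eq[OF f' assms(2)] by auto
  with f' show ?thesis by simp
qed

lemma Ck_on_tri_deriv:
  assumes "Ck_on (Suc k) tri_star f"
  shows "Ck_on k tri_star (\<lambda>z. tri_deriv f z v)"
proof -
  from assms obtain f' where f': "\<And>z. z \<in> tri_star \<Longrightarrow> (f has_derivative f' z) (at z within tri_star)"
    "\<And>v. Ck_on k tri_star (\<lambda>z. f' z v)" by auto
  show ?thesis by (subst Ck_on_cong[of _ _ "\<lambda>z. f' z v"]) (auto simp: tri_deriv_eq[OF f'(1)] f'(2))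
qed

lemma tri_deriv_cong:
  assumes "\<And>w. w \<in> tri_star \<Longrightarrow> f w = g w" "z \<in> tri_star"
  shows "tri_deriv f z v = tri_deriv g z v"
proof -
  have "(f has_derivative D) (at z within tri_star) \<longleftrightarrow> (g has_derivative D) (at z within tri_star)" for D
    using assms by (metis has_derivative_transform)
  then show ?thesis unfolding tri_deriv_def frechet_derivative_def by simp
qed

lemma edge_in_tri_star: "0 < s \<Longrightarrow> s < 1 \<Longrightarrow> Complex s 0 \<in> tri_star"
  by (auto simp: tri_star_def tri_iff tri_vertices_def cis_pi_3 complex_eq_iff)

lemma edge_in_tri: "0 \<le> s \<Longrightarrow> s \<le> 1 \<Longrightarrow> Complex s 0 \<in> tri"
  by (auto simp: tri_iff)

text \<open>The side opposite 0 is Im z + sqrt 3 Re z = sqrt 3. At radius r the left side equals 2 r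
  sin (pi/3 + \<theta>), which is at most 2 r \<le> 1, so the sector stays inside.\<close>

lemma polar_in_tri_star:
  assumes "0 < r" "r \<le> 1/2" "0 \<le> \<theta>" "\<theta> \<le> pi / 3"
  shows "complex_of_real r * cis \<theta> \<in> tri_star"
proof -
  have s: "0 \<le> sin \<theta>" using assms by (intro sin_ge_zero) auto
  have "0 \<le> sin (pi / 3 - \<theta>)" using assms by (intro sin_ge_zero) auto
  then have 1: "sin \<theta> \<le> sqrt 3 * cos \<theta>" by (simp add: sin_diff sin_60 cos_60)
  have "0 \<le> sin (pi / 3 + \<theta>)" "sin (pi / 3 + \<theta>) \<le> 1" using assms by (auto intro!: sin_ge_zero)
  then have "sin \<theta> + sqrt 3 * cos \<theta> \<le> 2" by (simp add: sin_add sin_60 cos_60)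
  then have "r * (sin \<theta> + sqrt 3 * cos \<theta>) \<le> 1/2 * 2"
    using assms s 1 by (intro mult_mono) auto
  then have "r * (sin \<theta> + sqrt 3 * cos \<theta>) \<le> sqrt 3"
    by (rule order_trans) simp
  then have 2: "r * sin \<theta> \<le> sqrt 3 * (1 - r * cos \<theta>)" by (simp add: algebra_simps)
  have 3: "r * sin \<theta> \<le> sqrt 3 * (r * cos \<theta>)" using 1 assms by (simp add: mult.left_commute mult_left_mono)
  have "norm (complex_of_real r * cis \<theta>) = r" using assms by (simp add: norm_mult)
  then have "complex_of_real r * cis \<theta> \<notin> tri_vertices"
    using assms by (auto simp: tri_vertices_def)
  with 2 3 s assms show ?thesis by (auto simp: tri_star_def tri_iff)
qed

lemma tri_polar:
  assumes "z \<in> tri" "z \<noteq> 0"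
  obtains \<theta> where "0 \<le> \<theta>" "\<theta> \<le> pi / 3" "z = complex_of_real (norm z) * cis \<theta>"
proof -
  define \<theta> where "\<theta> = Arg z"
  have z: "z = complex_of_real (norm z) * cis \<theta>"
    using rcis_cmod_Arg[of z] by (simp add: \<theta>_def rcis_def)
  have n: "norm z > 0" using assms by simp
  have th: "- pi < \<theta>" "\<theta> \<le> pi" using Arg_bounded by (auto simp: \<theta>_def)
  have re: "Re z = norm z * cos \<theta>" and im: "Im z = norm z * sin \<theta>" by (subst z, simp)+
  have "0 \<le> sin \<theta>" using assms n by (simp add: tri_iff im zero_le_mult_iff)
  then have th0: "0 \<le> \<theta>" using th sin_gt_zero[of "-\<theta>"] by force
  have "norm z * sin \<theta> \<le> norm z * (sqrt 3 * cos \<theta>)" using assms by (simp add: tri_iff re im mult.left_commute)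
  then have "sin \<theta> \<le> sqrt 3 * cos \<theta>" using n by simp
  then have "sin (\<theta> - pi/3) \<le> 0" by (simp add: sin_diff sin_60 cos_60 mult.commute)
  then have "\<theta> \<le> pi/3" using sin_gt_zero[of "\<theta> - pi/3"] th by force
  with th0 z that show thesis by blast
qed

lemma small_tri_star: "z \<in> tri \<Longrightarrow> z \<noteq> 0 \<Longrightarrow> norm z < 1 \<Longrightarrow> z \<in> tri_star"
  by (auto simp: tri_star_def tri_vertices_def)

text \<open>The symmetries of the triangle, taken as isometries of the whole plane as in
  \<open>one_form\<close>: such maps are affine and are determined by their values on the
  triangle.\<close>

definition tri_iso :: "(complex \<Rightarrow> complex) \<Rightarrow> bool" where
  "tri_iso g \<longleftrightarrow> (\<forall>z w. dist (g z) (g w) = dist z w) \<and> g ` tri = tri"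

lemma isometry_linear_part:
  fixes g :: "complex \<Rightarrow> complex"
  assumes "\<And>z w. dist (g z) (g w) = dist z w"
  shows "orthogonal_transformation (\<lambda>v. g v - g 0)"
  by (subst orthogonal_transformation_isometry[symmetric, THEN sym], use assms in \<open>auto simp: orthogonal_transformation_isometry dist_norm\<close>)

lemma tri_iso_linear: "tri_iso g \<Longrightarrow> linear (\<lambda>v. g v - g 0)"
  by (auto simp: tri_iso_def intro: orthogonal_transformation_linear isometry_linear_part)

lemma tri_iso_has_derivative: "tri_iso g \<Longrightarrow> (g has_derivative (\<lambda>v. g v - g 0)) (at z within S)"
proof -
  assume g: "tri_iso g"
  have "((\<lambda>z. (g z - g 0) + g 0) has_derivative (\<lambda>v. g v - g 0)) (at z within S)"
    by (rule has_derivative_add_const[OF linear_imp_has_derivative[OF tri_iso_linear[OF g]]])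
  then show ?thesis by simp
qed

lemma tri_iso_bij: "tri_iso g \<Longrightarrow> bij g"
proof -
  assume g: "tri_iso g"
  have "bij (\<lambda>v. g v - g 0)"
    using isometry_linear_part[of g] g orthogonal_transformation_bij by (auto simp: tri_iso_def)
  then have "bij ((\<lambda>v. v + g 0) \<circ> (\<lambda>v. g v - g 0))"
    by (rule bij_comp) (simp add: bij_plus_right)
  then show ?thesis by (simp add: comp_def)
qed

lemma tri_iso_inv: "tri_iso g \<Longrightarrow> tri_iso (inv_into UNIV g)"
proof -
  assume g: "tri_iso g"
  have b: "bij g" by (rule tri_iso_bij[OF g])
  then have "dist (inv_into UNIV g z) (inv_into UNIV g w) = dist z w" for z w
    using g unfolding tri_iso_def by (metis bij_inv_eq_iff)
  moreover have "inv_into UNIV g ` tri = tri" using g b unfolding tri_iso_def by (metis bij_is_inj image_inv_f_f)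
  ultimately show ?thesis by (simp add: tri_iso_def)
qed

lemma tri_iso_comp: "tri_iso g \<Longrightarrow> tri_iso h \<Longrightarrow> tri_iso (g \<circ> h)"
  unfolding tri_iso_def by (metis comp_apply image_comp)

lemma tri_iso_combination:
  assumes "tri_iso g"
  shows "g ((1 - u) *\<^sub>R a + u *\<^sub>R b) = (1 - u) *\<^sub>R g a + u *\<^sub>R g b"
proof -
  note l = tri_iso_linear[OF assms]
  have "g ((1 - u) *\<^sub>R a + u *\<^sub>R b) - g 0 = (1 - u) *\<^sub>R (g a - g 0) + u *\<^sub>R (g b - g 0)"
    using linear_add[OF l] linear_scale[OF l] by (metis (no_types, lifting))
  then show ?thesis by (simp add: algebra_simps)
qed

text \<open>Vertices are exactly the extreme points, and an affine bijection of the triangle onto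
  itself pulls a segment through g v back to one through v.\<close>

lemma tri_iso_vertices: "tri_iso g \<Longrightarrow> v \<in> tri_vertices \<Longrightarrow> g v \<in> tri_vertices"
proof -
  assume g: "tri_iso g" and v: "v \<in> tri_vertices"
  have "g v extreme_point_of tri"
    unfolding extreme_point_of_def
  proof (intro conjI ballI notI)
    show "g v \<in> tri" using g v tri_vertices_subset unfolding tri_iso_def by blast
    fix a b assume ab: "a \<in> tri" "b \<in> tri" "g v \<in> open_segment a b"
    then obtain a' b' where a': "a = g a'" "a' \<in> tri" and b': "b = g b'" "b' \<in> tri"
      using g unfolding tri_iso_def by (metis imageE)
    from ab(3) obtain u where u: "0 < u" "u < 1" "g v = (1 - u) *\<^sub>R g a' + u *\<^sub>R g b'" "a \<noteq> b"
      by (auto simp: in_segment a' b')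
    then have "g v = g ((1 - u) *\<^sub>R a' + u *\<^sub>R b')" by (simp add: tri_iso_combination[OF g])
    then have "v = (1 - u) *\<^sub>R a' + u *\<^sub>R b'" using tri_iso_bij[OF g] by (metis bij_def injD)
    then have "v \<in> open_segment a' b'" using u a' b' by (auto simp: in_segment)
    then show False using v extreme_point_tri a' b' by (auto simp: extreme_point_of_def)
  qed
  then show ?thesis by (simp add: extreme_point_tri)
qed

lemma tri_iso_tri_star: "tri_iso g \<Longrightarrow> g z \<in> tri_star \<longleftrightarrow> z \<in> tri_star"
proof -
  have *: "h y \<in> tri_star" if "tri_iso h" "y \<in> tri_star" for h y
  proof -
    have "h y \<in> tri" using that by (auto simp: tri_iso_def tri_star_def)
    moreover have "h y \<notin> tri_vertices"
      using tri_iso_vertices[OF tri_iso_inv[OF that(1)], of "h y"] that tri_iso_bij[OF that(1)]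
      by (auto simp: tri_star_def bij_is_inj)
    ultimately show ?thesis by (simp add: tri_star_def)
  qed
  assume "tri_iso g"
  then show ?thesis using *[of g z] *[OF tri_iso_inv, of g "g z"] tri_iso_bij[of g] by (auto simp: bij_is_inj)
qed

text \<open>The symmetry k = g^{-1} h fixes 0 and 1. As it permutes the vertices it fixes the third
  one too, and 1 and cis (pi/3) span the plane over the reals.\<close>

lemma tri_iso_ext:
  assumes "tri_iso g" "tri_iso h" "g 0 = h 0" "g 1 = h 1"
  shows "g = h"
proof -
  define k where "k = inv_into UNIV g \<circ> h"
  have k: "tri_iso k" using assms by (auto simp: k_def intro: tri_iso_comp tri_iso_inv)
  have bg: "bij g" using assms tri_iso_bij by blast
  have k01: "k 0 = 0" "k 1 = 1" by (simp_all add: k_def assms(3,4)[symmetric] inv_f_f[OF bij_is_inj[OF bg]])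
  have "k (cis (pi/3)) \<in> tri_vertices" using tri_iso_vertices[OF k] by (simp add: tri_vertices_def)
  have cw: "cis (pi/3) \<noteq> 0" "cis (pi/3) \<noteq> 1" by (simp_all add: cis_pi_3 complex_eq_iff)
  have "inj k" using tri_iso_bij[OF k] by (rule bij_is_inj)
  then have "k (cis (pi/3)) \<noteq> k 0" "k (cis (pi/3)) \<noteq> k 1"
    using cw by (metis injD)+
  with \<open>k (cis (pi/3)) \<in> tri_vertices\<close> have kc: "k (cis (pi/3)) = cis (pi/3)" using k01 by (auto simp: tri_vertices_def)
  have l: "linear k" using tri_iso_linear[OF k] k01 by simp
  have "k z = z" for z
  proof -
    define b where "b = Im z * 2 / sqrt 3"
    define a where "a = Re z - b / 2"
    have z: "z = a *\<^sub>R 1 + b *\<^sub>R cis (pi/3)" by (simp add: complex_eq_iff cis_pi_3 a_def b_def)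
    have "k z = a *\<^sub>R k 1 + b *\<^sub>R k (cis (pi/3))"
      by (subst z) (simp only: linear_add[OF l] linear_scale[OF l])
    then show ?thesis using kc k01 z by simp
  qed
  then have "inv_into UNIV g (h z) = z" for z by (simp add: k_def)
  then have "h z = g z" for z using bg by (metis bij_inv_eq_iff)
  then show ?thesis by auto
qed

text \<open>All sides have length one, so b - a is a unit complex number. Exactly two plane
  isometries send 0 to a and 1 to b, and one of them puts the third vertex on the correct
  side.\<close>

lemma tri_iso_exists:
  assumes "a \<in> tri_vertices" "b \<in> tri_vertices" "a \<noteq> b"
  shows "\<exists>g. tri_iso g \<and> g 0 = a \<and> g 1 = b"
proof -
  have mk: "tri_iso g" if g: "\<And>z. g z = l z + c" "linear l" "\<And>z. norm (l z) = norm z" "g ` tri_vertices = tri_vertices" for g l c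
  proof -
    have "dist (g z) (g w) = dist z w" for z w
      by (simp add: g(1) dist_norm linear_diff[OF g(2), symmetric] g(3))
    moreover have "g ` tri = tri"
    proof -
      have "g ` S = (\<lambda>x. c + x) ` (l ` S)" for S by (auto simp: g(1) image_iff add.commute)
      then have "g ` tri = convex hull (g ` tri_vertices)"
        by (simp add: tri_def convex_hull_linear_image[OF g(2)] convex_hull_translation)
      then show ?thesis by (simp add: g(4) tri_def)
    qed
    ultimately show ?thesis by (simp add: tri_iso_def)
  qed
  have nw: "norm (cis (pi/3) - 1) = 1"
    by (simp add: cis_pi_3 cmod_def power2_eq_square)
  have nab: "norm (b - a) = 1" using assms nw by (auto simp: tri_vertices_def norm_minus_commute)
  have w2: "cis (pi/3) * cis (pi/3) = cis (pi/3) - 1"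
    by (simp add: cis_pi_3 complex_eq_iff)
  have wc: "cnj (cis (pi/3)) = 1 - cis (pi/3)" by (simp add: cis_pi_3 complex_eq_iff)
  \<comment> \<open>The orientation preserving candidate; \<open>g2\<close> is the orientation
    reversing one.\<close>
  define g1 where "g1 = (\<lambda>z. (b - a) * z + a)"
  define g2 where "g2 = (\<lambda>z. (b - a) * cnj z + a)"
  have "g1 ` tri_vertices = tri_vertices \<or> g2 ` tri_vertices = tri_vertices"
    using assms by (auto simp: tri_vertices_def g1_def g2_def algebra_simps w2 wc)
  then have "tri_iso g1 \<or> tri_iso g2"
  proof
    assume "g1 ` tri_vertices = tri_vertices"
    moreover have "linear (\<lambda>z. (b - a) * z)" by (auto intro!: linearI simp: algebra_simps)
    ultimately have "tri_iso g1"
      by (intro mk[of g1 "\<lambda>z. (b - a) * z" a]) (simp_all add: g1_def norm_mult nab)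
    then show ?thesis ..
  next
    assume "g2 ` tri_vertices = tri_vertices"
    moreover have "linear (\<lambda>z. (b - a) * cnj z)" by (auto intro!: linearI simp: algebra_simps)
    ultimately have "tri_iso g2"
      by (intro mk[of g2 "\<lambda>z. (b - a) * cnj z" a]) (simp_all add: g2_def norm_mult nab)
    then show ?thesis ..
  qed
  moreover have "g1 0 = a" "g1 1 = b" "g2 0 = a" "g2 1 = b" by (auto simp: g1_def g2_def)
  ultimately show ?thesis by blast
qed

section \<open>The logarithmic derivative as a form\<close>

lemmas mm_scaleR =
  bounded_bilinear.scaleR_right[OF bounded_bilinear_matrix_matrix_mult]
  bounded_bilinear.scaleR_left[OF bounded_bilinear_matrix_matrix_mult]

definition log_deriv :: "real \<Rightarrow> ('b \<Rightarrow> complex^'n^'n) \<Rightarrow> ('b, 'n) form" where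
  "log_deriv \<kappa> u = (\<lambda>c z v. \<kappa> *\<^sub>R (matrix_inv (u (c z)) ** tri_deriv (\<lambda>w. u (c w)) z v))"

lemma unitary_part_eq: "unitary_part u = log_deriv (1/2) u"
  by (simp add: unitary_part_def log_deriv_def)

lemma self_adjoint_part_eq: "self_adjoint_part u = log_deriv (-1/2) u"
  by (simp add: self_adjoint_part_def flat_connection_def unitary_part_def log_deriv_def fun_eq_iff)

lemma chart_in: "c \<in> charts X p Xt \<Longrightarrow> z \<in> tri \<Longrightarrow> c z \<in> Xt"
  by (auto simp: charts_def)

lemma compose_chart:
  assumes "c \<in> charts X p Xt" "tri_iso g"
  shows "compose tri c g \<in> charts X p Xt"
proof -
  have g: "g ` tri = tri" "\<And>z w. dist (g z) (g w) = dist z w" using assms by (auto simp: tri_iso_def)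
  have gt: "g z \<in> tri" if "z \<in> tri" for z using g that by blast
  have cg: "continuous_on tri g"
    using tri_iso_has_derivative[OF assms(2)] by (meson continuous_on_eq_continuous_within has_derivative_continuous)
  have im: "compose tri c g ` tri = c ` tri"
    using g(1) by (auto simp: compose_def image_iff) (metis g(1) imageE)
  have "continuous_on tri (\<lambda>z. c (g z))"
    by (rule continuous_on_compose2[OF _ cg, of tri]) (use assms gt in \<open>auto simp: charts_def\<close>)
  then have "continuous_on tri (compose tri c g)"
    by (rule continuous_on_eq) (simp add: compose_def)
  moreover have "dist (p (compose tri c g z)) (p (compose tri c g w)) = dist z w" if "z \<in> tri" "w \<in> tri" for z w
    using that gt assms g(2) by (auto simp: charts_def compose_def)
  ultimately show ?thesis using im assms by (auto simp: charts_def compose_extensional)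
qed

lemma smooth_on_log_deriv:
  assumes f: "smooth_on tri_star f" and det: "\<And>z. z \<in> tri_star \<Longrightarrow> det (f z) = (1::complex)"
  shows "smooth_on tri_star (\<lambda>z. \<kappa> *\<^sub>R (matrix_inv (f z) ** tri_deriv f z v))"
  unfolding smooth_on_def
proof
  fix k
  have "Ck_on k tri_star (\<lambda>z. matrix_inv (f z) ** tri_deriv f z v)"
    by (rule Ck_on_bounded_bilinear[OF bounded_bilinear_matrix_matrix_mult])
       (use f det in \<open>auto intro!: Ck_on_matrix_inv Ck_on_tri_deriv simp: smooth_on_def simp del: Ck_on.simps\<close>)
  then show "Ck_on k tri_star (\<lambda>z. \<kappa> *\<^sub>R (matrix_inv (f z) ** tri_deriv f z v))"
    by (rule Ck_on_bounded_linear[OF bounded_linear_scaleR_right])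
qed

lemma smooth_on_has_derivative:
  "smooth_on tri_star f \<Longrightarrow> z \<in> tri_star \<Longrightarrow> (f has_derivative tri_deriv f z) (at z within tri_star)"
  unfolding smooth_on_def by (rule has_derivative_tri_deriv[of 0]) auto

text \<open>The tangential derivative on the edge depends only on the values on the edge. This is
  why du satisfies the compatibility of forms on adjacent cells although the normal derivatives
  differ.\<close>

lemma tri_deriv_edge:
  assumes f: "smooth_on tri_star f" and h: "smooth_on tri_star h" and s: "0 < s" "s < 1"
    and eq: "\<And>s. s \<in> {0..1} \<Longrightarrow> f (Complex s 0) = h (Complex s 0)"
  shows "tri_deriv f (Complex s 0) 1 = tri_deriv h (Complex s 0) 1"
proof -
  have *: "((\<lambda>s. k (Complex s 0)) has_derivative (\<lambda>r. tri_deriv k (Complex s 0) (Complex r 0))) (at s)"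
    if k: "smooth_on tri_star k" for k :: "complex \<Rightarrow> 'a"
  proof -
    have g: "((\<lambda>s. Complex s 0) has_derivative (\<lambda>r. Complex r 0)) (at s within {0<..<1})"
    proof -
      have "complex_of_real = (\<lambda>r. Complex r 0)" by (auto simp: complex_of_real_def)
      moreover have "((\<lambda>s. complex_of_real s) has_derivative complex_of_real) (at s within {0<..<1})"
        by (intro bounded_linear_imp_has_derivative bounded_linear_of_real)
      ultimately show ?thesis by simp
    qed
    have sub: "(\<lambda>s. Complex s 0) ` {0<..<1} \<subseteq> tri_star" using edge_in_tri_star by auto
    have "(k has_derivative tri_deriv k (Complex s 0)) (at (Complex s 0) within (\<lambda>s. Complex s 0) ` {0<..<1})"
      using has_derivative_subset[OF smooth_on_has_derivative[OF k] sub] edge_in_tri_star s by auto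
    from has_derivative_in_compose[OF g this] show ?thesis
      using s by (simp add: at_within_open[of s "{0<..<1}"])
  qed
  have "((\<lambda>s. f (Complex s 0)) has_derivative (\<lambda>r. tri_deriv h (Complex s 0) (Complex r 0))) (at s)"
  proof (rule has_derivative_transform_within_open[OF *[OF h], of "{0<..<1}"])
    show "h (Complex s 0) = f (Complex s 0)" if "s \<in> {0<..<1}" for s using eq that by auto
  qed (use s in auto)
  from has_derivative_unique[OF *[OF f] this]
  have "tri_deriv f (Complex s 0) (Complex 1 0) = tri_deriv h (Complex s 0) (Complex 1 0)" by metis
  then show ?thesis by (simp add: complex_eq_iff one_complex.code)
qed

lemma tri_deriv_iso:
  assumes f: "smooth_on tri_star f" and g: "tri_iso g" and z: "z \<in> tri_star"
  shows "tri_deriv (\<lambda>w. f (g w)) z v = tri_deriv f (g z) (g v - g 0)"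
proof (rule tri_deriv_eq[OF _ z, of _ "\<lambda>v. tri_deriv f (g z) (g v - g 0)"])
  have im: "g ` tri_star \<subseteq> tri_star" using tri_iso_tri_star[OF g] by auto
  have "(f has_derivative tri_deriv f (g z)) (at (g z) within g ` tri_star)"
    using has_derivative_subset[OF smooth_on_has_derivative[OF f] im] tri_iso_tri_star[OF g] z by auto
  from has_derivative_in_compose[OF tri_iso_has_derivative[OF g] this]
  show "((\<lambda>w. f (g w)) has_derivative (\<lambda>v. tri_deriv f (g z) (g v - g 0))) (at z within tri_star)" .
qed

section \<open>Equivariance, trace, smoothness and adjointness of \<open>log_deriv\<close>\<close>

context
  fixes X :: "'a::euclidean_space set set"
    and p :: "'b::topological_space \<Rightarrow> 'a"
    and Xt :: "'b set"
    and u :: "'b \<Rightarrow> complex^'n^'n"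
  assumes smooth: "smooth_map X p Xt u"
    and target: "u ` Xt \<subseteq> sym_space"
begin

lemma chart_smooth: "c \<in> charts X p Xt \<Longrightarrow> smooth_on tri_star (\<lambda>z. u (c z))"
  using smooth by (auto simp: smooth_map_def)

lemma chart_sym: "c \<in> charts X p Xt \<Longrightarrow> z \<in> tri_star \<Longrightarrow> u (c z) \<in> sym_space"
  using target chart_in[of c X p Xt z] tri_star_subset by (auto simp: image_subset_iff)

lemma chart_has_derivative:
  "c \<in> charts X p Xt \<Longrightarrow> z \<in> tri_star \<Longrightarrow>
     ((\<lambda>w. u (c w)) has_derivative tri_deriv (\<lambda>w. u (c w)) z) (at z within tri_star)"
  by (rule smooth_on_has_derivative[OF chart_smooth])

lemma linear_chart_deriv: "c \<in> charts X p Xt \<Longrightarrow> z \<in> tri_star \<Longrightarrow> linear (tri_deriv (\<lambda>w. u (c w)) z)"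
  using chart_has_derivative has_derivative_linear by blast

lemma hconj_chart_deriv:
  assumes c: "c \<in> charts X p Xt" and z: "z \<in> tri_star"
  shows "hconj (tri_deriv (\<lambda>w. u (c w)) z v) = tri_deriv (\<lambda>w. u (c w)) z v"
proof -
  have "((\<lambda>w. hconj (u (c w))) has_derivative (\<lambda>v. hconj (tri_deriv (\<lambda>w. u (c w)) z v))) (at z within tri_star)"
    by (rule bounded_linear.has_derivative[OF bounded_linear_hconj chart_has_derivative[OF c z]])
  from tri_deriv_eq[OF this z, of v]
  have "hconj (tri_deriv (\<lambda>w. u (c w)) z v) = tri_deriv (\<lambda>w. hconj (u (c w))) z v" ..
  also have "\<dots> = tri_deriv (\<lambda>w. u (c w)) z v"
    by (rule tri_deriv_cong[OF _ z]) (simp add: sym_spaceD(1)[OF chart_sym[OF c]])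
  finally show ?thesis .
qed

lemma smooth_form_log_deriv: "smooth_form X p Xt (log_deriv \<kappa> u)"
  unfolding smooth_form_def log_deriv_def
  using smooth_on_log_deriv[OF chart_smooth] sym_spaceD(2)[OF chart_sym] by blast

lemma one_form_log_deriv: "one_form X p Xt (log_deriv \<kappa> u)"
  unfolding one_form_def
proof (intro conjI ballI allI impI)
  fix c z assume cz: "c \<in> charts X p Xt" "z \<in> tri_star"
  show "linear (log_deriv \<kappa> u c z)"
    unfolding log_deriv_def
    using linear_chart_deriv[OF cz]
    by (auto intro!: linearI simp: linear_add linear_scale matrix_add_ldistrib mm_scaleR scaleR_add_right)
next
  fix c g z v assume c: "c \<in> charts X p Xt" and z: "z \<in> tri_star"
    and g: "(\<forall>z w. dist (g z) (g w) = dist z w) \<and> g ` tri = tri"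
  have g: "tri_iso g" using g by (simp add: tri_iso_def)
  have 1: "compose tri c g w = c (g w)" if "w \<in> tri_star" for w
    using that tri_star_subset by (auto simp: compose_def)
  have "tri_deriv (\<lambda>w. u (compose tri c g w)) z v = tri_deriv (\<lambda>w. u (c (g w))) z v"
    by (rule tri_deriv_cong[OF _ z]) (simp add: 1)
  also have "\<dots> = tri_deriv (\<lambda>w. u (c w)) (g z) (g v - g 0)"
    by (rule tri_deriv_iso[OF chart_smooth[OF c] g z])
  finally show "log_deriv \<kappa> u (compose tri c g) z v = log_deriv \<kappa> u c (g z) (g v - g 0)"
    by (simp add: log_deriv_def 1[OF z])
next
  fix c c' s assume c: "c \<in> charts X p Xt" "c' \<in> charts X p Xt" "same_edge c c'" and s: "s \<in> {0<..<1::real}"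
  have eq: "c (Complex s 0) = c' (Complex s 0)" if "s \<in> {0..1}" for s
    using c(3) that by (auto simp: same_edge_def)
  show "log_deriv \<kappa> u c (Complex s 0) 1 = log_deriv \<kappa> u c' (Complex s 0) 1"
    unfolding log_deriv_def
    using tri_deriv_edge[OF chart_smooth[OF c(1)] chart_smooth[OF c(2)], of s] eq s by auto
qed

text \<open>A deck transformation changes u into hconj g^{-1} u g^{-1} with constant g, so u^{-1} du
  is conjugated by g. Its trace vanishes because det u = 1 throughout.\<close>

lemma End_form_log_deriv:
  assumes equi: "equivariant_map X p Xt xt0 \<rho> u"
    and hom: "\<rho> \<in> hom (fundamental_group (\<Union>X) (p xt0)) special_linear"
  shows "End_form X p Xt xt0 \<rho> (log_deriv \<kappa> u)"
  unfolding End_form_def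
proof (intro conjI ballI allI impI one_form_log_deriv)
  fix c z v assume cz: "c \<in> charts X p Xt" "z \<in> tri_star"
  have "trace (matrix_inv (u (c z)) ** tri_deriv (\<lambda>w. u (c w)) z v) = 0"
    by (rule trace_matrix_inv_derivative[OF convex_tri_star _ cz(2) chart_has_derivative[OF cz]])
       (auto simp: interior_tri_star interior_tri_nonempty sym_spaceD(2)[OF chart_sym[OF cz(1)]])
  then show "trace (log_deriv \<kappa> u c z v) = 0" by (simp add: log_deriv_def trace_scaleR)
next
  fix a T c z v
  assume a: "a \<in> carrier (fundamental_group (\<Union>X) (p xt0))" and T: "deck_transformation p Xt xt0 a T"
    and c: "c \<in> charts X p Xt" and z: "z \<in> tri_star"
  define g where "g = \<rho> a"
  have "\<rho> a \<in> carrier special_linear" using hom a by (auto simp: hom_def)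
  then have det: "det g = 1" by (simp add: special_linear_def g_def)
  have gi: "g ** matrix_inv g = mat 1" "matrix_inv g ** g = mat 1"
    using det matrix_inv_mult by (metis zero_neq_one)+
  have hgi: "hconj g ** hconj (matrix_inv g) = mat 1" "hconj (matrix_inv g) ** hconj g = mat 1"
    using gi by (metis hconj_mat_1 hconj_mult)+
  have uT: "u (compose tri T c w) = hconj (matrix_inv g) ** u (c w) ** matrix_inv g" if "w \<in> tri_star" for w
    using equi a T chart_in[OF c] that tri_star_subset
    by (auto simp: equivariant_map_def compose_def sym_action_def g_def)
  note ui = sym_spaceD[OF chart_sym[OF c z]]
  have inv: "matrix_inv (u (compose tri T c z)) = g ** matrix_inv (u (c z)) ** hconj g"
  proof (rule matrix_inv_unique)
    have "u (compose tri T c z) ** (g ** matrix_inv (u (c z)) ** hconj g)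
       = hconj (matrix_inv g) ** (u (c z) ** (matrix_inv g ** g) ** matrix_inv (u (c z))) ** hconj g"
      by (simp add: uT[OF z] matrix_mul_assoc)
    then show "u (compose tri T c z) ** (g ** matrix_inv (u (c z)) ** hconj g) = mat 1"
      by (simp add: gi ui hgi)
  qed
  have "tri_deriv (\<lambda>w. u (compose tri T c w)) z v = tri_deriv (\<lambda>w. hconj (matrix_inv g) ** u (c w) ** matrix_inv g) z v"
    by (rule tri_deriv_cong[OF uT z])
  also have "\<dots> = hconj (matrix_inv g) ** tri_deriv (\<lambda>w. u (c w)) z v ** matrix_inv g"
    by (rule tri_deriv_eq[OF bounded_linear.has_derivative[OF _ chart_has_derivative[OF c z]] z])
       (auto intro!: linear_conv_bounded_linear[THEN iffD1] linearI
         simp: matrix_add_ldistrib bounded_bilinear.add_left[OF bounded_bilinear_matrix_matrix_mult] mm_scaleR)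
  finally have D: "tri_deriv (\<lambda>w. u (compose tri T c w)) z v
      = hconj (matrix_inv g) ** tri_deriv (\<lambda>w. u (c w)) z v ** matrix_inv g" .
  have "g ** matrix_inv (u (c z)) ** hconj g ** (hconj (matrix_inv g) ** tri_deriv (\<lambda>w. u (c w)) z v ** matrix_inv g)
     = g ** matrix_inv (u (c z)) ** (hconj g ** hconj (matrix_inv g)) ** tri_deriv (\<lambda>w. u (c w)) z v ** matrix_inv g"
    by (simp add: matrix_mul_assoc)
  then show "log_deriv \<kappa> u (compose tri T c) z v = \<rho> a ** log_deriv \<kappa> u c z v ** matrix_inv (\<rho> a)"
    unfolding log_deriv_def inv D g_def[symmetric]
    by (simp add: hgi mm_scaleR matrix_mul_assoc)
qed

text \<open>u and its derivative are Hermitian, so the two terms on the right of the unitarity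
  condition are both half of du. This fixes the coefficient 1/2.\<close>

lemma unitary_log_deriv: "unitary X p Xt u (log_deriv (1/2) u)"
  unfolding unitary_def
proof (intro ballI allI)
  fix c z v assume cz: "c \<in> charts X p Xt" "z \<in> tri_star"
  note ui = sym_spaceD[OF chart_sym[OF cz]]
  let ?D = "tri_deriv (\<lambda>w. u (c w)) z v"
  have "hconj (log_deriv (1/2) u c z v) ** u (c z) = (1/2) *\<^sub>R (?D ** (matrix_inv (u (c z)) ** u (c z)))"
    by (simp add: log_deriv_def hconj_scaleR hconj_mult ui(5) hconj_chart_deriv[OF cz] mm_scaleR matrix_mul_assoc)
  moreover have "u (c z) ** log_deriv (1/2) u c z v = (1/2) *\<^sub>R ((u (c z) ** matrix_inv (u (c z))) ** ?D)"
    by (simp add: log_deriv_def mm_scaleR matrix_mul_assoc)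
  ultimately show "?D = hconj (log_deriv (1/2) u c z v) ** u (c z) + u (c z) ** log_deriv (1/2) u c z v"
    by (simp add: ui scaleR_add_left[symmetric])
qed

text \<open>Both sides equal \<kappa> du because du is Hermitian and u^{-1} cancels against
  u.\<close>

lemma self_adjoint_log_deriv: "self_adjoint X p Xt u (log_deriv \<kappa> u)"
  unfolding self_adjoint_def
proof (intro ballI allI)
  fix c z v assume cz: "c \<in> charts X p Xt" "z \<in> tri_star"
  note ui = sym_spaceD[OF chart_sym[OF cz]]
  let ?D = "tri_deriv (\<lambda>w. u (c w)) z v"
  have "hconj (log_deriv \<kappa> u c z v) ** u (c z) = \<kappa> *\<^sub>R (?D ** (matrix_inv (u (c z)) ** u (c z)))"
    by (simp add: log_deriv_def hconj_scaleR hconj_mult ui(5) hconj_chart_deriv[OF cz] mm_scaleR matrix_mul_assoc)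
  moreover have "u (c z) ** log_deriv \<kappa> u c z v = \<kappa> *\<^sub>R ((u (c z) ** matrix_inv (u (c z))) ** ?D)"
    by (simp add: log_deriv_def mm_scaleR matrix_mul_assoc)
  ultimately show "hconj (log_deriv \<kappa> u c z v) ** u (c z) = u (c z) ** log_deriv \<kappa> u c z v"
    by (simp add: ui)
qed

end

section \<open>Symmetry of second derivatives on the open triangle\<close>

lemma second_difference:
  fixes g :: "'a::real_normed_vector \<Rightarrow> real"
  assumes U: "ball z e \<subseteq> U"
    and g: "\<And>x. x \<in> U \<Longrightarrow> (g has_derivative G x) (at x)"
    and A: "\<And>x. x \<in> U \<Longrightarrow> ((\<lambda>x. G x a) has_derivative A x) (at x)"
    and h: "0 < h" "h * (norm a + norm b) < e"
  shows "\<exists>x. dist x z \<le> h * (norm a + norm b) \<and>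
     g (z + h *\<^sub>R a + h *\<^sub>R b) - g (z + h *\<^sub>R a) - g (z + h *\<^sub>R b) + g z = h * h * A x b"
proof -
  have near: "norm (s *\<^sub>R a + t *\<^sub>R b) \<le> h * (norm a + norm b)" if "0 \<le> s" "s \<le> h" "0 \<le> t" "t \<le> h" for s t
  proof -
    have "norm (s *\<^sub>R a + t *\<^sub>R b) \<le> s * norm a + t * norm b"
      using norm_triangle_ineq[of "s *\<^sub>R a" "t *\<^sub>R b"] that by simp
    also have "\<dots> \<le> h * norm a + h * norm b" using that by (intro add_mono mult_right_mono) auto
    finally show ?thesis by (simp add: algebra_simps)
  qed
  have inU: "z + s *\<^sub>R a + t *\<^sub>R b \<in> U" if "0 \<le> s" "s \<le> h" "0 \<le> t" "t \<le> h" for s t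
  proof -
    have "dist z (z + s *\<^sub>R a + t *\<^sub>R b) = norm (s *\<^sub>R a + t *\<^sub>R b)"
      unfolding dist_norm by (metis add.assoc add_diff_cancel_left' norm_minus_commute)
    then show ?thesis using near[OF that] h U by auto
  qed
  \<comment> \<open>The mean value theorem is applied twice: here in direction \<open>a\<close> to
    the difference over the step h b, and below, with \<open>m\<close>, in direction
    \<open>b\<close> to the derivative along \<open>a\<close>.\<close>
  define k where "k s = g (z + s *\<^sub>R a + h *\<^sub>R b) - g (z + s *\<^sub>R a + 0 *\<^sub>R b)" for s
  have k': "(k has_real_derivative (G (z + s *\<^sub>R a + h *\<^sub>R b) a - G (z + s *\<^sub>R a + 0 *\<^sub>R b) a)) (at s)"
    if s: "0 \<le> s" "s \<le> h" for s
  proof -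
    have *: "((\<lambda>s. g (z + s *\<^sub>R a + t *\<^sub>R b)) has_real_derivative G (z + s *\<^sub>R a + t *\<^sub>R b) a) (at s)" if "0 \<le> t" "t \<le> h" for t
    proof -
      have "((\<lambda>s. z + s *\<^sub>R a + t *\<^sub>R b) has_derivative (\<lambda>r. r *\<^sub>R a)) (at s)"
        by (auto intro!: derivative_eq_intros)
      from has_derivative_compose[OF this g[OF inU[OF s that]]]
      have "((\<lambda>s. g (z + s *\<^sub>R a + t *\<^sub>R b)) has_derivative (\<lambda>r. G (z + s *\<^sub>R a + t *\<^sub>R b) (r *\<^sub>R a))) (at s)" .
      then show ?thesis
        unfolding has_field_derivative_def
        using linear_scale[OF has_derivative_linear[OF g[OF inU[OF s that]]]]
        by (simp add: mult.commute[of _ "G _ _"])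
    qed
    show ?thesis unfolding k_def using h by (intro DERIV_diff *) auto
  qed
  obtain \<xi> where \<xi>: "0 < \<xi>" "\<xi> < h" "k h - k 0 = (h - 0) * (G (z + \<xi> *\<^sub>R a + h *\<^sub>R b) a - G (z + \<xi> *\<^sub>R a + 0 *\<^sub>R b) a)"
    using MVT2[OF h(1) k'] by blast
  define m where "m t = G (z + \<xi> *\<^sub>R a + t *\<^sub>R b) a" for t
  have m': "(m has_real_derivative A (z + \<xi> *\<^sub>R a + t *\<^sub>R b) b) (at t)" if t: "0 \<le> t" "t \<le> h" for t
  proof -
    have x: "z + \<xi> *\<^sub>R a + t *\<^sub>R b \<in> U" using \<xi> t by (intro inU) auto
    have "((\<lambda>t. z + \<xi> *\<^sub>R a + t *\<^sub>R b) has_derivative (\<lambda>r. r *\<^sub>R b)) (at t)"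
      by (auto intro!: derivative_eq_intros)
    from has_derivative_compose[OF this A[OF x]]
    show ?thesis
      unfolding has_field_derivative_def m_def
      using linear_scale[OF has_derivative_linear[OF A[OF x]]]
      by (simp add: mult.commute[of _ "A _ _"])
  qed
  obtain \<eta> where \<eta>: "0 < \<eta>" "\<eta> < h" "m h - m 0 = (h - 0) * A (z + \<xi> *\<^sub>R a + \<eta> *\<^sub>R b) b"
    using MVT2[OF h(1) m'] by blast
  show ?thesis
  proof (intro exI conjI)
    show "dist (z + \<xi> *\<^sub>R a + \<eta> *\<^sub>R b) z \<le> h * (norm a + norm b)"
      using near[of \<xi> \<eta>] \<xi> \<eta> by (simp add: dist_norm add.assoc)
    show "g (z + h *\<^sub>R a + h *\<^sub>R b) - g (z + h *\<^sub>R a) - g (z + h *\<^sub>R b) + g z = h * h * A (z + \<xi> *\<^sub>R a + \<eta> *\<^sub>R b) b"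
      using \<xi>(3) \<eta>(3) by (simp add: k_def m_def)
  qed
qed

text \<open>The second difference is symmetric in \<open>a\<close> and \<open>b\<close>. It equals
  h^2 times a value of either iterated derivative at a point near z, and continuity of both gives
  the same limit as h tends to 0.\<close>

lemma second_derivative_symmetric_real:
  fixes g :: "'a::real_normed_vector \<Rightarrow> real"
  assumes U: "open U" "z \<in> U"
    and g: "\<And>x. x \<in> U \<Longrightarrow> (g has_derivative G x) (at x)"
    and A: "\<And>x. x \<in> U \<Longrightarrow> ((\<lambda>x. G x a) has_derivative A x) (at x)"
    and B: "\<And>x. x \<in> U \<Longrightarrow> ((\<lambda>x. G x b) has_derivative B x) (at x)"
    and cA: "continuous_on U (\<lambda>x. A x b)" and cB: "continuous_on U (\<lambda>x. B x a)"
  shows "A z b = B z a"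
proof -
  obtain e where e: "e > 0" "ball z e \<subseteq> U" using U openE by blast
  define K where "K = norm a + norm b + 1"
  have K: "K > 0" "norm a + norm b \<le> K" by (auto simp: K_def intro: add_nonneg_pos)
  \<comment> \<open>A null sequence of steps so small that the parallelogram spanned by h a and h b
    stays in the ball around z.\<close>
  define h where "h n = e / (2 * K * real (Suc n))" for n
  have h0: "h n > 0" for n using e K by (simp add: h_def)
  have hK: "h n * (norm a + norm b) < e" for n
  proof -
    have "h n * (norm a + norm b) \<le> h n * K" using h0[of n] K by (intro mult_left_mono) auto
    also have "\<dots> = e / (2 * real (Suc n))" using K by (simp add: h_def)
    also have "\<dots> < e" using e by (simp add: field_simps add_pos_nonneg)
    finally show ?thesis .
  qed
  have hK': "h n * (norm b + norm a) < e" for n using hK by (simp add: add.commute)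
  obtain x where x: "\<And>n. dist (x n) z \<le> h n * (norm a + norm b)"
    "\<And>n. g (z + h n *\<^sub>R a + h n *\<^sub>R b) - g (z + h n *\<^sub>R a) - g (z + h n *\<^sub>R b) + g z = h n * h n * A (x n) b"
    using second_difference[OF e(2) g A h0 hK] by metis
  obtain y where y: "\<And>n. dist (y n) z \<le> h n * (norm b + norm a)"
    "\<And>n. g (z + h n *\<^sub>R b + h n *\<^sub>R a) - g (z + h n *\<^sub>R b) - g (z + h n *\<^sub>R a) + g z = h n * h n * B (y n) a"
    using second_difference[OF e(2) g B h0 hK'] by metis
  have eq: "A (x n) b = B (y n) a" for n
  proof -
    have "h n * h n * A (x n) b = h n * h n * B (y n) a"
      unfolding x(2)[symmetric] y(2)[symmetric] by (simp add: algebra_simps)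
    then show ?thesis using h0[of n] by simp
  qed
  have hl: "(\<lambda>n. h n * (norm a + norm b)) \<longlonglongrightarrow> 0"
  proof -
    have "(\<lambda>n. (e * (norm a + norm b) / (2 * K)) * inverse (real (Suc n))) \<longlonglongrightarrow> (e * (norm a + norm b) / (2 * K)) * 0"
      by (intro tendsto_mult_left LIMSEQ_inverse_real_of_nat)
    then show ?thesis by (simp add: h_def field_simps)
  qed
  have lim: "w \<longlonglongrightarrow> z" if "\<And>n. dist (w n) z \<le> h n * (norm a + norm b)" for w
    by (rule metric_tendsto_imp_tendsto[OF hl], rule always_eventually)
       (use that in \<open>simp add: dist_real_def order_trans[OF _ abs_ge_self]\<close>)
  have "(\<lambda>n. A (x n) b) \<longlonglongrightarrow> A z b"
    using cA U by (intro isCont_tendsto_compose[OF _ lim[OF x(1)], where g = "\<lambda>x. A x b"])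
      (simp add: continuous_on_eq_continuous_at)
  moreover have "(\<lambda>n. B (y n) a) \<longlonglongrightarrow> B z a"
    using cB U by (intro isCont_tendsto_compose[OF _ lim[OF y(1)[unfolded add.commute[of "norm b"]]], where g = "\<lambda>x. B x a"])
      (simp add: continuous_on_eq_continuous_at)
  ultimately show ?thesis unfolding eq by (rule LIMSEQ_unique)
qed

text \<open>Mean value arguments need real values and a full ball, hence the passage to components
  and the restriction to the interior.\<close>

lemma tri_deriv_symmetric:
  fixes f :: "complex \<Rightarrow> 'b::euclidean_space"
  assumes f: "smooth_on tri_star f" and z: "z \<in> interior tri"
  shows "tri_deriv (\<lambda>w. tri_deriv f w a) z b = tri_deriv (\<lambda>w. tri_deriv f w b) z a"
proof (rule euclidean_eqI)
  fix e :: 'b assume e: "e \<in> Basis"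
  have C: "Ck_on k tri_star f" for k using f by (auto simp: smooth_on_def)
  have at: "at x within tri_star = at x" if "x \<in> interior tri" for x
    using that by (metis at_within_interior interior_tri_star)
  have T: "x \<in> tri_star" if "x \<in> interior tri" for x using that interior_tri_subset_star by auto
  have d: "((\<lambda>w. tri_deriv f w a) has_derivative tri_deriv (\<lambda>w. tri_deriv f w a) x) (at x)" if "x \<in> interior tri" for x a
    using has_derivative_tri_deriv[OF Ck_on_tri_deriv[OF C[of "Suc (Suc 0)"]] T[OF that]] at[OF that] by simp
  have c: "continuous_on (interior tri) (\<lambda>x. tri_deriv (\<lambda>w. tri_deriv f w a) x b \<bullet> e)" for a b
  proof -
    have "Ck_on 0 tri_star (\<lambda>x. tri_deriv (\<lambda>w. tri_deriv f w a) x b)" by (intro Ck_on_tri_deriv C)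
    then show ?thesis
      by (intro continuous_intros) (simp add: continuous_on_subset[OF _ interior_tri_subset_star])
  qed
  show "tri_deriv (\<lambda>w. tri_deriv f w a) z b \<bullet> e = tri_deriv (\<lambda>w. tri_deriv f w b) z a \<bullet> e"
  proof (rule second_derivative_symmetric_real[OF open_interior z,
      where g = "\<lambda>x. f x \<bullet> e" and G = "\<lambda>x v. tri_deriv f x v \<bullet> e"])
    fix x assume x: "x \<in> interior tri"
    show "((\<lambda>x. f x \<bullet> e) has_derivative (\<lambda>v. tri_deriv f x v \<bullet> e)) (at x)"
      using has_derivative_tri_deriv[OF C[of "Suc 0"] T[OF x]] at[OF x]
      by (intro bounded_linear.has_derivative[OF bounded_linear_inner_left]) simp
    show "((\<lambda>x. tri_deriv f x a \<bullet> e) has_derivative (\<lambda>v. tri_deriv (\<lambda>w. tri_deriv f w a) x v \<bullet> e)) (at x)"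
      "((\<lambda>x. tri_deriv f x b \<bullet> e) has_derivative (\<lambda>v. tri_deriv (\<lambda>w. tri_deriv f w b) x v \<bullet> e)) (at x)"
      using d[OF x] by (auto intro: bounded_linear.has_derivative[OF bounded_linear_inner_left])
  qed (rule c)+
qed

section \<open>Finiteness of the weighted integrals, measurability and edge traces\<close>

lemma dyadic_annulus_exists:
  fixes x :: real
  assumes "0 < x" "x < 1"
  shows "\<exists>n. (1/2) ^ Suc n \<le> x \<and> x < (1/2) ^ n"
proof -
  have "\<exists>n. (1/2) ^ Suc n \<le> x"
  proof -
    obtain n where "(1/2::real) ^ n < x" using real_arch_pow_inv[OF assms(1), of "1/2"] by auto
    moreover have "(1/2::real) ^ Suc n \<le> (1/2) ^ n" by simp
    ultimately show ?thesis by (meson less_imp_le order_trans)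
  qed
  then have "\<exists>n. (1/2) ^ Suc n \<le> x \<and> (\<forall>m<n. \<not> (1/2) ^ Suc m \<le> x)"
    by (rule exists_least_iff[THEN iffD1])
  then obtain n where n: "(1/2) ^ Suc n \<le> x" "\<And>m. m < n \<Longrightarrow> x < (1/2) ^ Suc m" by force
  have "x < (1/2) ^ n" using n(2)[of "n - 1"] assms(2) by (cases n) auto
  with n show ?thesis by blast
qed

text \<open>For negative s, cut the punctured disc into dyadic annuli and bound each by the disc
  that contains it; the contributions form a convergent geometric series.\<close>

lemma nn_integral_norm_powr:
  fixes s :: real
  assumes s: "s > -2"
  shows "(\<integral>\<^sup>+z\<in>{z::complex. 0 < norm z \<and> norm z < 1}. ennreal (norm z powr s) \<partial>lborel) < \<infinity>"
proof (cases "s \<ge> 0")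
  case True
  have "(\<integral>\<^sup>+z\<in>{z::complex. 0 < norm z \<and> norm z < 1}. ennreal (norm z powr s) \<partial>lborel)
      \<le> (\<integral>\<^sup>+z. indicator (ball (0::complex) 1) z \<partial>lborel)"
  proof (rule nn_integral_mono)
    fix z :: complex
    show "ennreal (norm z powr s) * indicator {z. 0 < norm z \<and> norm z < 1} z \<le> indicator (ball 0 1) z"
      using True powr_mono2[of s "norm z" 1] by (auto simp: indicator_def ennreal_le_1)
  qed
  also have "\<dots> < \<infinity>" by (simp add: emeasure_ball)
  finally show ?thesis .
next
  case False
  \<comment> \<open>Ratio of the series: halving the radius multiplies the bound for the integrand
    by (1/2)^s and the area by (1/2)^2.\<close>
  define q where "q = (1/2::real) powr (s + 2)"
  have q: "0 < q" "q < 1" using s powr_less_mono2[of "s + 2" "1/2" 1] by (auto simp: q_def)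
  define V where "V = unit_ball_vol (real DIM(complex))"
  have V: "V \<ge> 0" by (simp add: V_def)
  have half: "((1/2) ^ n) powr a = ((1/2) powr a) ^ n" for n and a :: real
    by (simp add: powr_realpow[symmetric] powr_powr mult.commute)
  let ?c = "\<lambda>n. ennreal (((1/2) ^ Suc n) powr s)"
  have meas: "(\<lambda>z. ?c n * indicator (ball (0::complex) ((1/2) ^ n)) z) \<in> borel_measurable lborel" for n
    by (rule borel_measurable_times_ennreal[OF borel_measurable_const borel_measurable_indicator]) simp
  have "(\<integral>\<^sup>+z\<in>{z::complex. 0 < norm z \<and> norm z < 1}. ennreal (norm z powr s) \<partial>lborel)
      \<le> (\<integral>\<^sup>+z. (\<Sum>n. ?c n * indicator (ball (0::complex) ((1/2) ^ n)) z) \<partial>lborel)"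
  proof (rule nn_integral_mono)
    fix z :: complex
    show "ennreal (norm z powr s) * indicator {z. 0 < norm z \<and> norm z < 1} z
      \<le> (\<Sum>n. ?c n * indicator (ball (0::complex) ((1/2) ^ n)) z)"
    proof (cases "0 < norm z \<and> norm z < 1")
      case True
      then obtain n where n: "(1/2) ^ Suc n \<le> norm z" "norm z < (1/2) ^ n" using dyadic_annulus_exists by blast
      have "norm z powr s \<le> ((1/2) ^ Suc n) powr s"
        using n False by (intro powr_mono2') auto
      then have "ennreal (norm z powr s) \<le> ?c n * indicator (ball (0::complex) ((1/2) ^ n)) z"
        using n by (simp add: ennreal_leI del: power_Suc)
      also have "\<dots> = sum (\<lambda>n. ?c n * indicator (ball (0::complex) ((1/2) ^ n)) z) {n}"
        by (subst sum.insert) (simp_all only: finite.emptyI empty_iff sum.empty add_0_right not_False_eq_True)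
      also have "\<dots> \<le> (\<Sum>n. ?c n * indicator (ball (0::complex) ((1/2) ^ n)) z)"
        by (rule sum_le_suminf) auto
      finally show ?thesis using True by simp
    qed auto
  qed
  also have "\<dots> = (\<Sum>n. \<integral>\<^sup>+z. ?c n * indicator (ball (0::complex) ((1/2) ^ n)) z \<partial>lborel)"
    by (rule nn_integral_suminf[OF meas])
  also have "\<dots> = (\<Sum>n. ennreal ((1/2) powr s * V * q ^ n))"
  proof (rule suminf_cong)
    fix n
    have "(\<integral>\<^sup>+z. ?c n * indicator (ball (0::complex) ((1/2) ^ n)) z \<partial>lborel) = ?c n * ennreal (V * ((1/2) ^ n) ^ 2)"
      by (simp add: nn_integral_cmult_indicator emeasure_ball V_def)
    also have "\<dots> = ennreal (((1/2) ^ Suc n) powr s * (V * ((1/2) ^ n) ^ 2))"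
      using V by (simp add: ennreal_mult)
    also have "((1/2) ^ Suc n) powr s * (V * ((1/2) ^ n) ^ 2) = (1/2) powr s * V * q ^ n"
    proof -
      have "q = (1/2) powr s * (1/2)\<^sup>2" by (simp add: q_def powr_add flip: powr_numeral)
      then have "q ^ n = ((1/2) powr s) ^ n * ((1/2)\<^sup>2) ^ n" by (simp only: power_mult_distrib)
      moreover have "((1/2::real) ^ n)\<^sup>2 = ((1/2)\<^sup>2) ^ n" by (simp only: power_mult[symmetric] mult.commute)
      ultimately show ?thesis unfolding half by simp
    qed
    finally show "(\<integral>\<^sup>+z. ?c n * indicator (ball (0::complex) ((1/2) ^ n)) z \<partial>lborel) = ennreal ((1/2) powr s * V * q ^ n)" .
  qed
  also have "\<dots> = ennreal (\<Sum>n. (1/2) powr s * V * q ^ n)"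
    using q V by (intro suminf_ennreal2) (auto intro: summable_mult)
  finally show ?thesis by (simp add: order.strict_trans1)
qed

lemma frontier_tri_null: "frontier tri \<in> null_sets lborel"
  using negligible_convex_frontier[OF convex_tri]
  by (simp add: null_sets_completion_iff negligible_iff_null_sets)

lemma AE_interior_tri: "AE z in lborel. z \<in> tri \<longrightarrow> z \<in> interior tri"
  using AE_not_in[OF frontier_tri_null]
  by eventually_elim (auto simp: frontier_def closure_closed[OF closed_tri])

text \<open>The weight is |z|^{-\<delta>} and the cylinder measure is |z|^{-2} dx dy, so the
  integrand is at most K^2 |z|^{2 \<alpha> - \<delta> - 2}, whose exponent exceeds -2. The bound is
  asked almost everywhere since mixed derivatives are estimated only in the interior.\<close>

lemma collar_sq_finite:
  assumes F: "AE z in lborel. z \<in> tri \<and> 0 < norm z \<and> norm z < 1/2 \<longrightarrow> norm (F z) \<le> K * norm z powr \<alpha>"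
    and \<delta>: "\<delta> < 2 * \<alpha>"
  shows "collar_sq \<delta> F < \<infinity>"
proof -
  let ?s = "2 * \<alpha> - \<delta> - 2"
  have "collar_sq \<delta> F \<le> (\<integral>\<^sup>+z. ennreal (K\<^sup>2) * (ennreal (norm z powr ?s) * indicator {z. 0 < norm z \<and> norm z < 1} z) \<partial>(lborel :: complex measure))"
    unfolding collar_sq_def
  proof (rule nn_integral_mono_AE)
    show "AE z in lborel. ennreal (exp (\<delta> * - ln (norm z)) * (norm (F z))\<^sup>2 / (norm z)\<^sup>2) *
            indicator {z \<in> tri. 0 < norm z \<and> norm z < 1/2} z
         \<le> ennreal (K\<^sup>2) * (ennreal (norm z powr ?s) * indicator {z. 0 < norm z \<and> norm z < 1} z)"
      using F
    proof eventually_elim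
      fix z assume *: "z \<in> tri \<and> 0 < norm z \<and> norm z < 1/2 \<longrightarrow> norm (F z) \<le> K * norm z powr \<alpha>"
      show "ennreal (exp (\<delta> * - ln (norm z)) * (norm (F z))\<^sup>2 / (norm z)\<^sup>2) *
            indicator {z \<in> tri. 0 < norm z \<and> norm z < 1/2} z
         \<le> ennreal (K\<^sup>2) * (ennreal (norm z powr ?s) * indicator {z. 0 < norm z \<and> norm z < 1} z)"
      proof (cases "z \<in> tri \<and> 0 < norm z \<and> norm z < 1/2")
        case True
        then have n: "norm z > 0" by simp
        have e: "exp (\<delta> * - ln (norm z)) = norm z powr (- \<delta>)" using n by (simp add: powr_def)
        have "(norm (F z))\<^sup>2 \<le> (K * norm z powr \<alpha>)\<^sup>2" using * True by (intro power_mono) auto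
        also have "\<dots> = K\<^sup>2 * norm z powr (2 * \<alpha>)"
        proof -
          have "(norm z powr \<alpha>)\<^sup>2 = norm z powr (2 * \<alpha>)"
            using n by (simp add: power2_eq_square powr_add[symmetric])
          then show ?thesis by (simp add: power_mult_distrib)
        qed
        finally have "exp (\<delta> * - ln (norm z)) * (norm (F z))\<^sup>2 / (norm z)\<^sup>2 \<le>
           norm z powr (- \<delta>) * (K\<^sup>2 * norm z powr (2 * \<alpha>)) / (norm z)\<^sup>2"
          unfolding e by (intro divide_right_mono mult_left_mono) auto
        also have "\<dots> = K\<^sup>2 * norm z powr ?s"
        proof -
          have "(norm z)\<^sup>2 = norm z powr 2" using n by (simp flip: powr_numeral)
          moreover have "norm z powr (- \<delta>) * norm z powr (2 * \<alpha>) = norm z powr (2 * \<alpha> - \<delta>)"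
            by (simp add: powr_add[symmetric])
          moreover have "norm z powr ?s = norm z powr (2 * \<alpha> - \<delta>) / norm z powr 2"
            by (rule powr_diff)
          ultimately show ?thesis by (simp del: powr_numeral)
        qed
        finally show ?thesis using True by (simp add: ennreal_leI flip: ennreal_mult)
      qed auto
    qed
  qed
  also have "\<dots> = ennreal (K\<^sup>2) * (\<integral>\<^sup>+z\<in>{z::complex. 0 < norm z \<and> norm z < 1}. ennreal (norm z powr ?s) \<partial>lborel)"
    by (intro nn_integral_cmult) measurable
  also have "\<dots> < \<infinity>"
    using nn_integral_norm_powr[of ?s] \<delta> by (simp add: ennreal_mult_less_top)
  finally show ?thesis .
qed

lemma bounded_on_tri_star_compact:
  assumes "continuous_on tri_star F" "compact K" "K \<subseteq> tri_star"
  shows "\<exists>B\<ge>0. \<forall>z\<in>K. norm (F z) \<le> B"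
proof -
  have "compact (F ` K)" using assms by (meson compact_continuous_image continuous_on_subset)
  then obtain B where "\<forall>x\<in>F ` K. norm x \<le> B" using compact_imp_bounded bounded_iff by blast
  then show ?thesis by (intro exI[of _ "max B 0"]) (auto simp: le_max_iff_disj)
qed

text \<open>The core lies in a compact part of \<open>tri_star\<close>, obtained by removing open
  discs around the vertices, so continuity bounds the integrand.\<close>

lemma core_sq_finite:
  assumes "continuous_on tri_star F"
  shows "core_sq F < \<infinity>"
proof -
  define K where "K = tri \<inter> (\<Inter>w\<in>tri_vertices. - ball w (1/4))"
  have K: "compact K" unfolding K_def by (intro compact_Int_closed[OF compact_tri] closed_INT) auto
  have KT: "K \<subseteq> tri_star"
  proof
    fix z assume z: "z \<in> K"
    then have "z \<notin> tri_vertices" unfolding K_def by fastforce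
    with z show "z \<in> tri_star" by (simp add: K_def tri_star_def)
  qed
  from bounded_on_tri_star_compact[OF assms K KT]
  obtain B where B: "\<And>z. z \<in> K \<Longrightarrow> norm (F z) \<le> B" by auto
  have "core_sq F \<le> (\<integral>\<^sup>+z. ennreal (B\<^sup>2) * indicator tri z \<partial>lborel)"
    unfolding core_sq_def
  proof (rule nn_integral_mono)
    fix z
    show "ennreal ((norm (F z))\<^sup>2) * indicator {z \<in> tri. \<forall>w\<in>tri_vertices. 1/4 < norm (z - w)} z \<le> ennreal (B\<^sup>2) * indicator tri z"
    proof (cases "z \<in> tri \<and> (\<forall>w\<in>tri_vertices. 1/4 < norm (z - w))")
      case True
      then have "z \<in> K" by (force simp: K_def dist_norm norm_minus_commute)
      then have "(norm (F z))\<^sup>2 \<le> B\<^sup>2" using B by (intro power_mono) auto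
      then show ?thesis using True by (simp add: ennreal_leI)
    qed auto
  qed
  also have "\<dots> < \<infinity>"
    using emeasure_compact_finite[OF compact_tri] closed_tri
    by (simp add: nn_integral_cmult_indicator ennreal_mult_less_top)
  finally show ?thesis .
qed

text \<open>Nothing is known about F at the three vertices, but point values on a finite set only
  add finitely many measurable terms.\<close>

lemma set_borel_measurable_tri:
  fixes F :: "complex \<Rightarrow> 'b::euclidean_space"
  assumes "continuous_on tri_star F"
  shows "set_borel_measurable borel tri F"
proof -
  have fin: "finite tri_vertices" by (simp add: tri_vertices_def)
  have [measurable]: "tri_star \<in> sets borel"
    unfolding tri_star_def using closed_tri fin by (intro sets.Diff) (auto simp: finite_imp_closed)
  have "(\<lambda>z. indicator tri_star z *\<^sub>R F z) \<in> borel_measurable borel"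
    by (intro borel_measurable_continuous_on_indicator assms) measurable
  moreover have "(\<lambda>z. \<Sum>v\<in>tri_vertices. indicator {v} z *\<^sub>R F v) \<in> borel_measurable borel"
    by (intro borel_measurable_sum borel_measurable_scaleR borel_measurable_const borel_measurable_indicator) auto
  ultimately have "(\<lambda>z. indicator tri_star z *\<^sub>R F z + (\<Sum>v\<in>tri_vertices. indicator {v} z *\<^sub>R F v)) \<in> borel_measurable borel"
    by (rule borel_measurable_add)
  moreover have "indicator tri_star z *\<^sub>R F z + (\<Sum>v\<in>tri_vertices. indicator {v} z *\<^sub>R F v) = indicator tri z *\<^sub>R F z" for z
  proof -
    have "(\<Sum>v\<in>tri_vertices. indicator {v} z *\<^sub>R F v) = (\<Sum>v\<in>tri_vertices. if v = z then F v else 0)"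
      by (rule sum.cong) (auto simp: indicator_def)
    also have "\<dots> = indicator tri_vertices z *\<^sub>R F z" using fin by (simp add: sum.delta)
    finally show ?thesis using tri_vertices_subset by (auto simp: tri_star_def indicator_def)
  qed
  ultimately show ?thesis unfolding set_borel_measurable_def by simp
qed

text \<open>F is uniformly continuous on a thin compact rectangle standing on [a, b], so the
  integrand tends to 0 uniformly on an interval of length below one.\<close>

lemma edge_trace_continuous:
  fixes F :: "complex \<Rightarrow> 'b::euclidean_space"
  assumes F: "continuous_on tri_star F"
  shows "edge_trace F"
  unfolding edge_trace_def
proof (intro allI impI)
  fix a b :: real assume ab: "0 < a \<and> a < b \<and> b < 1"
  \<comment> \<open>The lateral sides of the triangle have slope sqrt 3, which is at least 1, so a
    rectangle of this height over [a, b] fits inside. It is at most 1/2 and thus also misses the top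
    vertex.\<close>
  define e0 where "e0 = min a (1 - b)"
  define K where "K = cbox (Complex a 0) (Complex b e0)"
  have e0: "e0 > 0" using ab by (simp add: e0_def)
  have s3: "1 \<le> sqrt 3" by simp
  have KT: "K \<subseteq> tri_star"
  proof
    fix z assume "z \<in> K"
    then have z: "a \<le> Re z" "Re z \<le> b" "0 \<le> Im z" "Im z \<le> e0" by (auto simp: K_def in_cbox_complex_iff)
    have "1 * Re z \<le> sqrt 3 * Re z" "1 * (1 - Re z) \<le> sqrt 3 * (1 - Re z)"
      using z ab by (intro mult_right_mono[OF s3]; simp)+
    moreover have "Im z \<le> a" "Im z \<le> 1 - b" using z by (auto simp: e0_def)
    moreover have "a \<le> 1 * Re z" "1 - b \<le> 1 * (1 - Re z)" using z by auto
    ultimately have "Im z \<le> sqrt 3 * Re z" "Im z \<le> sqrt 3 * (1 - Re z)"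
      by (meson order_trans)+
    moreover have "z \<notin> tri_vertices"
    proof
      assume "z \<in> tri_vertices"
      then have "z = cis (pi/3)" using z ab by (auto simp: tri_vertices_def)
      then have "sqrt 3 / 2 \<le> e0" using z by (simp add: cis_pi_3)
      moreover have "e0 \<le> 1/2" using ab by (auto simp: e0_def min_def)
      moreover have "1 < sqrt 3" by simp
      ultimately show False by linarith
    qed
    ultimately show "z \<in> tri_star" using z by (simp add: tri_star_def tri_iff)
  qed
  have "uniformly_continuous_on K F"
    using F KT by (intro compact_uniformly_continuous) (auto simp: K_def intro: continuous_on_subset)
  then have uc: "\<exists>d>0. \<forall>x\<in>K. \<forall>x'\<in>K. dist x' x < d \<longrightarrow> dist (F x') (F x) < r" if "r > 0" for r
    using that unfolding uniformly_continuous_on_def by blast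
  show "((\<lambda>e. \<integral>\<^sup>+s\<in>{a..b}. ennreal (norm (F (Complex s e) - F (Complex s 0))) \<partial>lborel) \<longlongrightarrow> 0) (at_right 0)"
  proof (rule order_tendstoI)
    fix y :: ennreal assume y: "0 < y"
    obtain r :: real where r: "r > 0" "ennreal r < y"
    proof (cases y)
      case (real x)
      then show thesis using y that[of "x / 2"] by (auto simp: ennreal_less_iff)
    qed (use that[of 1] in auto)
    obtain d where d: "d > 0" "\<And>x x'. x \<in> K \<Longrightarrow> x' \<in> K \<Longrightarrow> dist x' x < d \<Longrightarrow> dist (F x') (F x) < r"
      using uc[OF r(1)] by blast
    have "eventually (\<lambda>e. e \<in> {0<..<min d e0}) (at_right 0)"
      by (rule eventually_at_right_real) (use d e0 in auto)
    then show "eventually (\<lambda>e. (\<integral>\<^sup>+s\<in>{a..b}. ennreal (norm (F (Complex s e) - F (Complex s 0))) \<partial>lborel) < y) (at_right 0)"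
    proof eventually_elim
      fix e assume e: "e \<in> {0<..<min d e0}"
      have "(\<integral>\<^sup>+s\<in>{a..b}. ennreal (norm (F (Complex s e) - F (Complex s 0))) \<partial>lborel)
          \<le> (\<integral>\<^sup>+s. ennreal r * indicator {a..b} s \<partial>lborel)"
      proof (rule nn_integral_mono)
        fix s
        show "ennreal (norm (F (Complex s e) - F (Complex s 0))) * indicator {a..b} s \<le> ennreal r * indicator {a..b} s"
        proof (cases "s \<in> {a..b}")
          case True
          have "dist (F (Complex s e)) (F (Complex s 0)) < r"
          proof (rule d)
            show "Complex s 0 \<in> K" "Complex s e \<in> K" using True e e0 by (auto simp: K_def in_cbox_complex_iff)
            have "Complex s e - Complex s 0 = Complex 0 e" by (simp add: complex_eq_iff)
            then show "dist (Complex s e) (Complex s 0) < d" using e by (simp add: dist_norm cmod_def)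
          qed
          then show ?thesis by (simp add: dist_norm indicator_def ennreal_leI)
        qed auto
      qed
      also have "\<dots> = ennreal r * ennreal (b - a)" using ab by (simp add: nn_integral_cmult_indicator)
      also have "\<dots> \<le> ennreal r * 1" using ab by (intro mult_left_mono) (auto simp: ennreal_le_1)
      finally show "(\<integral>\<^sup>+s\<in>{a..b}. ennreal (norm (F (Complex s e) - F (Complex s 0))) \<partial>lborel) < y"
        using r by simp
    qed
  qed simp
qed

section \<open>Estimates at the vertices\<close>

context
  fixes F :: "complex \<Rightarrow> 'c::euclidean_space"
  assumes F: "smooth_on tri_star F"
begin

lemma smooth_on_tri_deriv: "smooth_on tri_star (\<lambda>w. tri_deriv F w v)"
  using F Ck_on_tri_deriv by (auto simp: smooth_on_def simp del: Ck_on.simps)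

lemma smooth_on_radial_derivative:
  assumes "0 < r" "r < 1/2" "0 \<le> \<theta>" "\<theta> \<le> pi / 3"
  shows "((\<lambda>s. F (complex_of_real s * cis \<theta>)) has_vector_derivative
      tri_deriv F (complex_of_real r * cis \<theta>) (cis \<theta>)) (at r)"
proof -
  let ?\<gamma> = "\<lambda>s. complex_of_real s * cis \<theta>"
  have g: "(?\<gamma> has_derivative (\<lambda>h. complex_of_real h * cis \<theta>)) (at r within {0<..<1/2})"
    by (auto intro!: derivative_eq_intros)
  have sub: "?\<gamma> ` {0<..<1/2} \<subseteq> tri_star"
    using assms by (auto intro!: polar_in_tri_star)
  have z: "?\<gamma> r \<in> tri_star" using assms by (auto intro!: polar_in_tri_star)
  note D = smooth_on_has_derivative[OF F z]
  have "((\<lambda>s. F (?\<gamma> s)) has_derivative (\<lambda>h. tri_deriv F (?\<gamma> r) (complex_of_real h * cis \<theta>))) (at r within {0<..<1/2})"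
    by (rule has_derivative_in_compose[OF g has_derivative_subset[OF D sub]])
  moreover have "tri_deriv F (?\<gamma> r) (complex_of_real h * cis \<theta>) = h *\<^sub>R tri_deriv F (?\<gamma> r) (cis \<theta>)" for h
    using linear_scale[OF has_derivative_linear[OF D], of h "cis \<theta>"] by (simp add: scaleR_conv_of_real)
  ultimately show ?thesis
    using assms by (simp add: has_vector_derivative_def at_within_open[of r "{0<..<1/2}"])
qed

lemma smooth_on_angular_derivative:
  assumes "0 < r" "r < 1/2" "0 \<le> \<theta>" "\<theta> \<le> pi / 3"
  shows "((\<lambda>\<tau>. F (complex_of_real r * cis \<tau>)) has_vector_derivative
      tri_deriv F (complex_of_real r * cis \<theta>) (\<i> * (complex_of_real r * cis \<theta>))) (at \<theta> within {0..pi/3})"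
proof -
  let ?\<gamma> = "\<lambda>\<tau>. complex_of_real r * cis \<tau>"
  have "(cis has_derivative (\<lambda>h. complex_of_real h * (\<i> * cis \<theta>))) (at \<theta> within {0..pi/3})"
    using has_derivative_cis[OF has_derivative_ident, of \<theta> "{0..pi/3}"] by (simp add: scaleR_conv_of_real)
  then have g: "(?\<gamma> has_derivative (\<lambda>h. complex_of_real r * (complex_of_real h * (\<i> * cis \<theta>)))) (at \<theta> within {0..pi/3})"
    by (rule has_derivative_mult_right)
  have sub: "?\<gamma> ` {0..pi/3} \<subseteq> tri_star"
    using assms by (auto intro!: polar_in_tri_star)
  have z: "?\<gamma> \<theta> \<in> tri_star" using assms by (auto intro!: polar_in_tri_star)
  note D = smooth_on_has_derivative[OF F z]
  have "((\<lambda>s. F (?\<gamma> s)) has_derivative (\<lambda>h. tri_deriv F (?\<gamma> \<theta>) (complex_of_real r * (complex_of_real h * (\<i> * cis \<theta>))))) (at \<theta> within {0..pi/3})"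
    by (rule has_derivative_in_compose[OF g has_derivative_subset[OF D sub]])
  moreover have "tri_deriv F (?\<gamma> \<theta>) (complex_of_real r * (complex_of_real h * (\<i> * cis \<theta>))) = h *\<^sub>R tri_deriv F (?\<gamma> \<theta>) (\<i> * ?\<gamma> \<theta>)" for h
    using linear_scale[OF has_derivative_linear[OF D], of h "\<i> * ?\<gamma> \<theta>"] by (simp add: scaleR_conv_of_real mult_ac)
  ultimately show ?thesis
    by (simp add: has_vector_derivative_def)
qed

text \<open>\<open>H\<close> is compared with \<open>F\<close> only for radii below R. This lets the
  lemma be iterated on functions that are themselves partial derivatives and are known only near the
  vertex.\<close>

lemma partial_r_eq:
  assumes r: "0 < r" "r < R" "R \<le> 1/2" and t: "0 \<le> \<theta>" "\<theta> \<le> pi / 3"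
    and eq: "\<And>s. 0 < s \<Longrightarrow> s < R \<Longrightarrow> H s \<theta> = F (complex_of_real s * cis \<theta>)"
  shows "partial_r H r \<theta> = tri_deriv F (complex_of_real r * cis \<theta>) (cis \<theta>)"
  unfolding partial_r_def
proof (rule vector_derivative_at)
  have "((\<lambda>s. F (complex_of_real s * cis \<theta>)) has_vector_derivative
      tri_deriv F (complex_of_real r * cis \<theta>) (cis \<theta>)) (at r)"
    using r t by (intro smooth_on_radial_derivative) auto
  then show "((\<lambda>s. H s \<theta>) has_vector_derivative tri_deriv F (complex_of_real r * cis \<theta>) (cis \<theta>)) (at r)"
    by (rule has_vector_derivative_transform_within_open[of _ _ _ "{0<..<R}"]) (use r eq in auto)
qed

lemma partial_theta_eq:
  assumes r: "0 < r" "r < R" "R \<le> 1/2" and t: "0 \<le> \<theta>" "\<theta> \<le> pi / 3"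
    and eq: "\<And>\<tau>. 0 \<le> \<tau> \<Longrightarrow> \<tau> \<le> pi/3 \<Longrightarrow> H r \<tau> = F (complex_of_real r * cis \<tau>)"
  shows "partial_theta H r \<theta> = tri_deriv F (complex_of_real r * cis \<theta>) (\<i> * (complex_of_real r * cis \<theta>))"
  unfolding partial_theta_def
proof (rule vector_derivative_within_closed_interval)
  have "((\<lambda>s. F (complex_of_real r * cis s)) has_vector_derivative
      tri_deriv F (complex_of_real r * cis \<theta>) (\<i> * (complex_of_real r * cis \<theta>))) (at \<theta> within {0..pi/3})"
    using r t by (intro smooth_on_angular_derivative) auto
  then show "((\<lambda>s. H r s) has_vector_derivative tri_deriv F (complex_of_real r * cis \<theta>) (\<i> * (complex_of_real r * cis \<theta>))) (at \<theta> within {0..pi/3})"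
    by (rule has_vector_derivative_transform[rotated 2]) (use t eq in auto)
qed (use t in auto)

text \<open>Product rule for dF applied to the vector field w \<mapsto> k w: one term freezes the
  vector, the other differentiates the field. Expanding in the directions 1 and \<i> reduces it to
  directional derivatives along constant vectors.\<close>

lemma tri_deriv_twisted_has_derivative:
  assumes z: "z \<in> tri_star"
  shows "((\<lambda>w. tri_deriv F w (k * w)) has_derivative
     (\<lambda>h. tri_deriv (\<lambda>w. tri_deriv F w (k * z)) z h + tri_deriv F z (k * h))) (at z within tri_star)"
proof -
  have dec: "tri_deriv F w a = Re a *\<^sub>R tri_deriv F w 1 + Im a *\<^sub>R tri_deriv F w \<i>" if "w \<in> tri_star" for w a
  proof -
    note l = has_derivative_linear[OF smooth_on_has_derivative[OF F that]]
    have "a = Re a *\<^sub>R 1 + Im a *\<^sub>R \<i>" by (simp add: complex_eq_iff)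
    then have "tri_deriv F w a = tri_deriv F w (Re a *\<^sub>R 1 + Im a *\<^sub>R \<i>)" by simp
    then show ?thesis by (simp only: linear_add[OF l] linear_scale[OF l])
  qed
  note D = smooth_on_has_derivative[OF smooth_on_tri_deriv z]
  have R: "((\<lambda>w. Re (k * w)) has_derivative (\<lambda>h. Re (k * h))) (at z within tri_star)"
    "((\<lambda>w. Im (k * w)) has_derivative (\<lambda>h. Im (k * h))) (at z within tri_star)"
    by (auto intro!: derivative_eq_intros)
  have "((\<lambda>w. Re (k * w) *\<^sub>R tri_deriv F w 1 + Im (k * w) *\<^sub>R tri_deriv F w \<i>) has_derivative
    (\<lambda>h. (Re (k * z) *\<^sub>R tri_deriv (\<lambda>w. tri_deriv F w 1) z h + Re (k * h) *\<^sub>R tri_deriv F z 1)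
       + (Im (k * z) *\<^sub>R tri_deriv (\<lambda>w. tri_deriv F w \<i>) z h + Im (k * h) *\<^sub>R tri_deriv F z \<i>))) (at z within tri_star)"
    by (intro has_derivative_add has_derivative_scaleR R D)
  then have 1: "((\<lambda>w. tri_deriv F w (k * w)) has_derivative
    (\<lambda>h. (Re (k * z) *\<^sub>R tri_deriv (\<lambda>w. tri_deriv F w 1) z h + Re (k * h) *\<^sub>R tri_deriv F z 1)
       + (Im (k * z) *\<^sub>R tri_deriv (\<lambda>w. tri_deriv F w \<i>) z h + Im (k * h) *\<^sub>R tri_deriv F z \<i>))) (at z within tri_star)"
    by (rule has_derivative_transform[OF z, rotated]) (rule dec)
  have 2: "tri_deriv (\<lambda>w. tri_deriv F w (k * z)) z h =
      Re (k * z) *\<^sub>R tri_deriv (\<lambda>w. tri_deriv F w 1) z h + Im (k * z) *\<^sub>R tri_deriv (\<lambda>w. tri_deriv F w \<i>) z h" for h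
  proof (rule tri_deriv_eq[OF _ z])
    have "((\<lambda>w. Re (k * z) *\<^sub>R tri_deriv F w 1 + Im (k * z) *\<^sub>R tri_deriv F w \<i>) has_derivative
      (\<lambda>h. Re (k * z) *\<^sub>R tri_deriv (\<lambda>w. tri_deriv F w 1) z h + Im (k * z) *\<^sub>R tri_deriv (\<lambda>w. tri_deriv F w \<i>) z h)) (at z within tri_star)"
      by (intro has_derivative_add has_derivative_scaleR_right D)
    then show "((\<lambda>w. tri_deriv F w (k * z)) has_derivative
      (\<lambda>h. Re (k * z) *\<^sub>R tri_deriv (\<lambda>w. tri_deriv F w 1) z h + Im (k * z) *\<^sub>R tri_deriv (\<lambda>w. tri_deriv F w \<i>) z h)) (at z within tri_star)"
      by (rule has_derivative_transform[OF z, rotated]) (rule dec)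
  qed
  have 3: "(\<lambda>h. (Re (k * z) *\<^sub>R tri_deriv (\<lambda>w. tri_deriv F w 1) z h + Re (k * h) *\<^sub>R tri_deriv F z 1)
       + (Im (k * z) *\<^sub>R tri_deriv (\<lambda>w. tri_deriv F w \<i>) z h + Im (k * h) *\<^sub>R tri_deriv F z \<i>))
     = (\<lambda>h. tri_deriv (\<lambda>w. tri_deriv F w (k * z)) z h + tri_deriv F z (k * h))"
    unfolding 2 dec[OF z, of "k * _"] by (rule ext) (simp only: add_ac)
  show ?thesis using 1 unfolding 3 .
qed

lemma tri_deriv_scale_arg:
  assumes "z \<in> tri_star"
  shows "tri_deriv (\<lambda>w. tri_deriv F w (r *\<^sub>R a)) z h = r *\<^sub>R tri_deriv (\<lambda>w. tri_deriv F w a) z h"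
proof (rule tri_deriv_eq[OF _ assms])
  have "((\<lambda>w. r *\<^sub>R tri_deriv F w a) has_derivative (\<lambda>h. r *\<^sub>R tri_deriv (\<lambda>w. tri_deriv F w a) z h)) (at z within tri_star)"
    by (intro has_derivative_scaleR_right smooth_on_has_derivative[OF smooth_on_tri_deriv assms])
  then show "((\<lambda>w. tri_deriv F w (r *\<^sub>R a)) has_derivative (\<lambda>h. r *\<^sub>R tri_deriv (\<lambda>w. tri_deriv F w a) z h)) (at z within tri_star)"
    by (rule has_derivative_transform[OF assms, rotated])
       (rule linear_scale[OF has_derivative_linear[OF smooth_on_has_derivative[OF F]]])
qed

end

lemma smooth_on_has_derivative_twisted:
  fixes F :: "complex \<Rightarrow> 'c::euclidean_space"
  assumes F: "smooth_on tri_star F" and z: "z \<in> tri_star"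
  shows "((\<lambda>w. tri_deriv F w (k * w)) has_derivative tri_deriv (\<lambda>w. tri_deriv F w (k * w)) z) (at z within tri_star)"
proof -
  note t = tri_deriv_twisted_has_derivative[OF F z, of k]
  have "tri_deriv (\<lambda>w. tri_deriv F w (k * w)) z = (\<lambda>h. tri_deriv (\<lambda>w. tri_deriv F w (k * z)) z h + tri_deriv F z (k * h))"
    by (rule ext) (rule tri_deriv_eq[OF t z])
  with t show ?thesis by simp
qed

text \<open>The fields z and \<i> z are r times the radial derivative and the angular derivative.
  Each radial derivative thus carries a factor r that compensates the loss in r^{\<alpha> - a}, so
  all bounds become multiples of r^\<alpha>.\<close>

lemma polar_estimates:
  fixes f :: "complex \<Rightarrow> 'c::euclidean_space"
  assumes f: "smooth_on tri_star f" and R: "0 < R" "R \<le> 1/2"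
    and est: "\<And>a b r \<theta>. 1 \<le> a + b \<Longrightarrow> a + b \<le> 2 \<Longrightarrow> r \<in> {0<..<R} \<Longrightarrow> \<theta> \<in> {0..pi/3} \<Longrightarrow>
       norm ((partial_r ^^ a) ((partial_theta ^^ b) (\<lambda>r \<theta>. f (complex_of_real r * cis \<theta>))) r \<theta>) \<le> C * r powr (\<alpha> - real a)"
    and z: "z \<in> tri" "0 < norm z" "norm z < R"
  shows "norm (tri_deriv f z z) \<le> C * norm z powr \<alpha>"
    and "norm (tri_deriv f z (\<i> * z)) \<le> C * norm z powr \<alpha>"
    and "z \<in> interior tri \<Longrightarrow> k \<in> {1, \<i>} \<Longrightarrow> l \<in> {1, \<i>} \<Longrightarrow>
       norm (tri_deriv (\<lambda>w. tri_deriv f w (k * w)) z (l * z)) \<le> 2 * C * norm z powr \<alpha>"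
proof -
  define h where "h = (\<lambda>r \<theta>. f (complex_of_real r * cis \<theta>))"
  define r where "r = norm z"
  have zs: "z \<in> tri_star" using z R by (intro small_tri_star) auto
  have r: "0 < r" "r < R" using z by (auto simp: r_def)
  from z obtain \<theta> where t: "0 \<le> \<theta>" "\<theta> \<le> pi / 3" and z': "z = complex_of_real r * cis \<theta>"
    using tri_polar[of z] by (auto simp: r_def)
  have ze: "z = r *\<^sub>R cis \<theta>" by (simp add: z' scaleR_conv_of_real)
  note lin = has_derivative_linear[OF smooth_on_has_derivative[OF f zs]]
  note lin2 = has_derivative_linear[OF smooth_on_has_derivative[OF smooth_on_tri_deriv[OF f] zs]]
  have pw: "r * (C * r powr (\<alpha> - 1)) = C * r powr \<alpha>" "r * (r * (C * r powr (\<alpha> - 2))) = C * r powr \<alpha>"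
    using r by (simp_all add: powr_diff power2_eq_square)
  have e10: "norm (partial_r h r \<theta>) \<le> C * r powr (\<alpha> - 1)" using est[of 1 0 r \<theta>] r t by (simp add: h_def)
  have e01: "norm (partial_theta h r \<theta>) \<le> C * r powr \<alpha>" using est[of 0 1 r \<theta>] r t by (simp add: h_def)
  have e20: "norm (partial_r (partial_r h) r \<theta>) \<le> C * r powr (\<alpha> - 2)"
    using est[of 2 0 r \<theta>] r t by (simp add: h_def numeral_2_eq_2)
  have e11: "norm (partial_r (partial_theta h) r \<theta>) \<le> C * r powr (\<alpha> - 1)"
    using est[of 1 1 r \<theta>] r t by (simp add: h_def)
  have e02: "norm (partial_theta (partial_theta h) r \<theta>) \<le> C * r powr \<alpha>"
    using est[of 0 2 r \<theta>] r t by (simp add: h_def numeral_2_eq_2)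
  have pr: "partial_r h s \<theta> = tri_deriv f (complex_of_real s * cis \<theta>) (cis \<theta>)" if "0 < s" "s < R" for s
    by (rule partial_r_eq[OF f that R(2) t]) (simp add: h_def)
  have pt: "partial_theta h s \<tau> = tri_deriv f (complex_of_real s * cis \<tau>) (\<i> * (complex_of_real s * cis \<tau>))"
    if "0 < s" "s < R" "0 \<le> \<tau>" "\<tau> \<le> pi/3" for s \<tau>
    by (rule partial_theta_eq[OF f that(1,2) R(2) that(3,4)]) (simp add: h_def)
  have 1: "tri_deriv f z z = r *\<^sub>R partial_r h r \<theta>"
    using linear_scale[OF lin, of r "cis \<theta>"] by (simp add: pr[OF r] z'[symmetric] ze[symmetric])
  have n1: "norm (tri_deriv f z z) \<le> C * r powr \<alpha>"
    unfolding 1 pw(1)[symmetric] using r e10 by (simp add: mult_left_mono)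
  then show "norm (tri_deriv f z z) \<le> C * norm z powr \<alpha>" by (simp add: r_def)
  have 2: "tri_deriv f z (\<i> * z) = partial_theta h r \<theta>" using pt[OF r t] by (simp add: z'[symmetric])
  have n2: "norm (tri_deriv f z (\<i> * z)) \<le> C * r powr \<alpha>" using e01 by (simp add: 2)
  then show "norm (tri_deriv f z (\<i> * z)) \<le> C * norm z powr \<alpha>" by (simp add: r_def)
  note tw = tri_deriv_eq[OF tri_deriv_twisted_has_derivative[OF f zs] zs]
  have C0: "0 \<le> C * r powr \<alpha>" using n1 norm_ge_zero order_trans by blast
  \<comment> \<open>The angular derivative as a function on the triangle. Its smoothness is needed
    to differentiate it again with \<open>partial_r_eq\<close> and
    \<open>partial_theta_eq\<close>.\<close>
  define Q where "Q = (\<lambda>w. tri_deriv f w (\<i> * w))"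
  have Q: "smooth_on tri_star Q"
  proof -
    have "Ck_on m tri_star Q" for m
    proof -
      have "Ck_on m tri_star (\<lambda>w. Re (\<i> * w) *\<^sub>R tri_deriv f w 1 + Im (\<i> * w) *\<^sub>R tri_deriv f w \<i>)"
      proof -
        have l: "bounded_linear (\<lambda>w. Re (\<i> * w))" "bounded_linear (\<lambda>w. Im (\<i> * w))"
          by (auto intro!: linear_conv_bounded_linear[THEN iffD1] linearI)
        have d: "Ck_on m tri_star (\<lambda>w. tri_deriv f w v)" for v
          using smooth_on_tri_deriv[OF f] unfolding smooth_on_def by blast
        show ?thesis
          by (intro Ck_on_add Ck_on_bounded_bilinear[OF bounded_bilinear_scaleR] d
              Ck_on_bounded_linear_self[OF l(1)] Ck_on_bounded_linear_self[OF l(2)])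
      qed
      then show ?thesis
      proof (subst Ck_on_cong[of _ _ "\<lambda>w. Re (\<i> * w) *\<^sub>R tri_deriv f w 1 + Im (\<i> * w) *\<^sub>R tri_deriv f w \<i>"])
        fix w assume w: "w \<in> tri_star"
        note l = has_derivative_linear[OF smooth_on_has_derivative[OF f w]]
        have "\<i> * w = Re (\<i> * w) *\<^sub>R 1 + Im (\<i> * w) *\<^sub>R \<i>" by (simp add: complex_eq_iff)
        then have "Q w = tri_deriv f w (Re (\<i> * w) *\<^sub>R 1 + Im (\<i> * w) *\<^sub>R \<i>)" by (simp add: Q_def)
        then show "Q w = Re (\<i> * w) *\<^sub>R tri_deriv f w 1 + Im (\<i> * w) *\<^sub>R tri_deriv f w \<i>"
          by (simp only: linear_add[OF l] linear_scale[OF l])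
      qed
    qed
    then show ?thesis by (simp add: smooth_on_def)
  qed
  have Qlin: "linear (tri_deriv Q z)" by (rule has_derivative_linear[OF smooth_on_has_derivative[OF Q zs]])
  have d11: "norm (tri_deriv Q z z) \<le> C * r powr \<alpha>"
  proof -
    have "partial_r (partial_theta h) r \<theta> = tri_deriv Q z (cis \<theta>)"
      unfolding z' by (rule partial_r_eq[OF Q r R(2) t]) (simp add: Q_def pt[OF _ _ t])
    then have "tri_deriv Q z z = r *\<^sub>R partial_r (partial_theta h) r \<theta>"
      using linear_scale[OF Qlin, of r "cis \<theta>"] by (simp add: ze[symmetric])
    then show ?thesis unfolding pw(1)[symmetric] using r e11 by (simp add: mult_left_mono)
  qed
  have d02: "norm (tri_deriv Q z (\<i> * z)) \<le> C * r powr \<alpha>"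
  proof -
    have "partial_theta (partial_theta h) r \<theta> = tri_deriv Q z (\<i> * z)"
      unfolding z' by (rule partial_theta_eq[OF Q r R(2) t]) (simp add: Q_def pt r)
    then show ?thesis using e02 by simp
  qed
  have d20: "norm (tri_deriv (\<lambda>w. tri_deriv f w z) z z) \<le> C * r powr \<alpha>"
  proof -
    have "partial_r (partial_r h) r \<theta> = tri_deriv (\<lambda>w. tri_deriv f w (cis \<theta>)) z (cis \<theta>)"
      unfolding z' by (rule partial_r_eq[OF smooth_on_tri_deriv[OF f] r R(2) t]) (simp add: pr)
    moreover have "tri_deriv (\<lambda>w. tri_deriv f w z) z z = r *\<^sub>R r *\<^sub>R tri_deriv (\<lambda>w. tri_deriv f w (cis \<theta>)) z (cis \<theta>)"
    proof -
      have "tri_deriv (\<lambda>w. tri_deriv f w z) z z = tri_deriv (\<lambda>w. tri_deriv f w (r *\<^sub>R cis \<theta>)) z (r *\<^sub>R cis \<theta>)"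
        by (simp only: ze[symmetric])
      then show ?thesis by (simp only: tri_deriv_scale_arg[OF f zs] linear_scale[OF lin2])
    qed
    ultimately show ?thesis unfolding pw(2)[symmetric] using r e20 by (simp add: mult_left_mono)
  qed
  show "norm (tri_deriv (\<lambda>w. tri_deriv f w (k * w)) z (l * z)) \<le> 2 * C * norm z powr \<alpha>"
    if zi: "z \<in> interior tri" and k: "k \<in> {1, \<i>}" and l: "l \<in> {1, \<i>}"
  proof -
    consider "k = 1" "l = 1" | "k = 1" "l = \<i>" | "k = \<i>" "l = 1" | "k = \<i>" "l = \<i>" using k l by auto
    then have "norm (tri_deriv (\<lambda>w. tri_deriv f w (k * w)) z (l * z)) \<le> 2 * (C * r powr \<alpha>)"
    proof cases
      case 1
      \<comment> \<open>Here (r d/dr)^2 = r^2 d^2/dr^2 + r d/dr; the two summands are the origin of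
        the factor 2.\<close>
      have "norm (tri_deriv (\<lambda>w. tri_deriv f w (k * w)) z (l * z)) \<le> norm (tri_deriv (\<lambda>w. tri_deriv f w z) z z) + norm (tri_deriv f z z)"
        unfolding tw using 1 by (simp add: norm_triangle_ineq)
      then show ?thesis using d20 n1 by linarith
    next
      case 2
      \<comment> \<open>The estimates take the angular derivative first and the radial one second.
        This case has the opposite order and is reduced to that one by symmetry, which is why z must
        be interior.\<close>
      have "tri_deriv (\<lambda>w. tri_deriv f w (k * w)) z (l * z) = tri_deriv (\<lambda>w. tri_deriv f w (\<i> * z)) z z + tri_deriv f z (\<i> * z)"
        unfolding tw using 2 tri_deriv_symmetric[OF f zi, of z "\<i> * z"] by simp
      also have "\<dots> = tri_deriv Q z z" unfolding Q_def tw by simp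
      finally show ?thesis using d11 C0 by simp
    next
      case 3
      then show ?thesis using d11 C0 by (simp add: Q_def)
    next
      case 4
      then show ?thesis using d02 C0 by (simp add: Q_def)
    qed
    then show ?thesis by (simp add: r_def)
  qed
qed

text \<open>The radial derivative is at most |C| r^{\<alpha> - 1}, which is integrable at 0.
  Integrating inward from the circle of radius R/2, where compactness bounds f, gives a bound near
  the vertex.\<close>

lemma bounded_near_vertex:
  fixes f :: "complex \<Rightarrow> 'c::euclidean_space"
  assumes f: "smooth_on tri_star f" and R: "0 < R" "R \<le> 1/2" and \<alpha>: "0 < \<alpha>"
    and est: "\<And>z. z \<in> tri \<Longrightarrow> 0 < norm z \<Longrightarrow> norm z < R \<Longrightarrow> norm (tri_deriv f z z) \<le> C * norm z powr \<alpha>"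
  shows "\<exists>B. \<forall>z\<in>tri. 0 < norm z \<and> norm z < R \<longrightarrow> norm (f z) \<le> B"
proof -
  define R2 where "R2 = R / 2"
  define K where "K = {z \<in> tri. R2 \<le> norm z \<and> norm z \<le> R}"
  have "K = tri \<inter> (cball 0 R - ball 0 R2)" by (auto simp: K_def)
  then have cK: "compact K" using compact_tri by (auto intro!: compact_Int_closed closed_Diff)
  have KT: "K \<subseteq> tri_star" unfolding K_def R2_def using R by (auto intro!: small_tri_star)
  have "continuous_on tri_star f" using f Ck_on_imp_continuous by (auto simp: smooth_on_def)
  from bounded_on_tri_star_compact[OF this cK KT]
  obtain B where B: "B \<ge> 0" "\<And>z. z \<in> K \<Longrightarrow> norm (f z) \<le> B" by auto
  show ?thesis
  proof (intro exI ballI impI)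
    fix z assume z: "z \<in> tri" "0 < norm z \<and> norm z < R"
    show "norm (f z) \<le> B + \<bar>C\<bar> / \<alpha> * R2 powr \<alpha>"
    proof (cases "R2 \<le> norm z")
      case True
      then have "norm (f z) \<le> B" using z by (intro B) (auto simp: K_def)
      then show ?thesis using \<alpha> by (simp add: add_increasing2)
    next
      case False
      define r where "r = norm z"
      have r: "0 < r" "r < R2" using z False by (auto simp: r_def)
      from z obtain \<theta> where t: "0 \<le> \<theta>" "\<theta> \<le> pi / 3" and z': "z = complex_of_real r * cis \<theta>"
        using tri_polar[of z] by (auto simp: r_def)
      let ?g = "\<lambda>s. f (complex_of_real s * cis \<theta>)"
      have T: "complex_of_real s * cis \<theta> \<in> tri_star" if "0 < s" "s \<le> R" for s
        using that R t by (intro polar_in_tri_star) auto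
      have d: "(?g has_vector_derivative tri_deriv f (complex_of_real s * cis \<theta>) (cis \<theta>)) (at s)" if "0 < s" "s < R" for s
        using that R t by (intro smooth_on_radial_derivative[OF f]) auto
      have dp: "((\<lambda>s. \<bar>C\<bar> / \<alpha> * s powr \<alpha>) has_vector_derivative \<bar>C\<bar> * s powr (\<alpha> - 1)) (at s)" if "0 < s" for s
      proof -
        have "((\<lambda>s. \<bar>C\<bar> / \<alpha> * s powr \<alpha>) has_real_derivative \<bar>C\<bar> / \<alpha> * (\<alpha> * s powr (\<alpha> - 1))) (at s)"
          using that by (intro DERIV_cmult has_real_derivative_powr)
        then show ?thesis using \<alpha> by (simp add: has_real_derivative_iff_has_vector_derivative)
      qed
      have "norm (?g R2 - ?g r) \<le> \<bar>C\<bar> / \<alpha> * R2 powr \<alpha> - \<bar>C\<bar> / \<alpha> * r powr \<alpha>"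
      proof (rule differentiable_bound_general[OF r(2)])
        show "continuous_on {r..R2} ?g"
          by (rule continuous_at_imp_continuous_on) (use d r R in \<open>auto simp: R2_def intro!: has_vector_derivative_continuous[OF d]\<close>)
        show "continuous_on {r..R2} (\<lambda>s. \<bar>C\<bar> / \<alpha> * s powr \<alpha>)"
          by (intro continuous_intros) (use r in auto)
        fix s assume s: "r < s" "s < R2"
        then have s': "0 < s" "s < R" using r R by (auto simp: R2_def)
        show "(?g has_vector_derivative tri_deriv f (complex_of_real s * cis \<theta>) (cis \<theta>)) (at s)" using d s' by blast
        show "((\<lambda>s. \<bar>C\<bar> / \<alpha> * s powr \<alpha>) has_vector_derivative \<bar>C\<bar> * s powr (\<alpha> - 1)) (at s)" using dp s' by blast
        let ?w = "complex_of_real s * cis \<theta>"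
        have w: "?w \<in> tri_star" using T s' by auto
        have nw: "norm ?w = s" using s' by (simp add: norm_mult)
        have "tri_deriv f ?w ?w = s *\<^sub>R tri_deriv f ?w (cis \<theta>)"
          using linear_scale[OF has_derivative_linear[OF smooth_on_has_derivative[OF f w]], of s "cis \<theta>"]
          by (simp add: scaleR_conv_of_real)
        then have "s * norm (tri_deriv f ?w (cis \<theta>)) \<le> C * s powr \<alpha>"
          using est[of ?w] w tri_star_subset s' by (auto simp: norm_mult)
        also have "\<dots> \<le> \<bar>C\<bar> * s powr \<alpha>" by (intro mult_right_mono) auto
        also have "\<dots> = s * (\<bar>C\<bar> * s powr (\<alpha> - 1))" using s' by (simp add: powr_diff)
        finally show "norm (tri_deriv f ?w (cis \<theta>)) \<le> \<bar>C\<bar> * s powr (\<alpha> - 1)" using s' by simp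
      qed
      moreover have "norm (?g R2) \<le> B"
      proof (rule B)
        have "norm (complex_of_real R2 * cis \<theta>) = R2" using r by (simp add: norm_mult)
        then show "complex_of_real R2 * cis \<theta> \<in> K"
          using T[of R2] tri_star_subset R by (auto simp: K_def R2_def)
      qed
      moreover have "norm (?g r) \<le> norm (?g R2) + norm (?g R2 - ?g r)" by (metis norm_minus_commute norm_triangle_sub)
      moreover have "0 \<le> \<bar>C\<bar> / \<alpha> * r powr \<alpha>" using \<alpha> by simp
      ultimately show ?thesis unfolding z' by linarith
    qed
  qed
qed

text \<open>The collar reaches to radius 1/2, the estimate only to R. On the compact shell between
  them continuity gives a constant bound.\<close>

lemma collar_bound_extend:
  fixes G :: "complex \<Rightarrow> 'c::euclidean_space"
  assumes G: "continuous_on tri_star G" and R: "0 < R" "R \<le> 1/2"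
    and K: "\<And>z. z \<in> interior tri \<Longrightarrow> 0 < norm z \<Longrightarrow> norm z < R \<Longrightarrow> norm (G z) \<le> K * norm z powr \<alpha>"
    and \<alpha>: "0 < \<alpha>" "\<delta> < 2 * \<alpha>"
  shows "collar_sq \<delta> G < \<infinity>"
proof -
  define L where "L = {z \<in> tri. R \<le> norm z \<and> norm z \<le> 1/2}"
  have "L = tri \<inter> (cball 0 (1/2) - ball 0 R)" by (auto simp: L_def)
  then have cL: "compact L" using compact_tri by (auto intro!: compact_Int_closed closed_Diff)
  have LT: "L \<subseteq> tri_star" unfolding L_def using R by (auto intro!: small_tri_star)
  from bounded_on_tri_star_compact[OF G cL LT]
  obtain B where B: "B \<ge> 0" "\<And>z. z \<in> L \<Longrightarrow> norm (G z) \<le> B" by auto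
  \<comment> \<open>On the shell |z|^\<alpha> is at least R^\<alpha>, so B / R^\<alpha> turns the
    constant bound into a multiple of |z|^\<alpha>.\<close>
  define K' where "K' = \<bar>K\<bar> + B / R powr \<alpha>"
  have Rp: "R powr \<alpha> > 0" using R by simp
  have "0 \<le> B / R powr \<alpha>" using B Rp by simp
  then have KK': "K \<le> K'" unfolding K'_def by linarith
  have "AE z in lborel. z \<in> tri \<and> 0 < norm z \<and> norm z < 1/2 \<longrightarrow> norm (G z) \<le> K' * norm z powr \<alpha>"
    using AE_interior_tri
  proof eventually_elim
    fix z assume zi: "z \<in> tri \<longrightarrow> z \<in> interior tri"
    show "z \<in> tri \<and> 0 < norm z \<and> norm z < 1/2 \<longrightarrow> norm (G z) \<le> K' * norm z powr \<alpha>"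
    proof (intro impI)
      assume z: "z \<in> tri \<and> 0 < norm z \<and> norm z < 1/2"
      show "norm (G z) \<le> K' * norm z powr \<alpha>"
      proof (cases "norm z < R")
        case True
        then have "norm (G z) \<le> K * norm z powr \<alpha>" using z zi by (intro K) auto
        also have "\<dots> \<le> K' * norm z powr \<alpha>" using B Rp by (intro mult_right_mono KK') auto
        finally show ?thesis .
      next
        case False
        then have "norm (G z) \<le> B" using z by (intro B) (auto simp: L_def)
        also have "B = B / R powr \<alpha> * R powr \<alpha>" using Rp by simp
        also have "\<dots> \<le> K' * norm z powr \<alpha>"
          using False R \<alpha> B Rp by (intro mult_mono powr_mono2) (auto simp: K'_def)
        finally show ?thesis .
      qed
    qed
  qed
  then show ?thesis by (rule collar_sq_finite) (use \<alpha> in auto)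
qed

lemma nn_integral_pointwise_zero: "(\<And>x. f x = 0) \<Longrightarrow> (\<integral>\<^sup>+x. f x \<partial>M) = 0"
  by simp

text \<open>The form is itself smooth, vanishes at the vertices and has finite norm, so the constant
  sequence approximates it. The work lies near a vertex: u^{-1} is bounded there because u is, and
  the derivative of u^{-1} du is u^{-1} ddu - u^{-1} du u^{-1} du, where every term keeps a factor
  r^\<alpha>.\<close>

lemma log_deriv_in_L21:
  fixes u :: "'b::topological_space \<Rightarrow> complex^'n^'n" and X :: "'a::euclidean_space set set"
  assumes smooth: "smooth_map X p Xt u" and target: "u ` Xt \<subseteq> sym_space"
    and est: "derivative_estimates X p Xt \<alpha> u" and \<alpha>: "0 < \<alpha>" "\<delta> < \<alpha>"
    and End: "End_form X p Xt xt0 \<rho> (log_deriv \<kappa> u)"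
  shows "in_L21 X p Xt xt0 \<rho> \<delta> (log_deriv \<kappa> u)"
proof -
  define \<omega> where "\<omega> = log_deriv \<kappa> u"
  have "\<exists>M>0. \<forall>(A :: complex^'n^'n) (B :: complex^'n^'n). norm (A ** B) \<le> norm A * norm B * M"
    by (rule bounded_bilinear.pos_bounded[OF bounded_bilinear_matrix_matrix_mult])
  then obtain M :: real where M: "M > 0" "\<And>(A :: complex^'n^'n) (B :: complex^'n^'n). norm (A ** B) \<le> norm A * norm B * M"
    by auto
  have mm: "norm (A ** B) \<le> a * b * M" if "norm A \<le> a" "norm B \<le> b" "0 \<le> a" for A B :: "complex^'n^'n" and a b
    using that M(1) by (intro order_trans[OF M(2)] mult_right_mono mult_mono) auto
  have twist: "((\<lambda>w. \<omega> c w (k * w)) has_derivative (\<lambda>h. \<kappa> *\<^sub>R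
        (matrix_inv (u (c z)) ** tri_deriv (\<lambda>w. tri_deriv (\<lambda>w. u (c w)) w (k * w)) z h
         + - (matrix_inv (u (c z)) ** tri_deriv (\<lambda>w. u (c w)) z h ** matrix_inv (u (c z))) ** tri_deriv (\<lambda>w. u (c w)) z (k * z))))
      (at z within tri_star)" if c: "c \<in> charts X p Xt" and z: "z \<in> tri_star" for c z k
  proof -
    note f = chart_smooth[OF smooth target c]
    have C: "Ck_on m tri_star (\<lambda>z. u (c z))" for m using f unfolding smooth_on_def by blast
    have det: "det (u (c z)) = 1" if "z \<in> tri_star" for z by (rule sym_spaceD(2)[OF chart_sym[OF smooth target c that]])
    have 1: "((\<lambda>w. matrix_inv (u (c w))) has_derivative (\<lambda>h. - (matrix_inv (u (c z)) ** tri_deriv (\<lambda>w. u (c w)) z h ** matrix_inv (u (c z))))) (at z within tri_star)"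
      by (rule matrix_inv_derivative[OF smooth_on_has_derivative[OF f z] z det Ck_on_matrix_inv[OF C det]])
    have 2: "((\<lambda>w. tri_deriv (\<lambda>w. u (c w)) w (k * w)) has_derivative tri_deriv (\<lambda>w. tri_deriv (\<lambda>w. u (c w)) w (k * w)) z) (at z within tri_star)"
      by (rule smooth_on_has_derivative_twisted[OF f z])
    show ?thesis unfolding \<omega>_def log_deriv_def
      by (intro has_derivative_scaleR_right matrix_mult_derivative 1 2)
  qed
  have smooth_dir: "smooth_on tri_star (\<lambda>z. \<omega> c z v)" if "c \<in> charts X p Xt" for c v
    using smooth_form_log_deriv[OF smooth target, of \<kappa>] that unfolding smooth_form_def \<omega>_def by blast
  have lin: "linear (\<omega> c z)" if "c \<in> charts X p Xt" "z \<in> tri_star" for c z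
    using one_form_log_deriv[OF smooth target, of \<kappa>] that unfolding one_form_def \<omega>_def by blast
  have smooth_twist: "smooth_on tri_star (\<lambda>z. \<omega> c z (k * z))" if c: "c \<in> charts X p Xt" for c k
    unfolding smooth_on_def
  proof
    fix m
    have l: "bounded_linear (\<lambda>w. Re (k * w))" "bounded_linear (\<lambda>w. Im (k * w))"
      by (auto intro!: linear_conv_bounded_linear[THEN iffD1] linearI simp: algebra_simps)
    have d: "Ck_on m tri_star (\<lambda>w. \<omega> c w v)" for v
      using smooth_dir[OF c] unfolding smooth_on_def by blast
    have "Ck_on m tri_star (\<lambda>w. Re (k * w) *\<^sub>R \<omega> c w 1 + Im (k * w) *\<^sub>R \<omega> c w \<i>)"
      by (intro Ck_on_add Ck_on_bounded_bilinear[OF bounded_bilinear_scaleR] d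
          Ck_on_bounded_linear_self[OF l(1)] Ck_on_bounded_linear_self[OF l(2)])
    moreover have "\<omega> c w (k * w) = Re (k * w) *\<^sub>R \<omega> c w 1 + Im (k * w) *\<^sub>R \<omega> c w \<i>" if "w \<in> tri_star" for w
    proof -
      have "k * w = Re (k * w) *\<^sub>R 1 + Im (k * w) *\<^sub>R \<i>" by (simp add: complex_eq_iff)
      then have "\<omega> c w (k * w) = \<omega> c w (Re (k * w) *\<^sub>R 1 + Im (k * w) *\<^sub>R \<i>)" by simp
      then show ?thesis by (simp only: linear_add[OF lin[OF c that]] linear_scale[OF lin[OF c that]])
    qed
    ultimately show "Ck_on m tri_star (\<lambda>w. \<omega> c w (k * w))" by (subst Ck_on_cong) auto
  qed
  have cont: "continuous_on tri_star F" if "smooth_on tri_star F" for F :: "complex \<Rightarrow> complex^'n^'n"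
    using that unfolding smooth_on_def by (intro Ck_on_imp_continuous[of 0]) blast
  have cont_twist: "continuous_on tri_star (\<lambda>z. tri_deriv F z (l * z))"
    if F: "smooth_on tri_star F" for F :: "complex \<Rightarrow> complex^'n^'n" and l
  proof -
    have "continuous_on tri_star (\<lambda>z. Re (l * z) *\<^sub>R tri_deriv F z 1 + Im (l * z) *\<^sub>R tri_deriv F z \<i>)"
      by (intro continuous_intros cont[OF smooth_on_tri_deriv[OF F]])
    moreover have "tri_deriv F z (l * z) = Re (l * z) *\<^sub>R tri_deriv F z 1 + Im (l * z) *\<^sub>R tri_deriv F z \<i>" if "z \<in> tri_star" for z
    proof -
      note li = has_derivative_linear[OF smooth_on_has_derivative[OF F that]]
      have "l * z = Re (l * z) *\<^sub>R 1 + Im (l * z) *\<^sub>R \<i>" by (simp add: complex_eq_iff)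
      then have "tri_deriv F z (l * z) = tri_deriv F z (Re (l * z) *\<^sub>R 1 + Im (l * z) *\<^sub>R \<i>)" by simp
      then show ?thesis by (simp only: linear_add[OF li] linear_scale[OF li])
    qed
    ultimately show ?thesis by (simp cong: continuous_on_cong)
  qed
  have near: "\<exists>R K. 0 < R \<and> R \<le> 1/2 \<and> (\<forall>z\<in>tri. 0 < norm z \<and> norm z < R \<longrightarrow>
       (\<forall>k\<in>{-1, \<i>}. norm (\<omega> c z (k * z)) \<le> K * norm z powr \<alpha> \<and>
         (z \<in> interior tri \<longrightarrow> (\<forall>l\<in>{-1, \<i>}. norm (tri_deriv (\<lambda>w. \<omega> c w (k * w)) z (l * z)) \<le> K * norm z powr \<alpha>))))"
    if c: "c \<in> charts X p Xt" for c
  proof -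
    define f where "f = (\<lambda>z. u (c z))"
    have f: "smooth_on tri_star f" unfolding f_def by (rule chart_smooth[OF smooth target c])
    obtain C R where R: "0 < R" "R \<le> 1/2" and e: "\<And>a b r \<theta>. 1 \<le> a + b \<Longrightarrow> a + b \<le> 3 \<Longrightarrow> r \<in> {0<..<R} \<Longrightarrow> \<theta> \<in> {0..pi/3} \<Longrightarrow>
       norm ((partial_r ^^ a) ((partial_theta ^^ b) (\<lambda>r \<theta>. f (complex_of_real r * cis \<theta>))) r \<theta>) \<le> C * r powr (\<alpha> - real a)"
      using est c unfolding derivative_estimates_def f_def by metis
    note pe = polar_estimates[OF f R e]
    obtain B where B: "\<And>z. z \<in> tri \<Longrightarrow> 0 < norm z \<Longrightarrow> norm z < R \<Longrightarrow> norm (f z) \<le> B"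
      using bounded_near_vertex[OF f R \<alpha>(1) pe(1)] by auto
    obtain J where J: "\<And>A::complex^'n^'n. det A = 1 \<Longrightarrow> norm A \<le> B \<Longrightarrow> norm (matrix_inv A) \<le> J"
      using norm_matrix_inv_bound[where B = B and 'n = 'n] by blast
    define J' where "J' = max J 0"
    define C' where "C' = \<bar>C\<bar>"
    \<comment> \<open>The two summands bound the second derivative term and the term from
      differentiating u^{-1}. J' bounds the inverse, C' the derivatives of u, and one M enters per
      matrix product.\<close>
    define K where "K = \<bar>\<kappa>\<bar> * (J' * (2 * C') * M + J' * C' * M * J' * M * C' * M)"
    have nn: "0 \<le> J'" "0 \<le> C'" "0 < M" using M by (auto simp: J'_def C'_def)
    show ?thesis
    proof (rule exI[of _ R], rule exI[of _ "K + \<bar>\<kappa>\<bar> * (J' * C' * M)"], intro conjI R ballI impI)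
      fix z k assume z: "z \<in> tri" "0 < norm z \<and> norm z < R" and k: "k \<in> {-1, \<i>}"
      let ?r = "norm z powr \<alpha>"
      have zs: "z \<in> tri_star" using z R by (intro small_tri_star) auto
      note lf = has_derivative_linear[OF smooth_on_has_derivative[OF f zs]]
      have r1: "0 \<le> ?r" "?r \<le> 1" using z R \<alpha> powr_mono2[of \<alpha> "norm z" 1] by auto
      have CC: "C * ?r \<le> C' * ?r" unfolding C'_def using r1 by (intro mult_right_mono) auto
      have inv: "norm (matrix_inv (f z)) \<le> J'"
        using J[OF _ B[of z]] z sym_spaceD(2)[OF chart_sym[OF smooth target c zs]] by (auto simp: J'_def f_def le_max_iff_disj)
      have D: "norm (tri_deriv f z (k * z)) \<le> C' * ?r" if "k \<in> {-1, \<i>}" for k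
      proof -
        have "norm (tri_deriv f z (k * z)) \<le> C * ?r"
          using that z pe(1)[of z] pe(2)[of z] linear_neg[OF lf, of z] by auto
        then show ?thesis using CC by simp
      qed
      have \<omega>: "\<omega> c w v = \<kappa> *\<^sub>R (matrix_inv (f w) ** tri_deriv f w v)" for w v by (simp add: \<omega>_def log_deriv_def f_def)
      have "norm (\<omega> c z (k * z)) \<le> \<bar>\<kappa>\<bar> * (J' * (C' * ?r) * M)"
        unfolding \<omega> norm_scaleR by (intro mult_left_mono mm D[OF k] inv nn) auto
      also have "\<dots> = \<bar>\<kappa>\<bar> * (J' * C' * M) * ?r" by simp
      also have "\<dots> \<le> (K + \<bar>\<kappa>\<bar> * (J' * C' * M)) * ?r" using nn r1 by (intro mult_right_mono) (auto simp: K_def)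
      finally show "norm (\<omega> c z (k * z)) \<le> (K + \<bar>\<kappa>\<bar> * (J' * C' * M)) * ?r" .
      fix l assume zi: "z \<in> interior tri" and l: "l \<in> {-1, \<i>}"
      let ?T = "tri_deriv (\<lambda>w. tri_deriv f w (k * w)) z (l * z)"
      \<comment> \<open>The frame of the norm contains -z, the field of d/dt, whereas
        \<open>polar_estimates\<close> uses z; the signs are pulled out of both derivatives and do
        not change the norm.\<close>
      have T: "norm ?T \<le> 2 * C' * ?r"
      proof -
        define k' where "k' = (if k = -1 then 1 else k)"
        define l' where "l' = (if l = -1 then 1 else l)"
        define s where "s = (if k = -1 then -1 else 1::real)"
        define s' where "s' = (if l = -1 then -1 else 1::real)"
        have kl: "k = s *\<^sub>R k'" "l = s' *\<^sub>R l'" "k' \<in> {1, \<i>}" "l' \<in> {1, \<i>}" "\<bar>s\<bar> = 1" "\<bar>s'\<bar> = 1"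
          using k l by (auto simp: k'_def l'_def s_def s'_def)
        have sm: "((\<lambda>w. tri_deriv f w (k' * w)) has_derivative tri_deriv (\<lambda>w. tri_deriv f w (k' * w)) z) (at z within tri_star)"
          by (rule smooth_on_has_derivative_twisted[OF f zs])
        have "?T = s *\<^sub>R tri_deriv (\<lambda>w. tri_deriv f w (k' * w)) z (l * z)"
        proof (rule tri_deriv_eq[OF _ zs])
          have "((\<lambda>w. s *\<^sub>R tri_deriv f w (k' * w)) has_derivative (\<lambda>h. s *\<^sub>R tri_deriv (\<lambda>w. tri_deriv f w (k' * w)) z h)) (at z within tri_star)"
            by (rule has_derivative_scaleR_right[OF sm])
          then show "((\<lambda>w. tri_deriv f w (k * w)) has_derivative (\<lambda>h. s *\<^sub>R tri_deriv (\<lambda>w. tri_deriv f w (k' * w)) z h)) (at z within tri_star)"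
            by (rule has_derivative_transform[OF zs, rotated])
               (simp add: kl(1) linear_scale[OF has_derivative_linear[OF smooth_on_has_derivative[OF f]]])
        qed
        also have "\<dots> = s *\<^sub>R s' *\<^sub>R tri_deriv (\<lambda>w. tri_deriv f w (k' * w)) z (l' * z)"
          by (simp add: kl(2) linear_scale[OF has_derivative_linear[OF sm]])
        finally have "norm ?T = norm (tri_deriv (\<lambda>w. tri_deriv f w (k' * w)) z (l' * z))" by (simp add: kl(5,6) abs_mult)
        also have "\<dots> \<le> 2 * C * ?r" using pe(3)[of z k' l'] z zi kl by auto
        finally show ?thesis using CC by simp
      qed
      let ?I = "matrix_inv (f z)"
      have t1: "norm (?I ** ?T) \<le> J' * (2 * C' * ?r) * M"
        by (intro mm T inv nn)
      \<comment> \<open>In the quadratic term one derivative is bounded crudely, using r^\<alpha>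
        \<le> 1, so that a single power r^\<alpha> survives from the other.\<close>
      have t2: "norm (?I ** tri_deriv f z (l * z)) \<le> J' * C' * M"
      proof -
        have "C' * ?r \<le> C' * 1" using nn r1 by (intro mult_left_mono)
        then have "norm (tri_deriv f z (l * z)) \<le> C'" using D[OF l] by simp
        then show ?thesis by (intro mm inv nn)
      qed
      have t3: "norm (?I ** tri_deriv f z (l * z) ** ?I) \<le> J' * C' * M * J' * M"
        using nn by (intro mm t2 inv) simp
      have t4: "norm (- (?I ** tri_deriv f z (l * z) ** ?I) ** tri_deriv f z (k * z)) \<le> J' * C' * M * J' * M * (C' * ?r) * M"
        using t3 nn by (intro mm D[OF k]) simp_all
      have "tri_deriv (\<lambda>w. \<omega> c w (k * w)) z (l * z) = \<kappa> *\<^sub>R (?I ** ?T + - (?I ** tri_deriv f z (l * z) ** ?I) ** tri_deriv f z (k * z))"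
        using tri_deriv_eq[OF twist[OF c zs, of k] zs] by (simp add: f_def)
      then have "norm (tri_deriv (\<lambda>w. \<omega> c w (k * w)) z (l * z)) \<le> \<bar>\<kappa>\<bar> * (J' * (2 * C' * ?r) * M + J' * C' * M * J' * M * (C' * ?r) * M)"
        unfolding norm_scaleR using t1 t4 by (auto intro!: mult_left_mono order_trans[OF norm_triangle_ineq] add_mono)
      also have "\<dots> = K * ?r" by (simp add: K_def algebra_simps)
      also have "\<dots> \<le> (K + \<bar>\<kappa>\<bar> * (J' * C' * M)) * ?r" using nn r1 by (intro mult_right_mono) auto
      finally show "norm (tri_deriv (\<lambda>w. \<omega> c w (k * w)) z (l * z)) \<le> (K + \<bar>\<kappa>\<bar> * (J' * C' * M)) * ?r" .
    qed
  qed
  \<comment> \<open>Squaring the pointwise bound doubles the exponent; with \<alpha> positive the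
    required inequality follows from \<delta> < \<alpha>.\<close>
  have d2: "\<delta> < 2 * \<alpha>" using \<alpha> by simp
  have fin: "L21_sq \<delta> \<omega> c < \<infinity>" if c: "c \<in> charts X p Xt" for c
  proof -
    obtain R K where R: "0 < R" "R \<le> 1/2" and n: "\<And>z k. z \<in> tri \<Longrightarrow> 0 < norm z \<Longrightarrow> norm z < R \<Longrightarrow> k \<in> {-1, \<i>} \<Longrightarrow> norm (\<omega> c z (k * z)) \<le> K * norm z powr \<alpha>"
       "\<And>z k l. z \<in> tri \<Longrightarrow> 0 < norm z \<Longrightarrow> norm z < R \<Longrightarrow> z \<in> interior tri \<Longrightarrow> k \<in> {-1, \<i>} \<Longrightarrow> l \<in> {-1, \<i>} \<Longrightarrow>
          norm (tri_deriv (\<lambda>w. \<omega> c w (k * w)) z (l * z)) \<le> K * norm z powr \<alpha>"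
      using near[OF c] by (elim exE conjE) (rule that; blast)
    have 1: "collar_sq \<delta> (\<lambda>z. \<omega> c z (k * z)) < \<infinity>" if "k \<in> {-1, \<i>}" for k
      by (rule collar_bound_extend[OF cont[OF smooth_twist[OF c]] R _ \<alpha>(1) d2, where K = K])
         (use n(1) that interior_subset in blast)
    have 2: "collar_sq \<delta> (\<lambda>z. tri_deriv (\<lambda>w. \<omega> c w (k * w)) z (l * z)) < \<infinity>" if "k \<in> {-1, \<i>}" "l \<in> {-1, \<i>}" for k l
      by (rule collar_bound_extend[OF cont_twist[OF smooth_twist[OF c]] R _ \<alpha>(1) d2, where K = K])
         (use n(2) that interior_subset in blast)
    have 3: "core_sq (\<lambda>z. \<omega> c z k) < \<infinity>" for k by (rule core_sq_finite[OF cont[OF smooth_dir[OF c]]])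
    have 4: "core_sq (\<lambda>z. tri_deriv (\<lambda>w. \<omega> c w k) z l) < \<infinity>" for k l
      by (rule core_sq_finite[OF cont[OF smooth_on_tri_deriv[OF smooth_dir[OF c]]]])
    have sum: "finite I \<Longrightarrow> (\<And>i. i \<in> I \<Longrightarrow> g i < \<infinity>) \<Longrightarrow> sum g I < \<infinity>" for I :: "complex set" and g :: "complex \<Rightarrow> ennreal"
      by (simp add: less_top)
    have add: "a < \<infinity> \<Longrightarrow> b < \<infinity> \<Longrightarrow> a + b < \<infinity>" for a b :: ennreal by simp
    show ?thesis unfolding L21_sq_def L2_sq_def
      by (intro add sum 1 2 3 4) auto
  qed
  have vanish: "vanishes_at_vertices X p Xt \<omega>"
    unfolding vanishes_at_vertices_def
  proof (intro ballI)
    fix c k assume c: "c \<in> charts X p Xt" and k: "k \<in> {-1, \<i>}"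
    obtain R K where R: "0 < R" and n: "\<And>z. z \<in> tri \<Longrightarrow> 0 < norm z \<Longrightarrow> norm z < R \<Longrightarrow> norm (\<omega> c z (k * z)) \<le> K * norm z powr \<alpha>"
      using near[OF c] k by (elim exE conjE) (rule that; blast)
    have "((\<lambda>z::complex. K * norm z powr \<alpha>) \<longlongrightarrow> 0) (at 0 within tri_star)"
    proof -
      have "((\<lambda>z::complex. norm z powr \<alpha>) \<longlongrightarrow> 0) (at 0 within tri_star)"
        by (rule tendsto_zero_powrI[OF _ tendsto_const _ \<alpha>(1)]) (auto intro!: tendsto_eq_intros)
      then show ?thesis by (rule tendsto_mult_right_zero)
    qed
    moreover have "eventually (\<lambda>z. norm (\<omega> c z (k * z)) \<le> K * norm z powr \<alpha>) (at 0 within tri_star)"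
      unfolding eventually_at
      by (intro exI[of _ R] conjI R ballI impI n) (use tri_star_subset in auto)
    ultimately show "((\<lambda>z. \<omega> c z (k * z)) \<longlongrightarrow> 0) (at 0 within tri_star)"
      by (rule Lim_null_comparison[rotated])
  qed
  \<comment> \<open>Differences of the constant sequence are the zero form. Its derivative is
    computed only on \<open>tri_star\<close>, and both regions of integration lie there.\<close>
  have z0: "tri_deriv (\<lambda>w. 0 :: complex^'n^'n) z v = 0" if "z \<in> tri_star" for z v
    using tri_deriv_eq[OF has_derivative_const that] by blast
  have col0: "collar_sq \<delta> G = 0" if "\<And>z. z \<in> tri_star \<Longrightarrow> G z = 0" for G :: "complex \<Rightarrow> complex^'n^'n"
    unfolding collar_sq_def
    by (rule nn_integral_pointwise_zero) (auto simp: indicator_def small_tri_star that)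
  have core0: "core_sq G = 0" if "\<And>z. z \<in> tri_star \<Longrightarrow> G z = 0" for G :: "complex \<Rightarrow> complex^'n^'n"
  proof -
    have "z \<in> tri_star" if "z \<in> tri" "\<forall>w\<in>tri_vertices. 1/4 < norm (z - w)" for z
      using that by (force simp: tri_star_def)
    then show ?thesis unfolding core_sq_def
      by (intro nn_integral_pointwise_zero) (auto simp: indicator_def that)
  qed
  have zero: "L21_sq \<delta> (\<lambda>c z v. 0 :: complex^'n^'n) c = 0" "L2_sq \<delta> (\<lambda>c z v. 0 :: complex^'n^'n) c = 0"
    for c :: "complex \<Rightarrow> 'b"
    unfolding L21_sq_def L2_sq_def by (simp_all add: col0 core0 z0)
  show ?thesis
    unfolding in_L21_def \<omega>_def[symmetric]
  proof (intro conjI ballI allI exI[of _ "\<lambda>_. \<omega>"] impI)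
    show "End_form X p Xt xt0 \<rho> \<omega>" unfolding \<omega>_def by (rule End)
    show "smooth_form X p Xt \<omega>" unfolding \<omega>_def by (rule smooth_form_log_deriv[OF smooth target])
    show "vanishes_at_vertices X p Xt \<omega>" by (rule vanish)
    fix c assume c: "c \<in> charts X p Xt"
    show "L21_sq \<delta> \<omega> c < \<infinity>" by (rule fin[OF c])
    show "set_borel_measurable borel tri (\<lambda>z. \<omega> c z v)" "edge_trace (\<lambda>z. \<omega> c z v)" for v
      using cont[OF smooth_dir[OF c]] by (auto intro: set_borel_measurable_tri edge_trace_continuous)
  qed (auto simp: zero)
qed

section \<open>Charts of the universal cover\<close>

text \<open>Agreement and disagreement of the lifts are both open conditions: on a common sheet p is
  injective and the lifts agree nearby, on different sheets they stay apart. Connectedness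
  decides.\<close>

lemma covering_lift_unique:
  fixes p :: "'b::topological_space \<Rightarrow> 'a::topological_space" and g h :: "'c::topological_space \<Rightarrow> 'b"
  assumes cov: "covering_space Xt p S" and T: "connected T"
    and g: "continuous_on T g" "g ` T \<subseteq> Xt" and h: "continuous_on T h" "h ` T \<subseteq> Xt"
    and eq: "\<And>x. x \<in> T \<Longrightarrow> p (g x) = p (h x)"
    and a: "a \<in> T" "g a = h a" and x: "x \<in> T"
  shows "g x = h x"
proof -
  have local: "\<exists>W. openin (top_of_set T) W \<and> y \<in> W \<and> ((\<forall>w\<in>W. g w = h w) \<or> (\<forall>w\<in>W. g w \<noteq> h w))" if y: "y \<in> T" for y
  proof -
    have "p (g y) \<in> S" using cov g y by (auto simp: covering_space_def)
    then obtain U V where U: "p (g y) \<in> U" "\<Union>V = Xt \<inter> p -` U" "\<And>u. u \<in> V \<Longrightarrow> openin (top_of_set Xt) u"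
      "pairwise disjnt V" "\<And>u. u \<in> V \<Longrightarrow> \<exists>q. homeomorphism u U p q"
      using cov unfolding covering_space_def by metis
    have "g y \<in> \<Union>V" "h y \<in> \<Union>V" using U g h eq y by auto
    then obtain u v where u: "u \<in> V" "g y \<in> u" and v: "v \<in> V" "h y \<in> v" by auto
    define W where "W = (T \<inter> g -` u) \<inter> (T \<inter> h -` v)"
    have "openin (top_of_set T) (T \<inter> g -` u)" "openin (top_of_set T) (T \<inter> h -` v)"
      using continuous_openin_preimage[OF g(1) _ U(3)[OF u(1)]] continuous_openin_preimage[OF h(1) _ U(3)[OF v(1)]] g h by auto
    then have "openin (top_of_set T) W" unfolding W_def by (rule openin_Int)
    moreover have "y \<in> W" using u v y by (simp add: W_def)
    moreover have "(\<forall>w\<in>W. g w = h w) \<or> (\<forall>w\<in>W. g w \<noteq> h w)"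
    proof (cases "u = v")
      case True
      from U(5)[OF u(1)] have "inj_on p u" by (metis homeomorphism_apply1 inj_onI)
      then have "g w = h w" if "w \<in> W" for w
        using that eq True by (auto simp: W_def inj_on_def)
      then show ?thesis by blast
    next
      case False
      then have "u \<inter> v = {}" using U(4) u v by (auto simp: pairwise_def disjnt_def)
      then show ?thesis by (auto simp: W_def)
    qed
    ultimately show ?thesis by blast
  qed
  have "openin (top_of_set T) {x \<in> T. g x = h x}"
    unfolding openin_subopen[of _ "{x \<in> T. g x = h x}"]
  proof safe
    fix y assume "y \<in> T" "g y = h y"
    with local[of y] show "\<exists>W. openin (top_of_set T) W \<and> y \<in> W \<and> W \<subseteq> {x \<in> T. g x = h x}"
      by (smt (verit) mem_Collect_eq openin_imp_subset subset_eq)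
  qed
  moreover have "openin (top_of_set T) {x \<in> T. g x \<noteq> h x}"
    unfolding openin_subopen[of _ "{x \<in> T. g x \<noteq> h x}"]
  proof safe
    fix y assume "y \<in> T" "g y \<noteq> h y"
    with local[of y] show "\<exists>W. openin (top_of_set T) W \<and> y \<in> W \<and> W \<subseteq> {x \<in> T. g x \<noteq> h x}"
      by (smt (verit) mem_Collect_eq openin_imp_subset subset_eq)
  qed
  ultimately have "{x \<in> T. g x = h x} = {} \<or> {x \<in> T. g x \<noteq> h x} = {}"
    using T unfolding connected_openin by blast
  then show ?thesis using a x by blast
qed

text \<open>The image of the dividing point has distances t d and (1 - t) d to the images of the
  ends, which forces it onto the segment. \<open>C\<close> need not be the whole plane, so nothing
  is extended.\<close>

lemma isometry_affine_on_segment: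
  fixes \<sigma> :: "complex \<Rightarrow> 'a::euclidean_space"
  assumes iso: "\<And>z w. z \<in> C \<Longrightarrow> w \<in> C \<Longrightarrow> dist (\<sigma> z) (\<sigma> w) = dist z w"
    and C: "convex C" "a \<in> C" "b \<in> C" and t: "0 \<le> t" "t \<le> 1"
  shows "\<sigma> ((1 - t) *\<^sub>R a + t *\<^sub>R b) = (1 - t) *\<^sub>R \<sigma> a + t *\<^sub>R \<sigma> b"
proof -
  define m where "m = (1 - t) *\<^sub>R a + t *\<^sub>R b"
  have m: "m \<in> C" unfolding m_def using C t by (intro convexD) auto
  have 1: "dist a m = t * dist a b"
  proof -
    have "a - m = t *\<^sub>R (a - b)" by (simp add: m_def algebra_simps)
    then show ?thesis using t by (simp add: dist_norm)
  qed
  have 2: "dist m b = (1 - t) * dist a b"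
  proof -
    have "m - b = (1 - t) *\<^sub>R (a - b)" by (simp add: m_def algebra_simps)
    then show ?thesis using t by (simp add: dist_norm)
  qed
  define x y where "x = \<sigma> m - \<sigma> a" and "y = \<sigma> b - \<sigma> a"
  define d where "d = norm y"
  have nx: "norm x = t * d" using iso[OF C(2) m] iso[OF C(2,3)] 1 by (simp add: x_def y_def d_def dist_norm norm_minus_commute)
  have nxy: "norm (x - y) = (1 - t) * d" using iso[OF m C(3)] iso[OF C(2,3)] 2 by (simp add: x_def y_def d_def dist_norm norm_minus_commute)
  \<comment> \<open>Stewart's identity in an inner product space; inserting the three known lengths
    makes the right side vanish.\<close>
  have "(norm (x - t *\<^sub>R y))\<^sup>2 = (1 - t) * (norm x)\<^sup>2 + t * (norm (x - y))\<^sup>2 - t * (1 - t) * (norm y)\<^sup>2"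
    by (simp add: power2_norm_eq_inner inner_diff_left inner_diff_right inner_commute algebra_simps)
  also have "\<dots> = 0" unfolding nx nxy d_def[symmetric] by (simp add: power2_eq_square algebra_simps)
  finally have "x = t *\<^sub>R y" by simp
  then have "\<sigma> m = \<sigma> a + t *\<^sub>R (\<sigma> b - \<sigma> a)" by (simp add: x_def y_def algebra_simps)
  then show ?thesis by (simp add: m_def algebra_simps)
qed

text \<open>Affinity on segments is used twice: along the edge from 0 to 1, then along the segment
  joining a point of that edge to the third vertex.\<close>

lemma isometry_tri_determined:
  fixes \<sigma> \<tau> :: "complex \<Rightarrow> 'a::euclidean_space"
  assumes \<sigma>: "\<And>z w. z \<in> tri \<Longrightarrow> w \<in> tri \<Longrightarrow> dist (\<sigma> z) (\<sigma> w) = dist z w"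
    and \<tau>: "\<And>z w. z \<in> tri \<Longrightarrow> w \<in> tri \<Longrightarrow> dist (\<tau> z) (\<tau> w) = dist z w"
    and eq: "\<And>v. v \<in> tri_vertices \<Longrightarrow> \<sigma> v = \<tau> v" and z: "z \<in> tri"
  shows "\<sigma> z = \<tau> z"
proof -
  have v: "0 \<in> tri" "1 \<in> tri" "cis (pi/3) \<in> tri" using tri_vertices_subset by (auto simp: tri_vertices_def)
  have v': "0 \<in> tri_vertices" "1 \<in> tri_vertices" "cis (pi/3) \<in> tri_vertices" by (auto simp: tri_vertices_def)
  have seg: "\<sigma> ((1 - t) *\<^sub>R a + t *\<^sub>R b) = \<tau> ((1 - t) *\<^sub>R a + t *\<^sub>R b)"
    if "a \<in> tri" "b \<in> tri" "\<sigma> a = \<tau> a" "\<sigma> b = \<tau> b" "0 \<le> t" "t \<le> 1" for a b t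
    using isometry_affine_on_segment[OF \<sigma> convex_tri that(1,2,5,6)]
      isometry_affine_on_segment[OF \<tau> convex_tri that(1,2,5,6)] that by simp
  have "z \<in> convex hull {cis (pi/3), 0, 1}" using z by (simp add: tri_def tri_vertices_def insert_commute)
  then obtain a b where ab: "0 \<le> a" "0 \<le> b" "a + b = 1" "\<exists>e. e \<in> convex hull {0, 1} \<and> z = a *\<^sub>R cis (pi/3) + b *\<^sub>R e"
    by (subst (asm) convex_hull_insert) auto
  then obtain e where e: "e \<in> closed_segment 0 1" "z = a *\<^sub>R cis (pi/3) + b *\<^sub>R e"
    by (auto simp: segment_convex_hull)
  then obtain t where t: "0 \<le> t" "t \<le> 1" "e = (1 - t) *\<^sub>R 0 + t *\<^sub>R 1" by (auto simp: closed_segment_def)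
  have "e \<in> tri" using e(1) v convex_tri convex_contains_segment by blast
  moreover have "\<sigma> e = \<tau> e" unfolding t(3) using t v v' eq by (intro seg) auto
  ultimately have "\<sigma> ((1 - b) *\<^sub>R cis (pi/3) + b *\<^sub>R e) = \<tau> ((1 - b) *\<^sub>R cis (pi/3) + b *\<^sub>R e)"
    using v v' eq ab by (intro seg) auto
  moreover have "1 - b = a" using ab by simp
  ultimately show ?thesis using e by simp
qed

section \<open>Charts of the universal cover: finiteness, sheets, and the charts along an
  edge\<close>

context
  fixes X :: "'a::euclidean_space set set"
    and p :: "'b::topological_space \<Rightarrow> 'a"
    and Xt :: "'b set"
  assumes X: "equilateral_2_complex X" and cov: "covering_space Xt p (\<Union>X)"
begin

lemma complex_finite: "finite X"
  and complex_face: "\<And>F S. S \<in> X \<Longrightarrow> F face_of S \<Longrightarrow> F \<in> X"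
  and complex_Int: "\<And>S S'. S \<in> X \<Longrightarrow> S' \<in> X \<Longrightarrow> (S \<inter> S') face_of S"
  and complex_simplex: "\<And>S. S \<in> X \<Longrightarrow> \<exists>n. n simplex S"
  using X by (auto simp: equilateral_2_complex_def simplicial_complex_def)

lemma complex_closed: "S \<in> X \<Longrightarrow> closed S"
  using complex_simplex closed_simplex by blast

lemma complex_convex: "S \<in> X \<Longrightarrow> convex S"
  using complex_simplex convex_simplex by blast

lemma chart_continuous: "c \<in> charts X p Xt \<Longrightarrow> continuous_on tri c"
  and chart_image: "c \<in> charts X p Xt \<Longrightarrow> p ` c ` tri \<in> X"
  and chart_isometry: "c \<in> charts X p Xt \<Longrightarrow> z \<in> tri \<Longrightarrow> w \<in> tri \<Longrightarrow> dist (p (c z)) (p (c w)) = dist z w"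
  and chart_subset: "c \<in> charts X p Xt \<Longrightarrow> c ` tri \<subseteq> Xt"
  by (auto simp: charts_def)

lemma chart_inj: "c \<in> charts X p Xt \<Longrightarrow> z \<in> tri \<Longrightarrow> w \<in> tri \<Longrightarrow> p (c z) = p (c w) \<Longrightarrow> z = w"
  using chart_isometry[of c z w] by simp

text \<open>Two charts over the same map to the complex are lifts of it, hence equal once they agree
  at a point; \<open>extensional\<close> takes care of the values outside the triangle.\<close>

lemma charts_eqI:
  assumes c: "c \<in> charts X p Xt" "c' \<in> charts X p Xt"
    and eq: "\<And>z. z \<in> tri \<Longrightarrow> p (c z) = p (c' z)" and a: "a \<in> tri" "c a = c' a"
  shows "c = c'"
proof (rule extensionalityI)
  show "c \<in> extensional tri" "c' \<in> extensional tri" using c by (auto simp: charts_def)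
  fix z assume z: "z \<in> tri"
  show "c z = c' z"
    by (rule covering_lift_unique[OF cov convex_connected[OF convex_tri]
      chart_continuous[OF c(1)] chart_subset[OF c(1)] chart_continuous[OF c(2)] chart_subset[OF c(2)] eq a z])
qed

text \<open>One-point faces are extreme points, and an isometric embedding, being affine on segments
  and injective, preserves extreme points in both directions.\<close>

lemma chart_vertex:
  assumes c: "c \<in> charts X p Xt" and that: "v \<in> tri"
  shows "{p (c v)} face_of p ` c ` tri \<longleftrightarrow> p (c v) \<in> p ` c ` tri_vertices"
proof -
  have T: "convex (p ` c ` tri)" using complex_convex[OF chart_image[OF c]] .
  have "p (c v) extreme_point_of (p ` c ` tri) \<longleftrightarrow> v extreme_point_of tri"
  proof
    assume e: "p (c v) extreme_point_of (p ` c ` tri)"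
    show "v extreme_point_of tri" unfolding extreme_point_of_def
    proof (intro conjI ballI notI that)
      fix a b assume ab: "a \<in> tri" "b \<in> tri" "v \<in> open_segment a b"
      then obtain t where t: "0 < t" "t < 1" "v = (1 - t) *\<^sub>R a + t *\<^sub>R b" "a \<noteq> b" by (auto simp: in_segment)
      have "p (c v) = (1 - t) *\<^sub>R p (c a) + t *\<^sub>R p (c b)" unfolding t(3)
        by (rule isometry_affine_on_segment[where \<sigma> = "\<lambda>z. p (c z)", OF chart_isometry[OF c] convex_tri ab(1,2)]) (use t in auto)
      moreover have "p (c a) \<noteq> p (c b)" using chart_inj[OF c ab(1,2)] t by blast
      ultimately have "p (c v) \<in> open_segment (p (c a)) (p (c b))" using t by (auto simp: in_segment)
      then show False using e ab by (auto simp: extreme_point_of_def)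
    qed
  next
    assume e: "v extreme_point_of tri"
    show "p (c v) extreme_point_of (p ` c ` tri)" unfolding extreme_point_of_def
    proof (intro conjI ballI notI)
      show "p (c v) \<in> p ` c ` tri" using that by blast
      fix a' b' assume ab': "a' \<in> p ` c ` tri" "b' \<in> p ` c ` tri" "p (c v) \<in> open_segment a' b'"
      then obtain a b where ab: "a \<in> tri" "b \<in> tri" "a' = p (c a)" "b' = p (c b)" by blast
      from ab'(3) obtain t where t: "0 < t" "t < 1" "p (c v) = (1 - t) *\<^sub>R p (c a) + t *\<^sub>R p (c b)" "a' \<noteq> b'"
        by (auto simp: in_segment ab)
      let ?w = "(1 - t) *\<^sub>R a + t *\<^sub>R b"
      have "p (c ?w) = (1 - t) *\<^sub>R p (c a) + t *\<^sub>R p (c b)"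
        by (rule isometry_affine_on_segment[where \<sigma> = "\<lambda>z. p (c z)", OF chart_isometry[OF c] convex_tri ab(1,2)]) (use t in auto)
      moreover have "?w \<in> tri" using ab t by (intro convexD[OF convex_tri]) auto
      ultimately have "v = ?w" using chart_inj[OF c that] t by metis
      then have "v \<in> open_segment a b" using t ab by (auto simp: in_segment)
      then show False using e ab by (auto simp: extreme_point_of_def)
    qed
  qed
  then have "{p (c v)} face_of p ` c ` tri \<longleftrightarrow> v \<in> tri_vertices"
    by (simp add: face_of_singleton extreme_point_tri)
  also have "\<dots> \<longleftrightarrow> p (c v) \<in> p ` c ` tri_vertices"
    using chart_inj[OF c that] tri_vertices_subset by blast
  finally show ?thesis .
qed

lemma chart_vertex_in: "c \<in> charts X p Xt \<Longrightarrow> v \<in> tri_vertices \<Longrightarrow> {p (c v)} \<in> X"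
  using complex_face[OF chart_image] chart_vertex tri_vertices_subset by blast

lemma finite_vertices: "finite {a. {a} \<in> X}"
proof -
  have "finite ((\<lambda>a. {a}) ` {a. {a} \<in> X})" by (rule finite_subset[OF _ complex_finite]) auto
  then show ?thesis by (rule finite_imageD) (auto simp: inj_on_def)
qed

text \<open>A finite invariant of a chart: the positions of the three corners determine the
  composite with p, and then one point upstairs determines the lift.\<close>

definition shape :: "(complex \<Rightarrow> 'b) \<Rightarrow> 'a \<times> 'a \<times> 'a" where
  "shape c = (p (c 0), p (c 1), p (c (cis (pi/3))))"

lemma finite_shapes: "finite (shape ` charts X p Xt)"
proof -
  define V where "V = {a. {a} \<in> X}"
  have "shape c \<in> V \<times> V \<times> V" if c: "c \<in> charts X p Xt" for c
  proof -
    have "p (c v) \<in> V" if "v \<in> tri_vertices" for v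
      unfolding V_def mem_Collect_eq by (rule chart_vertex_in[OF c that])
    then show ?thesis by (simp add: shape_def tri_vertices_def)
  qed
  then have "shape ` charts X p Xt \<subseteq> V \<times> V \<times> V" by (rule image_subsetI)
  then show ?thesis
    by (rule finite_subset) (intro finite_cartesian_product finite_vertices[folded V_def])
qed

lemma shape_eq:
  assumes "c \<in> charts X p Xt" "c' \<in> charts X p Xt" "shape c = shape c'" "z \<in> tri"
  shows "p (c z) = p (c' z)"
proof (rule isometry_tri_determined[where \<sigma> = "\<lambda>z. p (c z)" and \<tau> = "\<lambda>z. p (c' z)", OF chart_isometry[OF assms(1)] chart_isometry[OF assms(2)] _ assms(4)])
  show "p (c v) = p (c' v)" if "v \<in> tri_vertices" for v
    using that assms(3) by (auto simp: shape_def tri_vertices_def)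
qed

text \<open>\<open>shape\<close> takes finitely many values and is injective on the charts through
  y: equal shapes give equal projections, so y is reached at the same parameter and the lifts
  coincide there.\<close>

lemma finite_charts_at: "finite {c \<in> charts X p Xt. \<exists>z\<in>tri. c z = y}"
proof (rule finite_imageD[of shape])
  show "finite (shape ` {c \<in> charts X p Xt. \<exists>z\<in>tri. c z = y})"
    by (rule finite_subset[OF _ finite_shapes]) auto
  show "inj_on shape {c \<in> charts X p Xt. \<exists>z\<in>tri. c z = y}"
  proof (rule inj_onI)
    fix c c' assume A: "c \<in> {c \<in> charts X p Xt. \<exists>z\<in>tri. c z = y}" "c' \<in> {c \<in> charts X p Xt. \<exists>z\<in>tri. c z = y}"
      and sh: "shape c = shape c'"
    from A obtain z w where c: "c \<in> charts X p Xt" "c' \<in> charts X p Xt" and z: "z \<in> tri" "c' z = y" and w: "w \<in> tri" "c w = y"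
      by auto
    have "p (c z) = p (c w)" using shape_eq[OF c sh z(1)] z w by simp
    then have "z = w" by (rule chart_inj[OF c(1) z(1) w(1)])
    then have "c z = c' z" using z w by simp
    with z(1) show "c = c'" using shape_eq[OF c sh] charts_eqI[OF c] by blast
  qed
qed

text \<open>A sheet over a small ball around p y. The second quantified clause makes the projected
  distance to y control neighbourhoods of y. The last says that every chart meeting V passes through
  y and maps the R-ball around that parameter into V. Functions of this distance, cut off inside V,
  therefore become functions of the distance to one parameter point in each such chart.\<close>

definition good_nbhd :: "'b \<Rightarrow> 'b set \<Rightarrow> real \<Rightarrow> bool" where
  "good_nbhd y V R \<longleftrightarrow> openin (top_of_set Xt) V \<and> y \<in> V \<and> 0 < R \<and>
     inj_on p V \<and> (\<forall>w\<in>V. dist (p w) (p y) < R) \<and>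
     (\<forall>W. openin (top_of_set Xt) W \<longrightarrow> y \<in> W \<longrightarrow>
        (\<exists>e>0. e \<le> R \<and> (\<forall>w\<in>V. dist (p w) (p y) < e \<longrightarrow> w \<in> W))) \<and>
     (\<forall>c\<in>charts X p Xt. \<forall>z\<in>tri. c z \<in> V \<longrightarrow>
        (\<exists>z0\<in>tri. c z0 = y \<and> (\<forall>w\<in>tri. dist w z0 < R \<longrightarrow> c w \<in> V)))"

lemma good_nbhdD:
  assumes "good_nbhd y V R"
  shows "openin (top_of_set Xt) V" "y \<in> V" "0 < R" "inj_on p V" "\<And>w. w \<in> V \<Longrightarrow> dist (p w) (p y) < R"
  using assms by (simp_all add: good_nbhd_def)

lemma good_nbhd_small:
  assumes "good_nbhd y V R" "openin (top_of_set Xt) W" "y \<in> W"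
  shows "\<exists>e>0. e \<le> R \<and> (\<forall>w\<in>V. dist (p w) (p y) < e \<longrightarrow> w \<in> W)"
  using assms by (simp add: good_nbhd_def)

lemma good_nbhd_chart:
  assumes "good_nbhd y V R" "c \<in> charts X p Xt" "z \<in> tri" "c z \<in> V"
  shows "\<exists>z0\<in>tri. c z0 = y \<and> (\<forall>w\<in>tri. dist w z0 < R \<longrightarrow> c w \<in> V)"
proof -
  have "\<forall>c\<in>charts X p Xt. \<forall>z\<in>tri. c z \<in> V \<longrightarrow>
        (\<exists>z0\<in>tri. c z0 = y \<and> (\<forall>w\<in>tri. dist w z0 < R \<longrightarrow> c w \<in> V))"
    using assms(1) unfolding good_nbhd_def by (elim conjE)
  then show ?thesis using assms(2-4) by blast
qed

text \<open>R is the smaller of two radii: below \<open>R1\<close> the ball in the complex is evenly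
  covered, below \<open>R2\<close> it meets only simplices that contain p y.\<close>

lemma good_nbhd_exists:
  assumes y: "y \<in> Xt"
  shows "\<exists>V R. good_nbhd y V R"
proof -
  have py: "p y \<in> \<Union>X" using cov y by (auto simp: covering_space_def)
  then obtain U Vs where U: "p y \<in> U" "openin (top_of_set (\<Union>X)) U" "\<Union>Vs = Xt \<inter> p -` U" "\<And>u. u \<in> Vs \<Longrightarrow> openin (top_of_set Xt) u"
    "\<And>u. u \<in> Vs \<Longrightarrow> \<exists>q. homeomorphism u U p q"
    using cov unfolding covering_space_def by metis
  have "y \<in> \<Union>Vs" using U(1,3) y by auto
  then obtain u where u: "u \<in> Vs" "y \<in> u" by blast
  obtain q where q: "homeomorphism u U p q" using U(5)[OF u(1)] by blast
  obtain R1 where R1: "R1 > 0" "ball (p y) R1 \<inter> \<Union>X \<subseteq> U"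
    using U(1,2) unfolding openin_contains_ball by blast
  \<comment> \<open>The finitely many simplices that miss p y form a closed set, so a whole ball
    around p y avoids them.\<close>
  have clo: "closed (\<Union>{T \<in> X. p y \<notin> T})"
    using complex_finite complex_closed by (intro closed_Union) auto
  then have "open (- \<Union>{T \<in> X. p y \<notin> T})" by (rule open_Compl)
  moreover have "p y \<in> - \<Union>{T \<in> X. p y \<notin> T}" by blast
  ultimately obtain R2 where R2: "R2 > 0" "ball (p y) R2 \<subseteq> - \<Union>{T \<in> X. p y \<notin> T}"
    by (rule openE)
  define R where "R = min R1 R2"
  define V where "V = u \<inter> (Xt \<inter> p -` ball (p y) R)"
  have contp: "continuous_on Xt p" using cov by (simp add: covering_space_def)
  have uX: "u \<subseteq> Xt" using U(4)[OF u(1)] openin_imp_subset by blast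
  have oV: "openin (top_of_set Xt) V"
    unfolding V_def by (intro openin_Int U(4)[OF u(1)] continuous_openin_preimage_gen contp) auto
  have yV: "y \<in> V" using u y R1 R2 by (simp add: V_def R_def)
  have R: "R > 0" using R1 R2 by (simp add: R_def)
  have pq: "q (p w) = w" if "w \<in> u" for w using q that by (simp add: homeomorphism_def)
  have qp: "p (q t) = t" "q t \<in> u" if "t \<in> U" for t using q that by (auto simp: homeomorphism_def)
  have injV: "inj_on p V" by (rule inj_onI) (metis IntD1 V_def pq)
  have dV: "dist (p w) (p y) < R" if "w \<in> V" for w using that by (simp add: V_def dist_commute)
  have small: "\<exists>e>0. e \<le> R \<and> (\<forall>w\<in>V. dist (p w) (p y) < e \<longrightarrow> w \<in> W)" if W: "openin (top_of_set Xt) W" "y \<in> W" for W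
  proof -
    have oi: "openin (top_of_set u) (u \<inter> W)"
      by (metis W(1) inf_commute openin_Int_open openin_subtopology_Int2 uX openin_open_Int openin_open le_iff_inf inf_assoc)
    have "openin (top_of_set U) (p ` (u \<inter> W))"
      using homeomorphism_imp_open_map[OF q oi] .
    then have "openin (top_of_set (\<Union>X)) (p ` (u \<inter> W))" using U(2) openin_trans by blast
    moreover have "p y \<in> p ` (u \<inter> W)" using u W by blast
    ultimately obtain e where e: "e > 0" "ball (p y) e \<inter> \<Union>X \<subseteq> p ` (u \<inter> W)"
      unfolding openin_contains_ball by blast
    show ?thesis
    proof (intro exI[of _ "min e R"] conjI ballI impI)
      fix w assume w: "w \<in> V" "dist (p w) (p y) < min e R"
      have "p w \<in> \<Union>X" using cov w by (auto simp: covering_space_def V_def)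
      then have "p w \<in> p ` (u \<inter> W)" using e w by (auto simp: dist_commute)
      then obtain w' where "w' \<in> u" "w' \<in> W" "p w = p w'" by blast
      then show "w \<in> W" using pq w by (metis IntD1 V_def)
    qed (use e R in auto)
  qed
  have chart: "\<exists>z0\<in>tri. c z0 = y \<and> (\<forall>w\<in>tri. dist w z0 < R \<longrightarrow> c w \<in> V)"
    if c: "c \<in> charts X p Xt" and z: "z \<in> tri" "c z \<in> V" for c z
  proof -
    have "p (c z) \<in> ball (p y) R2" using z dV[OF z(2)] by (simp add: R_def dist_commute)
    moreover have "p (c z) \<in> p ` c ` tri" using z by blast
    ultimately have "p y \<in> p ` c ` tri" using R2(2) chart_image[OF c] by blast
    then obtain z0 where z0: "z0 \<in> tri" "p (c z0) = p y" by auto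
    \<comment> \<open>On this convex piece of the triangle the chart and q composed with p and the
      chart are two lifts that agree at z; hence the chart stays in the sheet and reaches y.\<close>
    define D where "D = tri \<inter> ball z0 R"
    have D: "connected D" unfolding D_def by (intro convex_connected convex_Int convex_tri convex_ball)
    have pc: "p (c w) \<in> ball (p y) R" if "w \<in> D" for w
      using that chart_isometry[OF c z0(1), of w] z0 by (simp add: D_def)
    have pcU: "p (c w) \<in> U" if "w \<in> D" for w
    proof -
      have "p (c w) \<in> p ` c ` tri" using that by (auto simp: D_def)
      then have "p (c w) \<in> \<Union>X" by (rule UnionI[OF chart_image[OF c]])
      then show ?thesis using pc[OF that] R1 by (auto simp: R_def)
    qed
    have zD: "z \<in> D" using chart_isometry[OF c z0(1) z(1)] z dV[OF z(2)] z0(2) by (simp add: D_def dist_commute)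
    have eq: "c w = q (p (c w))" if "w \<in> D" for w
    proof (rule covering_lift_unique[OF cov D _ _ _ _ _ zD _ that])
      show cc: "continuous_on D c" using chart_continuous[OF c] by (rule continuous_on_subset) (auto simp: D_def)
      show cD: "c ` D \<subseteq> Xt" using chart_subset[OF c] by (auto simp: D_def)
      have cpc: "continuous_on D (\<lambda>w. p (c w))" using continuous_on_compose2[OF contp cc cD] .
      have cq: "continuous_on U q" using q by (simp add: homeomorphism_def)
      show "continuous_on D (\<lambda>w. q (p (c w)))"
        by (rule continuous_on_compose2[OF cq cpc]) (rule image_subsetI, rule pcU)
      show "(\<lambda>w. q (p (c w))) ` D \<subseteq> Xt" using qp(2)[OF pcU] uX by auto
      show "p (c w) = p (q (p (c w)))" if "w \<in> D" for w using qp(1)[OF pcU[OF that]] by simp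
      show "c z = q (p (c z))" using z(2) pq by (simp add: V_def)
    qed
    have "z0 \<in> D" using z0 R by (simp add: D_def)
    then have "c z0 = y" using eq[of z0] z0 pq[OF u(2)] by simp
    moreover have "c w \<in> V" if "w \<in> tri" "dist w z0 < R" for w
    proof -
      have w: "w \<in> D" using that by (simp add: D_def dist_commute)
      then have "c w \<in> u" using eq[OF w] qp(2)[OF pcU[OF w]] by simp
      then show ?thesis using pc[OF w] chart_in[OF c that(1)] by (simp add: V_def)
    qed
    ultimately show ?thesis using z0 by blast
  qed
  have "good_nbhd y V R"
    unfolding good_nbhd_def using oV yV R injV dV small chart by simp
  then show ?thesis by blast
qed

text \<open>Every chart meeting a good neighbourhood passes through its centre, so finitely many
  charts meet it; finitely many such neighbourhoods cover \<open>K\<close>.\<close>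

lemma finite_charts_compact:
  assumes K: "compact K" "K \<subseteq> Xt"
  shows "finite {c \<in> charts X p Xt. \<exists>z\<in>tri. c z \<in> K}"
proof -
  have "\<exists>O'. open O' \<and> y \<in> O' \<and> finite {c \<in> charts X p Xt. \<exists>z\<in>tri. c z \<in> O'}" if y: "y \<in> K" for y
  proof -
    have "y \<in> Xt" by (rule subsetD[OF K(2) y])
    then obtain V R where g: "good_nbhd y V R" using good_nbhd_exists by blast
    note V = good_nbhdD(1,2)[OF g]
    from V(1) obtain O' where O': "open O'" "V = Xt \<inter> O'" unfolding openin_open by blast
    have "{c \<in> charts X p Xt. \<exists>z\<in>tri. c z \<in> O'} \<subseteq> {c \<in> charts X p Xt. \<exists>z\<in>tri. c z = y}"
    proof
      fix c assume "c \<in> {c \<in> charts X p Xt. \<exists>z\<in>tri. c z \<in> O'}"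
      then obtain z where c: "c \<in> charts X p Xt" and z: "z \<in> tri" "c z \<in> O'" by auto
      have "c z \<in> V" using z O' chart_in[OF c z(1)] by simp
      then obtain z0 where "z0 \<in> tri" "c z0 = y" using good_nbhd_chart[OF g c z(1)] by auto
      then show "c \<in> {c \<in> charts X p Xt. \<exists>z\<in>tri. c z = y}" using c by auto
    qed
    then have "finite {c \<in> charts X p Xt. \<exists>z\<in>tri. c z \<in> O'}" by (rule finite_subset[OF _ finite_charts_at])
    moreover have "y \<in> O'" using V(2) O'(2) by simp
    ultimately show ?thesis using O'(1) by (intro exI[of _ O'] conjI)
  qed
  then have "\<forall>y\<in>K. \<exists>O'. open O' \<and> y \<in> O' \<and> finite {c \<in> charts X p Xt. \<exists>z\<in>tri. c z \<in> O'}"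
    by (rule ballI)
  then obtain W where W': "\<forall>y\<in>K. open (W y) \<and> y \<in> W y \<and> finite {c \<in> charts X p Xt. \<exists>z\<in>tri. c z \<in> W y}"
    by (rule bchoice[THEN exE])
  have W: "open (W y)" "y \<in> W y" "finite {c \<in> charts X p Xt. \<exists>z\<in>tri. c z \<in> W y}" if "y \<in> K" for y
    using W' that by simp_all
  obtain Y where Y: "Y \<subseteq> K" "finite Y" "K \<subseteq> (\<Union>y\<in>Y. W y)"
  proof (rule compactE_image[OF K(1), of K W])
    show "K \<subseteq> (\<Union>y\<in>K. W y)" using W(2) by (rule_tac subsetI) (rule UN_I)
  qed (use W(1) that in auto)
  have "{c \<in> charts X p Xt. \<exists>z\<in>tri. c z \<in> K} \<subseteq> (\<Union>y\<in>Y. {c \<in> charts X p Xt. \<exists>z\<in>tri. c z \<in> W y})"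
    using Y by blast
  then show ?thesis by (rule finite_subset) (use Y W in auto)
qed

text \<open>Links the two ways of counting: the energy sums over all charts through the edge point,
  the balancing condition only over charts with the same parametrised edge. Each of the former
  becomes one of the latter after a unique symmetry of the triangle.\<close>

lemma charts_at_edge_point:
  assumes c0: "c0 \<in> charts X p Xt" and s: "0 < s" "s < 1"
  shows "bij_betw (\<lambda>(c, g). compose tri c g) ({c \<in> charts X p Xt. same_edge c0 c} \<times> {g. tri_iso g})
     {c \<in> charts X p Xt. \<exists>z\<in>tri. c z = c0 (Complex s 0)}"
    (is "bij_betw ?F (?D \<times> ?G) ?A")
proof (rule bij_betw_imageI)
  have e01: "c 0 = c0 0" "c 1 = c0 1" if "same_edge c0 c" for c
  proof -
    have "c0 (Complex 0 0) = c (Complex 0 0)" "c0 (Complex 1 0) = c (Complex 1 0)"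
      using that unfolding same_edge_def by force+
    then show "c 0 = c0 0" "c 1 = c0 1" by (simp_all add: Complex_eq_0 Complex_eq_1 flip: zero_complex.code one_complex.code)
  qed
  have v01: "0 \<in> tri" "1 \<in> tri" using tri_vertices_subset by (auto simp: tri_vertices_def)
  show "inj_on ?F (?D \<times> ?G)"
  proof (rule inj_onI, clarify)
    fix c g c' g' assume c: "c \<in> charts X p Xt" "same_edge c0 c" and c': "c' \<in> charts X p Xt" "same_edge c0 c'"
      and g: "tri_iso g" and g': "tri_iso g'" and eq: "compose tri c g = compose tri c' g'"
    have "c (g z) = c' (g' z)" if "z \<in> tri" for z using fun_cong[OF eq, of z] that by (simp add: compose_def)
    moreover have gi: "inv_into UNIV g w \<in> tri" "g (inv_into UNIV g w) = w" if "w \<in> tri" for w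
      using tri_iso_inv[OF g] that tri_iso_bij[OF g] by (auto simp: tri_iso_def bij_is_surj surj_f_inv_f)
    ultimately have 1: "c w = c' (g' (inv_into UNIV g w))" if "w \<in> tri" for w using that by metis
    have gt: "g' w \<in> tri" if "w \<in> tri" for w using g' that by (auto simp: tri_iso_def)
    have fixpt: "g' (inv_into UNIV g w) = w" if "w \<in> tri" "c w = c' w" for w
      using chart_inj[OF c'(1) gt[OF gi(1)[OF that(1)]] that(1)] 1[OF that(1)] that(2) by simp
    have "c 0 = c' 0" "c 1 = c' 1" using e01 c c' by metis+
    then have "g' (inv_into UNIV g 0) = 0" "g' (inv_into UNIV g 1) = 1" using fixpt v01 by auto
    \<comment> \<open>Both charts have the same ends of the edge, so this symmetry fixes 0 and 1 and
      is the identity.\<close>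
    then have "g' \<circ> inv_into UNIV g = id"
      by (intro tri_iso_ext tri_iso_comp g' tri_iso_inv g) (auto simp: tri_iso_def)
    then have 2: "g' (inv_into UNIV g w) = w" for w by (metis comp_apply id_apply)
    have "g' w = g w" for w using 2[of "g w"] tri_iso_bij[OF g] by (simp add: bij_is_inj)
    moreover have "c = c'"
    proof (rule extensionalityI)
      show "c \<in> extensional tri" "c' \<in> extensional tri" using c c' by (auto simp: charts_def)
      show "c w = c' w" if "w \<in> tri" for w using 1[OF that] 2 by simp
    qed
    ultimately show "c = c' \<and> g = g'" by auto
  qed
  have sT: "Complex s 0 \<in> tri" using s by (intro edge_in_tri) auto
  show "?F ` (?D \<times> ?G) = ?A"
  proof (intro equalityI subsetI)
    fix k assume "k \<in> ?F ` (?D \<times> ?G)"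
    then obtain c g where c: "c \<in> charts X p Xt" "same_edge c0 c" and g: "tri_iso g" and k: "k = compose tri c g" by auto
    have "inv_into UNIV g (Complex s 0) \<in> tri" using tri_iso_inv[OF g] sT by (auto simp: tri_iso_def)
    moreover have "k (inv_into UNIV g (Complex s 0)) = c0 (Complex s 0)"
      using calculation c s tri_iso_bij[OF g] by (simp add: k compose_def bij_is_surj surj_f_inv_f same_edge_def)
    ultimately show "k \<in> ?A" using compose_chart[OF c(1) g] k by blast
  next
    fix k assume "k \<in> ?A"
    then obtain z where k: "k \<in> charts X p Xt" and z: "z \<in> tri" "k z = c0 (Complex s 0)" by auto
    let ?T = "p ` k ` tri" and ?Tc = "p ` c0 ` tri"
    let ?x = "p (c0 (Complex s 0))"
    have T: "?T \<in> X" "?Tc \<in> X" using chart_image k c0 by auto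
    have "p (k z) \<in> ?T" using z(1) by blast
    then have xT: "?x \<in> ?T" using z(2) by simp
    have x0T: "?x \<in> ?Tc" using edge_in_tri s by simp
    have x0: "?x \<in> open_segment (p (c0 0)) (p (c0 1))"
    proof -
      have "Complex s 0 = (1 - s) *\<^sub>R 0 + s *\<^sub>R 1" by (simp add: complex_eq_iff)
      then have "?x = (1 - s) *\<^sub>R p (c0 0) + s *\<^sub>R p (c0 1)"
        using isometry_affine_on_segment[where \<sigma> = "\<lambda>z. p (c0 z)", OF chart_isometry[OF c0] convex_tri v01, of s] s by simp
      moreover have "p (c0 0) \<noteq> p (c0 1)" using chart_inj[OF c0 v01] by force
      ultimately show ?thesis using s by (auto simp: in_segment)
    qed
    \<comment> \<open>The two simplices meet in a face. A face that contains an interior point of a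
      segment of the simplex contains its ends, so the whole edge lies in both.\<close>
    have face: "(?Tc \<inter> ?T) face_of ?Tc" by (rule complex_Int[OF T(2,1)])
    have ends: "p (c0 0) \<in> ?Tc \<inter> ?T" "p (c0 1) \<in> ?Tc \<inter> ?T"
      using face x0 xT x0T v01 unfolding face_of_def by blast+
    have vert: "\<exists>v\<in>tri_vertices. p (k v) = p (c0 e)" if e: "e \<in> tri_vertices" "p (c0 e) \<in> ?T" for e
    proof -
      have "{p (c0 e)} \<in> X" by (rule chart_vertex_in[OF c0 e(1)])
      then have "({p (c0 e)} \<inter> ?T) face_of ?T" using complex_Int[OF T(1)] by (metis inf_commute)
      then have f: "{p (c0 e)} face_of ?T" using e(2) by (simp add: Int_insert_left)
      from e(2) obtain v where v: "v \<in> tri" "p (c0 e) = p (k v)" by blast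
      then have "p (k v) \<in> p ` k ` tri_vertices" using f chart_vertex[OF k v(1)] by simp
      then show ?thesis using v by auto
    qed
    obtain a b where ab: "a \<in> tri_vertices" "b \<in> tri_vertices" "p (k a) = p (c0 0)" "p (k b) = p (c0 1)"
      using vert[of 0] vert[of 1] ends by (auto simp: tri_vertices_def)
    have "a \<noteq> b" using ab chart_inj[OF c0 v01] by force
    then obtain g where g: "tri_iso g" "g 0 = a" "g 1 = b" using tri_iso_exists ab by blast
    define c where "c = compose tri k g"
    have c: "c \<in> charts X p Xt" unfolding c_def by (rule compose_chart[OF k g(1)])
    have gt: "g w \<in> tri" if "w \<in> tri" for w using g that by (auto simp: tri_iso_def)
    have cz: "c w = k (g w)" if "w \<in> tri" for w using that by (simp add: c_def compose_def)
    have peq: "p (c (Complex t 0)) = p (c0 (Complex t 0))" if "t \<in> {0..1}" for t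
    proof -
      have 1: "Complex t 0 = (1 - t) *\<^sub>R 0 + t *\<^sub>R 1" by (simp add: complex_eq_iff)
      show ?thesis unfolding 1
        using isometry_affine_on_segment[where \<sigma> = "\<lambda>z. p (c0 z)", OF chart_isometry[OF c0] convex_tri v01, of t]
          isometry_affine_on_segment[where \<sigma> = "\<lambda>z. p (c z)", OF chart_isometry[OF c] convex_tri v01, of t] that ab g cz v01
        by simp
    qed
    have at_s: "c (Complex s 0) = c0 (Complex s 0)"
    proof -
      have "p (k (g (Complex s 0))) = p (k z)" using peq[of s] s cz[OF sT] z by simp
      then have "g (Complex s 0) = z" using chart_inj[OF k gt[OF sT] z(1)] by blast
      then show ?thesis using cz[OF sT] z by simp
    qed
    \<comment> \<open>So far the edges agree only after projection. The edge is connected and the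
      two lifts of it agree at the given point, so they agree in the universal cover.\<close>
    define E where "E = (\<lambda>t. Complex t 0) ` {0..1}"
    have E: "connected E" unfolding E_def
      by (intro connected_continuous_image) (auto simp: Complex_eq intro!: continuous_intros)
    have ET: "E \<subseteq> tri" using edge_in_tri by (auto simp: E_def)
    have "same_edge c0 c"
      unfolding same_edge_def
    proof
      fix t :: real assume t: "t \<in> {0..1}"
      show "c0 (Complex t 0) = c (Complex t 0)"
      proof (rule covering_lift_unique[OF cov E, of c0 c "Complex s 0"])
        show "continuous_on E c0" "continuous_on E c"
          using chart_continuous[OF c0] chart_continuous[OF c] ET continuous_on_subset by blast+
        show "c0 ` E \<subseteq> Xt" "c ` E \<subseteq> Xt" using chart_subset[OF c0] chart_subset[OF c] ET by blast+
        show "p (c0 x) = p (c x)" if "x \<in> E" for x using that peq by (auto simp: E_def)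
      qed (use s t at_s in \<open>auto simp: E_def\<close>)
    qed
    moreover have "k = compose tri c (inv_into UNIV g)"
    proof (rule extensionalityI)
      show "k \<in> extensional tri" using k by (auto simp: charts_def)
      show "compose tri c (inv_into UNIV g) \<in> extensional tri" by (rule compose_extensional)
      fix w assume w: "w \<in> tri"
      then have "inv_into UNIV g w \<in> tri" using tri_iso_inv[OF g(1)] by (auto simp: tri_iso_def)
      then show "k w = compose tri c (inv_into UNIV g) w"
        using w cz tri_iso_bij[OF g(1)] by (simp add: compose_def bij_is_surj surj_f_inv_f)
    qed
    ultimately show "k \<in> ?F ` (?D \<times> ?G)" using c tri_iso_inv[OF g(1)] by (auto simp: image_iff)
  qed
qed

end

section \<open>Weak derivatives\<close>

text \<open>x^{-m} e^{-1/x} extended by 0. The derivatives of each member are combinations of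
  members with larger m, so smoothness follows by one induction over the whole family; m = 0 is the
  usual flat function.\<close>

definition flat_exp :: "nat \<Rightarrow> real \<Rightarrow> real" where
  "flat_exp m x = (if x > 0 then inverse x ^ m / exp (inverse x) else 0)"

lemma flat_exp_tendsto_0: "(flat_exp m \<longlongrightarrow> 0) (at 0)"
  unfolding filterlim_at_split
proof
  show "(flat_exp m \<longlongrightarrow> 0) (at_left 0)"
    by (rule tendsto_eventually) (auto simp: flat_exp_def eventually_at_filter)
  have "((\<lambda>x. inverse x ^ m / exp (inverse x)) \<longlongrightarrow> (0::real)) (at_right 0)"
    by (rule filterlim_compose[OF tendsto_power_div_exp_0 filterlim_inverse_at_top_right])
  then show "(flat_exp m \<longlongrightarrow> 0) (at_right 0)"
    by (rule Lim_transform_eventually) (auto simp: flat_exp_def eventually_at_filter)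
qed

lemma flat_exp_derivative:
  "(flat_exp m has_real_derivative (- real m * flat_exp (Suc m) x + flat_exp (m + 2) x)) (at x)"
proof -
  consider "x > 0" | "x < 0" | "x = 0" by linarith
  then show ?thesis
  proof cases
    case 1
    have "((\<lambda>x. inverse x ^ m / exp (inverse x)) has_real_derivative
        - real m * (inverse x ^ Suc m / exp (inverse x)) + inverse x ^ (m + 2) / exp (inverse x)) (at x)"
    proof -
      have "((\<lambda>x. inverse x ^ m * exp (- inverse x)) has_real_derivative
        real m * (- (inverse x * inverse x) * inverse x ^ (m - 1)) * exp (- inverse x)
          + exp (- inverse x) * (inverse x * inverse x) * inverse x ^ m) (at x)"
        using 1 by (auto intro!: derivative_eq_intros simp: power2_eq_square)
      moreover have "(\<lambda>x::real. inverse x ^ m * exp (- inverse x)) = (\<lambda>x. inverse x ^ m / exp (inverse x))"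
        by (rule ext) (simp add: exp_minus divide_inverse)
      moreover have "real m * (- (inverse x * inverse x) * inverse x ^ (m - 1)) * exp (- inverse x)
          + exp (- inverse x) * (inverse x * inverse x) * inverse x ^ m
         = - real m * (inverse x ^ Suc m / exp (inverse x)) + inverse x ^ (m + 2) / exp (inverse x)"
        by (cases m) (simp_all add: exp_minus divide_inverse algebra_simps)
      ultimately show ?thesis by (simp only:)
    qed
    then have "(flat_exp m has_real_derivative
        - real m * (inverse x ^ Suc m / exp (inverse x)) + inverse x ^ (m + 2) / exp (inverse x)) (at x)"
      by (rule has_field_derivative_transform_within_open[of _ _ _ "{0<..}"]) (use 1 in \<open>auto simp: flat_exp_def\<close>)
    then show ?thesis using 1 by (simp add: flat_exp_def)
  next
    case 2
    have "(flat_exp m has_real_derivative 0) (at x)"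
      by (rule has_field_derivative_transform_within_open[of "\<lambda>x. 0" _ _ "{..<0}"]) (use 2 in \<open>auto simp: flat_exp_def\<close>)
    then show ?thesis using 2 by (simp add: flat_exp_def)
  next
    case 3
    \<comment> \<open>At 0 the difference quotient of the function with index m is the function with
      index m + 1, which tends to 0.\<close>
    have "((\<lambda>y. (flat_exp m y - flat_exp m 0) / (y - 0)) \<longlongrightarrow> 0) (at 0)"
      by (rule Lim_transform_eventually[OF flat_exp_tendsto_0[of "Suc m"]])
         (auto simp: flat_exp_def divide_inverse eventually_at_filter)
    then have "(flat_exp m has_real_derivative 0) (at 0)" by (simp add: has_field_derivative_iff)
    then show ?thesis using 3 by (simp add: flat_exp_def)
  qed
qed

lemma Ck_on_flat_exp: "Ck_on k UNIV (flat_exp m)"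
proof (induction k arbitrary: m)
  case 0
  show ?case using DERIV_isCont[OF flat_exp_derivative] by (auto intro: continuous_at_imp_continuous_on)
next
  case (Suc k)
  show ?case
  proof (rule Ck_on_SucI)
    show "(flat_exp m has_derivative (\<lambda>v. (- real m * flat_exp (Suc m) x + flat_exp (m + 2) x) * v)) (at x within UNIV)" for x
      using flat_exp_derivative[of m x] by (simp add: has_field_derivative_def)
    show "Ck_on k UNIV (\<lambda>x. (- real m * flat_exp (Suc m) x + flat_exp (m + 2) x) * v)" for v
      by (intro Ck_on_mult Ck_on_add Ck_on_const Suc.IH)
  qed
qed

text \<open>Positive exactly on the open box. The factor \<open>Suc n\<close> sharpens the flanks:
  for x > 0 each factor exp (-1 / ((n + 1) x)) tends to 1, so the bumps converge to the indicator of
  the box and are bounded by one.\<close>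

definition box_bump :: "nat \<Rightarrow> complex \<Rightarrow> complex \<Rightarrow> complex \<Rightarrow> real" where
  "box_bump n a b z = flat_exp 0 (real (Suc n) * Re (z - a)) * flat_exp 0 (real (Suc n) * Re (b - z))
     * (flat_exp 0 (real (Suc n) * Im (z - a)) * flat_exp 0 (real (Suc n) * Im (b - z)))"

lemma smooth_on_box_bump: "smooth_on UNIV (box_bump n a b)"
proof -
  have "Ck_on k UNIV (\<lambda>z. flat_exp 0 (l z + c))" if "bounded_linear l" for k c and l :: "complex \<Rightarrow> real"
    by (rule Ck_on_compose_affine[OF that Ck_on_flat_exp]) auto
  moreover have "real (Suc n) * Re (z - a) = real (Suc n) * Re z + (- real (Suc n) * Re a)"
    "real (Suc n) * Re (b - z) = - real (Suc n) * Re z + real (Suc n) * Re b"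
    "real (Suc n) * Im (z - a) = real (Suc n) * Im z + (- real (Suc n) * Im a)"
    "real (Suc n) * Im (b - z) = - real (Suc n) * Im z + real (Suc n) * Im b" for z
    by (simp_all add: algebra_simps)
  ultimately show ?thesis
    unfolding smooth_on_def box_bump_def
    by (simp only:) (intro allI Ck_on_mult; simp only: bounded_linear_const_mult bounded_linear_Re bounded_linear_Im)
qed

lemma flat_exp_0_bounds: "0 \<le> flat_exp 0 x" "flat_exp 0 x \<le> 1"
  by (auto simp: flat_exp_def)

lemma flat_exp_0_pos: "flat_exp 0 x \<noteq> 0 \<longleftrightarrow> x > 0"
  by (auto simp: flat_exp_def)

lemma box_bump_bounds: "\<bar>box_bump n a b z\<bar> \<le> 1"
  unfolding box_bump_def abs_mult using flat_exp_0_bounds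
  by (intro mult_le_one mult_nonneg_nonneg) (auto simp: abs_of_nonneg)

lemma box_bump_nonzero: "box_bump n a b z \<noteq> 0 \<longleftrightarrow> z \<in> box a b"
  by (auto simp: box_bump_def flat_exp_0_pos in_box_complex_iff zero_less_mult_iff)

lemma box_bump_tendsto: "(\<lambda>n. box_bump n a b z) \<longlonglongrightarrow> indicator (box a b) z"
proof (cases "z \<in> box a b")
  case True
  have *: "(\<lambda>n. flat_exp 0 (real (Suc n) * x)) \<longlonglongrightarrow> 1" if x: "x > 0" for x
  proof -
    have "(\<lambda>n. 1 / exp (inverse (real (Suc n)) * inverse x)) \<longlonglongrightarrow> 1 / exp (0 * inverse x)"
      by (intro tendsto_intros LIMSEQ_inverse_real_of_nat) auto
    moreover have "flat_exp 0 (real (Suc n) * x) = 1 / exp (inverse (real (Suc n)) * inverse x)" for n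
      using x by (simp add: flat_exp_def)
    ultimately show ?thesis by simp
  qed
  have "(\<lambda>n. box_bump n a b z) \<longlonglongrightarrow> 1 * 1 * (1 * 1)"
    unfolding box_bump_def using True by (intro tendsto_mult *) (auto simp: in_box_complex_iff)
  then show ?thesis using True by simp
next
  case False
  then have "box_bump n a b z = 0" for n using box_bump_nonzero by blast
  then show ?thesis using False by simp
qed

lemma test_function_box_bump:
  assumes "cbox a b \<subseteq> interior tri"
  shows "test_function (box_bump n a b)"
proof -
  have "closure {z. box_bump n a b z \<noteq> 0} \<subseteq> cbox a b"
    by (rule closure_minimal) (auto simp: box_bump_nonzero box_subset_cbox[THEN subsetD])
  then show ?thesis using assms smooth_on_box_bump by (auto simp: test_function_def)
qed

lemma test_function_continuous:
  assumes "test_function \<phi>"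
  shows "continuous_on UNIV \<phi>" "(\<phi> has_derivative frechet_derivative \<phi> (at z)) (at z)"
    "continuous_on UNIV (\<lambda>z. frechet_derivative \<phi> (at z) v)"
proof -
  have C: "Ck_on k UNIV \<phi>" for k using assms by (auto simp: test_function_def smooth_on_def)
  show "continuous_on UNIV \<phi>" using C[of 0] by simp
  obtain f' where f': "\<And>x. (\<phi> has_derivative f' x) (at x)" "\<And>v. Ck_on 0 UNIV (\<lambda>x. f' x v)"
    using Ck_on_SucE[OF C, of 0] by auto
  have "frechet_derivative \<phi> (at x) = f' x" for x using frechet_derivative_at[OF f'(1)] by simp
  then show "(\<phi> has_derivative frechet_derivative \<phi> (at z)) (at z)" "continuous_on UNIV (\<lambda>z. frechet_derivative \<phi> (at z) v)"
    using f' by auto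
qed

lemma compact_support:
  assumes "test_function \<phi>"
  shows "compact (closure {z. \<phi> z \<noteq> 0})" "closure {z. \<phi> z \<noteq> 0} \<subseteq> interior tri"
proof -
  show "closure {z. \<phi> z \<noteq> 0} \<subseteq> interior tri" using assms by (simp add: test_function_def)
  then have "bounded (closure {z. \<phi> z \<noteq> 0})"
    using compact_imp_bounded[OF compact_tri] interior_subset bounded_subset by blast
  then show "compact (closure {z. \<phi> z \<noteq> 0})" by (simp add: compact_eq_bounded_closed)
qed

lemma locally_integrable_mult_continuous:
  fixes g :: "complex \<Rightarrow> 'c::{banach,second_countable_topology}" and \<phi> :: "complex \<Rightarrow> real"
  assumes g: "locally_integrable g" and K: "compact K" "K \<subseteq> interior tri"
    and \<phi>: "continuous_on UNIV \<phi>" and z: "\<And>z. z \<notin> K \<Longrightarrow> \<phi> z = 0"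
  shows "set_integrable lborel (interior tri) (\<lambda>z. \<phi> z *\<^sub>R g z)"
proof -
  have "compact (\<phi> ` K)" using \<phi> K by (meson compact_continuous_image continuous_on_subset subset_UNIV)
  then obtain B where B: "\<And>z. z \<in> K \<Longrightarrow> \<bar>\<phi> z\<bar> \<le> B"
    using compact_imp_bounded[of "\<phi> ` K"] unfolding bounded_iff by auto
  have gi: "integrable lborel (\<lambda>z. indicator K z *\<^sub>R g z)"
    using g K by (auto simp: locally_integrable_def set_integrable_def)
  have [measurable]: "\<phi> \<in> borel_measurable borel" by (rule borel_measurable_continuous_onI[OF \<phi>])
  have "integrable lborel (\<lambda>z. \<phi> z *\<^sub>R (indicator K z *\<^sub>R g z))"
  proof (rule Bochner_Integration.integrable_bound)
    show "integrable lborel (\<lambda>z. B *\<^sub>R (indicator K z *\<^sub>R g z))" by (intro integrable_scaleR_right gi)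
    show "(\<lambda>z. \<phi> z *\<^sub>R (indicator K z *\<^sub>R g z)) \<in> borel_measurable lborel"
      by (rule borel_measurable_scaleR[OF _ borel_measurable_integrable[OF gi]]) simp
    have "norm (\<phi> z *\<^sub>R (indicator K z *\<^sub>R g z)) \<le> norm (B *\<^sub>R (indicator K z *\<^sub>R g z))" for z
    proof (cases "z \<in> K")
      case True
      then have "\<bar>\<phi> z\<bar> \<le> \<bar>B\<bar>" using B[OF True] by linarith
      then show ?thesis using True by (simp add: mult_right_mono)
    qed simp
    then show "AE z in lborel. norm (\<phi> z *\<^sub>R (indicator K z *\<^sub>R g z)) \<le> norm (B *\<^sub>R (indicator K z *\<^sub>R g z))" by simp
  qed
  moreover have "(\<lambda>z. \<phi> z *\<^sub>R (indicator K z *\<^sub>R g z)) = (\<lambda>z. indicator (interior tri) z *\<^sub>R (\<phi> z *\<^sub>R g z))"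
    (is "?l = ?r")
  proof
    show "?l x = ?r x" for x using K z[of x] by (cases "x \<in> K") auto
  qed
  ultimately show ?thesis unfolding set_integrable_def by (simp only:)
qed

text \<open>Open boxes are stable under intersection and generate the Borel sets, so vanishing of
  the integral spreads to all Borel sets. Cutting off by one fixed box makes the function integrable
  and its total integral zero, as the complement step requires.\<close>

lemma integral_zero_on_boxes_imp_AE_zero:
  fixes w :: "complex \<Rightarrow> 'c::{banach,second_countable_topology}"
  assumes w: "set_integrable lborel (cbox a b) w"
    and z: "\<And>c d. cbox c d \<subseteq> cbox a b \<Longrightarrow> (LINT z:box c d|lborel. w z) = 0"
  shows "AE z in lborel. z \<in> cbox a b \<longrightarrow> w z = 0"
proof -
  let ?f = "\<lambda>z. indicator (box a b) z *\<^sub>R w z"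
  have "set_integrable lborel (box a b) w" by (rule set_integrable_subset[OF w]) (auto simp: box_subset_cbox)
  then have f: "integrable lborel ?f" by (simp add: set_integrable_def)
  have fA: "set_integrable lborel A ?f" if "A \<in> sets borel" for A
    using integrable_mult_indicator[of A lborel ?f] that f by (simp add: set_integrable_def)
  have boxz: "(LINT z:box c d|lborel. ?f z) = 0" for c d
  proof -
    obtain c' d' where cd: "box c d \<inter> box a b = box c' d'" by (rule that[OF box_Int_box])
    have "(LINT z:box c d|lborel. ?f z) = (LINT z:box c' d'|lborel. w z)"
      unfolding set_lebesgue_integral_def cd[symmetric] by (simp add: indicator_inter_arith mult.commute)
    also have "\<dots> = 0"
    proof (cases "box c' d' = {}")
      case True then show ?thesis by (simp add: set_lebesgue_integral_def)
    next
      case False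
      have "box c' d' \<subseteq> cbox a b" using cd box_subset_cbox by blast
      then have "closure (box c' d') \<subseteq> cbox a b" by (rule closure_minimal) (rule closed_cbox)
      then show ?thesis using False z by (simp add: closure_box)
    qed
    finally show ?thesis .
  qed
  have univ: "(LINT z:UNIV|lborel. ?f z) = 0"
    using z[of a b] by (simp add: set_lebesgue_integral_def)
  let ?E = "range (\<lambda>(a, b). box a b::complex set)"
  have "(LINT z:A|lborel. ?f z) = 0" if A: "A \<in> sets lborel" for A
  proof -
    have "Int_stable ?E" by (auto simp: Int_stable_def box_Int_box)
    moreover have "?E \<subseteq> Pow UNIV" by simp
    moreover have "A \<in> sigma_sets UNIV ?E" using A by (simp add: borel_eq_box)
    ultimately show ?thesis
    proof (induction rule: sigma_sets_induct_disjoint)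
      case (basic A) then show ?case using boxz by auto
    next
      case empty then show ?case by (simp add: set_lebesgue_integral_def)
    next
      case (compl A)
      have Ab: "A \<in> sets borel" using compl(1) by (simp add: borel_eq_box)
      have "(LINT z:A|lborel. ?f z) + (LINT z:UNIV - A|lborel. ?f z) = (LINT z:A \<union> (UNIV - A)|lborel. ?f z)"
        using Ab by (intro set_integral_Un[symmetric] fA) auto
      then show ?case using compl(2) univ by simp
    next
      case (union A)
      have Ab: "A i \<in> sets borel" for i using union(2) by (auto simp: borel_eq_box)
      have "(LINT z:(\<Union>i. A i)|lborel. ?f z) = (\<Sum>i. LINT z:A i|lborel. ?f z)"
        using union(1) Ab by (intro lebesgue_integral_countable_add fA) (auto simp: disjoint_family_on_def)
      then show ?case using union(3) by simp
    qed
  qed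
  then have 1: "AE z in lborel. ?f z = 0" by (rule sigma_finite_measure.density_zero[OF sigma_finite_lborel f])
  have "cbox a b - box a b \<in> null_sets lborel"
    using negligible_frontier_interval[of a b] by (simp add: null_sets_completion_iff negligible_iff_null_sets)
  from AE_not_in[OF this] 1 show ?thesis by eventually_elim auto
qed

text \<open>Needed because the energy density picks some weak derivative. Testing the difference
  with \<open>box_bump\<close> and passing to the limit shows that it integrates to zero over
  boxes.\<close>

lemma weak_deriv_unique:
  fixes f :: "complex \<Rightarrow> 'c::{banach,second_countable_topology}"
  assumes g: "weak_deriv f v g" and h: "weak_deriv f v h"
  shows "AE z in lborel. z \<in> interior tri \<longrightarrow> g z = h z"
proof -
  let ?w = "\<lambda>z. g z - h z"
  have li: "locally_integrable g" "locally_integrable h" using g h by (auto simp: weak_deriv_def)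
  then have lw: "locally_integrable ?w" by (auto simp: locally_integrable_def intro: set_integral_diff)
  have test: "(LINT z:interior tri|lborel. \<phi> z *\<^sub>R ?w z) = 0" if \<phi>: "test_function \<phi>" for \<phi>
  proof -
    have nz: "\<phi> z = 0" if "z \<notin> closure {z. \<phi> z \<noteq> 0}" for z
      using that closure_subset[of "{z. \<phi> z \<noteq> 0}"] by blast
    have i: "set_integrable lborel (interior tri) (\<lambda>z. \<phi> z *\<^sub>R g z)" "set_integrable lborel (interior tri) (\<lambda>z. \<phi> z *\<^sub>R h z)"
      using locally_integrable_mult_continuous[OF _ compact_support[OF \<phi>] test_function_continuous(1)[OF \<phi>] nz] li by auto
    have "- (LINT z:interior tri|lborel. \<phi> z *\<^sub>R g z) = - (LINT z:interior tri|lborel. \<phi> z *\<^sub>R h z)"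
      using g h \<phi> unfolding weak_deriv_def by metis
    then show ?thesis using set_integral_diff(2)[OF i] by (simp add: scaleR_diff_right)
  qed
  have box: "AE z in lborel. z \<in> cbox a b \<longrightarrow> ?w z = 0" if ab: "cbox a b \<subseteq> interior tri" for a b
  proof (rule integral_zero_on_boxes_imp_AE_zero)
    show wi: "set_integrable lborel (cbox a b) ?w" using lw ab by (simp add: locally_integrable_def)
    fix c d assume cd: "cbox c d \<subseteq> cbox a b"
    have cdi: "cbox c d \<subseteq> interior tri" using cd ab by blast
    have wi': "integrable lborel (\<lambda>z. indicator (cbox c d) z *\<^sub>R ?w z)"
      using lw cdi by (simp add: locally_integrable_def set_integrable_def)
    have "(\<lambda>n. LINT z|lborel. box_bump n c d z *\<^sub>R (indicator (cbox c d) z *\<^sub>R ?w z))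
       \<longlonglongrightarrow> (LINT z|lborel. indicator (box c d) z *\<^sub>R (indicator (cbox c d) z *\<^sub>R ?w z))"
    proof (rule integral_dominated_convergence)
      show "integrable lborel (\<lambda>z. norm (indicator (cbox c d) z *\<^sub>R ?w z))" by (rule integrable_norm[OF wi'])
      show "(\<lambda>z. indicator (box c d) z *\<^sub>R (indicator (cbox c d) z *\<^sub>R ?w z)) \<in> borel_measurable lborel"
        by (rule borel_measurable_scaleR[OF _ borel_measurable_integrable[OF wi']]) auto
      show "(\<lambda>z. box_bump n c d z *\<^sub>R (indicator (cbox c d) z *\<^sub>R ?w z)) \<in> borel_measurable lborel" for n
        by (rule borel_measurable_scaleR[OF _ borel_measurable_integrable[OF wi']])
           (simp add: borel_measurable_continuous_onI test_function_continuous(1)[OF test_function_box_bump[OF cdi]])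
      show "AE z in lborel. (\<lambda>n. box_bump n c d z *\<^sub>R (indicator (cbox c d) z *\<^sub>R ?w z))
          \<longlonglongrightarrow> indicator (box c d) z *\<^sub>R (indicator (cbox c d) z *\<^sub>R ?w z)"
        by (intro AE_I2 tendsto_scaleR box_bump_tendsto tendsto_const)
      have "norm (box_bump n c d z *\<^sub>R x) \<le> norm x" for n z and x :: 'c
        using box_bump_bounds[of n c d z] by (simp add: mult_left_le_one_le)
      then show "AE z in lborel. norm (box_bump n c d z *\<^sub>R (indicator (cbox c d) z *\<^sub>R ?w z))
          \<le> norm (indicator (cbox c d) z *\<^sub>R ?w z)" for n by (intro AE_I2)
    qed
    moreover have "(LINT z|lborel. box_bump n c d z *\<^sub>R (indicator (cbox c d) z *\<^sub>R ?w z)) = 0" for n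
    proof -
      have "(\<lambda>z. box_bump n c d z *\<^sub>R (indicator (cbox c d) z *\<^sub>R ?w z))
          = (\<lambda>z. indicator (interior tri) z *\<^sub>R (box_bump n c d z *\<^sub>R ?w z))" (is "?l = ?r")
      proof
        show "?l x = ?r x" for x
          using cdi box_bump_nonzero[of n c d x] box_subset_cbox[of c d] by (auto simp: indicator_def)
      qed
      with test[OF test_function_box_bump[OF cdi], of n] show ?thesis
        unfolding set_lebesgue_integral_def by (simp only:)
    qed
    moreover have "(\<lambda>z. indicator (box c d) z *\<^sub>R (indicator (cbox c d) z *\<^sub>R ?w z)) = (\<lambda>z. indicator (box c d) z *\<^sub>R ?w z)"
      (is "?l = ?r")
    proof
      show "?l x = ?r x" for x using box_subset_cbox[of c d] by (auto simp: indicator_def)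
    qed
    ultimately have "(\<lambda>n. 0) \<longlonglongrightarrow> (LINT z:box c d|lborel. ?w z)"
      unfolding set_lebesgue_integral_def by (simp only:)
    then show "(LINT z:box c d|lborel. ?w z) = 0" by (simp add: LIMSEQ_const_iff)
  qed
  \<comment> \<open>The open triangle is a countable union of closed boxes with rational corners;
    this joins the local null sets into one.\<close>
  define a where "a f = (\<Sum>(i::complex)\<in>Basis. fst (f i) *\<^sub>R i)" for f :: "complex \<Rightarrow> real \<times> real"
  define b where "b f = (\<Sum>(i::complex)\<in>Basis. snd (f i) *\<^sub>R i)" for f :: "complex \<Rightarrow> real \<times> real"
  define I where "I = {f \<in> Basis \<rightarrow>\<^sub>E \<rat> \<times> \<rat>. cbox (a f) (b f) \<subseteq> interior tri}"
  have cover: "countable I" "interior tri = (\<Union>i\<in>I. cbox (a i) (b i))"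
  proof -
    have "countable (Basis \<rightarrow>\<^sub>E \<rat> \<times> \<rat> :: (complex \<Rightarrow> real \<times> real) set)"
      by (intro countable_PiE finite_Basis countable_SIGMA countable_rat)
    then show "countable I" unfolding I_def by (rule countable_subset[rotated]) auto
    show "interior tri = (\<Union>i\<in>I. cbox (a i) (b i))"
      unfolding I_def a_def b_def by (rule open_UNION_cbox[OF open_interior])
  qed
  have "AE z in lborel. \<forall>i\<in>I. z \<in> cbox (a i) (b i) \<longrightarrow> ?w z = 0"
    unfolding AE_ball_countable[OF cover(1)]
  proof
    fix i assume "i \<in> I"
    then have "cbox (a i) (b i) \<subseteq> interior tri" using cover(2) by blast
    then show "AE z in lborel. z \<in> cbox (a i) (b i) \<longrightarrow> ?w z = 0" by (rule box)
  qed
  then show ?thesis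
    by eventually_elim (auto simp: cover(2))
qed

lemma integral_translation:
  fixes h :: "complex \<Rightarrow> 'c::{banach,second_countable_topology}"
  assumes "h \<in> borel_measurable borel"
  shows "(LINT z|lborel. h (z + c)) = (LINT z|lborel. h z)"
proof -
  have "(LINT z|lborel. h z) = (LINT z|distr lborel borel ((+) c). h z)" by (simp add: lborel_distr_plus)
  also have "\<dots> = (LINT z|lborel. h (c + z))" by (rule integral_distr) (use assms in auto)
  finally show ?thesis by (simp add: add.commute)
qed

text \<open>Translation invariance makes the integral of each difference quotient of h vanish, and
  dominated convergence passes to the derivative. Only the direction v is used, so no iterated
  integral is needed.\<close>

lemma integral_directional_derivative_eq_0:
  fixes h :: "complex \<Rightarrow> 'c::{banach,second_countable_topology}"
  assumes K: "compact K" and h0: "\<And>z. z \<notin> K \<Longrightarrow> h z = 0" and H0: "\<And>z. z \<notin> K \<Longrightarrow> H z = 0"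
    and ch: "continuous_on UNIV h" and cH: "continuous_on UNIV H"
    and d: "\<And>z. ((\<lambda>t. h (z + t *\<^sub>R v)) has_vector_derivative H z) (at 0)"
  shows "(LINT z|lborel. H z) = 0"
proof -
  have "compact (H ` K)" using cH K by (meson compact_continuous_image continuous_on_subset subset_UNIV)
  then obtain B0 where B0: "\<And>z. z \<in> K \<Longrightarrow> norm (H z) \<le> B0"
    using compact_imp_bounded[of "H ` K"] unfolding bounded_iff by auto
  define B where "B = max B0 0"
  have B: "norm (H z) \<le> B" for z using B0[of z] H0[of z] by (cases "z \<in> K") (auto simp: B_def)
  have B0': "0 \<le> B" by (simp add: B_def)
  define s where "s n = inverse (real (Suc n))" for n
  have s: "0 < s n" "s n \<le> 1" for n by (auto simp: s_def divide_simps)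
  \<comment> \<open>All points from which a step of length at most one along v can reach
    \<open>K\<close>. It supports every difference quotient, and the mean value inequality bounds
    them there by \<open>B\<close>.\<close>
  define K1 where "K1 = (\<lambda>(x, t). x - t *\<^sub>R v) ` (K \<times> {0..1::real})"
  have K1: "compact K1" unfolding K1_def
    by (intro compact_continuous_image compact_Times K compact_Icc) (auto simp: case_prod_unfold intro!: continuous_intros)
  have mem: "z \<in> K1" if "z + t *\<^sub>R v \<in> K" "0 \<le> t" "t \<le> 1" for z t
    unfolding K1_def using that by (intro image_eqI[of _ _ "(z + t *\<^sub>R v, t)"]) auto
  define q where "q n z = (1 / s n) *\<^sub>R (h (z + s n *\<^sub>R v) - h z)" for n z
  have d': "((\<lambda>t. h (z + t *\<^sub>R v)) has_vector_derivative H (z + t *\<^sub>R v)) (at t)" for z t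
  proof -
    have "((\<lambda>r. h ((z + t *\<^sub>R v) + r *\<^sub>R v)) \<circ> (\<lambda>x. x - t) has_vector_derivative (1 *\<^sub>R H (z + t *\<^sub>R v))) (at t)"
      by (rule vector_diff_chain_at) (use d[of "z + t *\<^sub>R v"] in \<open>auto intro!: derivative_eq_intros\<close>)
    moreover have "(\<lambda>r. h ((z + t *\<^sub>R v) + r *\<^sub>R v)) \<circ> (\<lambda>x. x - t) = (\<lambda>t. h (z + t *\<^sub>R v))"
      by (auto simp: fun_eq_iff algebra_simps)
    ultimately show ?thesis by simp
  qed
  have qb: "norm (q n z) \<le> B" for n z
  proof -
    have "norm (h (z + s n *\<^sub>R v) - h (z + 0 *\<^sub>R v)) \<le> B * s n - B * 0"
    proof (rule differentiable_bound_general[OF s(1), where f = "\<lambda>t. h (z + t *\<^sub>R v)" and \<phi> = "\<lambda>t. B * t"])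
      show "continuous_on {0..s n} (\<lambda>t. h (z + t *\<^sub>R v))"
        by (rule continuous_on_compose2[OF ch]) (auto intro!: continuous_intros)
      show "((\<lambda>t. B * t) has_vector_derivative B) (at x)" for x
        by (auto intro!: derivative_eq_intros simp: has_real_derivative_iff_has_vector_derivative[symmetric])
    qed (auto intro!: continuous_intros d' B)
    then have "norm (h (z + s n *\<^sub>R v) - h z) \<le> B * s n" by simp
    then show ?thesis using s(1)[of n] by (simp add: q_def divide_simps mult.commute)
  qed
  have q0: "q n z = 0" if "z \<notin> K1" for n z
    using mem[of z "s n"] mem[of z 0] that s[of n] h0 by (force simp: q_def)
  have [measurable]: "h \<in> borel_measurable borel" "H \<in> borel_measurable borel"
    using ch cH borel_measurable_continuous_onI by auto
  have hi: "integrable lborel h"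
  proof -
    have "integrable lborel (\<lambda>x. indicator K x *\<^sub>R h x)"
      by (rule borel_integrable_compact[OF K continuous_on_subset[OF ch]]) simp
    moreover have "indicator K x *\<^sub>R h x = h x" for x using h0[of x] by (auto simp: indicator_def)
    ultimately show ?thesis by simp
  qed
  have hi': "integrable lborel (\<lambda>z. h (z + c))" for c
  proof -
    have "integrable (distr lborel borel ((+) c)) h" by (simp add: lborel_distr_plus hi)
    then show ?thesis by (subst (asm) integrable_distr_eq) (auto simp: add.commute)
  qed
  have "(\<lambda>n. LINT z|lborel. q n z) \<longlonglongrightarrow> (LINT z|lborel. H z)"
  proof (rule integral_dominated_convergence)
    show "H \<in> borel_measurable lborel" "q n \<in> borel_measurable lborel" for n unfolding q_def by measurable
    show "integrable lborel (\<lambda>z. indicator K1 z *\<^sub>R B)"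
      by (rule borel_integrable_compact[OF K1]) (auto intro!: continuous_intros)
    show "AE z in lborel. norm (q n z) \<le> indicator K1 z *\<^sub>R B" for n
      using qb[of n] q0[of _ n] by (intro AE_I2) (auto simp: indicator_def)
    have "(\<lambda>n. q n z) \<longlonglongrightarrow> H z" for z
    proof -
      have "((\<lambda>t. norm (h (z + t *\<^sub>R v) - h z - t *\<^sub>R H z) / norm t) \<longlongrightarrow> 0) (at 0)"
        using d[of z] unfolding has_vector_derivative_def has_derivative_at by simp
      then have "((\<lambda>t. norm ((1 / t) *\<^sub>R (h (z + t *\<^sub>R v) - h z) - H z)) \<longlongrightarrow> 0) (at 0)"
      proof (rule Lim_transform_eventually)
        have "norm (h (z + t *\<^sub>R v) - h z - t *\<^sub>R H z) / norm t = norm ((1 / t) *\<^sub>R (h (z + t *\<^sub>R v) - h z) - H z)" if "t \<noteq> 0" for t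
        proof -
          have "(1 / t) *\<^sub>R (h (z + t *\<^sub>R v) - h z) - H z = (1 / t) *\<^sub>R (h (z + t *\<^sub>R v) - h z - t *\<^sub>R H z)"
            using that by (simp add: scaleR_diff_right)
          then show ?thesis by (simp add: divide_inverse mult.commute)
        qed
        then show "\<forall>\<^sub>F t in at 0. norm (h (z + t *\<^sub>R v) - h z - t *\<^sub>R H z) / norm t = norm ((1 / t) *\<^sub>R (h (z + t *\<^sub>R v) - h z) - H z)"
          by (simp add: eventually_at_filter)
      qed
      then have "((\<lambda>t. (1 / t) *\<^sub>R (h (z + t *\<^sub>R v) - h z)) \<longlongrightarrow> H z) (at 0)"
        by (simp add: Lim_null[of _ "H z"] tendsto_norm_zero_iff)
      moreover have "filterlim s (at 0) sequentially"
        unfolding filterlim_at using s LIMSEQ_inverse_real_of_nat by (auto simp: s_def[abs_def] less_imp_neq[symmetric])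
      ultimately have "(\<lambda>n. (1 / s n) *\<^sub>R (h (z + s n *\<^sub>R v) - h z)) \<longlonglongrightarrow> H z"
        by (rule filterlim_compose)
      then show ?thesis by (simp add: q_def)
    qed
    then show "AE z in lborel. (\<lambda>n. q n z) \<longlonglongrightarrow> H z" by simp
  qed
  moreover have "(LINT z|lborel. q n z) = 0" for n
    unfolding q_def using integral_translation[of h "s n *\<^sub>R v"] hi hi' by simp
  ultimately show ?thesis by (simp add: LIMSEQ_const_iff)
qed

lemma locally_integrable_continuous:
  fixes f :: "complex \<Rightarrow> 'c::{banach,second_countable_topology}"
  assumes "continuous_on (interior tri) f"
  shows "locally_integrable f"
  unfolding locally_integrable_def set_integrable_def
  by (intro allI impI, elim conjE) (rule borel_integrable_compact[OF _ continuous_on_subset[OF assms]])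

text \<open>The product of \<phi> and f, extended by zero, is continuously differentiable along v
  with compact support, so the integral of its derivative vanishes; the product rule splits it into
  the two sides. No behaviour of f at the boundary enters.\<close>

lemma weak_deriv_classical:
  fixes f :: "complex \<Rightarrow> 'c::{banach,second_countable_topology}"
  assumes f: "\<And>z. z \<in> interior tri \<Longrightarrow> (f has_derivative D z) (at z)"
    and c: "continuous_on (interior tri) (\<lambda>z. D z v)"
  shows "weak_deriv f v (\<lambda>z. D z v)"
  unfolding weak_deriv_def
proof (intro conjI allI impI)
  have cf: "continuous_on (interior tri) f"
    using f by (meson continuous_at_imp_continuous_on has_derivative_continuous)
  show "locally_integrable f" "locally_integrable (\<lambda>z. D z v)"
    by (rule locally_integrable_continuous, fact)+
  fix \<phi> assume \<phi>: "test_function \<phi>"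
  define K0 where "K0 = closure {z. \<phi> z \<noteq> 0}"
  note K = compact_support[OF \<phi>, folded K0_def] and tc = test_function_continuous[OF \<phi>]
  let ?U = "interior tri"
  let ?d\<phi> = "\<lambda>z. frechet_derivative \<phi> (at z) v"
  have nz: "\<phi> z = 0" if "z \<notin> K0" for z using that closure_subset[of "{z. \<phi> z \<noteq> 0}"] unfolding K0_def by blast
  have dnz: "?d\<phi> z = 0" if "z \<notin> K0" for z
  proof -
    have "((\<lambda>z. 0) has_derivative (\<lambda>v. 0)) (at z)" by simp
    then have "(\<phi> has_derivative (\<lambda>v. 0)) (at z)"
      by (rule has_derivative_transform_within_open[of _ _ _ _ "- K0"]) (use that nz compact_imp_closed[OF K(1)] in auto)
    then show ?thesis using frechet_derivative_at by metis
  qed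
  define h where "h z = indicator ?U z *\<^sub>R (\<phi> z *\<^sub>R f z)" for z
  define H where "H z = indicator ?U z *\<^sub>R (?d\<phi> z *\<^sub>R f z + \<phi> z *\<^sub>R D z v)" for z
  \<comment> \<open>The open triangle and the complement of the support are two open sets covering
    the plane, which glues the extension by zero.\<close>
  have cont: "continuous_on UNIV G" if G: "continuous_on ?U G" and G0: "\<And>z. z \<notin> K0 \<Longrightarrow> G z = 0" for G :: "complex \<Rightarrow> 'c"
  proof -
    have "continuous_on (?U \<union> - K0) G"
    proof (rule continuous_on_open_Un)
      show "open (- K0)" using compact_imp_closed[OF K(1)] by auto
      show "continuous_on (- K0) G" using G0 by (subst continuous_on_cong[OF refl, of _ _ "\<lambda>_. 0"]) auto
    qed (use G in auto)
    moreover have "?U \<union> - K0 = UNIV" using K by blast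
    ultimately show ?thesis by simp
  qed
  have "(LINT z|lborel. H z) = 0"
  proof (rule integral_directional_derivative_eq_0[OF K(1), of h])
    show h0: "h z = 0" "H z = 0" if "z \<notin> K0" for z using nz dnz that by (auto simp: h_def H_def)
    have "continuous_on ?U (\<lambda>z. \<phi> z *\<^sub>R f z)"
      by (intro continuous_intros cf continuous_on_subset[OF tc(1)]) auto
    then have "continuous_on ?U h" by (rule continuous_on_eq) (simp add: h_def)
    then show "continuous_on UNIV h" using h0 by (intro cont)
    have "continuous_on ?U (\<lambda>z. ?d\<phi> z *\<^sub>R f z + \<phi> z *\<^sub>R D z v)"
      by (intro continuous_intros cf c continuous_on_subset[OF tc(1)] continuous_on_subset[OF tc(3)]) auto
    then have "continuous_on ?U H" by (rule continuous_on_eq) (simp add: H_def)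
    then show "continuous_on UNIV H" using h0 by (intro cont)
    fix z
    have line: "((\<lambda>t. z + t *\<^sub>R v) has_derivative (\<lambda>t. t *\<^sub>R v)) (at 0)" by (auto intro!: derivative_eq_intros)
    show "((\<lambda>t. h (z + t *\<^sub>R v)) has_vector_derivative H z) (at 0)"
    proof (cases "z \<in> ?U")
      case True
      have "((\<lambda>z. \<phi> z *\<^sub>R f z) has_derivative (\<lambda>w. \<phi> z *\<^sub>R D z w + frechet_derivative \<phi> (at z) w *\<^sub>R f z)) (at z)"
        by (rule has_derivative_scaleR[OF tc(2) f[OF True]])
      then have "(h has_derivative (\<lambda>w. \<phi> z *\<^sub>R D z w + frechet_derivative \<phi> (at z) w *\<^sub>R f z)) (at z)"
        by (rule has_derivative_transform_within_open[OF _ open_interior True]) (simp add: h_def)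
      then have hz: "(h has_derivative (\<lambda>w. \<phi> z *\<^sub>R D z w + frechet_derivative \<phi> (at z) w *\<^sub>R f z)) (at (z + 0 *\<^sub>R v))" by simp
      have "((\<lambda>t. h (z + t *\<^sub>R v)) has_derivative (\<lambda>t. \<phi> z *\<^sub>R D z (t *\<^sub>R v) + frechet_derivative \<phi> (at z) (t *\<^sub>R v) *\<^sub>R f z)) (at 0)"
        by (rule has_derivative_compose[OF line hz])
      moreover have "\<phi> z *\<^sub>R D z (t *\<^sub>R v) + frechet_derivative \<phi> (at z) (t *\<^sub>R v) *\<^sub>R f z = t *\<^sub>R H z" for t
        using True linear_scale[OF has_derivative_linear[OF f[OF True]]] linear_scale[OF has_derivative_linear[OF tc(2)]]
        by (simp add: H_def algebra_simps)
      ultimately show ?thesis by (simp add: has_vector_derivative_def)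
    next
      case False
      then have zK: "z \<in> - K0" using K(2) by auto
      have "((\<lambda>z. 0 :: 'c) has_derivative (\<lambda>w. 0)) (at z)" by simp
      then have "(h has_derivative (\<lambda>w. 0)) (at z)"
        by (rule has_derivative_transform_within_open[OF _ _ zK]) (use h0 compact_imp_closed[OF K(1)] in auto)
      then have "(h has_derivative (\<lambda>w. 0)) (at (z + 0 *\<^sub>R v))" by simp
      from has_derivative_compose[OF line this] show ?thesis
        using h0(2)[of z] zK by (simp add: has_vector_derivative_def)
    qed
  qed
  moreover have i1: "set_integrable lborel ?U (\<lambda>z. ?d\<phi> z *\<^sub>R f z)"
    by (rule locally_integrable_mult_continuous[OF locally_integrable_continuous[OF cf] K tc(3) dnz])
  moreover have i2: "set_integrable lborel ?U (\<lambda>z. \<phi> z *\<^sub>R D z v)"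
    by (rule locally_integrable_mult_continuous[OF locally_integrable_continuous[OF c] K tc(1) nz])
  moreover have "(LINT z|lborel. H z) = (LINT z:?U|lborel. ?d\<phi> z *\<^sub>R f z) + (LINT z:?U|lborel. \<phi> z *\<^sub>R D z v)"
    using set_integral_add(2)[OF i1 i2] by (simp add: H_def set_lebesgue_integral_def)
  ultimately show "(LINT z:?U|lborel. ?d\<phi> z *\<^sub>R f z) = - (LINT z:?U|lborel. \<phi> z *\<^sub>R D z v)"
    by (simp add: eq_neg_iff_add_eq_0)
qed

section \<open>Isometry invariance and a scaling limit\<close>

text \<open>Transport to \<open>real^2\<close>, where invariance of Lebesgue measure under
  orthogonal maps is available for box images.\<close>

definition to_vec2 :: "complex \<Rightarrow> real^2" where
  "to_vec2 z = (\<chi> i. if i = 1 then Re z else Im z)"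

definition of_vec2 :: "real^2 \<Rightarrow> complex" where
  "of_vec2 x = Complex (x $ 1) (x $ 2)"

lemma vec2_inverse [simp]: "of_vec2 (to_vec2 z) = z" "to_vec2 (of_vec2 x) = x"
  by (simp_all add: of_vec2_def to_vec2_def complex_eq_iff vec_eq_iff forall_2)

lemma linear_vec2: "linear to_vec2" "linear of_vec2"
  by (auto intro!: linearI simp: to_vec2_def of_vec2_def vec_eq_iff complex_eq_iff)

lemma norm_vec2 [simp]: "norm (to_vec2 z) = norm z" "norm (of_vec2 x) = norm x"
  by (simp_all add: to_vec2_def of_vec2_def norm_vec_def L2_set_def UNIV_2 cmod_def)

lemma measurable_vec2 [measurable]: "to_vec2 \<in> borel_measurable borel" "of_vec2 \<in> borel_measurable borel"
  by (auto intro!: borel_measurable_continuous_onI linear_continuous_on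
      linear_vec2[unfolded linear_conv_bounded_linear])

lemma prod_Basis_vec2: "(\<Prod>b\<in>(Basis :: (real^2) set). x \<bullet> b) = x $ 1 * x $ 2"
proof -
  have B: "(Basis :: (real^2) set) = {axis 1 1, axis 2 1}"
    by (auto simp: Basis_vec_def UNIV_2)
  have "axis 1 1 \<noteq> (axis 2 1 :: real^2)" by (simp add: axis_eq_axis)
  then show ?thesis unfolding B by (simp add: inner_axis)
qed

lemma distr_to_vec2: "distr lborel borel to_vec2 = lborel"
proof (rule lborel_eqI[symmetric])
  fix l u :: "real^2" assume lu: "\<And>b. b \<in> Basis \<Longrightarrow> l \<bullet> b \<le> u \<bullet> b"
  have le: "l $ 1 \<le> u $ 1" "l $ 2 \<le> u $ 2"
    using lu[of "axis 1 1"] lu[of "axis 2 1"] by (auto simp: inner_axis)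
  have "emeasure (distr lborel borel to_vec2) (box l u) = emeasure lborel (to_vec2 -` box l u)"
    by (subst emeasure_distr) auto
  also have "to_vec2 -` box l u = box (of_vec2 l) (of_vec2 u)"
    by (auto simp: in_box_complex_iff mem_box_cart to_vec2_def of_vec2_def forall_2)
  also have "emeasure lborel \<dots> = ennreal (\<Prod>b\<in>Basis. (of_vec2 u - of_vec2 l) \<bullet> b)"
    using le by (intro emeasure_lborel_box) (auto simp: Basis_complex_def of_vec2_def)
  also have "(\<Prod>b\<in>Basis. (of_vec2 u - of_vec2 l) \<bullet> b) = (u $ 1 - l $ 1) * (u $ 2 - l $ 2)"
    by (simp add: Basis_complex_def of_vec2_def)
  also have "\<dots> = (\<Prod>b\<in>Basis. (u - l) \<bullet> b)" by (simp add: prod_Basis_vec2)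
  finally show "emeasure (distr lborel borel to_vec2) (box l u) = (\<Prod>b\<in>Basis. (u - l) \<bullet> b)" .
qed simp

lemma distr_of_vec2: "distr lborel borel of_vec2 = lborel"
proof -
  have "distr lborel borel of_vec2 = distr (distr lborel borel to_vec2) borel of_vec2" by (simp add: distr_to_vec2)
  also have "\<dots> = distr lborel borel (of_vec2 \<circ> to_vec2)" by (rule distr_distr) auto
  also have "of_vec2 \<circ> to_vec2 = id" by auto
  finally show ?thesis by (simp add: id_def distr_id2)
qed

text \<open>A measure with the right values on boxes is Lebesgue measure, and the preimage of a box
  is its image under the inverse orthogonal map, which has the same measure.\<close>

lemma distr_orthogonal_vec2:
  fixes T :: "real^2 \<Rightarrow> real^2"
  assumes T: "orthogonal_transformation T"
  shows "distr lborel borel T = lborel"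
proof (rule lborel_eqI[symmetric])
  fix l u :: "real^2" assume lu: "\<And>b. b \<in> Basis \<Longrightarrow> l \<bullet> b \<le> u \<bullet> b"
  have [measurable]: "T \<in> borel_measurable borel"
    using T by (intro borel_measurable_continuous_onI linear_continuous_on)
      (simp add: orthogonal_transformation_linear linear_conv_bounded_linear[symmetric])
  define S where "S = inv_into UNIV T"
  have S: "orthogonal_transformation S" unfolding S_def by (rule orthogonal_transformation_inv[OF T])
  have bT: "bij T" by (rule orthogonal_transformation_bij[OF T])
  have vim: "T -` box l u = S ` box l u" unfolding S_def by (rule bij_vimage_eq_inv_image[OF bT])
  have B: "T -` box l u \<in> sets borel" using measurable_sets_borel[of T borel "box l u"] by simp
  have "emeasure (distr lborel borel T) (box l u) = emeasure lborel (T -` box l u)"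
    by (subst emeasure_distr) auto
  also have "\<dots> = emeasure lebesgue (T -` box l u)" using B by simp
  also have "\<dots> = ennreal (measure lebesgue (S ` box l u))"
    unfolding vim using measurable_orthogonal_image[OF S, of "box l u"] by (simp add: emeasure_eq_measure2 fmeasurableD2)
  also have "\<dots> = ennreal (measure lebesgue (box l u))" by (simp add: measure_orthogonal_image[OF S])
  also have "\<dots> = emeasure lborel (box l u)" by (simp add: emeasure_eq_measure2)
  also have "\<dots> = (\<Prod>b\<in>Basis. (u - l) \<bullet> b)" using lu by (rule emeasure_lborel_box)
  finally show "emeasure (distr lborel borel T) (box l u) = (\<Prod>b\<in>Basis. (u - l) \<bullet> b)" .
qed simp

lemma isometry_measurable:
  fixes g :: "complex \<Rightarrow> complex"
  assumes "\<And>z w. dist (g z) (g w) = dist z w"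
  shows "g \<in> borel_measurable borel"
  by (rule borel_measurable_continuous_onI, rule continuous_onI) (use assms in auto)

lemma distr_isometry:
  fixes g :: "complex \<Rightarrow> complex"
  assumes g: "\<And>z w. dist (g z) (g w) = dist z w"
  shows "distr lborel borel g = lborel"
proof -
  define l where "l v = g v - g 0" for v
  have l: "orthogonal_transformation l" unfolding l_def using isometry_linear_part[OF g] .
  have ln: "linear l" "\<And>v. norm (l v) = norm v" using l by (auto simp: orthogonal_transformation)
  define T where "T = to_vec2 \<circ> l \<circ> of_vec2"
  have "linear T" unfolding T_def by (intro linear_compose linear_vec2 ln)
  then have T: "orthogonal_transformation T" by (simp add: orthogonal_transformation T_def ln)
  have [measurable]: "T \<in> borel_measurable borel"
    using \<open>linear T\<close> by (intro borel_measurable_continuous_onI linear_continuous_on) (simp add: linear_conv_bounded_linear[symmetric])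
  have [measurable]: "g \<in> borel_measurable borel" by (rule isometry_measurable[OF g])
  have [measurable]: "l \<in> borel_measurable borel" unfolding l_def by measurable
  have "distr lborel borel l = distr lborel borel (of_vec2 \<circ> (T \<circ> to_vec2))"
    by (simp add: T_def comp_def)
  also have "\<dots> = distr (distr lborel borel (T \<circ> to_vec2)) borel of_vec2" by (rule distr_distr[symmetric]) auto
  also have "distr lborel borel (T \<circ> to_vec2) = distr (distr lborel borel to_vec2) borel T" by (rule distr_distr[symmetric]) auto
  finally have dl: "distr lborel borel l = lborel"
    by (simp add: distr_to_vec2 distr_orthogonal_vec2[OF T] distr_of_vec2)
  have "g = (+) (g 0) \<circ> l" by (auto simp: l_def)
  then have "distr lborel borel g = distr lborel borel ((+) (g 0) \<circ> l)" by simp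
  also have "\<dots> = distr (distr lborel borel l) borel ((+) (g 0))" by (rule distr_distr[symmetric]) auto
  finally show ?thesis by (simp add: dl lborel_distr_plus)
qed

lemma integral_isometry:
  fixes g :: "complex \<Rightarrow> complex" and f :: "complex \<Rightarrow> real"
  assumes g: "\<And>z w. dist (g z) (g w) = dist z w" and f: "f \<in> borel_measurable borel"
  shows "(LINT z|lborel. f (g z)) = (LINT z|lborel. f z)"
proof -
  have "(LINT z|lborel. f z) = (LINT z|distr lborel borel g. f z)" by (simp add: distr_isometry[OF g])
  also have "\<dots> = (LINT z|lborel. f (g z))" by (rule integral_distr) (use isometry_measurable[OF g] f in auto)
  finally show ?thesis by simp
qed

lemma strict_tri_subset_interior:
  "{z. 0 < Im z \<and> Im z < sqrt 3 * Re z \<and> Im z < sqrt 3 * (1 - Re z)} \<subseteq> interior tri"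
  by (rule interior_maximal[OF _ open_strict_tri]) (auto simp: tri_iff)

lemma interior_tri_Im_pos:
  assumes "z \<in> interior tri"
  shows "0 < Im z"
proof -
  obtain e where e: "e > 0" "cball z e \<subseteq> tri" using assms mem_interior_cball by blast
  have "z - \<i> * of_real e \<in> cball z e" using e by (simp add: dist_norm norm_mult)
  then have "z - \<i> * of_real e \<in> tri" using e by blast
  then show ?thesis using e by (simp add: tri_iff)
qed

text \<open>The radius is at most half the distance to the nearer end of the edge, and the lateral
  sides are steeper than slope one, so a half disc of this size stays below them.\<close>

lemma half_ball_subset_tri_star:
  assumes s: "0 < s" "s < 1" and \<epsilon>: "0 < \<epsilon>" "\<epsilon> \<le> min s (1 - s) / 2"
    and z: "dist z (Complex s 0) \<le> \<epsilon>"
  shows "0 \<le> Im z \<Longrightarrow> z \<in> tri_star" and "0 < Im z \<Longrightarrow> z \<in> interior tri"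
proof -
  have x: "\<bar>Re z - s\<bar> \<le> \<epsilon>" "\<bar>Im z\<bar> \<le> \<epsilon>"
    using abs_Re_le_cmod[of "z - Complex s 0"] abs_Im_le_cmod[of "z - Complex s 0"] z by (auto simp: dist_norm)
  have e2: "2 * \<epsilon> \<le> s" "2 * \<epsilon> \<le> 1 - s" using \<epsilon> by auto
  have r: "\<epsilon> \<le> Re z" "\<epsilon> \<le> 1 - Re z" using x e2 by linarith+
  have c: "1 < sqrt 3" by simp
  have st: "\<epsilon> < sqrt 3 * Re z" "\<epsilon> < sqrt 3 * (1 - Re z)"
  proof -
    have "1 * Re z < sqrt 3 * Re z" "1 * (1 - Re z) < sqrt 3 * (1 - Re z)"
      by (rule mult_strict_right_mono[OF c], use r \<epsilon> in linarith)+
    then show "\<epsilon> < sqrt 3 * Re z" "\<epsilon> < sqrt 3 * (1 - Re z)" using r by (simp_all only: mult_1 le_less_trans)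
  qed
  show "z \<in> interior tri" if "0 < Im z"
    using that st x strict_tri_subset_interior by auto
  show "z \<in> tri_star" if "0 \<le> Im z"
  proof -
    have "z \<in> tri" unfolding tri_iff using that st x by auto
    moreover have "z \<notin> tri_vertices"
    proof
      assume "z \<in> tri_vertices"
      then have "z = cis (pi/3)" using r \<epsilon> by (auto simp: tri_vertices_def)
      then have "sqrt 3 / 2 \<le> \<epsilon>" using x by (simp add: cis_pi_3)
      moreover have "\<epsilon> \<le> 1/4" using e2 by linarith
      ultimately show False using c by linarith
    qed
    ultimately show ?thesis by (simp add: tri_star_def)
  qed
qed

lemma content_cbox_complex:
  assumes "a \<le> c" "b \<le> d"
  shows "measure lborel (cbox (Complex a b) (Complex c d)) = (c - a) * (d - b)"
proof -
  have "measure lborel (cbox (Complex a b) (Complex c d)) = (\<Prod>i\<in>Basis. Complex c d \<bullet> i - Complex a b \<bullet> i)"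
    by (rule content_cbox) (use assms in \<open>auto simp: Basis_complex_def\<close>)
  then show ?thesis by (simp add: Basis_complex_def)
qed

text \<open>The scalar factor in the gradient of the bump \<open>bump2\<close>, not the bump itself:
  that gradient at w is a multiple of \<open>tent \<epsilon> w\<close> times w.\<close>

definition tent :: "real \<Rightarrow> complex \<Rightarrow> real" where
  "tent \<epsilon> w = max 0 (1 - (norm w)\<^sup>2 / \<epsilon>\<^sup>2)"

lemma tent_bounds: "0 \<le> tent \<epsilon> w" "tent \<epsilon> w \<le> 1"
  by (auto simp: tent_def)

lemma tent_eq_0: "0 < \<epsilon> \<Longrightarrow> \<epsilon> \<le> norm w \<Longrightarrow> tent \<epsilon> w = 0"
  by (simp add: tent_def divide_simps power_mono)

lemma continuous_tent: "continuous_on UNIV (tent \<epsilon>)"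
  unfolding tent_def by (cases "\<epsilon> = 0") (auto intro!: continuous_intros)

text \<open>Freeze \<tau> at the edge point with components b along and a normal to the edge. On the
  half disc the tangential part is odd and integrates to zero, the normal part has size at least |a|
  \<epsilon>^3 / 64, and the freezing error is smaller for small \<epsilon>. Hence a must
  vanish.\<close>

lemma tent_scaling_limit:
  fixes \<tau> :: "complex \<Rightarrow> complex \<Rightarrow> real"
  assumes s: "0 < s" "s < 1" and \<epsilon>0: "0 < \<epsilon>0"
    and lin: "\<And>z. z \<in> tri_star \<Longrightarrow> linear (\<tau> z)"
    and cont: "\<And>v. continuous_on tri_star (\<lambda>z. \<tau> z v)"
    and zero: "\<And>\<epsilon>. 0 < \<epsilon> \<Longrightarrow> \<epsilon> < \<epsilon>0 \<Longrightarrow>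
       (LINT z:interior tri|lborel. tent \<epsilon> (z - Complex s 0) * \<tau> z (z - Complex s 0)) = 0"
  shows "\<tau> (Complex s 0) \<i> = 0"
proof (rule ccontr)
  let ?z = "Complex s 0"
  define a b where "a = \<tau> ?z \<i>" and "b = \<tau> ?z 1"
  assume "\<tau> ?z \<i> \<noteq> 0"
  then have a: "\<bar>a\<bar> > 0" by (simp add: a_def)
  have zs: "?z \<in> tri_star" by (rule edge_in_tri_star[OF s])
  \<comment> \<open>Chosen so that the error bound 4 \<eta> \<epsilon>^3 becomes |a| \<epsilon>^3 /
    256, strictly below |a| \<epsilon>^3 / 64.\<close>
  define \<eta> where "\<eta> = \<bar>a\<bar> / 1024"
  have \<eta>: "\<eta> > 0" using a by (simp add: \<eta>_def)
  obtain d1 where d1: "d1 > 0" "\<And>z. z \<in> tri_star \<Longrightarrow> dist z ?z < d1 \<Longrightarrow> \<bar>\<tau> z 1 - b\<bar> < \<eta>"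
    using cont[of 1] zs \<eta> unfolding continuous_on_iff dist_real_def b_def by metis
  obtain d2 where d2: "d2 > 0" "\<And>z. z \<in> tri_star \<Longrightarrow> dist z ?z < d2 \<Longrightarrow> \<bar>\<tau> z \<i> - a\<bar> < \<eta>"
    using cont[of \<i>] zs \<eta> unfolding continuous_on_iff dist_real_def a_def by metis
  define \<epsilon> where "\<epsilon> = min (min (\<epsilon>0 / 2) (min s (1 - s) / 2)) (min (d1 / 2) (d2 / 2))"
  have "\<epsilon> \<le> min s (1 - s) / 2"
    unfolding \<epsilon>_def by (rule order_trans[OF min.cobounded1 min.cobounded2])
  moreover have "\<epsilon> \<le> \<epsilon>0 / 2"
    unfolding \<epsilon>_def by (rule order_trans[OF min.cobounded1 min.cobounded1])
  moreover have "\<epsilon> \<le> d1 / 2"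
    unfolding \<epsilon>_def by (rule order_trans[OF min.cobounded2 min.cobounded1])
  moreover have "\<epsilon> \<le> d2 / 2"
    unfolding \<epsilon>_def by (rule order_trans[OF min.cobounded2 min.cobounded2])
  moreover have "0 < \<epsilon>" using \<epsilon>0 s d1(1) d2(1) by (simp add: \<epsilon>_def)
  ultimately have \<epsilon>: "0 < \<epsilon>" "\<epsilon> < \<epsilon>0" "\<epsilon> \<le> min s (1 - s) / 2" "\<epsilon> < d1" "\<epsilon> < d2"
    by linarith+
  define K where "K = cball ?z \<epsilon> \<inter> {z. 0 \<le> Im z}"
  define U where "U = ball ?z \<epsilon> \<inter> {z. 0 < Im z}"
  have cK: "compact K" unfolding K_def by (intro compact_Int_closed compact_cball closed_halfspace_Im_ge)
  have KT: "K \<subseteq> tri_star" using half_ball_subset_tri_star(1)[OF s \<epsilon>(1,3)] by (auto simp: K_def dist_commute)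
  have UK: "U \<subseteq> K" by (auto simp: U_def K_def)
  have UI: "U \<subseteq> interior tri" using half_ball_subset_tri_star(2)[OF s \<epsilon>(1,3)] by (auto simp: U_def dist_commute)
  have [measurable]: "U \<in> sets borel" unfolding U_def by (auto intro!: borel_open open_Int open_halfspace_Im_gt)
  have ctent: "continuous_on S (\<lambda>z. tent \<epsilon> (z - ?z))" for S
    by (rule continuous_on_compose2[OF continuous_tent]) (auto intro!: continuous_intros)
  have int: "set_integrable lborel U f" if "continuous_on K f" for f :: "complex \<Rightarrow> real"
  proof -
    have "set_integrable lborel K f" unfolding set_integrable_def by (rule borel_integrable_compact[OF cK that])
    then show ?thesis by (rule set_integrable_subset) (use UK in auto)
  qed
  define x y where "x z = Re z - s" and "y z = Im z" for z
  define e1 e2 where "e1 z = \<tau> z 1 - b" and "e2 z = \<tau> z \<i> - a" for z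
  have ce: "continuous_on K e1" "continuous_on K e2" unfolding e1_def e2_def
    by (intro continuous_intros continuous_on_subset[OF cont KT])+
  have cxy: "continuous_on K x" "continuous_on K y" unfolding x_def y_def by (intro continuous_intros)+
  let ?\<psi> = "\<lambda>z. tent \<epsilon> (z - ?z)"
  have dec: "\<tau> z (z - ?z) = x z * (b + e1 z) + y z * (a + e2 z)" if "z \<in> tri_star" for z
  proof -
    have "z - ?z = x z *\<^sub>R 1 + y z *\<^sub>R \<i>" by (simp add: complex_eq_iff x_def y_def)
    then have "\<tau> z (z - ?z) = \<tau> z (x z *\<^sub>R 1 + y z *\<^sub>R \<i>)" by simp
    also have "\<dots> = x z * \<tau> z 1 + y z * \<tau> z \<i>"
      by (simp only: linear_add[OF lin[OF that]] linear_scale[OF lin[OF that]] real_scaleR_def)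
    finally show ?thesis by (simp add: e1_def e2_def)
  qed
  have "(LINT z:interior tri|lborel. ?\<psi> z * \<tau> z (z - ?z)) = (LINT z:U|lborel. ?\<psi> z * (x z * (b + e1 z) + y z * (a + e2 z)))"
    unfolding set_lebesgue_integral_def
  proof (rule Bochner_Integration.integral_cong[OF refl])
    fix z
    show "indicat_real (interior tri) z *\<^sub>R (?\<psi> z * \<tau> z (z - ?z)) = indicat_real U z *\<^sub>R (?\<psi> z * (x z * (b + e1 z) + y z * (a + e2 z)))"
    proof (cases "z \<in> U")
      case True
      then have "z \<in> interior tri" using UI by blast
      then show ?thesis using True dec[of z] interior_tri_subset_star by auto
    next
      case False
      have "z \<notin> interior tri \<or> ?\<psi> z = 0"
      proof (rule ccontr)
        assume "\<not> ?thesis"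
        then have zi: "z \<in> interior tri" and "?\<psi> z \<noteq> 0" by auto
        then have "norm (z - ?z) < \<epsilon>" using tent_eq_0[OF \<epsilon>(1), of "z - ?z"] by force
        then show False using False interior_tri_Im_pos[OF zi] by (simp add: U_def dist_norm norm_minus_commute)
      qed
      then show ?thesis using False by auto
    qed
  qed
  then have I0: "(LINT z:U|lborel. ?\<psi> z * (x z * (b + e1 z) + y z * (a + e2 z))) = 0" using zero[OF \<epsilon>(1,2)] by simp
  have ix: "set_integrable lborel U (\<lambda>z. ?\<psi> z * x z)" by (intro int continuous_intros ctent cxy)
  have iy: "set_integrable lborel U (\<lambda>z. ?\<psi> z * y z)" by (intro int continuous_intros ctent cxy)
  have ie: "set_integrable lborel U (\<lambda>z. ?\<psi> z * (x z * e1 z + y z * e2 z))" by (intro int continuous_intros ctent cxy ce)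
  have X0: "(LINT z:U|lborel. ?\<psi> z * x z) = 0"
  proof -
    \<comment> \<open>Reflection in the vertical line through the edge point: it preserves the half
      disc and the tent and reverses the sign of \<open>x\<close>.\<close>
    define g where "g z = 2 * of_real s - cnj z" for z
    have g: "dist (g z) (g w) = dist z w" for z w
    proof -
      have "g z - g w = cnj (w - z)" by (simp add: g_def)
      then show ?thesis by (metis complex_mod_cnj dist_commute dist_norm)
    qed
    have gU: "g z \<in> U \<longleftrightarrow> z \<in> U" for z
    proof -
      have "g ?z = ?z" by (simp add: g_def complex_eq_iff)
      then have "dist ?z (g z) = dist ?z z" using g[of ?z z] by simp
      moreover have "Im (g z) = Im z" by (simp add: g_def)
      ultimately show ?thesis by (simp add: U_def)
    qed
    have gx: "x (g z) = - x z" for z by (simp add: g_def x_def)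
    have gp: "?\<psi> (g z) = ?\<psi> z" for z
    proof -
      have "g ?z = ?z" by (simp add: g_def complex_eq_iff)
      then have "norm (g z - ?z) = norm (z - ?z)" using g[of z ?z] by (simp add: dist_norm)
      then show ?thesis by (simp add: tent_def)
    qed
    let ?f = "\<lambda>z. indicat_real U z *\<^sub>R (?\<psi> z * x z)"
    have "?f \<in> borel_measurable borel"
      using borel_measurable_integrable[OF ix[unfolded set_integrable_def]] by simp
    from integral_isometry[OF g this] have "(LINT z|lborel. ?f (g z)) = (LINT z|lborel. ?f z)" .
    moreover have "?f (g z) = - ?f z" for z using gU[of z] by (simp add: gx gp indicator_def)
    ultimately have "(LINT z|lborel. ?f z) = - (LINT z|lborel. ?f z)" by simp
    then show ?thesis by (simp add: set_lebesgue_integral_def)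
  qed
  have split: "(LINT z:U|lborel. ?\<psi> z * (x z * (b + e1 z) + y z * (a + e2 z))) =
      b * (LINT z:U|lborel. ?\<psi> z * x z) + a * (LINT z:U|lborel. ?\<psi> z * y z) + (LINT z:U|lborel. ?\<psi> z * (x z * e1 z + y z * e2 z))"
  proof -
    have "(LINT z:U|lborel. ?\<psi> z * (x z * (b + e1 z) + y z * (a + e2 z))) =
      (LINT z:U|lborel. (b * (?\<psi> z * x z) + a * (?\<psi> z * y z)) + ?\<psi> z * (x z * e1 z + y z * e2 z))"
      by (simp add: algebra_simps)
    also have "\<dots> = (LINT z:U|lborel. b * (?\<psi> z * x z) + a * (?\<psi> z * y z)) + (LINT z:U|lborel. ?\<psi> z * (x z * e1 z + y z * e2 z))"
      by (intro set_integral_add(2) set_integral_add(1) set_integrable_mult_right ix iy ie)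
    also have "(LINT z:U|lborel. b * (?\<psi> z * x z) + a * (?\<psi> z * y z)) = (LINT z:U|lborel. b * (?\<psi> z * x z)) + (LINT z:U|lborel. a * (?\<psi> z * y z))"
      by (intro set_integral_add(2) set_integrable_mult_right ix iy)
    finally show ?thesis by simp
  qed
  define J where "J = (LINT z:U|lborel. ?\<psi> z * y z)"
  have eq: "a * J = - (LINT z:U|lborel. ?\<psi> z * (x z * e1 z + y z * e2 z))" using I0 split X0 by (simp add: J_def)
  have iU: "set_integrable lborel U (\<lambda>z. 2 * \<epsilon> * \<eta> :: real)" by (intro int continuous_intros)
  have Ubox: "U \<subseteq> cbox (Complex (s - \<epsilon>) 0) (Complex (s + \<epsilon>) \<epsilon>)"
  proof
    fix z assume z: "z \<in> U"
    have "\<bar>Re z - s\<bar> \<le> \<epsilon>" "\<bar>Im z\<bar> \<le> \<epsilon>"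
      using abs_Re_le_cmod[of "z - ?z"] abs_Im_le_cmod[of "z - ?z"] z by (auto simp: U_def dist_norm norm_minus_commute)
    then show "z \<in> cbox (Complex (s - \<epsilon>) 0) (Complex (s + \<epsilon>) \<epsilon>)" using z by (auto simp: in_cbox_complex_iff U_def)
  qed
  have mU: "measure lborel U \<le> 2 * \<epsilon>\<^sup>2"
  proof -
    have "measure lborel U \<le> measure lborel (cbox (Complex (s - \<epsilon>) 0) (Complex (s + \<epsilon>) \<epsilon>))"
      by (intro measure_mono_fmeasurable Ubox) auto
    also have "\<dots> = 2 * \<epsilon>\<^sup>2" using \<epsilon> by (simp add: content_cbox_complex power2_eq_square)
    finally show ?thesis .
  qed
  \<comment> \<open>The integrand is at most 2 \<epsilon> \<eta>, and the half disc lies in a box of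
    area 2 \<epsilon>^2.\<close>
  have err: "\<bar>LINT z:U|lborel. ?\<psi> z * (x z * e1 z + y z * e2 z)\<bar> \<le> 4 * \<eta> * \<epsilon> ^ 3"
  proof -
    have bd: "\<bar>?\<psi> z * (x z * e1 z + y z * e2 z)\<bar> \<le> 2 * \<epsilon> * \<eta>" if z: "z \<in> U" for z
    proof -
      have zt: "z \<in> tri_star" using z UK KT by auto
      have dz: "dist z ?z < \<epsilon>" using z by (simp add: U_def dist_commute)
      have "\<bar>x z\<bar> \<le> \<epsilon>" "\<bar>y z\<bar> \<le> \<epsilon>"
        using abs_Re_le_cmod[of "z - ?z"] abs_Im_le_cmod[of "z - ?z"] dz by (auto simp: x_def y_def dist_norm)
      moreover have "\<bar>e1 z\<bar> \<le> \<eta>" "\<bar>e2 z\<bar> \<le> \<eta>" using d1(2)[OF zt] d2(2)[OF zt] dz \<epsilon> by (auto simp: e1_def e2_def)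
      ultimately have "\<bar>x z\<bar> * \<bar>e1 z\<bar> \<le> \<epsilon> * \<eta>" "\<bar>y z\<bar> * \<bar>e2 z\<bar> \<le> \<epsilon> * \<eta>" by (auto intro!: mult_mono)
      then have "\<bar>x z * e1 z + y z * e2 z\<bar> \<le> 2 * \<epsilon> * \<eta>"
        using abs_triangle_ineq[of "x z * e1 z" "y z * e2 z"] by (simp add: abs_mult)
      then have "?\<psi> z * \<bar>x z * e1 z + y z * e2 z\<bar> \<le> 1 * (2 * \<epsilon> * \<eta>)"
        by (intro mult_mono) (use tent_bounds in auto)
      then show ?thesis using tent_bounds(1)[of \<epsilon> "z - ?z"] by (simp add: abs_mult)
    qed
    have "\<bar>LINT z:U|lborel. ?\<psi> z * (x z * e1 z + y z * e2 z)\<bar> \<le> (LINT z:U|lborel. \<bar>?\<psi> z * (x z * e1 z + y z * e2 z)\<bar>)"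
      using set_integral_norm_bound[OF ie] by simp
    also have "\<dots> \<le> (LINT z:U|lborel. 2 * \<epsilon> * \<eta>)"
      by (intro set_integral_mono set_integrable_abs ie iU bd)
    also have "\<dots> = 2 * \<epsilon> * \<eta> * measure lborel U" by (simp add: set_lebesgue_integral_def)
    also have "\<dots> \<le> 2 * \<epsilon> * \<eta> * (2 * \<epsilon>\<^sup>2)" using mU \<epsilon> \<eta> by (intro mult_left_mono) auto
    finally show ?thesis by (simp add: power2_eq_square power3_eq_cube mult_ac)
  qed
  have Jlow: "\<epsilon> ^ 3 / 64 \<le> J"
  proof -
    \<comment> \<open>A box of area \<epsilon>^2 / 8 inside the half disc on which the tent is at
      least 1/2 and the height at least \<epsilon> / 4; the product is \<epsilon>^3 / 64.\<close>
    define Q where "Q = cbox (Complex (s - \<epsilon>/4) (\<epsilon>/4)) (Complex (s + \<epsilon>/4) (\<epsilon>/2))"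
    have Q: "cmod (z - ?z) ^ 2 \<le> \<epsilon>\<^sup>2 / 2 \<and> \<epsilon> / 4 \<le> y z" if "z \<in> Q" for z
    proof -
      have "\<bar>Re z - s\<bar> \<le> \<epsilon> / 4" "\<epsilon> / 4 \<le> Im z" "\<bar>Im z\<bar> \<le> \<epsilon> / 2"
      proof -
        have "s - \<epsilon> / 4 \<le> Re z" "Re z \<le> s + \<epsilon> / 4" "\<epsilon> / 4 \<le> Im z" "Im z \<le> \<epsilon> / 2"
          using that by (simp_all add: Q_def in_cbox_complex_iff)
        then show "\<bar>Re z - s\<bar> \<le> \<epsilon> / 4" "\<epsilon> / 4 \<le> Im z" "\<bar>Im z\<bar> \<le> \<epsilon> / 2" using \<epsilon>(1) by linarith+
      qed
      moreover from this have "(Re z - s)\<^sup>2 \<le> (\<epsilon> / 4)\<^sup>2" "(Im z)\<^sup>2 \<le> (\<epsilon> / 2)\<^sup>2"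
        using \<epsilon> by (auto intro!: abs_le_square_iff[THEN iffD1])
      then have "(Re z - s)\<^sup>2 \<le> \<epsilon>\<^sup>2 / 16" "(Im z)\<^sup>2 \<le> \<epsilon>\<^sup>2 / 4" by (simp_all add: power_divide)
      then have "(Re z - s)\<^sup>2 + (Im z)\<^sup>2 \<le> \<epsilon>\<^sup>2 / 2" using zero_le_power2[of \<epsilon>] by linarith
      ultimately show ?thesis by (simp add: cmod_power2 y_def)
    qed
    have QU: "Q \<subseteq> U"
    proof
      fix z assume z: "z \<in> Q"
      have "0 < \<epsilon>\<^sup>2" using \<epsilon>(1) by simp
      then have "cmod (z - ?z) ^ 2 < \<epsilon>\<^sup>2" using Q[OF z] by linarith
      then have "cmod (z - ?z) < \<epsilon>" by (rule power_less_imp_less_base) (rule less_imp_le[OF \<epsilon>(1)])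
      then show "z \<in> U" using Q[OF z] \<epsilon> by (simp add: U_def y_def dist_norm norm_minus_commute)
    qed
    have low: "indicator Q z *\<^sub>R (\<epsilon> / 8) \<le> indicator U z *\<^sub>R (?\<psi> z * y z)" for z
    proof (cases "z \<in> Q")
      case True
      have "0 < \<epsilon>\<^sup>2" using \<epsilon>(1) by simp
      then have "(cmod (z - ?z))\<^sup>2 / \<epsilon>\<^sup>2 \<le> 1 / 2" using Q[OF True] by (simp add: pos_divide_le_eq)
      then have "1 / 2 \<le> 1 - (cmod (z - ?z))\<^sup>2 / \<epsilon>\<^sup>2" by linarith
      then have "1 / 2 \<le> ?\<psi> z" unfolding tent_def by (rule max.coboundedI2)
      then have "1 / 2 * (\<epsilon> / 4) \<le> ?\<psi> z * y z" using Q[OF True] \<epsilon> by (intro mult_mono) auto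
      then show ?thesis using True QU by auto
    next
      case False
      have "0 \<le> ?\<psi> z * y z" if "z \<in> U" using that tent_bounds by (auto simp: U_def y_def)
      then show ?thesis using False by (auto simp: indicator_def)
    qed
    have "measure lborel Q = \<epsilon>\<^sup>2 / 8" using \<epsilon> by (simp add: Q_def content_cbox_complex power2_eq_square)
    then have "\<epsilon> ^ 3 / 64 = (LINT z|lborel. indicator Q z *\<^sub>R (\<epsilon> / 8))"
      by (simp add: power2_eq_square power3_eq_cube)
    also have "\<dots> \<le> J" unfolding J_def set_lebesgue_integral_def
      by (rule integral_mono[OF borel_integrable_compact[OF _ continuous_on_const] iy[unfolded set_integrable_def] low])
         (simp add: Q_def)
    finally show ?thesis .
  qed
  have "\<bar>a\<bar> * (\<epsilon> ^ 3 / 64) \<le> \<bar>a\<bar> * J" using Jlow by (intro mult_left_mono) auto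
  also have "\<dots> = \<bar>a * J\<bar>" using Jlow \<epsilon> by (simp add: abs_mult order_trans[OF _ Jlow])
  also have "\<dots> \<le> 4 * \<eta> * \<epsilon> ^ 3" unfolding eq using err by simp
  finally have "\<bar>a\<bar> * (\<epsilon> ^ 3 / 64) \<le> \<bar>a\<bar> * (\<epsilon> ^ 3 / 256)" by (simp add: \<eta>_def)
  moreover have "0 < \<bar>a\<bar> * \<epsilon> ^ 3" using a \<epsilon>(1) by simp
  ultimately show False by simp
qed

section \<open>The first variation of the energy\<close>

lemma weak_deriv_cong:
  assumes "\<And>z. z \<in> interior tri \<Longrightarrow> f z = g z"
  shows "weak_deriv f v h \<longleftrightarrow> weak_deriv g v h"
proof -
  have "(\<lambda>z. indicator K z *\<^sub>R f z) = (\<lambda>z. indicator K z *\<^sub>R g z)" if "K \<subseteq> interior tri" for K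
    using that assms by (auto simp: fun_eq_iff indicator_def)
  then have "locally_integrable f \<longleftrightarrow> locally_integrable g"
    unfolding locally_integrable_def set_integrable_def by (metis (no_types, lifting))
  moreover have "(\<lambda>z. indicator (interior tri) z *\<^sub>R (c z *\<^sub>R f z)) = (\<lambda>z. indicator (interior tri) z *\<^sub>R (c z *\<^sub>R g z))" for c :: "complex \<Rightarrow> real"
    using assms by (auto simp: fun_eq_iff indicator_def)
  ultimately show ?thesis unfolding weak_deriv_def set_lebesgue_integral_def by simp
qed

lemma edge_trace_cong:
  assumes "\<And>z. z \<in> tri \<Longrightarrow> f z = g z" and f: "edge_trace f"
  shows "edge_trace g"
  unfolding edge_trace_def
proof (intro allI impI)
  fix a b :: real assume ab: "0 < a \<and> a < b \<and> b < 1"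
  define e0 where "e0 = min a (1 - b)"
  have e0: "e0 > 0" using ab by (simp add: e0_def)
  have in_tri: "Complex s e \<in> tri" if "s \<in> {a..b}" "0 \<le> e" "e < e0" for s e
  proof -
    have c: "1 \<le> sqrt 3" by simp
    have "1 * s \<le> sqrt 3 * s" "1 * (1 - s) \<le> sqrt 3 * (1 - s)"
      by (rule mult_right_mono[OF c], use that ab in auto)+
    moreover have "e \<le> 1 * s" "e \<le> 1 * (1 - s)" using that by (auto simp: e0_def)
    ultimately show ?thesis unfolding tri_iff using that by (auto intro: order_trans)
  qed
  have "((\<lambda>e. \<integral>\<^sup>+s\<in>{a..b}. ennreal (norm (f (Complex s e) - f (Complex s 0))) \<partial>lborel) \<longlongrightarrow> 0) (at_right 0)"
    using f ab unfolding edge_trace_def by blast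
  moreover have "eventually (\<lambda>e. (\<integral>\<^sup>+s\<in>{a..b}. ennreal (norm (f (Complex s e) - f (Complex s 0))) \<partial>lborel)
      = (\<integral>\<^sup>+s\<in>{a..b}. ennreal (norm (g (Complex s e) - g (Complex s 0))) \<partial>lborel)) (at_right 0)"
  proof -
    have "eventually (\<lambda>e. e \<in> {0<..<e0}) (at_right 0)" by (rule eventually_at_right_real[OF e0])
    then show ?thesis
    proof eventually_elim
      fix e assume e: "e \<in> {0<..<e0}"
      show "(\<integral>\<^sup>+s\<in>{a..b}. ennreal (norm (f (Complex s e) - f (Complex s 0))) \<partial>lborel)
      = (\<integral>\<^sup>+s\<in>{a..b}. ennreal (norm (g (Complex s e) - g (Complex s 0))) \<partial>lborel)"
        by (rule nn_integral_cong) (use e e0 in \<open>auto simp: indicator_def assms(1) in_tri\<close>)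
    qed
  qed
  ultimately show "((\<lambda>e. \<integral>\<^sup>+s\<in>{a..b}. ennreal (norm (g (Complex s e) - g (Complex s 0))) \<partial>lborel) \<longlongrightarrow> 0) (at_right 0)"
    by (rule Lim_transform_eventually)
qed

lemma set_borel_measurable_cong_tri:
  fixes f g :: "complex \<Rightarrow> 'c::euclidean_space"
  assumes "\<And>z. z \<in> tri \<Longrightarrow> f z = g z" and "set_borel_measurable borel tri f"
  shows "set_borel_measurable borel tri g"
proof -
  have "(\<lambda>z. indicator tri z *\<^sub>R f z) = (\<lambda>z. indicator tri z *\<^sub>R g z)"
    using assms by (auto simp: fun_eq_iff indicator_def)
  then show ?thesis using assms(2) unfolding set_borel_measurable_def by simp
qed

text \<open>\<open>v\<close> is the variation \<open>g\<^sup>* u g\<close> with \<open>g = 1 + t \<phi> N\<close>.  Since \<open>N\<^sup>2 = 0\<close>, its energy density is exactly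
  quadratic in \<open>t\<close>.\<close>

context
  fixes f :: "complex \<Rightarrow> complex^'n^'n" and N :: "complex^'n^'n"
    and \<phi> :: "complex \<Rightarrow> real" and d\<phi> :: "complex \<Rightarrow> complex \<Rightarrow> real"
  assumes f: "smooth_on tri_star f" and fs0: "\<forall>z\<in>tri_star. f z \<in> sym_space"
    and N: "N \<in> nil2"
    and \<phi>: "\<And>z. (\<phi> has_derivative d\<phi> z) (at z)" and cd\<phi>: "\<And>v. continuous_on UNIV (\<lambda>z. d\<phi> z v)"
begin

lemma fs: "z \<in> tri_star \<Longrightarrow> f z \<in> sym_space"
  using fs0 by blast

definition var_map :: "real \<Rightarrow> complex \<Rightarrow> complex^'n^'n" where
  "var_map t z = hconj (mat 1 + (t * \<phi> z) *\<^sub>R N) ** f z ** (mat 1 + (t * \<phi> z) *\<^sub>R N)"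

definition var_deriv :: "real \<Rightarrow> complex \<Rightarrow> complex \<Rightarrow> complex^'n^'n" where
  "var_deriv t z v = hconj (mat 1 + (t * \<phi> z) *\<^sub>R N) ** f z ** ((t * d\<phi> z v) *\<^sub>R N) +
     (hconj (mat 1 + (t * \<phi> z) *\<^sub>R N) ** tri_deriv f z v + (t * d\<phi> z v) *\<^sub>R hconj N ** f z) ** (mat 1 + (t * \<phi> z) *\<^sub>R N)"

definition log_form :: "complex \<Rightarrow> complex \<Rightarrow> complex^'n^'n" where
  "log_form z v = matrix_inv (f z) ** tri_deriv f z v"

definition lin_coeff :: "complex \<Rightarrow> real" where
  "lin_coeff z = (\<Sum>k\<in>{1, \<i>}. d\<phi> z k * (4 * Re (trace (log_form z k ** N))))"

definition quad_coeff :: "complex \<Rightarrow> real" where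
  "quad_coeff z = (\<Sum>k\<in>{1, \<i>}. (d\<phi> z k)\<^sup>2 *
     Re (trace ((N + matrix_inv (f z) ** hconj N ** f z) ** (N + matrix_inv (f z) ** hconj N ** f z))))"

definition base_density :: "complex \<Rightarrow> real" where
  "base_density z = (\<Sum>k\<in>{1, \<i>}. Re (trace (log_form z k ** log_form z k)))"

lemma var_det: "det (mat 1 + r *\<^sub>R N) = 1"
  using N by (simp add: nil2_def)

lemma var_map_sym: "z \<in> tri_star \<Longrightarrow> var_map t z \<in> sym_space"
  unfolding var_map_def by (intro sym_space_congruence fs var_det)

lemma var_map_derivative:
  assumes z: "z \<in> tri_star"
  shows "(var_map t has_derivative var_deriv t z) (at z within tri_star)"
proof -
  have p: "((\<lambda>z. (t * \<phi> z) *\<^sub>R M) has_derivative (\<lambda>v. (t * d\<phi> z v) *\<^sub>R M)) (at z within tri_star)" for M :: "complex^'n^'n"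
    by (intro has_derivative_scaleR_left has_derivative_mult_right has_derivative_at_withinI[OF \<phi>])
  have g: "((\<lambda>z. mat 1 + (t * \<phi> z) *\<^sub>R M) has_derivative (\<lambda>v. (t * d\<phi> z v) *\<^sub>R M)) (at z within tri_star)" for M :: "complex^'n^'n"
    using has_derivative_add[OF has_derivative_const p, of "mat 1" M] by simp
  have hg: "hconj (mat 1 + r *\<^sub>R N) = mat 1 + r *\<^sub>R hconj N" for r by (simp add: hconj_add hconj_scaleR)
  have 1: "((\<lambda>z. hconj (mat 1 + (t * \<phi> z) *\<^sub>R N) ** f z) has_derivative
    (\<lambda>v. hconj (mat 1 + (t * \<phi> z) *\<^sub>R N) ** tri_deriv f z v + (t * d\<phi> z v) *\<^sub>R hconj N ** f z)) (at z within tri_star)"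
    unfolding hg by (rule matrix_mult_derivative[OF g smooth_on_has_derivative[OF f z]])
  show ?thesis
    unfolding var_map_def[abs_def] var_deriv_def[abs_def] by (rule matrix_mult_derivative[OF 1 g])
qed

lemma cont_f: "continuous_on tri_star f" "continuous_on tri_star (\<lambda>z. tri_deriv f z v)"
  "continuous_on tri_star (\<lambda>z. matrix_inv (f z))"
proof -
  have C: "Ck_on k tri_star f" for k using f by (simp add: smooth_on_def)
  show "continuous_on tri_star f" using C[of 0] by simp
  show "continuous_on tri_star (\<lambda>z. tri_deriv f z v)" using Ck_on_tri_deriv[OF C, of 0] by simp
  show "continuous_on tri_star (\<lambda>z. matrix_inv (f z))"
    using Ck_on_matrix_inv[OF C sym_spaceD(2)[OF fs], of 0] by simp
qed

lemmas mm_cont = bounded_bilinear.continuous_on[OF bounded_bilinear_matrix_matrix_mult]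
lemmas hc_cont = bounded_linear.continuous_on[OF bounded_linear_hconj]

lemma cont_\<phi>: "continuous_on S \<phi>" "continuous_on S (\<lambda>z. d\<phi> z v)"
proof -
  have "continuous_on UNIV \<phi>" using \<phi> by (meson continuous_at_imp_continuous_on has_derivative_continuous)
  then show "continuous_on S \<phi>" by (rule continuous_on_subset) simp
  show "continuous_on S (\<lambda>z. d\<phi> z v)" by (rule continuous_on_subset[OF cd\<phi>]) simp
qed

lemma var_map_continuous: "continuous_on tri_star (var_map t)"
  unfolding var_map_def[abs_def] by (intro mm_cont hc_cont continuous_intros cont_f cont_\<phi>)

lemma var_deriv_continuous: "continuous_on tri_star (\<lambda>z. var_deriv t z v)"
  unfolding var_deriv_def by (intro continuous_on_add mm_cont hc_cont continuous_on_scaleR continuous_on_mult continuous_on_const cont_f cont_\<phi>)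

lemma weak_deriv_var_map: "weak_deriv (var_map t) v (\<lambda>z. var_deriv t z v)"
proof (rule weak_deriv_classical)
  fix z assume z: "z \<in> interior tri"
  have "at z within tri_star = at z" using z by (metis at_within_interior interior_tri_star)
  then show "(var_map t has_derivative var_deriv t z) (at z)"
    using var_map_derivative[of z t] z interior_tri_subset_star by auto
qed (rule continuous_on_subset[OF var_deriv_continuous interior_tri_subset_star])

lemma hconj_tri_deriv:
  assumes z: "z \<in> tri_star"
  shows "hconj (tri_deriv f z v) = tri_deriv f z v"
proof -
  have "((\<lambda>w. hconj (f w)) has_derivative (\<lambda>v. hconj (tri_deriv f z v))) (at z within tri_star)"
    by (rule bounded_linear.has_derivative[OF bounded_linear_hconj smooth_on_has_derivative[OF f z]])
  from tri_deriv_eq[OF this z, of v]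
  have "hconj (tri_deriv f z v) = tri_deriv (\<lambda>w. hconj (f w)) z v" ..
  also have "\<dots> = tri_deriv f z v" by (rule tri_deriv_cong[OF _ z]) (simp add: sym_spaceD(1)[OF fs])
  finally show ?thesis .
qed

lemma var_deriv_hermitian:
  assumes z: "z \<in> tri_star"
  shows "hconj (var_deriv t z v) = var_deriv t z v"
  by (simp add: var_deriv_def hconj_add hconj_mult hconj_scaleR hconj_tri_deriv[OF z] sym_spaceD(1)[OF fs[OF z]]
      matrix_add_ldistrib bounded_bilinear.add_left[OF bounded_bilinear_matrix_matrix_mult] mm_scaleR
      matrix_mul_assoc scaleR_add_right add_ac)

lemma var_density:
  assumes z: "z \<in> tri_star"
  shows "(\<Sum>k\<in>{1, \<i>}. Re (trace ((matrix_inv (var_map t z) ** var_deriv t z k) ** (matrix_inv (var_map t z) ** var_deriv t z k))))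
    = base_density z + t * lin_coeff z + t\<^sup>2 * quad_coeff z"
proof -
  have "Re (trace ((matrix_inv (var_map t z) ** var_deriv t z k) ** (matrix_inv (var_map t z) ** var_deriv t z k)))
    = Re (trace (log_form z k ** log_form z k)) + t * (d\<phi> z k * (4 * Re (trace (log_form z k ** N)))) +
      t\<^sup>2 * ((d\<phi> z k)\<^sup>2 * Re (trace ((N + matrix_inv (f z) ** hconj N ** f z) ** (N + matrix_inv (f z) ** hconj N ** f z))))" for k
    unfolding var_map_def log_form_def
    by (rule variation_trace[OF fs[OF z] hconj_tri_deriv[OF z]]) (use N in \<open>auto simp: nil2_def var_deriv_def\<close>)
  then show ?thesis by (simp add: base_density_def lin_coeff_def quad_coeff_def sum.distrib sum_distrib_left algebra_simps)
qed

text \<open>For every t this is the density of an actual competitor, so integrals of the polynomial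
  may be computed in \<open>ennreal\<close> without truncation.\<close>

lemma var_density_nonneg:
  assumes z: "z \<in> tri_star"
  shows "0 \<le> base_density z + t * lin_coeff z + t\<^sup>2 * quad_coeff z"
  unfolding var_density[OF z, symmetric]
  by (intro sum_nonneg trace_square_nonneg var_map_sym[OF z] var_deriv_hermitian[OF z])

text \<open>The competitor has a classical derivative, which is a weak one. By uniqueness the
  derivative chosen in \<open>energy_density\<close> coincides with it almost everywhere, and that
  is all an integral sees.\<close>

lemma energy_density_var:
  fixes v :: "'b::topological_space \<Rightarrow> complex^'n^'n" and c :: "complex \<Rightarrow> 'b"
  assumes v: "\<forall>z\<in>tri. v (c z) = var_map t z"
  shows "AE z in lborel. z \<in> interior tri \<longrightarrow>
     energy_density v c z = ennreal (base_density z + t * lin_coeff z + t\<^sup>2 * quad_coeff z)"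
proof -
  have vi: "v (c z) = var_map t z" if "z \<in> interior tri" for z using v that interior_subset by blast
  have w: "weak_deriv (\<lambda>w. v (c w)) k (\<lambda>z. var_deriv t z k)" for k
    using weak_deriv_var_map weak_deriv_cong[of "\<lambda>w. v (c w)" "var_map t"] vi by blast
  have "AE z in lborel. z \<in> interior tri \<longrightarrow> (SOME g. weak_deriv (\<lambda>w. v (c w)) k g) z = var_deriv t z k" for k
    by (rule weak_deriv_unique[OF someI[of "weak_deriv (\<lambda>w. v (c w)) k", OF w] w])
  from this[of 1] this[of \<i>] show ?thesis
  proof eventually_elim
    fix z assume 1: "z \<in> interior tri \<longrightarrow> (SOME g. weak_deriv (\<lambda>w. v (c w)) 1 g) z = var_deriv t z 1"
      and 2: "z \<in> interior tri \<longrightarrow> (SOME g. weak_deriv (\<lambda>w. v (c w)) \<i> g) z = var_deriv t z \<i>"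
    show "z \<in> interior tri \<longrightarrow> energy_density v c z = ennreal (base_density z + t * lin_coeff z + t\<^sup>2 * quad_coeff z)"
    proof
      assume z: "z \<in> interior tri"
      then have zs: "z \<in> tri_star" using interior_tri_subset_star by blast
      let ?g = "\<lambda>k. matrix_inv (var_map t z) ** var_deriv t z k"
      have nn: "0 \<le> Re (trace (?g k ** ?g k))" for k
        by (rule trace_square_nonneg[OF var_map_sym[OF zs] var_deriv_hermitian[OF zs]])
      have "energy_density v c z = (\<Sum>k\<in>{1, \<i>}. ennreal (Re (trace (?g k ** ?g k))))"
        unfolding energy_density_def Let_def using 1 2 z by (simp add: vi)
      also have "\<dots> = ennreal (\<Sum>k\<in>{1, \<i>}. Re (trace (?g k ** ?g k)))" by (rule sum_ennreal) (rule nn)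
      also have "\<dots> = ennreal (base_density z + t * lin_coeff z + t\<^sup>2 * quad_coeff z)" by (simp only: var_density[OF zs])
      finally show "energy_density v c z = ennreal (base_density z + t * lin_coeff z + t\<^sup>2 * quad_coeff z)" .
    qed
  qed
qed

lemma bounded_linear_Re_trace: "bounded_linear (\<lambda>A::complex^'n^'n. Re (trace A))"
  by (auto intro!: linear_conv_bounded_linear[THEN iffD1] linearI simp: trace_add trace_scaleR)

lemma coeff_continuous:
  "continuous_on tri_star lin_coeff" "continuous_on tri_star quad_coeff" "continuous_on tri_star base_density"
proof -
  have tr: "continuous_on tri_star (\<lambda>z. Re (trace (A z)))" if "continuous_on tri_star A" for A :: "complex \<Rightarrow> complex^'n^'n"
    by (rule bounded_linear.continuous_on[OF bounded_linear_Re_trace that])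
  show "continuous_on tri_star lin_coeff" unfolding lin_coeff_def[abs_def] log_form_def
    by (intro continuous_on_sum continuous_on_mult continuous_on_const cont_\<phi> tr mm_cont cont_f)
  show "continuous_on tri_star quad_coeff" unfolding quad_coeff_def[abs_def]
    by (intro continuous_on_sum continuous_on_mult continuous_on_power continuous_on_add continuous_on_const cont_\<phi> tr mm_cont cont_f)
  show "continuous_on tri_star base_density" unfolding base_density_def[abs_def] log_form_def
    by (intro continuous_on_sum tr mm_cont cont_f)
qed

text \<open>The coefficients are continuous only away from the vertices; a compact set
  \<open>B\<close> that carries the gradient of \<phi> and meets the triangle inside
  \<open>tri_star\<close> makes them integrable.\<close>

lemma coeff_integrable:
  assumes B: "compact B" "B \<inter> tri \<subseteq> tri_star" and off: "\<forall>z k. z \<notin> B \<longrightarrow> d\<phi> z k = 0"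
  shows "set_integrable lborel (interior tri) lin_coeff" "set_integrable lborel (interior tri) quad_coeff"
proof -
  have *: "set_integrable lborel (interior tri) h"
    if h: "continuous_on tri_star h" and h0: "\<And>z. z \<notin> B \<Longrightarrow> h z = 0" for h :: "complex \<Rightarrow> real"
  proof -
    have "compact (B \<inter> tri)" using B compact_tri by blast
    then have "set_integrable lborel (B \<inter> tri) h"
      unfolding set_integrable_def by (rule borel_integrable_compact[OF _ continuous_on_subset[OF h B(2)]])
    then have "set_integrable lborel (B \<inter> interior tri) h"
      by (rule set_integrable_subset) (use B interior_subset in \<open>auto simp: compact_imp_closed\<close>)
    moreover have "(\<lambda>z. indicator (B \<inter> interior tri) z *\<^sub>R h z) = (\<lambda>z. indicator (interior tri) z *\<^sub>R h z)"
      using h0 by (auto simp: fun_eq_iff indicator_def)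
    ultimately show ?thesis unfolding set_integrable_def by simp
  qed
  show "set_integrable lborel (interior tri) lin_coeff"
    by (rule *[OF coeff_continuous(1)]) (simp add: lin_coeff_def off)
  show "set_integrable lborel (interior tri) quad_coeff"
    by (rule *[OF coeff_continuous(2)]) (simp add: quad_coeff_def off)
qed

text \<open>Continuity gives no control at the vertices. Integrability comes from the finite energy
  of \<open>u\<close>, the density of which is the case t = 0 of the variation.\<close>

lemma base_integrable:
  fixes u :: "'b::topological_space \<Rightarrow> complex^'n^'n" and c :: "complex \<Rightarrow> 'b"
  assumes u: "\<forall>z\<in>tri. u (c z) = f z"
    and fin: "(\<integral>\<^sup>+z\<in>interior tri. energy_density u c z \<partial>lborel) < \<infinity>"
  shows "set_integrable lborel (interior tri) base_density"
  unfolding set_integrable_def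
proof (rule integrableI_nonneg)
  show "(\<lambda>z. indicator (interior tri) z *\<^sub>R base_density z) \<in> borel_measurable lborel"
    using borel_measurable_continuous_on_indicator[OF _ continuous_on_subset[OF coeff_continuous(3) interior_tri_subset_star]]
    by simp
  show "AE z in lborel. 0 \<le> indicator (interior tri) z *\<^sub>R base_density z"
    using var_density_nonneg[of _ 0] interior_tri_subset_star by (auto simp: indicator_def)
  have "\<forall>z\<in>tri. u (c z) = var_map 0 z" using u by (simp add: var_map_def)
  from energy_density_var[where v = u and c = c and t = 0, OF this]
  have "AE z in lborel. ennreal (indicator (interior tri) z *\<^sub>R base_density z) = energy_density u c z * indicator (interior tri) z"
    by eventually_elim (auto simp: indicator_def)
  then have "(\<integral>\<^sup>+z. ennreal (indicator (interior tri) z *\<^sub>R base_density z) \<partial>lborel) = (\<integral>\<^sup>+z\<in>interior tri. energy_density u c z \<partial>lborel)"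
    by (rule nn_integral_cong_AE)
  with fin show "(\<integral>\<^sup>+z. ennreal (indicator (interior tri) z *\<^sub>R base_density z) \<partial>lborel) < \<infinity>" by simp
qed

text \<open>\<open>S\<close> is meant for the part of the cell lying in the region of minimality.
  The gradient of \<phi> vanishes on the remaining part, so the two coefficient integrals may be
  taken over the whole triangle, while the base term stays on \<open>S\<close>.\<close>

lemma var_energy:
  fixes v :: "'b::topological_space \<Rightarrow> complex^'n^'n" and c :: "complex \<Rightarrow> 'b"
  assumes v: "\<forall>z\<in>tri. v (c z) = var_map t z"
    and b: "set_integrable lborel (interior tri) base_density"
    and B: "compact B" "B \<inter> tri \<subseteq> tri_star" "\<forall>z k. z \<notin> B \<longrightarrow> d\<phi> z k = 0"
    and S: "S \<in> sets borel" "S \<subseteq> interior tri" and supp: "\<forall>z k. z \<in> interior tri \<longrightarrow> z \<notin> S \<longrightarrow> d\<phi> z k = 0"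
  shows "(\<integral>\<^sup>+z\<in>S. energy_density v c z \<partial>lborel) =
     ennreal ((LINT z:S|lborel. base_density z) + t * (LINT z:interior tri|lborel. lin_coeff z) + t\<^sup>2 * (LINT z:interior tri|lborel. quad_coeff z))"
    and "0 \<le> (LINT z:S|lborel. base_density z) + t * (LINT z:interior tri|lborel. lin_coeff z) + t\<^sup>2 * (LINT z:interior tri|lborel. quad_coeff z)"
proof -
  note ci = coeff_integrable[OF B]
  let ?e = "\<lambda>z. base_density z + t * lin_coeff z + t\<^sup>2 * quad_coeff z"
  have i: "set_integrable lborel S base_density" "set_integrable lborel S lin_coeff" "set_integrable lborel S quad_coeff"
    using S(1) by (auto intro: set_integrable_subset[OF b _ S(2)] set_integrable_subset[OF ci(1) _ S(2)] set_integrable_subset[OF ci(2) _ S(2)])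
  have ie: "set_integrable lborel S ?e" by (intro set_integral_add(1) set_integrable_mult_right i)
  have eqS: "(LINT z:S|lborel. h z) = (LINT z:interior tri|lborel. h z)"
    if "\<And>z. z \<in> interior tri \<Longrightarrow> z \<notin> S \<Longrightarrow> h z = 0" for h :: "complex \<Rightarrow> real"
    unfolding set_lebesgue_integral_def
    by (rule Bochner_Integration.integral_cong[OF refl]) (use that S(2) in \<open>auto simp: indicator_def\<close>)
  have linS: "(LINT z:S|lborel. lin_coeff z) = (LINT z:interior tri|lborel. lin_coeff z)"
    by (rule eqS) (simp add: lin_coeff_def supp)
  have quadS: "(LINT z:S|lborel. quad_coeff z) = (LINT z:interior tri|lborel. quad_coeff z)"
    by (rule eqS) (simp add: quad_coeff_def supp)
  have "(LINT z:S|lborel. ?e z) = (LINT z:S|lborel. base_density z + t * lin_coeff z) + (LINT z:S|lborel. t\<^sup>2 * quad_coeff z)"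
    by (intro set_integral_add(2) set_integral_add(1) set_integrable_mult_right i)
  also have "(LINT z:S|lborel. base_density z + t * lin_coeff z) = (LINT z:S|lborel. base_density z) + (LINT z:S|lborel. t * lin_coeff z)"
    by (intro set_integral_add(2) set_integrable_mult_right i)
  also have "(LINT z:S|lborel. t * lin_coeff z) = t * (LINT z:interior tri|lborel. lin_coeff z)"
    using linS by simp
  also have "(LINT z:S|lborel. t\<^sup>2 * quad_coeff z) = t\<^sup>2 * (LINT z:interior tri|lborel. quad_coeff z)"
    using quadS by simp
  finally have I: "(LINT z:S|lborel. ?e z) = (LINT z:S|lborel. base_density z) + t * (LINT z:interior tri|lborel. lin_coeff z) + t\<^sup>2 * (LINT z:interior tri|lborel. quad_coeff z)" .
  have nn: "0 \<le> indicator S z *\<^sub>R ?e z" for z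
    using var_density_nonneg[of z t] S(2) interior_tri_subset_star by (auto simp: indicator_def)
  have "(\<integral>\<^sup>+z\<in>S. energy_density v c z \<partial>lborel) = (\<integral>\<^sup>+z. ennreal (indicator S z *\<^sub>R ?e z) \<partial>lborel)"
  proof (rule nn_integral_cong_AE)
    show "AE z in lborel. energy_density v c z * indicator S z = ennreal (indicator S z *\<^sub>R ?e z)"
      using energy_density_var[where v = v and c = c and t = t, OF v] by eventually_elim (use S(2) in \<open>auto simp: indicator_def\<close>)
  qed
  also have "\<dots> = ennreal (LINT z|lborel. indicator S z *\<^sub>R ?e z)"
    by (rule nn_integral_eq_integral) (use ie nn in \<open>auto simp: set_integrable_def\<close>)
  finally show "(\<integral>\<^sup>+z\<in>S. energy_density v c z \<partial>lborel) =
     ennreal ((LINT z:S|lborel. base_density z) + t * (LINT z:interior tri|lborel. lin_coeff z) + t\<^sup>2 * (LINT z:interior tri|lborel. quad_coeff z))"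
    using I by (simp add: set_lebesgue_integral_def)
  have "0 \<le> (LINT z:S|lborel. ?e z)" unfolding set_lebesgue_integral_def by (intro Bochner_Integration.integral_nonneg nn)
  then show "0 \<le> (LINT z:S|lborel. base_density z) + t * (LINT z:interior tri|lborel. lin_coeff z) + t\<^sup>2 * (LINT z:interior tri|lborel. quad_coeff z)"
    using I by simp
qed

end

lemma tri_iso_interior: "tri_iso g \<Longrightarrow> g z \<in> interior tri \<longleftrightarrow> z \<in> interior tri"
proof -
  have *: "h y \<in> interior tri" if h: "tri_iso h" and y: "y \<in> interior tri" for h y
  proof -
    obtain e where e: "e > 0" "ball y e \<subseteq> tri" using y by (auto simp: mem_interior)
    have "ball (h y) e \<subseteq> tri"
    proof
      fix w assume w: "w \<in> ball (h y) e"
      obtain w' where w': "w = h w'" using tri_iso_bij[OF h] by (metis bij_pointE)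
      then have "dist y w' < e" using w h by (simp add: tri_iso_def)
      then have "w' \<in> tri" using e by auto
      then have "h w' \<in> h ` tri" by (rule imageI)
      then show "w \<in> tri" using h w' by (simp add: tri_iso_def)
    qed
    then show ?thesis using e by (auto simp: mem_interior)
  qed
  assume g: "tri_iso g"
  show ?thesis using *[OF g, of z] *[OF tri_iso_inv[OF g], of "g z"] tri_iso_bij[OF g] by (auto simp: bij_is_inj)
qed

lemma edge_point_vertex_dist:
  assumes "0 < s" "s < 1" "v \<in> tri_vertices"
  shows "min s (1 - s) \<le> dist (Complex s 0) v"
proof -
  consider "v = 0" | "v = 1" | "v = cis (pi / 3)" using assms(3) by (auto simp: tri_vertices_def)
  then show ?thesis
  proof cases
    case 1
    have "\<bar>Re (Complex s 0 - v)\<bar> \<le> dist (Complex s 0) v" unfolding dist_norm by (rule abs_Re_le_cmod)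
    then show ?thesis using 1 assms by simp
  next
    case 2
    have "\<bar>Re (Complex s 0 - v)\<bar> \<le> dist (Complex s 0) v" unfolding dist_norm by (rule abs_Re_le_cmod)
    then show ?thesis using 2 assms by simp
  next
    case 3
    have "\<bar>Im (Complex s 0 - v)\<bar> \<le> dist (Complex s 0) v" unfolding dist_norm by (rule abs_Im_le_cmod)
    then have "sqrt 3 / 2 \<le> dist (Complex s 0) v" using 3 by (simp add: cis_pi_3)
    moreover have "1 \<le> sqrt 3" by simp
    moreover have "min s (1 - s) \<le> 1 / 2" by (simp add: min_def)
    ultimately show ?thesis by linarith
  qed
qed

text \<open>A polynomial that is non-negative and vanishes at 0 has a minimum there.\<close>

lemma quadratic_nonneg_imp_linear_zero:
  fixes a b :: real
  assumes "\<And>t. 0 \<le> t * a + t\<^sup>2 * b"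
  shows "a = 0"
proof (rule ccontr)
  assume a: "a \<noteq> 0"
  \<comment> \<open>Small enough that r |b| \<le> 1/2; at t = - r a the linear term then dominates
    and makes the value negative.\<close>
  define r where "r = 1 / (2 * (\<bar>b\<bar> + 1))"
  have r: "r > 0" "r * \<bar>b\<bar> \<le> 1 / 2" by (auto simp: r_def divide_simps)
  have "0 \<le> (- (r * a)) * a + (- (r * a))\<^sup>2 * b" by (rule assms)
  also have "\<dots> = r * a\<^sup>2 * (r * b - 1)" by (simp add: power2_eq_square algebra_simps)
  also have "\<dots> < 0"
  proof (rule mult_pos_neg)
    show "0 < r * a\<^sup>2" using a r by simp
    have "r * b \<le> r * \<bar>b\<bar>" using r(1) by (intro mult_left_mono) auto
    then show "r * b - 1 < 0" using r(2) by linarith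
  qed
  finally show False by simp
qed

lemma has_real_derivative_max_0_square: "((\<lambda>x. (max 0 x)\<^sup>2) has_real_derivative 2 * max 0 x) (at (x::real))"
proof -
  consider "x > 0" | "x < 0" | "x = 0" by linarith
  then show ?thesis
  proof cases
    case 1
    have "((\<lambda>x. x\<^sup>2) has_real_derivative 2 * x) (at x)" by (auto intro!: derivative_eq_intros)
    then have "((\<lambda>x. (max 0 x)\<^sup>2) has_real_derivative 2 * x) (at x)"
      by (rule has_field_derivative_transform_within_open[of _ _ _ "{0<..}"]) (use 1 in auto)
    then show ?thesis using 1 by simp
  next
    case 2
    have "((\<lambda>x. (max 0 x)\<^sup>2) has_real_derivative 0) (at x)"
      by (rule has_field_derivative_transform_within_open[of "\<lambda>x. 0" _ _ "{..<0}"]) (use 2 in auto)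
    then show ?thesis using 2 by simp
  next
    case 3
    have "((\<lambda>y::real. max 0 y) \<longlongrightarrow> max 0 0) (at 0)" by (intro tendsto_intros)
    then have "((\<lambda>y::real. max 0 y) \<longlongrightarrow> 0) (at 0)" by simp
    then have "((\<lambda>y::real. ((max 0 y)\<^sup>2 - (max 0 0)\<^sup>2) / (y - 0)) \<longlongrightarrow> 0) (at 0)"
      by (rule Lim_transform_eventually) (auto simp: max_def power2_eq_square eventually_at_filter)
    then show ?thesis using 3 by (simp add: has_field_derivative_iff)
  qed
qed

text \<open>Squaring makes the truncation in \<open>tent\<close> continuously differentiable, which
  is the regularity that the variation uses. The gradient stays radial, and this is the source of
  the vector z - z0 in the integrand of \<open>tent_scaling_limit\<close>.\<close>

definition bump2 :: "real \<Rightarrow> complex \<Rightarrow> real" where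
  "bump2 \<epsilon> w = (tent \<epsilon> w)\<^sup>2"

definition bump2_deriv :: "real \<Rightarrow> complex \<Rightarrow> complex \<Rightarrow> real" where
  "bump2_deriv \<epsilon> w h = - (4 / \<epsilon>\<^sup>2) * tent \<epsilon> w * (w \<bullet> h)"

lemma bump2_has_derivative: "(bump2 \<epsilon> has_derivative bump2_deriv \<epsilon> w) (at w)"
proof -
  have q: "((\<lambda>w::complex. 1 - (norm w)\<^sup>2 / \<epsilon>\<^sup>2) has_derivative (\<lambda>h. - (2 * (w \<bullet> h) / \<epsilon>\<^sup>2))) (at w)"
  proof -
    have "((\<lambda>w::complex. w \<bullet> w) has_derivative (\<lambda>h. 2 * (w \<bullet> h))) (at w)"
      by (auto intro!: derivative_eq_intros simp: inner_commute)
    from has_derivative_diff[OF has_derivative_const has_derivative_mult_left[OF this, of "inverse (\<epsilon>\<^sup>2)"], of 1]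
    show ?thesis by (simp add: divide_inverse power2_norm_eq_inner)
  qed
  have "((\<lambda>w. (max 0 (1 - (norm w)\<^sup>2 / \<epsilon>\<^sup>2))\<^sup>2) has_derivative
      (\<lambda>h. 2 * max 0 (1 - (norm w)\<^sup>2 / \<epsilon>\<^sup>2) * (- (2 * (w \<bullet> h) / \<epsilon>\<^sup>2)))) (at w)"
    using has_derivative_compose[OF q has_real_derivative_max_0_square[unfolded has_field_derivative_def]] .
  then show ?thesis unfolding bump2_def[abs_def] bump2_deriv_def[abs_def] tent_def
    by (simp add: mult_ac)
qed

lemma bump2_deriv_continuous: "continuous_on UNIV (\<lambda>w. bump2_deriv \<epsilon> w h)"
  unfolding bump2_deriv_def by (intro continuous_intros continuous_tent)

lemma bump2_deriv_eq_0: "0 < \<epsilon> \<Longrightarrow> \<epsilon> \<le> norm w \<Longrightarrow> bump2_deriv \<epsilon> w h = 0"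
  by (simp add: bump2_deriv_def tent_eq_0)

section \<open>Balancing from local minimality\<close>

context
  fixes X :: "'a::euclidean_space set set"
    and p :: "'b::topological_space \<Rightarrow> 'a"
    and Xt :: "'b set"
    and u :: "'b \<Rightarrow> complex^'n^'n"
  assumes X: "equilateral_2_complex X" and cov: "covering_space Xt p (\<Union>X)"
    and smooth: "smooth_map X p Xt u" and target: "u ` Xt \<subseteq> sym_space"
    and minimizing: "locally_energy_minimizing X p Xt u"
begin

lemma finite_energy_u: "finite_energy_map X p Xt u"
  using minimizing by (simp add: locally_energy_minimizing_def)

definition local_energy :: "'b set \<Rightarrow> ('b \<Rightarrow> complex^'n^'n) \<Rightarrow> (complex \<Rightarrow> 'b) \<Rightarrow> ennreal" where
  "local_energy \<Omega> v c = (\<integral>\<^sup>+z\<in>{z \<in> interior tri. c z \<in> \<Omega>}. energy_density v c z \<partial>lborel)"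

text \<open>Charts that miss the compact set K see nothing of \<Omega>, so the infinite sum reduces
  to finitely many terms that can be expanded in t.\<close>

lemma energy_finite_sum:
  assumes K: "\<Omega> \<subseteq> K" "compact K" "K \<subseteq> Xt"
  shows "energy X p Xt \<Omega> v = (\<Sum>c\<in>{c \<in> charts X p Xt. \<exists>z\<in>tri. c z \<in> K}. local_energy \<Omega> v c) / 6"
proof -
  let ?S = "{c \<in> charts X p Xt. \<exists>z\<in>tri. c z \<in> K}"
  have fin: "finite ?S" by (rule finite_charts_compact[OF X cov K(2,3)])
  have "(\<Sum>\<^sub>\<infinity>c\<in>charts X p Xt. local_energy \<Omega> v c) = (\<Sum>\<^sub>\<infinity>c\<in>?S. local_energy \<Omega> v c)"
  proof (rule infsum_cong_neutral)
    fix c assume c: "c \<in> charts X p Xt - ?S"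
    have S0: "{z \<in> interior tri. c z \<in> \<Omega>} = {}" using c K(1) interior_subset[of tri] by blast
    then show "local_energy \<Omega> v c = 0" unfolding local_energy_def S0 by simp
  qed auto
  also have "\<dots> = (\<Sum>c\<in>?S. local_energy \<Omega> v c)" by (rule infsum_finite[OF fin])
  finally show ?thesis unfolding energy_def local_energy_def by simp
qed

text \<open>The competitors agree with \<open>u\<close> outside the region of minimality and have
  finite energy, so their energy, a quadratic polynomial in t, is minimal at t = 0.
  \<open>zc\<close> only names the parameter at which a chart passes through the edge point.\<close>

lemma first_variation:
  assumes c0: "c0 \<in> charts X p Xt" and s: "0 < s" "s < 1"
  shows "\<exists>\<epsilon>0>0. \<epsilon>0 \<le> min s (1 - s) \<and> (\<forall>\<epsilon> N zc. 0 < \<epsilon> \<longrightarrow> \<epsilon> < \<epsilon>0 \<longrightarrow> N \<in> nil2 \<longrightarrow>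
     (\<forall>c\<in>charts X p Xt. (\<exists>z\<in>tri. c z = c0 (Complex s 0)) \<longrightarrow> zc c \<in> tri \<and> c (zc c) = c0 (Complex s 0)) \<longrightarrow>
     (\<Sum>c | c \<in> charts X p Xt \<and> (\<exists>z\<in>tri. c z = c0 (Complex s 0)).
        LINT z:interior tri|lborel. lin_coeff (\<lambda>z. u (c z)) N (\<lambda>z. bump2_deriv \<epsilon> (z - zc c)) z) = 0)"
proof -
  define x where "x = c0 (Complex s 0)"
  define A where "A = {c. c \<in> charts X p Xt \<and> (\<exists>z\<in>tri. c z = x)}"
  have z0t: "Complex s 0 \<in> tri" using s by (intro edge_in_tri) auto
  have x: "x \<in> Xt" unfolding x_def by (rule chart_in[OF c0 z0t])
  obtain V R where V: "good_nbhd X p Xt x V R" using good_nbhd_exists[OF X cov x] by blast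
  note Vd = good_nbhdD[OF X cov V]
  have "\<exists>\<Omega> K. x \<in> \<Omega> \<and> openin (top_of_set Xt) \<Omega> \<and> \<Omega> \<subseteq> K \<and> compact K \<and> K \<subseteq> Xt \<and>
        (\<forall>v. finite_energy_map X p Xt v \<and> (\<forall>y\<in>Xt - \<Omega>. v y = u y) \<longrightarrow> energy X p Xt \<Omega> u \<le> energy X p Xt \<Omega> v)"
    using minimizing x unfolding locally_energy_minimizing_def by (elim conjE) (rule bspec)
  then obtain \<Omega> K where \<Omega>: "x \<in> \<Omega>" "openin (top_of_set Xt) \<Omega>" and K: "\<Omega> \<subseteq> K" "compact K" "K \<subseteq> Xt"
    and min: "\<And>v. finite_energy_map X p Xt v \<Longrightarrow> (\<And>y. y \<in> Xt - \<Omega> \<Longrightarrow> v y = u y) \<Longrightarrow> energy X p Xt \<Omega> u \<le> energy X p Xt \<Omega> v"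
    by auto
  obtain e where e: "e > 0" "e \<le> R" "\<And>w. w \<in> V \<Longrightarrow> dist (p w) (p x) < e \<Longrightarrow> w \<in> \<Omega>"
    using good_nbhd_small[OF X cov V \<Omega>(2,1)] by auto
  \<comment> \<open>Below \<open>e\<close> the support stays in \<Omega> and in the sheet; below min
    s (1 - s) it avoids the vertices in every chart.\<close>
  define \<epsilon>0 where "\<epsilon>0 = min e (min s (1 - s))"
  have \<epsilon>0: "\<epsilon>0 > 0" "\<epsilon>0 \<le> min s (1 - s)" "\<epsilon>0 \<le> e" using e s by (auto simp: \<epsilon>0_def)
  have main: "(\<Sum>c\<in>A. LINT z:interior tri|lborel. lin_coeff (\<lambda>z. u (c z)) N (\<lambda>z. bump2_deriv \<epsilon> (z - zc c)) z) = 0"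
    if \<epsilon>: "0 < \<epsilon>" "\<epsilon> < \<epsilon>0" and N: "N \<in> nil2" and zc: "\<And>c. c \<in> A \<Longrightarrow> zc c \<in> tri \<and> c (zc c) = x" for \<epsilon> N zc
  proof -
    have \<epsilon>e: "\<epsilon> < e" "\<epsilon> < R" "\<epsilon> < min s (1 - s)" using \<epsilon> \<epsilon>0 e by linarith+
    \<comment> \<open>The bump on the universal cover. It depends on the projected distance alone
      and is cut off by the sheet V; otherwise it would reappear around the other preimages of p
      x.\<close>
    define \<Phi> where "\<Phi> y = (if y \<in> V then (max 0 (1 - (dist (p y) (p x))\<^sup>2 / \<epsilon>\<^sup>2))\<^sup>2 else 0)" for y
    define \<phi> where "\<phi> c z = (if c \<in> A then bump2 \<epsilon> (z - zc c) else 0)" for c z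
    define d\<phi> where "d\<phi> c z h = (if c \<in> A then bump2_deriv \<epsilon> (z - zc c) h else 0)" for c z h
    define v where "v t y = hconj (mat 1 + (t * \<Phi> y) *\<^sub>R N) ** u y ** (mat 1 + (t * \<Phi> y) *\<^sub>R N)" for t y
    have inV: "c z \<in> V" if c: "c \<in> A" and z: "z \<in> tri" "dist z (zc c) < R" for c z
    proof -
      have cc: "c \<in> charts X p Xt" using c by (simp add: A_def)
      have "c (zc c) \<in> V" using zc[OF c] Vd(2) by simp
      from good_nbhd_chart[OF X cov V cc _ this] zc[OF c]
      obtain z1 where z1: "z1 \<in> tri" "c z1 = x" "\<And>w. w \<in> tri \<Longrightarrow> dist w z1 < R \<Longrightarrow> c w \<in> V" by auto
      have "z1 = zc c" using chart_inj[OF X cov cc z1(1), of "zc c"] z1(2) zc[OF c] by simp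
      then show ?thesis using z1(3)[OF z(1)] z(2) by simp
    qed
    have distA: "dist (p (c z)) (p x) = dist z (zc c)" if c: "c \<in> A" and z: "z \<in> tri" for c z
    proof -
      have cc: "c \<in> charts X p Xt" using c by (simp add: A_def)
      show ?thesis using chart_isometry[OF X cov cc z, of "zc c"] zc[OF c] by simp
    qed
    \<comment> \<open>In a chart through x the projected distance is the distance to
      \<open>zc c\<close>, and the sheet contains the whole support. Any other chart misses V, so
      the bump vanishes there.\<close>
    have \<Phi>c: "\<Phi> (c z) = \<phi> c z" if c: "c \<in> charts X p Xt" and z: "z \<in> tri" for c z
    proof (cases "c \<in> A")
      case True
      show ?thesis
      proof (cases "c z \<in> V")
        case V': True
        then show ?thesis using True distA[OF True z] by (simp add: \<Phi>_def \<phi>_def bump2_def tent_def dist_norm)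
      next
        case False
        then have "\<not> dist z (zc c) < R" using inV[OF True z] by blast
        then have "tent \<epsilon> (z - zc c) = 0" using \<epsilon> \<epsilon>e by (intro tent_eq_0) (auto simp: dist_norm)
        then show ?thesis using True False by (simp add: \<Phi>_def \<phi>_def bump2_def)
      qed
    next
      case False
      have "c z \<notin> V"
      proof
        assume "c z \<in> V"
        from good_nbhd_chart[OF X cov V c z this] have "c \<in> A" using c by (auto simp: A_def)
        with False show False by simp
      qed
      then show ?thesis using False by (simp add: \<Phi>_def \<phi>_def)
    qed
    have d: "(\<phi> c has_derivative d\<phi> c z) (at z)" for c z
    proof (cases "c \<in> A")
      case True
      have "((\<lambda>z. z - zc c) has_derivative (\<lambda>h. h)) (at z)" by (auto intro!: derivative_eq_intros)
      from has_derivative_compose[OF this bump2_has_derivative]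
      show ?thesis using True by (simp add: \<phi>_def[abs_def] d\<phi>_def[abs_def])
    next
      case False then show ?thesis by (simp add: \<phi>_def[abs_def] d\<phi>_def[abs_def])
    qed
    have cd: "continuous_on UNIV (\<lambda>z. d\<phi> c z h)" for c h
    proof (cases "c \<in> A")
      case True
      have "continuous_on UNIV (\<lambda>z. bump2_deriv \<epsilon> (z - zc c) h)"
        by (rule continuous_on_compose2[OF bump2_deriv_continuous]) (auto intro!: continuous_intros)
      then show ?thesis using True by (simp add: d\<phi>_def)
    next
      case False then show ?thesis by (simp add: d\<phi>_def)
    qed
    define B where "B c = (if c \<in> A then cball (zc c) \<epsilon> else {})" for c
    have B: "compact (B c)" "B c \<inter> tri \<subseteq> tri_star" "\<forall>z k. z \<notin> B c \<longrightarrow> d\<phi> c z k = 0" if c: "c \<in> charts X p Xt" for c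
    proof -
      show "compact (B c)" by (simp add: B_def)
      show "\<forall>z k. z \<notin> B c \<longrightarrow> d\<phi> c z k = 0"
        using \<epsilon>(1) by (auto simp: B_def d\<phi>_def dist_norm norm_minus_commute intro!: bump2_deriv_eq_0)
      show "B c \<inter> tri \<subseteq> tri_star"
      proof
        fix z assume z: "z \<in> B c \<inter> tri"
        then have cA: "c \<in> A" and dz: "dist (zc c) z \<le> \<epsilon>" by (auto simp: B_def split: if_splits)
        \<comment> \<open>Up to a symmetry of the triangle the chart shares the edge of
          \<open>c0\<close>, so \<open>zc c\<close> is as far from the vertices as the given edge
          point is.\<close>
        have "c \<in> (\<lambda>(c, g). compose tri c g) ` ({c \<in> charts X p Xt. same_edge c0 c} \<times> {g. tri_iso g})"
          using charts_at_edge_point[OF X cov c0 s] cA unfolding bij_betw_def A_def x_def by auto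
        then obtain c' g where c': "c' \<in> charts X p Xt" "same_edge c0 c'" and g: "tri_iso g" and cg: "c = compose tri c' g" by auto
        have ev: "c w = c' (g w)" if "w \<in> tri" for w using that by (simp add: cg compose_def)
        have "c' (Complex s 0) = x" using c'(2) s by (simp add: x_def same_edge_def)
        then have "c' (g (zc c)) = c' (Complex s 0)" using zc[OF cA] ev[of "zc c"] by simp
        moreover have "g (zc c) \<in> tri" using zc[OF cA] g by (auto simp: tri_iso_def)
        ultimately have gz: "g (zc c) = Complex s 0" using chart_inj[OF X cov c'(1) _ z0t] by simp
        have "z \<notin> tri_vertices"
        proof
          assume "z \<in> tri_vertices"
          then have "g z \<in> tri_vertices" by (rule tri_iso_vertices[OF g])
          then have "min s (1 - s) \<le> dist (g (zc c)) (g z)" unfolding gz by (rule edge_point_vertex_dist[OF s])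
          also have "\<dots> = dist (zc c) z" using g by (simp add: tri_iso_def)
          finally show False using dz \<epsilon>e by linarith
        qed
        then show "z \<in> tri_star" using z by (simp add: tri_star_def)
      qed
    qed
    have fsm: "smooth_on tri_star (\<lambda>z. u (c z))" if "c \<in> charts X p Xt" for c by (rule chart_smooth[OF smooth target that])
    have fsy: "\<forall>z\<in>tri_star. u (c z) \<in> sym_space" if "c \<in> charts X p Xt" for c using chart_sym[OF smooth target that] by blast
    have vc: "\<forall>z\<in>tri. v t (c z) = var_map (\<lambda>z. u (c z)) N (\<phi> c) t z" if "c \<in> charts X p Xt" for t c
      by (simp add: v_def var_map_def[OF fsm[OF that] fsy[OF that] N d cd] \<Phi>c[OF that])
    have fin_u: "(\<integral>\<^sup>+z\<in>interior tri. energy_density u c z \<partial>lborel) < \<infinity>" if "c \<in> charts X p Xt" for c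
      using finite_energy_u that unfolding finite_energy_map_def by blast
    have base: "set_integrable lborel (interior tri) (base_density (\<lambda>z. u (c z)))" if c: "c \<in> charts X p Xt" for c
      by (rule base_integrable[where u = u and c = c, OF fsm[OF c] fsy[OF c] N d cd _ fin_u[OF c]]) simp
    have "finite_energy_map X p Xt (v t)" for t
      unfolding finite_energy_map_def
    proof (intro conjI ballI)
      show "v t ` Xt \<subseteq> sym_space"
      proof (rule image_subsetI)
        fix y assume y: "y \<in> Xt"
        have "det (mat 1 + (t * \<Phi> y) *\<^sub>R N) = 1" using N by (simp add: nil2_def)
        moreover have "u y \<in> sym_space" using target y by blast
        ultimately show "v t y \<in> sym_space" unfolding v_def by (intro sym_space_congruence)
      qed
      fix c assume c: "c \<in> charts X p Xt"
      note ctx = fsm[OF c] fsy[OF c] N d cd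
      have cont: "continuous_on tri_star (var_map (\<lambda>z. u (c z)) N (\<phi> c) t)" by (rule var_map_continuous[OF ctx])
      show "set_borel_measurable borel tri (\<lambda>z. v t (c z))"
        by (rule set_borel_measurable_cong_tri[OF _ set_borel_measurable_tri[OF cont]]) (use vc[OF c, of t] in simp)
      show "edge_trace (\<lambda>z. v t (c z))"
        by (rule edge_trace_cong[OF _ edge_trace_continuous[OF cont]]) (use vc[OF c, of t] in simp)
      show "\<exists>g. weak_deriv (\<lambda>z. v t (c z)) k g" for k
      proof -
        have "weak_deriv (\<lambda>z. v t (c z)) k (\<lambda>z. var_deriv (\<lambda>z. u (c z)) N (\<phi> c) (d\<phi> c) t z k)"
          by (subst weak_deriv_cong[of _ "var_map (\<lambda>z. u (c z)) N (\<phi> c) t"])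
             (use vc[OF c, of t] interior_subset[of tri] weak_deriv_var_map[OF ctx] in auto)
        then show ?thesis by blast
      qed
      show "(\<integral>\<^sup>+z\<in>interior tri. energy_density (v t) c z \<partial>lborel) < \<infinity>"
        by (subst var_energy(1)[where v = "v t" and c = c and t = t, OF ctx vc[OF c] base[OF c] B[OF c], of "interior tri"]) auto
    qed
    moreover have "v t y = u y" if y: "y \<in> Xt - \<Omega>" for t y
    proof -
      have "\<Phi> y = 0"
      proof (cases "y \<in> V")
        case True
        then have "\<not> dist (p y) (p x) < e" using e(3) y by blast
        then have "\<epsilon>\<^sup>2 \<le> (dist (p y) (p x))\<^sup>2" using \<epsilon> \<epsilon>e by (intro power_mono) auto
        then show ?thesis using \<epsilon> True by (simp add: \<Phi>_def divide_simps)
      qed (simp add: \<Phi>_def)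
      then show ?thesis by (simp add: v_def)
    qed
    ultimately have le: "energy X p Xt \<Omega> u \<le> energy X p Xt \<Omega> (v t)" for t by (intro min)
    define S where "S c = {z \<in> interior tri. c z \<in> \<Omega>}" for c
    define SK where "SK = {c \<in> charts X p Xt. \<exists>z\<in>tri. c z \<in> K}"
    have SKc: "c \<in> charts X p Xt" if "c \<in> SK" for c using that by (simp add: SK_def)
    have finSK: "finite SK" unfolding SK_def by (rule finite_charts_compact[OF X cov K(2,3)])
    define L where "L c = (LINT z:interior tri|lborel. lin_coeff (\<lambda>z. u (c z)) N (d\<phi> c) z)" for c
    define M where "M c = (LINT z:interior tri|lborel. quad_coeff (\<lambda>z. u (c z)) N (d\<phi> c) z)" for c
    define E where "E c = (LINT z:S c|lborel. base_density (\<lambda>z. u (c z)) z)" for c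
    have Sb: "S c \<in> sets borel" if c: "c \<in> charts X p Xt" for c
    proof -
      have "openin (top_of_set (interior tri)) (interior tri \<inter> c -` \<Omega>)"
      proof (rule continuous_openin_preimage[OF _ _ \<Omega>(2)])
        show "continuous_on (interior tri) c"
          by (rule continuous_on_subset[OF chart_continuous[OF X cov c] interior_subset])
        show "c \<in> interior tri \<rightarrow> Xt" using chart_in[OF c] interior_subset[of tri] by auto
      qed
      then have "open (interior tri \<inter> c -` \<Omega>)" using openin_open_trans open_interior by blast
      moreover have "S c = interior tri \<inter> c -` \<Omega>" by (auto simp: S_def)
      ultimately show ?thesis by simp
    qed
    have supp0: "d\<phi> c z k = 0" if z: "z \<in> interior tri" "z \<notin> S c" for c z k
    proof (cases "c \<in> A")
      case True
      have zt: "z \<in> tri" using z(1) interior_subset by blast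
      have "\<not> dist z (zc c) < \<epsilon>"
      proof
        assume "dist z (zc c) < \<epsilon>"
        then have "c z \<in> V" "dist (p (c z)) (p x) < e"
          using inV[OF True zt] distA[OF True zt] \<epsilon>e by auto
        then have "c z \<in> \<Omega>" by (rule e(3))
        then show False using z by (simp add: S_def)
      qed
      then show ?thesis using True \<epsilon> by (auto simp: d\<phi>_def dist_norm intro!: bump2_deriv_eq_0)
    qed (simp add: d\<phi>_def)
    have supp: "\<forall>z k. z \<in> interior tri \<longrightarrow> z \<notin> S c \<longrightarrow> d\<phi> c z k = 0" for c using supp0 by blast
    have Ev: "local_energy \<Omega> (v t) c = ennreal (E c + t * L c + t\<^sup>2 * M c)" "0 \<le> E c + t * L c + t\<^sup>2 * M c"
      if c: "c \<in> charts X p Xt" for t c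
    proof -
      have sub: "S c \<subseteq> interior tri" by (auto simp: S_def)
      note ve = var_energy[where v = "v t" and c = c and t = t, OF fsm[OF c] fsy[OF c] N d cd vc[OF c] base[OF c] B[OF c] Sb[OF c] sub supp]
      show "local_energy \<Omega> (v t) c = ennreal (E c + t * L c + t\<^sup>2 * M c)"
        using ve(1) by (simp add: local_energy_def S_def E_def L_def M_def)
      show "0 \<le> E c + t * L c + t\<^sup>2 * M c" using ve(2) by (simp add: E_def L_def M_def)
    qed
    have v0: "v 0 = u" by (simp add: v_def fun_eq_iff)
    \<comment> \<open>All terms are finite real numbers, so the base energies \<open>E c\<close>
      cancel in the comparison with t = 0.\<close>
    have "0 \<le> t * (\<Sum>c\<in>SK. L c) + t\<^sup>2 * (\<Sum>c\<in>SK. M c)" for t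
    proof -
      have sum_v: "(\<Sum>c\<in>SK. local_energy \<Omega> (v t) c) = ennreal (\<Sum>c\<in>SK. E c + t * L c + t\<^sup>2 * M c)" for t
        using Ev SKc by (subst sum_ennreal[symmetric]) auto
      have "(\<Sum>c\<in>SK. local_energy \<Omega> (v 0) c) / 6 \<le> (\<Sum>c\<in>SK. local_energy \<Omega> (v t) c) / 6"
        using le[of t] unfolding energy_finite_sum[OF K] SK_def[symmetric] v0 .
      then have "(\<Sum>c\<in>SK. local_energy \<Omega> (v 0) c) / 6 * 6 \<le> (\<Sum>c\<in>SK. local_energy \<Omega> (v t) c) / 6 * 6"
        by (rule mult_right_mono) simp
      then have "(\<Sum>c\<in>SK. local_energy \<Omega> (v 0) c) \<le> (\<Sum>c\<in>SK. local_energy \<Omega> (v t) c)"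
        by (simp add: ennreal_divide_times)
      then have "(\<Sum>c\<in>SK. E c) \<le> (\<Sum>c\<in>SK. E c + t * L c + t\<^sup>2 * M c)"
        unfolding sum_v using Ev(2)[OF SKc] by (subst (asm) ennreal_le_iff) (auto intro: sum_nonneg)
      then show ?thesis by (simp add: sum.distrib sum_distrib_left)
    qed
    then have "(\<Sum>c\<in>SK. L c) = 0" by (rule quadratic_nonneg_imp_linear_zero)
    \<comment> \<open>Charts that do not pass through x carry no variation, hence no linear
      coefficient.\<close>
    moreover have "(\<Sum>c\<in>SK. L c) = (\<Sum>c\<in>A. L c)"
    proof (rule sum.mono_neutral_right[OF finSK])
      show "A \<subseteq> SK" using K(1) \<Omega>(1) by (auto simp: A_def SK_def)
      show "\<forall>c\<in>SK - A. L c = 0"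
      proof
        fix c assume c: "c \<in> SK - A"
        then have cc: "c \<in> charts X p Xt" by (simp add: SKc)
        have "d\<phi> c z h = 0" for z h using c by (simp add: d\<phi>_def)
        then have "lin_coeff (\<lambda>z. u (c z)) N (d\<phi> c) z = 0" for z
          by (simp add: lin_coeff_def[OF fsm[OF cc] fsy[OF cc] N d cd])
        then show "L c = 0" by (simp add: L_def set_lebesgue_integral_def)
      qed
    qed
    moreover have "L c = (LINT z:interior tri|lborel. lin_coeff (\<lambda>z. u (c z)) N (\<lambda>z. bump2_deriv \<epsilon> (z - zc c)) z)" if "c \<in> A" for c
    proof -
      have "d\<phi> c = (\<lambda>z. bump2_deriv \<epsilon> (z - zc c))" using that by (simp add: d\<phi>_def fun_eq_iff)
      then show ?thesis by (simp add: L_def)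
    qed
    ultimately show ?thesis by simp
  qed
  show ?thesis
  proof (rule exI[of _ \<epsilon>0], intro conjI allI impI \<epsilon>0(1,2))
    fix \<epsilon> :: real and N :: "complex^'n^'n" and zc :: "(complex \<Rightarrow> 'b) \<Rightarrow> complex"
    assume *: "0 < \<epsilon>" "\<epsilon> < \<epsilon>0" "N \<in> nil2"
      "\<forall>c\<in>charts X p Xt. (\<exists>z\<in>tri. c z = c0 (Complex s 0)) \<longrightarrow> zc c \<in> tri \<and> c (zc c) = c0 (Complex s 0)"
    have zc: "zc c \<in> tri \<and> c (zc c) = x" if "c \<in> A" for c using *(4) that by (auto simp: A_def x_def)
    show "(\<Sum>c | c \<in> charts X p Xt \<and> (\<exists>z\<in>tri. c z = c0 (Complex s 0)).
        LINT z:interior tri|lborel. lin_coeff (\<lambda>z. u (c z)) N (\<lambda>z. bump2_deriv \<epsilon> (z - zc c)) z) = 0"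
      using main[OF *(1-3) zc] by (simp add: A_def x_def)
  qed
qed

text \<open>Splitting the charts through the edge point into \<open>D\<close> times the symmetries,
  each symmetry gives the same integral. The vanishing first variation thus becomes the hypothesis
  of \<open>tent_scaling_limit\<close> for the sum over D, tested against one N at a time;
  \<open>traceless_eq_0I\<close> removes N, and \<kappa> is a common factor.\<close>

lemma balanced_log_deriv:
  assumes trace0: "\<And>c z v. c \<in> charts X p Xt \<Longrightarrow> z \<in> tri_star \<Longrightarrow> trace (log_deriv 1 u c z v) = 0"
  shows "balanced X p Xt (log_deriv \<kappa> u)"
  unfolding balanced_def
proof (intro ballI)
  fix c0 s assume c0: "c0 \<in> charts X p Xt" and "s \<in> {0<..<1::real}"
  then have s: "0 < s" "s < 1" by auto
  let ?z0 = "Complex s 0"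
  define D where "D = {c \<in> charts X p Xt. same_edge c0 c}"
  define A where "A = {c. c \<in> charts X p Xt \<and> (\<exists>z\<in>tri. c z = c0 ?z0)}"
  define G where "G = {g. tri_iso g}"
  have bij: "bij_betw (\<lambda>(c, g). compose tri c g) (D \<times> G) A"
    using charts_at_edge_point[OF X cov c0 s] by (simp add: D_def A_def G_def)
  have finA: "finite A" using finite_charts_at[OF X cov, of "c0 ?z0"] by (simp add: A_def)
  have finDG: "finite (D \<times> G)" using bij finA bij_betw_finite by blast
  have c0D: "c0 \<in> D" using c0 by (simp add: D_def same_edge_def)
  have idG: "id \<in> G" by (simp add: G_def tri_iso_def)
  have finD: "finite D" and finG: "finite G"
    using finDG c0D idG finite_cartesian_productD1 finite_cartesian_productD2 by blast+
  have Dc: "c \<in> charts X p Xt" "c ?z0 = c0 ?z0" if "c \<in> D" for c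
    using that s by (auto simp: D_def same_edge_def)
  have z0: "?z0 \<in> tri" "?z0 \<in> tri_star" using s edge_in_tri edge_in_tri_star by auto
  define \<omega> where "\<omega> = log_deriv 1 u"
  have \<omega>_lin: "linear (\<omega> c z)" if "c \<in> charts X p Xt" "z \<in> tri_star" for c z
    using one_form_log_deriv[OF smooth target, of 1] that unfolding one_form_def \<omega>_def by blast
  have \<omega>_iso: "\<omega> (compose tri c g) z v = \<omega> c (g z) (g v - g 0)"
    if "c \<in> charts X p Xt" "tri_iso g" "z \<in> tri_star" for c g z v
    using one_form_log_deriv[OF smooth target, of 1] that unfolding one_form_def \<omega>_def tri_iso_def by blast
  have \<omega>_cont: "continuous_on tri_star (\<lambda>z. \<omega> c z v)" if "c \<in> charts X p Xt" for c v
    using smooth_form_log_deriv[OF smooth target, of 1] that unfolding smooth_form_def \<omega>_def smooth_on_def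
    by (intro Ck_on_imp_continuous[of 0]) blast
  obtain \<epsilon>0 where \<epsilon>0: "\<epsilon>0 > 0" "\<epsilon>0 \<le> min s (1 - s)" and fv: "\<And>\<epsilon> N zc. 0 < \<epsilon> \<Longrightarrow> \<epsilon> < \<epsilon>0 \<Longrightarrow> N \<in> nil2 \<Longrightarrow>
     (\<forall>c\<in>charts X p Xt. (\<exists>z\<in>tri. c z = c0 ?z0) \<longrightarrow> zc c \<in> tri \<and> c (zc c) = c0 ?z0) \<Longrightarrow>
     (\<Sum>c\<in>A. LINT z:interior tri|lborel. lin_coeff (\<lambda>z. u (c z)) N (\<lambda>z. bump2_deriv \<epsilon> (z - zc c)) z) = 0"
    using first_variation[OF c0 s] unfolding A_def by auto
  have "(\<Sum>c\<in>D. \<omega> c ?z0 \<i>) = 0"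
  proof (rule traceless_eq_0I)
    have "trace (\<Sum>c\<in>D. \<omega> c ?z0 \<i>) = (\<Sum>c\<in>D. trace (\<omega> c ?z0 \<i>))"
      using finD by (induction D rule: finite_induct) (auto simp: trace_add, simp add: trace_def)
    also have "\<dots> = 0" using trace0[OF Dc(1) z0(2)] by (simp add: \<omega>_def)
    finally show "trace (\<Sum>c\<in>D. \<omega> c ?z0 \<i>) = 0" .
    fix N :: "complex^'n^'n" assume N: "N \<in> nil2"
    define T where "T = (\<lambda>A::complex^'n^'n. Re (trace (A ** N)))"
    have T: "bounded_linear T" unfolding T_def
      by (auto intro!: linear_conv_bounded_linear[THEN iffD1] linearI simp: trace_add trace_scaleR mm_scaleR
         bounded_bilinear.add_left[OF bounded_bilinear_matrix_matrix_mult])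
    note Tl = bounded_linear.linear[OF T]
    define \<tau> where "\<tau> z v = (\<Sum>c\<in>D. T (\<omega> c z v))" for z v
    have "\<tau> ?z0 \<i> = 0"
    proof (rule tent_scaling_limit[OF s \<epsilon>0(1)])
      show "linear (\<tau> z)" if z: "z \<in> tri_star" for z
        unfolding \<tau>_def
        by (intro linear_compose_sum ballI linear_compose[OF \<omega>_lin[OF Dc(1) z] Tl, unfolded o_def])
      show "continuous_on tri_star (\<lambda>z. \<tau> z v)" for v
        unfolding \<tau>_def by (intro continuous_on_sum bounded_linear.continuous_on[OF T] \<omega>_cont Dc(1))
      fix \<epsilon> :: real assume \<epsilon>: "0 < \<epsilon>" "\<epsilon> < \<epsilon>0"
      define zc where "zc c = (SOME z. z \<in> tri \<and> c z = c0 ?z0)" for c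
      have zc: "zc c \<in> tri \<and> c (zc c) = c0 ?z0" if "\<exists>z\<in>tri. c z = c0 ?z0" for c
        unfolding zc_def by (rule someI_ex) (use that in blast)
      define L where "L c = (LINT z:interior tri|lborel. lin_coeff (\<lambda>z. u (c z)) N (\<lambda>z. bump2_deriv \<epsilon> (z - zc c)) z)" for c
      define P where "P c z = tent \<epsilon> (z - ?z0) * T (\<omega> c z (z - ?z0))" for c z
      have SL: "(\<Sum>c\<in>A. L c) = 0" unfolding L_def by (rule fv[OF \<epsilon> N]) (use zc in blast)
      have der: "((\<lambda>z. bump2 \<epsilon> (z - w)) has_derivative bump2_deriv \<epsilon> (z - w)) (at z)" for w z
      proof -
        have "((\<lambda>z. z - w) has_derivative (\<lambda>h. h)) (at z)" by (auto intro!: derivative_eq_intros)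
        from has_derivative_compose[OF this bump2_has_derivative] show ?thesis .
      qed
      have cder: "continuous_on UNIV (\<lambda>z. bump2_deriv \<epsilon> (z - w) h)" for w h
        by (rule continuous_on_compose2[OF bump2_deriv_continuous]) (auto intro!: continuous_intros)
      have fsm: "smooth_on tri_star (\<lambda>z. u (c z))" if "c \<in> charts X p Xt" for c by (rule chart_smooth[OF smooth target that])
      have fsy: "\<forall>z\<in>tri_star. u (c z) \<in> sym_space" if "c \<in> charts X p Xt" for c using chart_sym[OF smooth target that] by blast
      \<comment> \<open>The 16 is the 4 in front of the trace in the variation times the 4 in the
        gradient of the bump. The radial gradient turns the sum over the two coordinate directions
        into \<omega> evaluated on z - w.\<close>
      have lin_eq: "lin_coeff (\<lambda>z. u (c z)) N (\<lambda>z. bump2_deriv \<epsilon> (z - w)) z = - (16 / \<epsilon>\<^sup>2) * (tent \<epsilon> (z - w) * T (\<omega> c z (z - w)))"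
        if c: "c \<in> charts X p Xt" and z: "z \<in> tri_star" for c z w
      proof -
        have lf: "log_form (\<lambda>z. u (c z)) z k = \<omega> c z k" for k
          by (simp add: log_form_def[OF fsm[OF c] fsy[OF c] N der cder] \<omega>_def log_deriv_def)
        have "z - w = Re (z - w) *\<^sub>R 1 + Im (z - w) *\<^sub>R \<i>" by (simp add: complex_eq_iff)
        then have "T (\<omega> c z (z - w)) = T (\<omega> c z (Re (z - w) *\<^sub>R 1 + Im (z - w) *\<^sub>R \<i>))" by simp
        also have "\<dots> = Re (z - w) * T (\<omega> c z 1) + Im (z - w) * T (\<omega> c z \<i>)"
          by (simp only: linear_add[OF \<omega>_lin[OF c z]] linear_scale[OF \<omega>_lin[OF c z]] linear_add[OF Tl] linear_scale[OF Tl] real_scaleR_def)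
        finally have e: "T (\<omega> c z (z - w)) = Re (z - w) * T (\<omega> c z 1) + Im (z - w) * T (\<omega> c z \<i>)" .
        have "lin_coeff (\<lambda>z. u (c z)) N (\<lambda>z. bump2_deriv \<epsilon> (z - w)) z
           = bump2_deriv \<epsilon> (z - w) 1 * (4 * T (\<omega> c z 1)) + bump2_deriv \<epsilon> (z - w) \<i> * (4 * T (\<omega> c z \<i>))"
          by (simp add: lin_coeff_def[OF fsm[OF c] fsy[OF c] N der cder] lf T_def)
        also have "\<dots> = - (16 / \<epsilon>\<^sup>2) * (tent \<epsilon> (z - w) * T (\<omega> c z (z - w)))"
        proof -
          have "- (4 / \<epsilon>\<^sup>2) * t * a * (4 * P) + - (4 / \<epsilon>\<^sup>2) * t * b * (4 * Q) = - (16 / \<epsilon>\<^sup>2) * (t * (a * P + b * Q))" for t a b P Q :: real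
            by (simp add: algebra_simps add_divide_distrib)
          then show ?thesis unfolding e bump2_deriv_def inner_complex_def by simp
        qed
        finally show ?thesis .
      qed
      \<comment> \<open>The symmetry g carries \<open>zc\<close> to the edge point, preserves
        distances and transforms \<omega> by its linear part; the substitution z \<mapsto> g z then
        removes it from the integral.\<close>
      have L_eq: "L (compose tri c g) = - (16 / \<epsilon>\<^sup>2) * (LINT z:interior tri|lborel. P c z)" if c: "c \<in> D" and g: "g \<in> G" for c g
      proof -
        have gi: "tri_iso g" using g by (simp add: G_def)
        have gd: "dist (g z) (g w) = dist z w" for z w using gi by (simp add: tri_iso_def)
        let ?c = "compose tri c g"
        have cA: "?c \<in> A" using bij c g by (auto simp: bij_betw_def)
        have cc: "?c \<in> charts X p Xt" using cA by (simp add: A_def)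
        have zcc: "zc ?c \<in> tri" "?c (zc ?c) = c0 ?z0" using zc[of ?c] cA by (auto simp: A_def)
        have "g (zc ?c) \<in> tri" using zcc(1) gi by (auto simp: tri_iso_def)
        moreover have "c (g (zc ?c)) = c ?z0" using zcc Dc(2)[OF c] by (simp add: compose_def)
        ultimately have gz: "g (zc ?c) = ?z0" using chart_inj[OF X cov Dc(1)[OF c] _ z0(1)] by simp
        let ?f = "\<lambda>z. indicat_real (interior tri) z *\<^sub>R P c z"
        have fm: "?f \<in> borel_measurable borel"
        proof (rule borel_measurable_continuous_on_indicator)
          have "continuous_on tri_star (P c)"
          proof -
            have "continuous_on tri_star (\<lambda>z. tent \<epsilon> (z - ?z0) * (Re (z - ?z0) * T (\<omega> c z 1) + Im (z - ?z0) * T (\<omega> c z \<i>)))"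
              by (intro continuous_intros continuous_on_compose2[OF continuous_tent] bounded_linear.continuous_on[OF T] \<omega>_cont Dc(1)[OF c]) auto
            moreover have "P c z = tent \<epsilon> (z - ?z0) * (Re (z - ?z0) * T (\<omega> c z 1) + Im (z - ?z0) * T (\<omega> c z \<i>))" if z: "z \<in> tri_star" for z
            proof -
              note l = \<omega>_lin[OF Dc(1)[OF c] z]
              have "z - ?z0 = Re (z - ?z0) *\<^sub>R 1 + Im (z - ?z0) *\<^sub>R \<i>" by (simp add: complex_eq_iff)
              then have "P c z = tent \<epsilon> (z - ?z0) * T (\<omega> c z (Re (z - ?z0) *\<^sub>R 1 + Im (z - ?z0) *\<^sub>R \<i>))" by (simp add: P_def)
              then show ?thesis by (simp only: linear_add[OF l] linear_scale[OF l] linear_add[OF Tl] linear_scale[OF Tl] real_scaleR_def)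
            qed
            ultimately show ?thesis by (simp cong: continuous_on_cong)
          qed
          then show "continuous_on (interior tri) (P c)" by (rule continuous_on_subset[OF _ interior_tri_subset_star])
        qed simp
        have "L ?c = (LINT z|lborel. - (16 / \<epsilon>\<^sup>2) * ?f (g z))"
          unfolding L_def set_lebesgue_integral_def
        proof (rule Bochner_Integration.integral_cong[OF refl])
          fix z
          show "indicat_real (interior tri) z *\<^sub>R lin_coeff (\<lambda>z. u (?c z)) N (\<lambda>z. bump2_deriv \<epsilon> (z - zc ?c)) z = - (16 / \<epsilon>\<^sup>2) * ?f (g z)"
          proof (cases "z \<in> interior tri")
            case True
            then have zs: "z \<in> tri_star" using interior_tri_subset_star by blast
            have n: "norm (z - zc ?c) = norm (g z - ?z0)" using gd[of z "zc ?c"] gz by (simp add: dist_norm)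
            have dl: "g (z - zc ?c) - g 0 = g z - ?z0"
              using linear_diff[OF tri_iso_linear[OF gi], of z "zc ?c"] gz by simp
            have "lin_coeff (\<lambda>z. u (?c z)) N (\<lambda>z. bump2_deriv \<epsilon> (z - zc ?c)) z = - (16 / \<epsilon>\<^sup>2) * (tent \<epsilon> (z - zc ?c) * T (\<omega> ?c z (z - zc ?c)))"
              by (rule lin_eq[OF cc zs])
            also have "\<omega> ?c z (z - zc ?c) = \<omega> c (g z) (g z - ?z0)" unfolding \<omega>_iso[OF Dc(1)[OF c] gi zs] dl ..
            also have "tent \<epsilon> (z - zc ?c) = tent \<epsilon> (g z - ?z0)" unfolding tent_def n ..
            finally show ?thesis using True tri_iso_interior[OF gi, of z] by (simp add: P_def)
          next
            case False then show ?thesis using tri_iso_interior[OF gi, of z] by simp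
          qed
        qed
        also have "\<dots> = - (16 / \<epsilon>\<^sup>2) * (LINT z|lborel. ?f (g z))" by simp
        also have "(LINT z|lborel. ?f (g z)) = (LINT z|lborel. ?f z)" by (rule integral_isometry[OF gd fm])
        finally show ?thesis by (simp add: set_lebesgue_integral_def)
      qed
      have "(\<Sum>c\<in>A. L c) = (\<Sum>(c, g)\<in>D \<times> G. L (compose tri c g))"
        using sum.reindex_bij_betw[OF bij, of L] by (simp add: case_prod_unfold)
      also have "\<dots> = (\<Sum>(c, g)\<in>D \<times> G. - (16 / \<epsilon>\<^sup>2) * (LINT z:interior tri|lborel. P c z))"
        by (rule sum.cong) (auto simp: L_eq)
      also have "\<dots> = (\<Sum>c\<in>D. \<Sum>g\<in>G. - (16 / \<epsilon>\<^sup>2) * (LINT z:interior tri|lborel. P c z))"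
        by (rule sum.cartesian_product[symmetric])
      also have "\<dots> = (real (card G) * - (16 / \<epsilon>\<^sup>2)) * (\<Sum>c\<in>D. LINT z:interior tri|lborel. P c z)"
        by (simp add: sum_distrib_left mult.assoc)
      finally have "(real (card G) * - (16 / \<epsilon>\<^sup>2)) * (\<Sum>c\<in>D. LINT z:interior tri|lborel. P c z) = 0" using SL by simp
      \<comment> \<open>The group is finite because the charts through the point are, and it
        contains the identity, so the common factor can be divided out.\<close>
      moreover have "real (card G) * - (16 / \<epsilon>\<^sup>2) \<noteq> 0" using \<epsilon>(1) finG idG by (auto simp: card_eq_0_iff)
      ultimately have PZ: "(\<Sum>c\<in>D. LINT z:interior tri|lborel. P c z) = 0" by simp
      have Pi: "set_integrable lborel (interior tri) (P c)" if c: "c \<in> D" for c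
      proof -
        \<comment> \<open>Integrability of \<open>P c\<close> is inherited from the linear
          coefficient, of which it is a constant multiple on the open triangle; the disc carries the
          gradient of the bump.\<close>
        have B: "compact (cball ?z0 \<epsilon>)" "cball ?z0 \<epsilon> \<inter> tri \<subseteq> tri_star" "\<forall>z k. z \<notin> cball ?z0 \<epsilon> \<longrightarrow> bump2_deriv \<epsilon> (z - ?z0) k = 0"
        proof -
          show "cball ?z0 \<epsilon> \<inter> tri \<subseteq> tri_star"
            using edge_point_vertex_dist[OF s] \<epsilon> \<epsilon>0(2) by (force simp: tri_star_def)
          show "\<forall>z k. z \<notin> cball ?z0 \<epsilon> \<longrightarrow> bump2_deriv \<epsilon> (z - ?z0) k = 0"
            using \<epsilon>(1) by (auto simp: dist_norm norm_minus_commute intro!: bump2_deriv_eq_0)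
        qed simp
        have "set_integrable lborel (interior tri) (lin_coeff (\<lambda>z. u (c z)) N (\<lambda>z. bump2_deriv \<epsilon> (z - ?z0)))"
          by (rule coeff_integrable(1)[OF fsm[OF Dc(1)[OF c]] fsy[OF Dc(1)[OF c]] N der cder B])
        then have "set_integrable lborel (interior tri) (\<lambda>z. - (\<epsilon>\<^sup>2 / 16) * lin_coeff (\<lambda>z. u (c z)) N (\<lambda>z. bump2_deriv \<epsilon> (z - ?z0)) z)"
          by (rule set_integrable_mult_right)
        moreover have "(\<lambda>z. indicat_real (interior tri) z *\<^sub>R (- (\<epsilon>\<^sup>2 / 16) * lin_coeff (\<lambda>z. u (c z)) N (\<lambda>z. bump2_deriv \<epsilon> (z - ?z0)) z))
            = (\<lambda>z. indicat_real (interior tri) z *\<^sub>R P c z)"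
        proof
          fix z
          show "indicat_real (interior tri) z *\<^sub>R (- (\<epsilon>\<^sup>2 / 16) * lin_coeff (\<lambda>z. u (c z)) N (\<lambda>z. bump2_deriv \<epsilon> (z - ?z0)) z)
            = indicat_real (interior tri) z *\<^sub>R P c z"
          proof (cases "z \<in> interior tri")
            case True
            then have "z \<in> tri_star" using interior_tri_subset_star by blast
            from lin_eq[OF Dc(1)[OF c] this, of ?z0] show ?thesis using \<epsilon>(1) by (simp add: P_def)
          qed simp
        qed
        ultimately show ?thesis unfolding set_integrable_def by (simp only:)
      qed
      have "(LINT z:interior tri|lborel. tent \<epsilon> (z - ?z0) * \<tau> z (z - ?z0)) = (LINT z|lborel. (\<Sum>c\<in>D. indicat_real (interior tri) z *\<^sub>R P c z))"
        by (simp add: set_lebesgue_integral_def \<tau>_def P_def sum_distrib_left)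
      also have "\<dots> = (\<Sum>c\<in>D. LINT z|lborel. indicat_real (interior tri) z *\<^sub>R P c z)"
        by (rule Bochner_Integration.integral_sum) (use Pi in \<open>simp add: set_integrable_def\<close>)
      finally show "(LINT z:interior tri|lborel. tent \<epsilon> (z - ?z0) * \<tau> z (z - ?z0)) = 0"
        using PZ by (simp add: set_lebesgue_integral_def)
    qed
    then show "Re (trace ((\<Sum>c\<in>D. \<omega> c ?z0 \<i>) ** N)) = 0"
      using linear_sum[OF Tl, of "\<lambda>c. \<omega> c ?z0 \<i>" D] by (simp add: \<tau>_def T_def)
  qed
  then have "\<kappa> *\<^sub>R (\<Sum>c\<in>D. \<omega> c ?z0 \<i>) = 0" by simp
  then show "(\<Sum>c' | c' \<in> charts X p Xt \<and> same_edge c0 c'. log_deriv \<kappa> u c' ?z0 \<i>) = 0"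
    by (simp add: D_def \<omega>_def log_deriv_def scaleR_sum_right)
qed

end

lemma weak_deriv_zero: "weak_deriv (\<lambda>z. 0 :: complex^'n^'n) v (\<lambda>z. 0)"
  by (simp add: weak_deriv_def locally_integrable_def set_integrable_def set_lebesgue_integral_def)

lemma flat_connection_flat: "flat X p Xt flat_connection"
  unfolding flat_def
proof
  fix c
  show "\<exists>g h. weak_deriv (\<lambda>z. flat_connection c z \<i>) 1 g \<and> weak_deriv (\<lambda>z. flat_connection c z 1) \<i> h \<and>
        (AE z in lborel. z \<in> interior tri \<longrightarrow>
           g z - h z + flat_connection c z 1 ** flat_connection c z \<i> - flat_connection c z \<i> ** flat_connection c z 1 = 0)"
    by (intro exI[of _ "\<lambda>z. 0"]) (simp add: flat_connection_def weak_deriv_zero)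
qed

theorem proposition4p5:
  fixes X :: "'a::euclidean_space set set"
    and Xt :: "'b::topological_space set" and p :: "'b \<Rightarrow> 'a" and xt0 :: 'b
    and \<rho> :: "(real \<Rightarrow> 'a) set \<Rightarrow> complex^'n^'n"
    and u :: "'b \<Rightarrow> complex^'n^'n"
    and \<alpha> \<delta> :: real
  assumes "equilateral_2_complex X" and "connected (\<Union>X)"
    and "admissible X" and "without_boundary X"
    and "universal_cover Xt p (\<Union>X)" and "xt0 \<in> Xt"
    and "\<rho> \<in> hom (fundamental_group (\<Union>X) (p xt0)) special_linear"
    and "irreducible_rep (fundamental_group (\<Union>X) (p xt0)) \<rho>"
    and "harmonic_map X p Xt xt0 \<rho> u"
    and "smooth_map X p Xt u"
    and "0 < \<alpha>" and "derivative_estimates X p Xt \<alpha> u"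
    and "\<delta> < \<alpha>"
  shows "flat_connection \<in> bal_flat_connections X p Xt xt0 \<rho> \<delta>
       \<and> (\<forall>c z v. flat_connection c z v = unitary_part u c z v + self_adjoint_part u c z v)
       \<and> unitary_part u \<in> bal_unitary_connections X p Xt xt0 \<rho> u \<delta>
       \<and> self_adjoint_part u \<in> bal_hermitian_forms X p Xt xt0 \<rho> u \<delta>
       \<and> smooth_form X p Xt (flat_connection :: ('b, 'n) form)
       \<and> smooth_form X p Xt (unitary_part u)
       \<and> smooth_form X p Xt (self_adjoint_part u)"
proof -
  have cov: "covering_space Xt p (\<Union>X)" using assms(5) by (simp add: universal_cover_def)
  have equi: "equivariant_map X p Xt xt0 \<rho> u" and min: "locally_energy_minimizing X p Xt u"
    using assms(9) by (simp_all add: harmonic_map_def)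
  have target: "u ` Xt \<subseteq> sym_space" using equi by (simp add: equivariant_map_def)
  note sm = assms(10) target
  have End: "End_form X p Xt xt0 \<rho> (log_deriv \<kappa> u)" for \<kappa> by (rule End_form_log_deriv[OF sm equi assms(7)])
  have bal: "balanced X p Xt (log_deriv \<kappa> u)" for \<kappa>
    by (rule balanced_log_deriv[OF assms(1) cov sm min]) (use End[of 1] in \<open>simp add: End_form_def\<close>)
  have L21: "in_L21 X p Xt xt0 \<rho> \<delta> (log_deriv \<kappa> u)" for \<kappa>
    by (rule log_deriv_in_L21[OF sm assms(12,11,13) End])
  \<comment> \<open>The zero form is the case \<kappa> = 0, so membership of the flat connection is
    covered by the same lemmas as its two parts.\<close>
  have flat0: "(flat_connection :: ('b, 'n) form) = log_deriv 0 u"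
    by (simp add: flat_connection_def log_deriv_def)
  have fl: "flat X p Xt (log_deriv 0 u)" unfolding flat0[symmetric] by (rule flat_connection_flat)
  have "flat_connection \<in> bal_flat_connections X p Xt xt0 \<rho> \<delta>"
    using End[of 0] bal[of 0] L21[of 0] fl
    by (simp add: bal_flat_connections_def flat0)
  moreover have "unitary_part u \<in> bal_unitary_connections X p Xt xt0 \<rho> u \<delta>"
    using End bal L21 unitary_log_deriv[OF sm]
    by (simp add: bal_unitary_connections_def unitary_part_eq)
  moreover have "self_adjoint_part u \<in> bal_hermitian_forms X p Xt xt0 \<rho> u \<delta>"
    using End bal L21 self_adjoint_log_deriv[OF sm]
    by (simp add: bal_hermitian_forms_def self_adjoint_part_eq)
  moreover have "flat_connection c z v = unitary_part u c z v + self_adjoint_part u c z v" for c z v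
    by (simp add: self_adjoint_part_def)
  ultimately show ?thesis
    using smooth_form_log_deriv[OF sm] by (simp add: unitary_part_eq self_adjoint_part_eq flat0)
qed

end
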